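(* Let $d\geq 6$ be an even integer, let $r>0$, put $N=d/2-1$, and let $M\geq 1$ be an integer. Then there exist real numbers $\rho^{(1)}_{m,n,k}$, $\rho^{(2)}_{m,n,k}$, $\rho^{(3)}_k$, $\rho^{(4)}_k$ (not depending on $t$) such that, as $t\to\infty$, $$ \begin{aligned} L(t)=S_r^{(d)}\Biggl[&\frac{d-2}{2}\,t+\frac{r^2}{d-4} +\sum_{m=0}^{M-1}\sum_{n=0}^{N-1}\frac{r^{2N(m+1)+2n}}{t^{N(m+1)+n-1}}\sum_{k=0}^m\rho^{(1)}_{m,n,k}(\log t)^k\\ &+\sum_{m=0}^{M-1}\sum_{n=0}^{N(M-m)-1}\frac{r^{2N(m+1)+2n+1}}{t^{N(m+1)+n-1/2}}\sum_{k=0}^m\rho^{(2)}_{m,n,k}(\log t)^k\\ &+\frac{r^{2N(M+1)}}{t^{N(M+1)-1}}\sum_{k=0}^M\rho^{(3)}_k(\log t)^k +\frac{r^{2N(M+1)+1}}{t^{N(M+1)-1/2}}\sum_{k=0}^M\rho^{(4)}_k(\log t)^k\Biggr] +O\left(\frac{1}{t^{N(M+1)-1/2}}\right). \end{aligned} $$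
   Context: Let $\{B(t)\}_{t\ge 0}$ be a standard Brownian motion on $\mathbb{R}^d$ and let $P_x$ denote the probability measure for the Brownian motion starting from $x\in\mathbb{R}^d$. Let $D$ be the closed ball in $\mathbb{R}^d$ with center $0$ and radius $r>0$, and $\tau_D=\inf\{t\ge 0: B(t)\in D\}$. For $t>0$ define $$L(t)=\int_{\mathbb{R}^d\setminus D}P_x[\tau_D\le t]\,dx.$$ (The expected volume of the Wiener sausage $\{x\in\mathbb{R}^d: x+B(s)\in D\text{ for some }s\in[0,t]\}$ equals $L(t)$ plus the volume of $D$.) Let $S_{d-1}$ be the surface area of the $(d-1)$-dimensional unit sphere in $\mathbb{R}^d$, and $S_r^{(d)}=S_{d-1}r^{d-2}$. *)

theory Defs
  imports "HOL-Probability.Probability"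
begin

text \<open>
  Standard Brownian motion on R^d, where d is the cardinality of the index type.  Paths are
  continuous for every outcome, not merely almost surely, so that hitting events of closed sets
  are measurable without assuming the probability space to be complete.
\<close>

locale standard_brownian_motion = prob_space \<Omega>
  for \<Omega> :: "'w measure" +
  fixes B :: "real \<Rightarrow> 'w \<Rightarrow> real ^ 'd"
  assumes measurable_B: "\<And>t. 0 \<le> t \<Longrightarrow> random_variable borel (B t)"
    and B_start: "AE \<omega> in \<Omega>. B 0 \<omega> = 0"
    and indep_increments: "\<And>(n::nat) s. 0 \<le> s 0 \<Longrightarrow> strict_mono_on {..n} s \<Longrightarrow>
          indep_vars (\<lambda>_. borel) (\<lambda>i \<omega>. B (s (Suc i)) \<omega> - B (s i) \<omega>) {..<n}"
    and gaussian_increments: "\<And>s t. 0 \<le> s \<Longrightarrow> s < t \<Longrightarrow>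
          distributed \<Omega> lborel (\<lambda>\<omega>. B t \<omega> - B s \<omega>)
            (\<lambda>y. ennreal (\<Prod>i\<in>UNIV. normal_density 0 (sqrt (t - s)) (y $ i)))"
    and continuous_paths: "\<And>\<omega>. \<omega> \<in> space \<Omega> \<Longrightarrow> continuous_on {0..} (\<lambda>t. B t \<omega>)"

text \<open>The value is infinite if the path \<open>X\<close> never hits \<open>D\<close>.\<close>

definition hitting_time :: "'a set \<Rightarrow> (real \<Rightarrow> 'a) \<Rightarrow> ereal" where
  "hitting_time D X = (INF s \<in> {s. 0 \<le> s \<and> X s \<in> D}. ereal s)"

text \<open>
  \<open>P\<^sub>x[\<tau>\<^sub>D \<le> t]\<close>: the Brownian motion started from \<open>x\<close> is the translate by \<open>x\<close> of the
  standard one, \<open>s \<mapsto> x + B s\<close>.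
\<close>

definition hitting_prob ::
    "'w measure \<Rightarrow> (real \<Rightarrow> 'w \<Rightarrow> 'a::real_vector) \<Rightarrow> 'a set \<Rightarrow> 'a \<Rightarrow> real \<Rightarrow> real" where
  "hitting_prob \<Omega> B D x t =
     measure \<Omega> {\<omega> \<in> space \<Omega>. hitting_time D (\<lambda>s. x + B s \<omega>) \<le> ereal t}"

definition L ::
    "'w measure \<Rightarrow> (real \<Rightarrow> 'w \<Rightarrow> 'a::euclidean_space) \<Rightarrow> real \<Rightarrow> real \<Rightarrow> real" where
  "L \<Omega> B r t = (LINT x:(UNIV - cball 0 r)|lborel. hitting_prob \<Omega> B (cball 0 r) x t)"

text \<open>
  Surface area of a hypersurface, as Minkowski content of codimension one.  For the unit sphere
  the lemma \<open>unit_sphere_area_eq\<close> below gives the usual closed form.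
\<close>

definition surface_area :: "'a::euclidean_space set \<Rightarrow> real" where
  "surface_area A =
     Lim (at_right 0) (\<lambda>\<epsilon>. measure lebesgue {x. infdist x A \<le> \<epsilon>} / (2 * \<epsilon>))"

definition unit_sphere_area :: "'a::euclidean_space itself \<Rightarrow> real" where
  "unit_sphere_area _ = surface_area (sphere (0 :: 'a) 1)"

lemma infdist_unit_sphere:
  fixes x :: "'a::euclidean_space"
  shows "infdist x (sphere 0 1) = \<bar>norm x - 1\<bar>"
proof -
  obtain b :: 'a where b: "b \<in> Basis" using nonempty_Basis by blast
  define u where "u = (if x = 0 then b else x /\<^sub>R norm x)"
  have u: "norm u = 1" using b by (auto simp: u_def)
  have "x - u = (norm x - 1) *\<^sub>R u"
    by (auto simp: u_def algebra_simps)
  then have d: "dist x u = \<bar>norm x - 1\<bar>" by (simp add: dist_norm u)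
  show ?thesis
  proof (rule antisym)
    show "infdist x (sphere 0 1) \<le> \<bar>norm x - 1\<bar>"
      using infdist_le[of u "sphere 0 1" x] u d by simp
    have "\<bar>norm x - 1\<bar> \<le> dist x a" if "a \<in> sphere 0 1" for a
      using that norm_triangle_ineq3[of x a] by (simp add: dist_norm)
    then show "\<bar>norm x - 1\<bar> \<le> infdist x (sphere 0 1)"
      using u by (subst infdist_notempty) (auto intro!: cINF_greatest simp: ex_in_conv[symmetric])
  qed
qed

lemma unit_sphere_area_eq:
  "unit_sphere_area TYPE('a::euclidean_space) = 2 * pi powr (DIM('a) / 2) / Gamma (DIM('a) / 2)"
proof -
  define n where "n = DIM('a)"
  define v where "v = unit_ball_vol (real n)"
  have n: "n > 0" by (simp add: n_def)
  have ev: "measure lebesgue {x::'a. infdist x (sphere 0 1) \<le> \<epsilon>} / (2 * \<epsilon>) =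
              v * (((1 + \<epsilon>) ^ n - (1 - \<epsilon>) ^ n) / (2 * \<epsilon>))" if "0 < \<epsilon>" "\<epsilon> < 1" for \<epsilon>
  proof -
    have "{x::'a. infdist x (sphere 0 1) \<le> \<epsilon>} = cball 0 (1 + \<epsilon>) - ball 0 (1 - \<epsilon>)"
      by (auto simp: infdist_unit_sphere)
    moreover have "measure lebesgue (cball (0::'a) (1 + \<epsilon>) - ball 0 (1 - \<epsilon>)) =
        measure lebesgue (cball (0::'a) (1 + \<epsilon>)) - measure lebesgue (ball (0::'a) (1 - \<epsilon>))"
      using that by (intro measurable_measure_Diff) auto
    ultimately show ?thesis
      using that by (simp add: content_cball content_ball v_def n_def field_simps)
  qed
  have "((\<lambda>\<epsilon>. (1 + \<epsilon>) ^ n - (1 - \<epsilon>) ^ n) has_real_derivative 2 * real n) (at 0)"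
    by (auto intro!: derivative_eq_intros)
  then have "((\<lambda>\<epsilon>::real. ((1 + \<epsilon>) ^ n - (1 - \<epsilon>) ^ n) / \<epsilon>) \<longlongrightarrow> 2 * real n) (at 0)"
    by (simp add: has_field_derivative_iff)
  from tendsto_mult[OF tendsto_const[of "v / 2"] this]
  have "((\<lambda>\<epsilon>. v * (((1 + \<epsilon>) ^ n - (1 - \<epsilon>) ^ n) / (2 * \<epsilon>))) \<longlongrightarrow> real n * v) (at 0)"
    by (simp add: mult_ac)
  then have "((\<lambda>\<epsilon>. v * (((1 + \<epsilon>) ^ n - (1 - \<epsilon>) ^ n) / (2 * \<epsilon>))) \<longlongrightarrow> real n * v) (at_right 0)"
    by (rule filterlim_mono) (auto simp: at_within_le_nhds at_le)
  moreover have "eventually (\<lambda>\<epsilon>::real. 0 < \<epsilon> \<and> \<epsilon> < 1) (at_right 0)"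
    using eventually_at_right_real[of 0 1] by (auto elim: eventually_mono)
  ultimately have
    "((\<lambda>\<epsilon>. measure lebesgue {x::'a. infdist x (sphere 0 1) \<le> \<epsilon>} / (2 * \<epsilon>)) \<longlongrightarrow> real n * v)
       (at_right 0)"
    by (elim Lim_transform_eventually eventually_mono) (elim conjE, rule ev [symmetric])
  then have "unit_sphere_area TYPE('a) = real n * v"
    unfolding unit_sphere_area_def surface_area_def by (intro tendsto_Lim) auto
  moreover have "Gamma (real n / 2 + 1) = real n / 2 * Gamma (real n / 2)"
    using n nonpos_Ints_nonpos[of "real n / 2"] by (intro Gamma_plus1) auto
  moreover have "Gamma (real n / 2) > 0"
    using n by (intro Gamma_real_pos) simp
  ultimately show ?thesis
    using n by (simp add: v_def unit_ball_vol_def flip: n_def)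
qed

end

theory Submission
  imports Defs "HOL-Complex_Analysis.Complex_Analysis" "HOL-Real_Asymp.Real_Asymp"
begin

text \<open>
The proof goes through the Laplace transform in time.  Let \<open>c = r\<^sup>2 / 2\<close> and let
\<open>G\<^sub>l(x)\<close> be the resolvent of the heat kernel, the integral over \<open>t > 0\<close> of \<open>exp (- l t)\<close>
times the Gaussian density of variance \<open>t\<close> at \<open>x\<close>.  A path from outside the ball reaches it
through the sphere, on which \<open>G\<^sub>l\<close> is constant, so the Laplace transform of the hitting
probability is the quotient of the values of \<open>G\<^sub>l\<close> at \<open>x\<close> and on the sphere
(\<open>hit_laplace_eq\<close>).  To prove this, the path is observed on a grid; for the resulting walk,
conditioning on one step at a time gives two inequalities, and refining the grid turns them
into an equality (\<open>hit_laplace_upper\<close>, \<open>hit_laplace_lower\<close>).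

In even dimension \<open>2 N + 2\<close> the resolvent is a Bessel function of the second kind of integer
order \<open>N\<close>.  With \<open>\<phi>\<^sub>n(z) = 2 z\<^bsup>n/2\<^esup> K\<^sub>n(2 \<surd>z)\<close>, integrating over the outside of the ball and using
the recurrence of \<open>\<phi>\<close> gives for the Laplace transform of \<open>L\<close> the value
\<open>S (N / l\<^sup>2 + c H(c l) / l)\<close> with \<open>H = \<phi>\<^sub>n / \<phi>\<^sub>N\<close> and \<open>n = N - 1\<close> (\<open>laplace_L\<close>).  Everything thus
depends on inverting the transform \<open>(H(0) - H(l)) / l\<close>, where \<open>H(0) = 1 / n\<close>.

The function \<open>\<phi>\<^sub>n\<close> is an entire function plus \<open>z\<^sup>n log z\<close> times another one, and \<open>\<phi>\<^sub>N\<close> has no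
zero in the upper half plane or near the origin.  Hence \<open>H\<close> extends continuously to the part of
the closed upper half plane that lies to the right of a diagonal line through a point
\<open>- \<delta>\<close> of the cut, and it decays there.  Cauchy's theorem expresses \<open>H(l)\<close>
by its values on that boundary (\<open>H_representation\<close>), and each boundary point \<open>\<zeta>\<close> contributes
a multiple of \<open>1 / (l - \<zeta>)\<close>, the transform of \<open>exp (\<zeta> t)\<close>.  So the original \<open>K\<close> is a
superposition of exponentials (\<open>laplace_superposition\<close>): the diagonal part is
\<open>O(exp (- \<delta> t))\<close>, and the rest is, up to the factor \<open>1 / pi\<close>, the Laplace
integral of \<open>- Im H(- x) / x\<close> over \<open>(0, \<delta>]\<close>.
That density is \<open>x\<^bsup>n - 1\<^esup>\<close> times a function with an expansion in the monomials \<open>x\<^sup>p (log x)\<^sup>m\<close>,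
\<open>N m \<le> p\<close>, because the logarithm occurs only together with \<open>x\<^sup>N\<close>.  Watson's lemma
(\<open>watson\<close>) turns this into an expansion of \<open>K\<close> in \<open>t\<^bsup>- n - p\<^esup> (log t)\<^sup>k\<close> with \<open>N k \<le> p\<close>
(\<open>bessel_ratio_tail\<close>).

As \<open>L\<close> is monotone and \<open>K\<close> is continuous, uniqueness of Laplace transforms yields the exact
formula \<open>L(t) = S (N t + c (1 / n - K(t / c)))\<close> (\<open>L_closed_form\<close>).  The powers of \<open>1 / t\<close> in the
expansion of \<open>K\<close> are integral, so the coefficients of the half-integral powers in the theorem
can be taken to be zero.
\<close>

section \<open>A Bessel integral\<close>

text \<open>On a ball the mean value inequality bounds every difference quotient by the dominating
  function \<open>g\<close>, so dominated convergence applies along any sequence tending to \<open>z0\<close>.\<close>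

lemma has_field_derivative_integral_dominated:
  fixes f f' :: "complex \<Rightarrow> 'a \<Rightarrow> complex" and g :: "'a \<Rightarrow> real"
  assumes \<rho>: "\<rho> > 0"
    and der: "\<And>z u. z \<in> ball z0 \<rho> \<Longrightarrow> u \<in> space M \<Longrightarrow> ((\<lambda>z. f z u) has_field_derivative f' z u) (at z)"
    and int: "\<And>z. z \<in> ball z0 \<rho> \<Longrightarrow> integrable M (f z)"
    and meas: "f' z0 \<in> borel_measurable M"
    and bd: "\<And>z u. z \<in> ball z0 \<rho> \<Longrightarrow> u \<in> space M \<Longrightarrow> norm (f' z u) \<le> g u"
    and g: "integrable M g"
  shows "((\<lambda>z. \<integral>u. f z u \<partial>M) has_field_derivative (\<integral>u. f' z0 u \<partial>M)) (at z0)"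
  unfolding has_field_derivative_iff tendsto_at_iff_sequentially comp_def
proof (intro allI impI)
  fix X :: "nat \<Rightarrow> complex"
  assume X: "\<forall>i. X i \<in> UNIV - {z0}" and Xl: "X \<longlonglongrightarrow> z0"
  have z0: "z0 \<in> ball z0 \<rho>" using \<rho> by simp
  have ev: "eventually (\<lambda>i. X i \<in> ball z0 \<rho>) sequentially"
    using Xl z0 by (rule topological_tendstoD[OF _ open_ball])
  then obtain n0 where n0: "\<And>i. i \<ge> n0 \<Longrightarrow> X i \<in> ball z0 \<rho>"
    by (auto simp: eventually_sequentially)
  define Y where "Y i = X (i + n0)" for i
  have Yb: "Y i \<in> ball z0 \<rho>" "Y i \<noteq> z0" for i using n0 X by (auto simp: Y_def)
  have Yl: "Y \<longlonglongrightarrow> z0" using Xl unfolding Y_def by (rule LIMSEQ_ignore_initial_segment)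
  have "(\<lambda>i. \<integral>u. (f (Y i) u - f z0 u) / (Y i - z0) \<partial>M) \<longlonglongrightarrow> (\<integral>u. f' z0 u \<partial>M)"
  proof (rule integral_dominated_convergence[OF meas _ g])
    show "(\<lambda>u. (f (Y i) u - f z0 u) / (Y i - z0)) \<in> borel_measurable M" for i
      using int[OF Yb(1)[of i]] int[OF z0] by (intro borel_measurable_divide borel_measurable_diff) auto
    have "(\<lambda>i. (f (Y i) u - f z0 u) / (Y i - z0)) \<longlonglongrightarrow> f' z0 u" if "u \<in> space M" for u
      using der[OF z0 that] Yl Yb unfolding has_field_derivative_iff tendsto_at_iff_sequentially comp_def by auto
    then show "AE u in M. (\<lambda>i. (f (Y i) u - f z0 u) / (Y i - z0)) \<longlonglongrightarrow> f' z0 u" by simp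
    have "norm ((f (Y i) u - f z0 u) / (Y i - z0)) \<le> g u" if "u \<in> space M" for u i
    proof -
      have "norm (f (Y i) u - f z0 u) \<le> g u * norm (Y i - z0)"
        by (rule field_differentiable_bound[of "ball z0 \<rho>" "\<lambda>z. f z u" "\<lambda>z. f' z u"])
           (use der[OF _ that] bd[OF _ that] Yb z0 in \<open>auto intro: has_field_derivative_at_within\<close>)
      then show ?thesis using Yb(2)[of i] by (simp add: norm_divide field_simps)
    qed
    then show "AE u in M. norm ((f (Y i) u - f z0 u) / (Y i - z0)) \<le> g u" for i by simp
  qed
  moreover have "(\<integral>u. (f (Y i) u - f z0 u) / (Y i - z0) \<partial>M) = ((\<integral>u. f (Y i) u \<partial>M) - (\<integral>u. f z0 u \<partial>M)) / (Y i - z0)" for i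
    using Bochner_Integration.integral_diff[OF int[OF Yb(1)[of i]] int[OF z0]] by simp
  ultimately have "(\<lambda>i. ((\<integral>u. f (Y i) u \<partial>M) - (\<integral>u. f z0 u \<partial>M)) / (Y i - z0)) \<longlonglongrightarrow> (\<integral>u. f' z0 u \<partial>M)" by (simp only:)
  then show "(\<lambda>i. ((\<integral>u. f (X i) u \<partial>M) - (\<integral>u. f z0 u \<partial>M)) / (X i - z0)) \<longlonglongrightarrow> (\<integral>u. f' z0 u \<partial>M)"
    unfolding Y_def by (rule LIMSEQ_offset)
qed

text \<open>This makes the integrands below Gaussian at infinity, uniformly in the parameter.\<close>

lemma cosh_ge_quadratic: "1 + v\<^sup>2 / 2 \<le> cosh (v::real)"
proof -
  have *: "\<bar>x\<bar> \<le> \<bar>sinh x\<bar>" for x :: real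
  proof -
    have "y \<le> sinh y" if "y \<ge> 0" for y :: real
    proof -
      have "(\<lambda>y. sinh y - y) 0 \<le> (\<lambda>y. sinh y - y) y"
        by (rule DERIV_nonneg_imp_nondecreasing[OF that])
           (auto intro!: exI derivative_eq_intros simp: cosh_real_ge_1)
      then show ?thesis by simp
    qed
    from this[of "\<bar>x\<bar>"] show ?thesis by simp
  qed
  have "cosh v = 1 + 2 * (sinh (v/2))\<^sup>2"
    using cosh_double[of "v/2"] cosh_square_eq[of "v/2"] by simp
  moreover have "(v/2)\<^sup>2 \<le> (sinh (v/2))\<^sup>2"
    using *[of "v/2"] by (metis abs_le_square_iff)
  ultimately show ?thesis by (simp add: power_divide)
qed

lemma integrable_gauss_lin:
  assumes "a > (0::real)"
  shows "integrable lborel (\<lambda>v::real. exp (m * v - a * v\<^sup>2))"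
proof -
  have s: "1 / sqrt (2*a) > 0" using assms by simp
  have s2: "(1 / sqrt (2*a))\<^sup>2 = 1 / (2*a)" using assms by (simp add: power_divide)
  have "exp (m * v - a * v\<^sup>2) = (exp (m\<^sup>2/(4*a)) * sqrt (pi/a)) * normal_density (m/(2*a)) (1 / sqrt (2*a)) v" for v
  proof -
    have 1: "m * v - a * v\<^sup>2 = m\<^sup>2/(4*a) + - ((v - m/(2*a))\<^sup>2) / (2 * (1 / (2*a)))"
      using assms by (simp add: field_simps power2_eq_square)
    have 2: "sqrt (2 * pi * (1 / (2*a))) = sqrt (pi/a)" by simp
    have 3: "sqrt (pi/a) \<noteq> 0" using assms by simp
    show ?thesis unfolding normal_density_def s2 1 2 exp_add using 3 by simp
  qed
  then show ?thesis using s by (simp add: integrable_normal_density)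
qed

lemma borel_measurable_cosh [measurable]: "(cosh :: real \<Rightarrow> real) \<in> borel_measurable borel"
  and borel_measurable_sinh [measurable]: "(sinh :: real \<Rightarrow> real) \<in> borel_measurable borel"
  by (intro borel_measurable_continuous_onI continuous_intros; simp)+

lemma sinh_complex_of_real: "sinh (of_real x) = (of_real (sinh x) :: complex)"
  and cosh_complex_of_real: "cosh (of_real x) = (of_real (cosh x) :: complex)"
  by (simp_all add: sinh_def cosh_def scaleR_conv_of_real flip: exp_of_real)

lemma integrable_exp_cosh:
  assumes "a > (0::real)"
  shows "integrable lborel (\<lambda>v::real. exp (m * v - a * cosh v))"
proof (rule Bochner_Integration.integrable_bound)
  show "integrable lborel (\<lambda>v::real. exp (m * v - (a/2) * v\<^sup>2))" using assms by (intro integrable_gauss_lin) auto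
  have "a * (1 + v\<^sup>2/2) \<le> a * cosh v" for v using assms cosh_ge_quadratic by simp
  then have "m * v - a * cosh v \<le> m * v - (a/2) * v\<^sup>2" for v
  proof -
    have "m * v - a * cosh v \<le> m * v - a * (1 + v\<^sup>2/2)" using \<open>\<And>v. a * (1 + v\<^sup>2/2) \<le> a * cosh v\<close> by simp
    also have "\<dots> \<le> m * v - (a/2) * v\<^sup>2" using assms by (simp add: algebra_simps)
    finally show ?thesis .
  qed
  then show "AE x in lborel. norm (exp (m * x - a * cosh x)) \<le> norm (exp (m * x - a / 2 * x\<^sup>2))"
    by simp
qed measurable

text \<open>For \<open>Re s > 0\<close> this is \<open>2 K\<^sub>n(2 s)\<close>, with \<open>K\<^sub>n\<close> the modified Bessel function of the second
  kind.  The integral over the whole line keeps the symmetry between \<open>n\<close> and \<open>- n\<close> visible.\<close>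

definition besselint :: "real \<Rightarrow> complex \<Rightarrow> complex" where
  "besselint n s = (\<integral>v. exp (of_real (n * v) - 2 * s * of_real (cosh v)) \<partial>lborel)"

definition besselint_real :: "real \<Rightarrow> real \<Rightarrow> real" where
  "besselint_real n s = (\<integral>v. exp (n * v - 2 * s * cosh v) \<partial>lborel)"

lemma norm_besselint_integrand:
  "norm (exp (of_real (n * v) - 2 * s * of_real (cosh v)) :: complex) = exp (n * v - 2 * Re s * cosh v)"
  by simp

lemma integrable_besselint:
  assumes "Re s > 0"
  shows "integrable lborel (\<lambda>v. exp (of_real (n * v) - 2 * s * of_real (cosh v)) :: complex)"
  by (rule Bochner_Integration.integrable_bound[OF integrable_exp_cosh[of "2 * Re s" n]])
     (use assms in auto)

lemma integrable_besselint_real: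
  assumes "s > 0"
  shows "integrable lborel (\<lambda>v::real. exp (n * v - 2 * s * cosh v))"
  using integrable_exp_cosh[of "2 * s" n] assms by simp

lemma besselint_of_real: "besselint n (of_real s) = of_real (besselint_real n s)"
  unfolding besselint_def besselint_real_def
  by (subst integral_complex_of_real[symmetric]) (simp add: exp_of_real[symmetric])

lemma besselint_real_pos:
  assumes "s > 0" shows "besselint_real n s > 0"
proof -
  have nonneg: "besselint_real n s \<ge> 0" unfolding besselint_real_def by (rule Bochner_Integration.integral_nonneg) simp
  have "besselint_real n s \<noteq> 0"
  proof
    assume "besselint_real n s = 0"
    then have "AE v in lborel. exp (n * v - 2 * s * cosh v) = 0"
      using integral_nonneg_eq_0_iff_AE[OF integrable_besselint_real[OF assms, of n]]
      by (simp add: besselint_real_def)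
    then show False using AE_iff_measurable[of UNIV lborel "\<lambda>v::real. False"] by simp
  qed
  with nonneg show ?thesis by simp
qed

lemma norm_besselint_le:
  assumes "Re s > 0"
  shows "norm (besselint n s) \<le> besselint_real n (Re s)"
  unfolding besselint_def besselint_real_def
  by (rule order_trans[OF integral_norm_bound]) (simp add: norm_besselint_integrand)

lemma besselint_real_le:
  assumes "1 \<le> s"
  shows "besselint_real n s \<le> exp (- 2 * (s - 1)) * besselint_real n 1"
proof -
  have "n * v - 2 * s * cosh v \<le> - 2 * (s - 1) + (n * v - 2 * 1 * cosh v)" for v
  proof -
    have "(s - 1) * 1 \<le> (s - 1) * cosh v" using assms cosh_real_ge_1 by (intro mult_left_mono) auto
    then show ?thesis by (simp add: algebra_simps)
  qed
  then have "exp (n * v - 2 * s * cosh v) \<le> exp (- 2 * (s - 1)) * exp (n * v - 2 * 1 * cosh v)" for v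
    by (metis exp_add exp_le_cancel_iff)
  then have "besselint_real n s \<le> (\<integral>v. exp (- 2 * (s - 1)) * exp (n * v - 2 * 1 * cosh v) \<partial>lborel)"
    unfolding besselint_real_def using assms
    by (intro integral_mono integrable_besselint_real integrable_mult_right) auto
  then show ?thesis by (simp add: besselint_real_def)
qed

text \<open>Differentiating under the integral brings down \<open>- 2 cosh v\<close>, and \<open>2 cosh v\<close> is the sum of
  the two exponentials that shift the order by one.\<close>

lemma besselint_deriv:
  assumes "Re s > 0"
  shows "(besselint n has_field_derivative - (besselint (n + 1) s + besselint (n - 1) s)) (at s)"
proof -
  let ?f = "\<lambda>z v. exp (of_real (n * v) - 2 * z * of_real (cosh v)) :: complex"
  let ?f' = "\<lambda>z v. - 2 * of_real (cosh v) * exp (of_real (n * v) - 2 * z * of_real (cosh v)) :: complex"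
  let ?\<sigma> = "Re s / 2"
  let ?g = "\<lambda>v. exp ((n+1) * v - 2 * ?\<sigma> * cosh v) + exp ((n-1) * v - 2 * ?\<sigma> * cosh v)"
  have Re: "Re z > ?\<sigma>" if "z \<in> ball s ?\<sigma>" for z
  proof -
    have "\<bar>Re (s - z)\<bar> \<le> norm (s - z)" by (rule abs_Re_le_cmod)
    with that show ?thesis by (auto simp: dist_norm)
  qed
  have c: "2 * cosh v * exp (n * v - a) = exp ((n+1) * v - a) + exp ((n-1) * v - a)" for v a :: real
    by (simp add: cosh_def algebra_simps flip: exp_add)
  have c': "2 * of_real (cosh v) * exp (of_real (n * v) - b) = exp (of_real ((n+1) * v) - b) + exp (of_real ((n-1) * v) - b)"
    for v :: real and b :: complex
  proof -
    have "2 * of_real (cosh v) = (exp (of_real v) + exp (- of_real v) :: complex)"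
      by (simp add: cosh_def scaleR_conv_of_real flip: exp_of_real)
    then show ?thesis by (simp add: algebra_simps flip: exp_add)
  qed
  have "((\<lambda>z. \<integral>v. ?f z v \<partial>lborel) has_field_derivative (\<integral>v. ?f' s v \<partial>lborel)) (at s)"
  proof (rule has_field_derivative_integral_dominated[where \<rho> = ?\<sigma> and g = ?g])
    show "?\<sigma> > 0" using assms by simp
    show "((\<lambda>z. ?f z u) has_field_derivative ?f' z u) (at z)" for z u
      by (auto intro!: derivative_eq_intros)
    show "integrable lborel (?f z)" if "z \<in> ball s ?\<sigma>" for z
      using Re[OF that] assms by (intro integrable_besselint) auto
    show "norm (?f' z u) \<le> ?g u" if "z \<in> ball s ?\<sigma>" for z u
    proof -
      have "norm (?f' z u) = 2 * cosh u * exp (n * u - 2 * Re z * cosh u)"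
        by (simp add: norm_mult)
      also have "\<dots> \<le> 2 * cosh u * exp (n * u - 2 * ?\<sigma> * cosh u)"
        using Re[OF that] by (intro mult_left_mono) (auto intro: mult_right_mono less_imp_le)
      finally show ?thesis unfolding c .
    qed
    show "integrable lborel ?g" using assms by (intro Bochner_Integration.integrable_add integrable_besselint_real) auto
  qed measurable
  also have "(\<integral>v. ?f' s v \<partial>lborel) = - (\<integral>v. exp (of_real ((n+1) * v) - 2 * s * of_real (cosh v)) + exp (of_real ((n-1) * v) - 2 * s * of_real (cosh v)) \<partial>lborel)"
    unfolding c'[symmetric] by (subst integral_minus[symmetric]) simp
  also have "\<dots> = - (besselint (n + 1) s + besselint (n - 1) s)"
    unfolding besselint_def
    by (subst Bochner_Integration.integral_add[OF integrable_besselint[OF assms] integrable_besselint[OF assms]]) simp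
  finally show ?thesis by (simp add: besselint_def[abs_def])
qed

text \<open>The derivative of the integrand in \<open>v\<close> is \<open>n - 2 s sinh v\<close> times the integrand; it
  integrates to zero over the line, and \<open>2 sinh v\<close> again shifts the order by one.\<close>

lemma besselint_recurrence:
  assumes s: "Re s > 0"
  shows "of_real n * besselint n s = s * (besselint (n + 1) s - besselint (n - 1) s)"
proof -
  let ?F = "\<lambda>v::real. exp (of_real (n * v) - 2 * s * of_real (cosh v)) :: complex"
  let ?f = "\<lambda>v::real. (of_real n - 2 * s * of_real (sinh v)) * ?F v"
  have c': "2 * of_real (sinh v) * exp (of_real (n * v) - b) = exp (of_real ((n+1) * v) - b) - exp (of_real ((n-1) * v) - b)"
    for v :: real and b :: complex
  proof -
    have "2 * of_real (sinh v) = (exp (of_real v) - exp (- of_real v) :: complex)"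
      by (simp add: sinh_def scaleR_conv_of_real flip: exp_of_real)
    then have "2 * of_real (sinh v) * exp (of_real (n * v) - b) =
       exp (of_real v) * exp (of_real (n * v) - b) - exp (- of_real v) * exp (of_real (n * v) - b)"
      by (simp only: left_diff_distrib)
    also have "\<dots> = exp (of_real ((n+1) * v) - b) - exp (of_real ((n-1) * v) - b)"
      by (simp add: algebra_simps flip: exp_add)
    finally show ?thesis .
  qed
  have feq: "?f v = of_real n * ?F v - s * (exp (of_real ((n+1) * v) - 2 * s * of_real (cosh v)) - exp (of_real ((n-1) * v) - 2 * s * of_real (cosh v)))" for v
    unfolding c'[symmetric] by (simp add: algebra_simps)
  have int: "integrable lborel ?f"
    unfolding feq using s by (intro Bochner_Integration.integrable_diff integrable_mult_right integrable_besselint)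
  have der: "(?F has_vector_derivative ?f v) (at v)" for v
  proof -
    have "((\<lambda>z. exp (of_real n * z - 2 * s * cosh z)) has_field_derivative
        (of_real n - 2 * s * sinh (of_real v)) * exp (of_real n * of_real v - 2 * s * cosh (of_real v))) (at (of_real v :: complex))"
      by (auto intro!: derivative_eq_intros)
    from has_vector_derivative_real_field[OF this]
    show ?thesis by (simp add: sinh_complex_of_real cosh_complex_of_real)
  qed
  have bnd: "norm (?F v) \<le> exp (\<bar>n\<bar> * \<bar>v\<bar> - 2 * Re s * (1 + v\<^sup>2/2))" for v
  proof -
    have "n * v \<le> \<bar>n\<bar> * \<bar>v\<bar>" using abs_ge_self[of "n * v"] unfolding abs_mult .
    moreover have "2 * Re s * (1 + v\<^sup>2/2) \<le> 2 * Re s * cosh v" using s cosh_ge_quadratic by (intro mult_left_mono) auto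
    ultimately show ?thesis unfolding norm_besselint_integrand by simp
  qed
  have top: "(?F \<longlongrightarrow> 0) at_top"
  proof (rule Lim_null_comparison)
    show "\<forall>\<^sub>F v in at_top. norm (?F v) \<le> exp (\<bar>n\<bar> * \<bar>v\<bar> - 2 * Re s * (1 + v\<^sup>2/2))" using bnd by simp
    show "((\<lambda>v. exp (\<bar>n\<bar> * \<bar>v\<bar> - 2 * Re s * (1 + v\<^sup>2/2))) \<longlongrightarrow> 0) at_top"
      using s by real_asymp
  qed
  have bot: "(?F \<longlongrightarrow> 0) at_bot"
  proof (rule Lim_null_comparison)
    show "\<forall>\<^sub>F v in at_bot. norm (?F v) \<le> exp (\<bar>n\<bar> * \<bar>v\<bar> - 2 * Re s * (1 + v\<^sup>2/2))" using bnd by simp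
    show "((\<lambda>v. exp (\<bar>n\<bar> * \<bar>v\<bar> - 2 * Re s * (1 + v\<^sup>2/2))) \<longlongrightarrow> 0) at_bot"
      using s by real_asymp
  qed
  have "(LBINT v=-\<infinity>..\<infinity>. ?f v) = 0 - 0"
  proof (rule interval_integral_FTC_integrable)
    show "((?F \<circ> real_of_ereal) \<longlongrightarrow> 0) (at_right (-\<infinity>))"
      using bot by (simp add: ereal_tendsto_simps)
    show "((?F \<circ> real_of_ereal) \<longlongrightarrow> 0) (at_left \<infinity>)"
      using top by (simp add: ereal_tendsto_simps)
    show "set_integrable lborel (einterval (-\<infinity>) \<infinity>) ?f" using int by (simp add: set_integrable_def)
    show "isCont ?f v" for v by (intro continuous_intros)
  qed (use der in auto)
  then have "0 = (\<integral>v. ?f v \<partial>lborel)"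
    by (simp add: interval_lebesgue_integral_def set_lebesgue_integral_def)
  also have "(\<integral>v. ?f v \<partial>lborel) = of_real n * besselint n s - s * (besselint (n + 1) s - besselint (n - 1) s)"
    unfolding feq besselint_def
    by (subst Bochner_Integration.integral_diff, intro integrable_mult_right integrable_besselint s,
        intro integrable_mult_right Bochner_Integration.integrable_diff integrable_besselint s,
        subst integral_mult_right_zero, subst integral_mult_right_zero,
        subst Bochner_Integration.integral_diff[OF integrable_besselint[OF s] integrable_besselint[OF s]]) simp
  finally show ?thesis by simp
qed

lemma besselint_minus: "besselint (- n) s = besselint n s"
  unfolding besselint_def
  by (subst lborel_integral_real_affine[where c = "-1" and t = 0]) auto

lemma holomorphic_eq_from_pos_reals:
  assumes f: "f holomorphic_on S" and g: "g holomorphic_on S"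
    and S: "open S" "connected S" and pos: "\<And>x. x > 0 \<Longrightarrow> of_real x \<in> S"
    and eq: "\<And>x. x > 0 \<Longrightarrow> f (of_real x) = g (of_real x)" and z: "z \<in> S"
  shows "f z = (g z :: complex)"
proof -
  let ?U = "of_real ` {0<..} :: complex set"
  have lim: "(1::complex) islimpt ?U"
  proof -
    have "(1::real) islimpt {0<..}"
      by (rule open_imp_islimpt) auto
    then have "(of_real (1::real) :: complex) islimpt ?U"
      by (rule islimpt_isCont_image) (auto simp: eventually_at_filter)
    then show ?thesis by simp
  qed
  have "f z - g z = 0"
    by (rule analytic_continuation[where f = "\<lambda>z. f z - g z" and S = S and U = ?U and \<xi> = 1])
       (use assms lim pos[of 1] in \<open>auto intro!: holomorphic_intros\<close>)
  then show ?thesis by simp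
qed

lemma gaussian_integral_real:
  assumes "w > 0"
  shows "(\<integral>x. exp (- w * x\<^sup>2) \<partial>lborel) = sqrt (pi / w)"
proof -
  have s2: "(1 / sqrt (2*w))\<^sup>2 = 1 / (2*w)" using assms by (simp add: power_divide)
  have "exp (- w * x\<^sup>2) = sqrt (pi/w) * normal_density 0 (1 / sqrt (2*w)) x" for x
    unfolding normal_density_def s2 using assms by (simp add: field_simps)
  then have "(\<integral>x. exp (- w * x\<^sup>2) \<partial>lborel) = (\<integral>x. sqrt (pi/w) * normal_density 0 (1 / sqrt (2*w)) x \<partial>lborel)"
    by simp
  also have "\<dots> = sqrt (pi/w)" using assms by (simp add: integral_normal_density)
  finally show ?thesis .
qed

text \<open>The square of the integral times \<open>w\<close> is holomorphic and equals \<open>pi\<close> for real \<open>w > 0\<close>,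
  hence everywhere.  This limit value keeps the Bessel integrals away from zero at infinity.\<close>

lemma gaussian_integral_complex_nz:
  assumes "Re w > 0"
  shows "(\<integral>x. exp (- w * of_real (x\<^sup>2)) \<partial>lborel) \<noteq> (0::complex)"
proof -
  define g where "g w = (\<integral>x. exp (- w * of_real (x\<^sup>2)) \<partial>lborel)" for w :: complex
  have int: "integrable lborel (\<lambda>x. exp (- w * of_real (x\<^sup>2)) :: complex)" if "Re w > 0" for w
    by (rule Bochner_Integration.integrable_bound[OF integrable_gauss_lin[of "Re w" 0]]) (use that in auto)
  have der: "(g has_field_derivative (\<integral>x. - of_real (x\<^sup>2) * exp (- w * of_real (x\<^sup>2)) \<partial>lborel)) (at w)"
    if "Re w > 0" for w
    unfolding g_def
  proof (rule has_field_derivative_integral_dominated[where \<rho> = "Re w / 2" and g = "\<lambda>x. (4 / Re w) * exp (0 * x - (Re w/4) * x\<^sup>2)"])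
    have Re: "Re z > Re w / 2" if "z \<in> ball w (Re w / 2)" for z
    proof -
      have "\<bar>Re (w - z)\<bar> \<le> norm (w - z)" by (rule abs_Re_le_cmod)
      with that show ?thesis by (auto simp: dist_norm)
    qed
    show "Re w / 2 > 0" using that by simp
    show "integrable lborel (\<lambda>x. exp (- z * of_real (x\<^sup>2)))" if "z \<in> ball w (Re w / 2)" for z
      using Re[OF that] \<open>Re w > 0\<close> by (intro int) auto
    show "norm (- of_real (x\<^sup>2) * exp (- z * of_real (x\<^sup>2))) \<le> (4 / Re w) * exp (0 * x - (Re w/4) * x\<^sup>2)"
      if "z \<in> ball w (Re w / 2)" for z and x :: real
    proof -
      have "norm (- of_real (x\<^sup>2) * exp (- z * of_real (x\<^sup>2))) = x\<^sup>2 * exp (- Re z * x\<^sup>2)"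
        by (simp add: norm_mult norm_power)
      also have "\<dots> \<le> x\<^sup>2 * exp (- (Re w/2) * x\<^sup>2)"
        using mult_right_mono[OF less_imp_le[OF Re[OF that]], of "x\<^sup>2"] by (intro mult_left_mono) auto
      also have "\<dots> = (4 / Re w) * ((Re w/4 * x\<^sup>2) * exp (- (Re w/2) * x\<^sup>2))" using \<open>Re w > 0\<close> by simp
      also have "\<dots> \<le> (4 / Re w) * (exp (Re w/4 * x\<^sup>2) * exp (- (Re w/2) * x\<^sup>2))"
        using \<open>Re w > 0\<close> exp_ge_add_one_self[of "Re w/4 * x\<^sup>2"] by (intro mult_left_mono mult_right_mono) (linarith | simp)+
      also have "\<dots> = (4 / Re w) * exp (0 * x - (Re w/4) * x\<^sup>2)" unfolding exp_add[symmetric] by simp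
      finally show ?thesis .
    qed
    show "integrable lborel (\<lambda>x. (4 / Re w) * exp (0 * x - (Re w/4) * x\<^sup>2))"
      using that by (intro integrable_mult_right integrable_gauss_lin) simp
  qed (auto intro!: derivative_eq_intros)
  have hol: "g holomorphic_on {w. Re w > 0}"
    using der by (auto simp: holomorphic_on_def field_differentiable_def intro: has_field_derivative_at_within)
  have "w * (g w)\<^sup>2 = of_real pi"
  proof (rule holomorphic_eq_from_pos_reals[where S = "{w. Re w > 0}" and f = "\<lambda>w. w * (g w)\<^sup>2" and g = "\<lambda>_. of_real pi"])
    show "(\<lambda>w. w * (g w)\<^sup>2) holomorphic_on {w. Re w > 0}" by (intro holomorphic_intros hol)
    show "open {w. Re w > 0}" by (rule open_halfspace_Re_gt)
    show "connected {w. Re w > 0}" by (intro convex_connected convex_halfspace_Re_gt)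
    fix x :: real assume x: "x > 0"
    have "g (of_real x) = of_real (\<integral>t. exp (- x * t\<^sup>2) \<partial>lborel)"
      unfolding g_def by (subst integral_complex_of_real[symmetric]) (simp flip: exp_of_real)
    then have "g (of_real x) = of_real (sqrt (pi / x))" using gaussian_integral_real[OF x] by simp
    moreover have "x * (sqrt (pi / x))\<^sup>2 = pi" using x by simp
    ultimately show "of_real x * (g (of_real x))\<^sup>2 = of_real pi" by (metis of_real_mult of_real_power)
  qed (use assms in auto)
  then show ?thesis unfolding g_def by auto
qed

text \<open>The scale \<open>q\<close> will be the square root of \<open>norm s\<close>: then the integrand converges to a Gaussian
  as \<open>s\<close> tends to infinity (the saddle point method).\<close>

lemma besselint_scaled:
  assumes q: "q > 0"
  shows "exp (2 * s) * of_real q * besselint n s =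
    (\<integral>x. exp (of_real (n * (x / q)) - 2 * s * of_real (cosh (x / q) - 1)) \<partial>lborel)"
proof -
  have "besselint n s = of_real (1/q) * (\<integral>x. exp (of_real (n * (x / q)) - 2 * s * of_real (cosh (x / q))) \<partial>lborel)"
    unfolding besselint_def
    by (subst lborel_integral_real_affine[where c = "1/q" and t = 0]) (use q in \<open>auto simp: scaleR_conv_of_real\<close>)
  then have "exp (2 * s) * of_real q * besselint n s = exp (2 * s) * (\<integral>x. exp (of_real (n * (x / q)) - 2 * s * of_real (cosh (x / q))) \<partial>lborel)"
    using q by simp
  also have "\<dots> = (\<integral>x. exp (2 * s) * exp (of_real (n * (x / q)) - 2 * s * of_real (cosh (x / q))) \<partial>lborel)"
    by simp
  also have "\<dots> = (\<integral>x. exp (of_real (n * (x / q)) - 2 * s * of_real (cosh (x / q) - 1)) \<partial>lborel)"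
    unfolding exp_add[symmetric] by (simp add: algebra_simps)
  finally show ?thesis .
qed

lemma besselint_scaled_bound:
  assumes c: "c > 0" and s: "norm s \<ge> 1" "Re s \<ge> c * norm s"
  defines "q \<equiv> sqrt (norm s)"
  shows "norm (exp (of_real (n * (x / q)) - 2 * s * of_real (cosh (x / q) - 1)) :: complex)
     \<le> exp (n * x - c * x\<^sup>2) + exp (- n * x - c * x\<^sup>2)"
proof -
  have q: "q \<ge> 1" "q\<^sup>2 = norm s" using s by (auto simp: q_def)
  have 1: "n * (x / q) \<le> \<bar>n * x\<bar>"
  proof -
    have "n * (x / q) \<le> \<bar>n * x\<bar> / q" using q by (simp add: divide_right_mono)
    also have "\<dots> \<le> \<bar>n * x\<bar> / 1" using q by (intro divide_left_mono) auto
    finally show ?thesis by simp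
  qed
  have Re: "0 \<le> Re s" using s c by (meson mult_nonneg_nonneg norm_ge_zero less_imp_le order_trans)
  have "c * q\<^sup>2 * ((x / q)\<^sup>2/2) \<le> Re s * (cosh (x / q) - 1)"
    using s q cosh_ge_quadratic[of "x / q"] c Re by (intro mult_mono) auto
  moreover have "c * q\<^sup>2 * ((x / q)\<^sup>2/2) = c * x\<^sup>2 / 2" using q(1) by (simp add: power_divide)
  ultimately have 2: "2 * Re s * (cosh (x / q) - 1) \<ge> c * x\<^sup>2" by linarith
  have "norm (exp (of_real (n * (x / q)) - 2 * s * of_real (cosh (x / q) - 1)) :: complex) = exp (n * (x / q) - 2 * Re s * (cosh (x / q) - 1))"
    by simp
  also have "\<dots> \<le> exp (\<bar>n * x\<bar> - c * x\<^sup>2)" using 1 2 by simp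
  also have "\<dots> \<le> exp (n * x - c * x\<^sup>2) + exp (- n * x - c * x\<^sup>2)"
    by (cases "n * x \<ge> 0") auto
  finally show ?thesis .
qed

lemma besselint_upper:
  assumes c: "c > 0"
  obtains C where "\<And>s. norm s \<ge> 1 \<Longrightarrow> Re s \<ge> c * norm s \<Longrightarrow> norm (exp (2 * s) * sqrt (norm s) * besselint n s) \<le> C"
proof
  fix s :: complex assume s: "norm s \<ge> 1" "Re s \<ge> c * norm s"
  let ?g = "\<lambda>x::real. exp (n * x - c * x\<^sup>2) + exp (- n * x - c * x\<^sup>2)"
  have i: "integrable lborel ?g" using c by (intro Bochner_Integration.integrable_add integrable_gauss_lin)
  have q: "sqrt (norm s) > 0" using s(1) by (subst real_sqrt_gt_0_iff) linarith
  have "norm (exp (2 * s) * sqrt (norm s) * besselint n s) \<le> (\<integral>x. ?g x \<partial>lborel)"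
    unfolding besselint_scaled[OF q]
  proof (rule Bochner_Integration.integral_norm_bound_integral[OF _ i])
    show "integrable lborel (\<lambda>x. exp (of_real (n * (x / sqrt (norm s))) - 2 * s * of_real (cosh (x / sqrt (norm s)) - 1)) :: complex)"
      by (rule Bochner_Integration.integrable_bound[OF i])
        (use besselint_scaled_bound[OF c s, of n] in \<open>auto intro: order_trans[OF _ abs_ge_self]\<close>)
  qed (rule besselint_scaled_bound[OF c s])
  then show "norm (exp (2 * s) * sqrt (norm s) * besselint n s) \<le> (\<integral>x. ?g x \<partial>lborel)" .
qed

lemma cosh_scaled_limit:
  fixes x :: real
  shows "((\<lambda>q. q\<^sup>2 * (cosh (x / q) - 1)) \<longlongrightarrow> x\<^sup>2 / 2) at_top"
proof (cases "x = 0")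
  case False
  have "((\<lambda>y::real. (cosh y - 1) / y\<^sup>2) \<longlongrightarrow> 1/2) (at 0)" by real_asymp
  moreover have "filterlim (\<lambda>q. x / q) (at 0) at_top"
    unfolding filterlim_at using False by (auto intro!: tendsto_divide_0[OF tendsto_const] filterlim_at_top_imp_at_infinity filterlim_ident eventually_mono[OF eventually_gt_at_top[of 0]])
  ultimately have "((\<lambda>q. (cosh (x/q) - 1) / (x/q)\<^sup>2) \<longlongrightarrow> 1/2) at_top" by (rule filterlim_compose)
  then have "((\<lambda>q. x\<^sup>2 * ((cosh (x/q) - 1) / (x/q)\<^sup>2)) \<longlongrightarrow> x\<^sup>2 * (1/2)) at_top" by (rule tendsto_mult_left)
  then show ?thesis using False by (auto simp: power_divide mult_ac elim!: Lim_transform_eventually)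
qed auto

text \<open>If there were no such bound, a sequence \<open>s k\<close> along which the scaled integrals tend to
  \<open>0\<close> would have a subsequence of converging directions \<open>l\<close>; along it the scaled
  integrals tend to the Gaussian integral with parameter \<open>l\<close>, which does not vanish.\<close>

lemma besselint_lower:
  assumes c: "c > 0"
  obtains R C where "C > 0" "\<And>s. norm s \<ge> R \<Longrightarrow> Re s \<ge> c * norm s \<Longrightarrow> C \<le> norm (exp (2 * s) * sqrt (norm s) * besselint n s)"
proof (rule ccontr)
  assume no: "\<not> thesis"
  have "\<exists>s. norm s \<ge> real (Suc k) \<and> Re s \<ge> c * norm s \<and> norm (exp (2 * s) * sqrt (norm s) * besselint n s) < inverse (real (Suc k))" for k :: nat
  proof (rule ccontr)
    assume "\<not> ?thesis"
    then show False using that[of "inverse (real (Suc k))" "real (Suc k)"] no by (auto simp: not_less)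
  qed
  then obtain s where s: "\<And>k. norm (s k) \<ge> real (Suc k)" "\<And>k. Re (s k) \<ge> c * norm (s k)"
    "\<And>k. norm (exp (2 * s k) * sqrt (norm (s k)) * besselint n (s k)) < inverse (real (Suc k))" by metis
  define e where "e k = s k / norm (s k)" for k
  have nz: "norm (s k) > 0" for k using s(1)[of k] by linarith
  have es: "s k = e k * norm (s k)" for k using nz[of k] by (simp add: e_def)
  have "e k \<in> sphere 0 1" for k using nz[of k] by (simp add: e_def norm_divide)
  then obtain l r where lr: "strict_mono r" "(e \<circ> r) \<longlonglongrightarrow> l"
    using compact_sphere[of "0::complex" 1] unfolding compact_def by metis
  have Ree: "Re (e k) \<ge> c" for k
    using s(2)[of k] nz[of k] by (simp add: e_def Re_divide_of_real field_simps)
  have Rel: "Re l \<ge> c"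
    by (rule tendsto_lowerbound[OF tendsto_Re[OF lr(2)]]) (auto simp: Ree)
  define q where "q k = sqrt (norm (s (r k)))" for k
  have q2: "(q k)\<^sup>2 = norm (s (r k))" "q k > 0" for k using nz by (auto simp: q_def)
  have qtop: "filterlim q at_top sequentially"
    unfolding q_def
  proof (rule filterlim_compose[OF sqrt_at_top])
    have "real (Suc (r k)) \<ge> real k" for k using seq_suble[OF lr(1), of k] by simp
    then have "norm (s (r k)) \<ge> real k" for k using s(1)[of "r k"] order_trans by blast
    then show "filterlim (\<lambda>k. norm (s (r k))) at_top sequentially"
      by (intro filterlim_at_top_mono[OF filterlim_real_sequentially]) auto
  qed
  let ?g = "\<lambda>x::real. exp (n * x - c * x\<^sup>2) + exp (- n * x - c * x\<^sup>2)"
  have i: "integrable lborel ?g" using c by (intro Bochner_Integration.integrable_add integrable_gauss_lin)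
  have "(\<lambda>k. \<integral>x. exp (of_real (n * (x / q k)) - 2 * s (r k) * of_real (cosh (x / q k) - 1)) \<partial>lborel) \<longlonglongrightarrow> (\<integral>x. exp (- l * of_real (x\<^sup>2)) \<partial>lborel)"
  proof (rule integral_dominated_convergence[OF _ _ i])
    show "AE x in lborel. norm (exp (of_real (n * (x / q k)) - 2 * s (r k) * of_real (cosh (x / q k) - 1)) :: complex) \<le> ?g x" for k
    proof -
      have "norm (s (r k)) \<ge> 1" using s(1)[of "r k"] by simp
      from besselint_scaled_bound[OF c this s(2)] show ?thesis unfolding q_def by simp
    qed
    have "(\<lambda>k. exp (of_real (n * (x / q k)) - 2 * s (r k) * of_real (cosh (x / q k) - 1)) :: complex) \<longlonglongrightarrow> exp (- l * of_real (x\<^sup>2))" for x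
    proof -
      have 1: "(\<lambda>k. n * (x / q k)) \<longlonglongrightarrow> n * 0"
        by (intro tendsto_intros tendsto_divide_0[OF tendsto_const] filterlim_at_top_imp_at_infinity qtop)
      have 2: "(\<lambda>k. (q k)\<^sup>2 * (cosh (x / q k) - 1)) \<longlonglongrightarrow> x\<^sup>2 / 2"
        by (rule filterlim_compose[OF cosh_scaled_limit qtop])
      have "(\<lambda>k. exp (of_real (n * (x / q k)) - 2 * (e \<circ> r) k * of_real ((q k)\<^sup>2 * (cosh (x / q k) - 1)))) \<longlonglongrightarrow> exp (of_real (n * 0) - 2 * l * of_real (x\<^sup>2 / 2))"
        by (intro tendsto_intros 1 2 lr(2))
      moreover have "2 * (e \<circ> r) k * of_real ((q k)\<^sup>2 * (cosh (x / q k) - 1)) = 2 * s (r k) * of_real (cosh (x / q k) - 1)" for k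
      proof -
        have "s (r k) = e (r k) * of_real ((q k)\<^sup>2)" unfolding q2 using es[of "r k"] by simp
        then show ?thesis by simp
      qed
      ultimately show ?thesis by (simp only:) simp
    qed
    then show "AE x in lborel. (\<lambda>k. exp (of_real (n * (x / q k)) - 2 * s (r k) * of_real (cosh (x / q k) - 1)) :: complex) \<longlonglongrightarrow> exp (- l * of_real (x\<^sup>2))"
      by simp
  qed measurable
  then have "(\<lambda>k. exp (2 * s (r k)) * of_real (q k) * besselint n (s (r k))) \<longlonglongrightarrow> (\<integral>x. exp (- l * of_real (x\<^sup>2)) \<partial>lborel)"
    by (subst besselint_scaled[OF q2(2)])
  moreover have "(\<lambda>k. exp (2 * s (r k)) * of_real (q k) * besselint n (s (r k))) \<longlonglongrightarrow> 0"
  proof (rule Lim_null_comparison)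
    show "\<forall>\<^sub>F k in sequentially. norm (exp (2 * s (r k)) * of_real (q k) * besselint n (s (r k))) \<le> inverse (real (Suc (r k)))"
      using less_imp_le[OF s(3)] unfolding q_def by (intro always_eventually allI)
    show "(\<lambda>k. inverse (real (Suc (r k)))) \<longlonglongrightarrow> 0"
      using LIMSEQ_subseq_LIMSEQ[OF LIMSEQ_inverse_real_of_nat lr(1)] by (simp add: comp_def)
  qed
  ultimately have "(\<integral>x. exp (- l * of_real (x\<^sup>2)) \<partial>lborel) = (0::complex)" by (rule LIMSEQ_unique)
  with gaussian_integral_complex_nz[of l] Rel c show False by simp
qed

section \<open>The function phi off the negative axis\<close>

text \<open>This is \<open>2 z\<^bsup>n/2\<^esup> K\<^sub>n(2 \<surd>z)\<close>.  The power of \<open>z\<close> removes the singularity at the origin up to a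
  logarithm, and turns the two Bessel identities into \<open>\<phi>\<^sub>n\<^sub>+\<^sub>1' = - \<phi>\<^sub>n\<close> and
  \<open>\<phi>\<^sub>n\<^sub>+\<^sub>2 = (n + 1) \<phi>\<^sub>n\<^sub>+\<^sub>1 + z \<phi>\<^sub>n\<close>.\<close>

definition bphi :: "nat \<Rightarrow> complex \<Rightarrow> complex" where
  "bphi n z = csqrt z ^ n * besselint (real n) (csqrt z)"

definition bphi_real :: "nat \<Rightarrow> real \<Rightarrow> real" where
  "bphi_real n x = sqrt x ^ n * besselint_real (real n) (sqrt x)"

lemma Re_csqrt_pos: "z \<notin> \<real>\<^sub>\<le>\<^sub>0 \<Longrightarrow> Re (csqrt z) > 0"
  using csqrt_principal[of z] Re_csqrt[of z]
  by (metis complex_nonpos_Reals_iff csqrt.sel(1) less_eq_real_def power2_csqrt complex_eq_iff Re_power2 Im_power2 mult_zero_left mult_zero_right power2_less_eq_zero_iff diff_gt_0_iff_gt zero_power2 not_less diff_0 neg_le_0_iff_le zero_le_power2)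

lemma bphi_of_real: "x \<ge> 0 \<Longrightarrow> bphi n (of_real x) = of_real (bphi_real n x)"
  unfolding bphi_def bphi_real_def by (simp add: besselint_of_real)

lemma bphi_real_pos: "x > 0 \<Longrightarrow> bphi_real n x > 0"
  unfolding bphi_real_def using besselint_real_pos by simp

lemma bphi_recurrence:
  assumes "z \<notin> \<real>\<^sub>\<le>\<^sub>0"
  shows "bphi (Suc (Suc n)) z = of_nat (Suc n) * bphi (Suc n) z + z * bphi n z"
proof -
  let ?s = "csqrt z"
  have "of_real (real (Suc n)) * besselint (real (Suc n)) ?s = ?s * (besselint (real (Suc n) + 1) ?s - besselint (real (Suc n) - 1) ?s)"
    by (rule besselint_recurrence[OF Re_csqrt_pos[OF assms]])
  then have "?s ^ Suc n * (of_nat (Suc n) * besselint (real (Suc n)) ?s) = ?s ^ Suc n * (?s * (besselint (real (Suc (Suc n))) ?s - besselint (real n) ?s))"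
    by (simp add: add.commute)
  moreover have "z = ?s * ?s" using power2_csqrt[of z] by (simp add: power2_eq_square)
  then have "z * bphi n z = ?s ^ Suc n * (?s * besselint (real n) ?s)"
    unfolding bphi_def by (simp add: mult_ac)
  moreover have "?s ^ Suc n * (of_nat (Suc n) * besselint (real (Suc n)) ?s) = of_nat (Suc n) * bphi (Suc n) z"
    "?s ^ Suc n * (?s * (besselint (real (Suc (Suc n))) ?s - besselint (real n) ?s)) = bphi (Suc (Suc n)) z - ?s ^ Suc n * (?s * besselint (real n) ?s)"
    unfolding bphi_def by (simp_all add: algebra_simps)
  ultimately show ?thesis by (metis diff_add_cancel)
qed

lemma bphi_Suc_deriv:
  assumes z: "z \<notin> \<real>\<^sub>\<le>\<^sub>0"
  shows "(bphi (Suc n) has_field_derivative - bphi n z) (at z)"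
proof -
  let ?s = "csqrt z" let ?m = "real (Suc n)"
  have s: "Re ?s > 0" by (rule Re_csqrt_pos[OF z])
  then have snz: "?s \<noteq> 0" by auto
  have "((\<lambda>s. s ^ Suc n * besselint ?m s) has_field_derivative
     (of_nat (Suc n) * ?s ^ n * besselint ?m ?s - ?s ^ Suc n * (besselint (?m + 1) ?s + besselint (?m - 1) ?s))) (at ?s)"
    by (rule derivative_eq_intros besselint_deriv[OF s] refl)+ (simp add: algebra_simps)
  also have "of_nat (Suc n) * ?s ^ n * besselint ?m ?s - ?s ^ Suc n * (besselint (?m + 1) ?s + besselint (?m - 1) ?s)
    = - 2 * ?s * bphi n z"
  proof -
    have "of_nat (Suc n) * besselint ?m ?s = ?s * (besselint (?m + 1) ?s - besselint (?m - 1) ?s)"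
      using besselint_recurrence[OF s, of ?m] by simp
    then have "of_nat (Suc n) * ?s ^ n * besselint ?m ?s = ?s ^ n * (?s * (besselint (?m + 1) ?s - besselint (?m - 1) ?s))"
      by (metis mult.assoc mult.commute)
    then show ?thesis unfolding bphi_def by (simp add: algebra_simps)
  qed
  finally have "((\<lambda>s. s ^ Suc n * besselint ?m s) has_field_derivative - 2 * ?s * bphi n z) (at ?s)" .
  from DERIV_chain2[OF this has_field_derivative_csqrt[OF z]]
  have "((\<lambda>x. csqrt x ^ Suc n * besselint ?m (csqrt x)) has_field_derivative - 2 * ?s * bphi n z * inverse (2 * ?s)) (at z)" .
  moreover have "- 2 * ?s * bphi n z * inverse (2 * ?s) = - bphi n z" using snz by simp
  ultimately show ?thesis by (simp only: bphi_def[abs_def])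
qed

lemma bphi_0_deriv:
  assumes z: "z \<notin> \<real>\<^sub>\<le>\<^sub>0"
  shows "(bphi 0 has_field_derivative - bphi 1 z / z) (at z)"
proof -
  let ?s = "csqrt z"
  have s: "Re ?s > 0" by (rule Re_csqrt_pos[OF z])
  then have snz: "?s \<noteq> 0" by auto
  have zz: "z = ?s * ?s" using power2_csqrt[of z] by (simp add: power2_eq_square)
  have "(besselint 0 has_field_derivative - 2 * besselint 1 ?s) (at ?s)"
    using besselint_deriv[OF s, of 0] besselint_minus[of 1 ?s] by simp
  from DERIV_chain2[OF this has_field_derivative_csqrt[OF z]]
  have "((\<lambda>x. besselint 0 (csqrt x)) has_field_derivative - 2 * besselint 1 ?s * (inverse (2 * ?s))) (at z)" by simp
  moreover have "- 2 * besselint 1 ?s * (inverse (2 * ?s)) = - bphi 1 z / z"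
  proof -
    have "bphi 1 z / z = ?s * besselint 1 ?s / (?s * ?s)" unfolding bphi_def using zz by simp
    then show ?thesis using snz by (simp add: field_simps)
  qed
  ultimately show ?thesis by (simp add: bphi_def[abs_def])
qed

lemma bphi_holomorphic: "bphi n holomorphic_on - \<real>\<^sub>\<le>\<^sub>0"
proof (cases n)
  case 0 then show ?thesis using bphi_0_deriv
    by (auto simp: holomorphic_on_def field_differentiable_def intro: has_field_derivative_at_within)
next
  case (Suc m) then show ?thesis using bphi_Suc_deriv[of _ m]
    by (auto simp: holomorphic_on_def field_differentiable_def intro: has_field_derivative_at_within)
qed

text \<open>The modified Bessel function of the first kind in the same normalisation, \<open>z\<^bsup>- n/2\<^esup> I\<^sub>n(2 \<surd>z)\<close>.
  With the harmonic series \<open>bharm\<close> that follows, \<open>bI 0 z * Ln z + bharm z\<close> is the second solution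
  of the equation \<open>(z f')' = f\<close> satisfied by \<open>\<phi>\<^sub>0\<close>.\<close>

definition bI :: "nat \<Rightarrow> complex \<Rightarrow> complex" where
  "bI n z = (\<Sum>k. of_real (1 / (fact k * fact (n + k))) * z ^ k)"

definition bharm :: "complex \<Rightarrow> complex" where
  "bharm z = (\<Sum>k. of_real (- 2 * harm k / (fact k)\<^sup>2) * z ^ k)"

lemma summable_factorial_bound:
  fixes c :: "nat \<Rightarrow> real"
  assumes c: "\<And>k. \<bar>c k\<bar> \<le> C / fact k"
  shows "summable (\<lambda>k. of_real (c k) * (z::complex) ^ k)"
proof (rule summable_comparison_test')
  show "summable (\<lambda>k. C * (norm z ^ k /\<^sub>R fact k))"
    by (intro summable_mult summable_exp_generic)
  fix k :: nat
  have "norm (of_real (c k) * z ^ k) = \<bar>c k\<bar> * norm z ^ k" by (simp add: norm_mult norm_power)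
  also have "\<dots> \<le> C / fact k * norm z ^ k" by (intro mult_right_mono c) auto
  finally show "norm (of_real (c k) * z ^ k) \<le> C * (norm z ^ k /\<^sub>R fact k)" by (simp add: field_simps)
qed

lemma entire_real_power_series:
  fixes c :: "nat \<Rightarrow> real"
  assumes s: "\<And>z::complex. summable (\<lambda>k. of_real (c k) * z ^ k)"
  defines "f \<equiv> \<lambda>z::complex. (\<Sum>k. of_real (c k) * z ^ k)"
  defines "f' \<equiv> \<lambda>z::complex. (\<Sum>k. of_real (diffs c k) * z ^ k)"
  shows "(f has_field_derivative f' z) (at z)"
    and "\<And>z::complex. summable (\<lambda>k. of_real (diffs c k) * z ^ k)"
    and "f 0 = of_real (c 0)"
    and "f (cnj z) = cnj (f z)"
proof -
  have d: "diffs (\<lambda>k. of_real (c k) :: complex) = (\<lambda>k. of_real (diffs c k))"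
    by (simp add: diffs_def fun_eq_iff)
  show "(f has_field_derivative f' z) (at z)"
    unfolding f_def f'_def using termdiffs_strong_converges_everywhere[OF s] unfolding d .
  show "summable (\<lambda>k. of_real (diffs c k) * z ^ k)" for z :: complex
    using termdiff_converges_all[OF s, of z] unfolding d .
  show "f 0 = of_real (c 0)" unfolding f_def by simp
  have "(\<lambda>k. cnj (of_real (c k) * z ^ k)) sums cnj (f z)"
    unfolding f_def sums_cnj using s[of z] by (rule summable_sums)
  then show "f (cnj z) = cnj (f z)" unfolding f_def by (simp add: sums_iff)
qed

lemma bI_bound: "\<bar>1 / (fact k * fact (n + k) :: real)\<bar> \<le> 1 / fact k"
proof -
  have "(1::real) \<le> fact (n + k)" by (rule fact_ge_1)
  then show ?thesis by (simp add: divide_le_eq field_simps)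
qed

lemma bharm_bound: "\<bar>- 2 * harm k / (fact k)\<^sup>2 :: real\<bar> \<le> 2 / fact k"
proof -
  have h: "harm k \<le> (fact k :: real)"
  proof (induction k)
    case (Suc k)
    have "harm (Suc k) = harm k + inverse (real (Suc k))" by (simp add: harm_Suc)
    also have "\<dots> \<le> fact (Suc k)"
    proof (cases "k = 0")
      case False
      have "inverse (real (Suc k)) \<le> 1" by (simp add: field_simps)
      also have "1 \<le> fact k * (real k)" using False fact_ge_1[of k, where 'a = real]
        by (metis One_nat_def Suc_leI mult_mono' mult_1 of_nat_1 of_nat_le_iff neq0_conv zero_le_one)
      finally show ?thesis using Suc by (simp add: algebra_simps)
    qed (simp add: harm_def)
    finally show ?case .
  qed (simp add: harm_def)
  have "\<bar>- 2 * harm k / (fact k)\<^sup>2 :: real\<bar> = 2 * harm k / (fact k)\<^sup>2" using harm_nonneg[of k, where 'a = real] by simp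
  also have "\<dots> \<le> 2 * fact k / (fact k)\<^sup>2" using h by (intro divide_right_mono) auto
  also have "\<dots> = 2 / fact k" by (simp add: power2_eq_square)
  finally show ?thesis .
qed

lemma summable_bI: "summable (\<lambda>k. of_real (1 / (fact k * fact (n + k))) * (z::complex) ^ k)"
  by (rule summable_factorial_bound[of "\<lambda>k. 1 / (fact k * fact (n + k))", OF bI_bound])

lemma bI_sums: "(\<lambda>k. of_real (1 / (fact k * fact (n + k))) * z ^ k) sums bI n z"
  unfolding bI_def by (intro summable_sums summable_bI)

lemma bI_deriv: "(bI n has_field_derivative bI (Suc n) z) (at z)"
proof -
  have "diffs (\<lambda>k. 1 / (fact k * fact (n + k))) = (\<lambda>k. 1 / (fact k * fact (Suc n + k)) :: real)"
    by (auto simp: diffs_def fun_eq_iff field_simps simp del: of_nat_Suc)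
  then show ?thesis using entire_real_power_series(1)[of "\<lambda>k. 1 / (fact k * fact (n + k))" z, OF summable_bI]
    unfolding bI_def[abs_def] by (simp only:)
qed

lemma bI_cnj: "bI n (cnj z) = cnj (bI n z)"
  using entire_real_power_series(4)[of "\<lambda>k. 1 / (fact k * fact (n + k))" z, OF summable_bI] unfolding bI_def .

lemma bI_0: "bI n 0 = of_real (1 / fact n)"
  using entire_real_power_series(3)[of "\<lambda>k. 1 / (fact k * fact (n + k))", OF summable_bI] unfolding bI_def by simp

lemma bI_holomorphic [holomorphic_intros]: "bI n holomorphic_on A"
  using bI_deriv by (auto simp: holomorphic_on_def field_differentiable_def intro: has_field_derivative_at_within)

lemma bI_recurrence: "z * bI (Suc (Suc n)) z = bI n z - of_nat (Suc n) * bI (Suc n) z"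
proof -
  have "(\<lambda>k. of_real (1 / (fact k * fact (n + k))) * z ^ k - of_nat (Suc n) * (of_real (1 / (fact k * fact (Suc n + k))) * z ^ k))
     sums (bI n z - of_nat (Suc n) * bI (Suc n) z)"
    by (intro sums_diff sums_mult bI_sums)
  then have "(\<lambda>k. of_real (1 / (fact (Suc k) * fact (n + Suc k))) * z ^ Suc k - of_nat (Suc n) * (of_real (1 / (fact (Suc k) * fact (Suc n + Suc k))) * z ^ Suc k))
     sums (bI n z - of_nat (Suc n) * bI (Suc n) z)"
  proof -
    assume F: "(\<lambda>k. of_real (1 / (fact k * fact (n + k))) * z ^ k - of_nat (Suc n) * (of_real (1 / (fact k * fact (Suc n + k))) * z ^ k))
     sums (bI n z - of_nat (Suc n) * bI (Suc n) z)" (is "?F sums ?L")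
    have "real (Suc n) * (1 / fact (Suc n)) = (1 / fact n)" by (simp add: divide_simps)
    then have "of_nat (Suc n) * of_real (1 / fact (Suc n)) = (of_real (1 / fact n) :: complex)"
      by (metis of_real_mult of_real_of_nat_eq)
    then have "?F 0 = 0" by simp
    then have "?F sums (?L + ?F 0)" using F by (simp only: add_0_right)
    then show ?thesis by (subst sums_Suc_iff)
  qed
  moreover have "of_real (1 / (fact (Suc k) * fact (n + Suc k))) * z ^ Suc k - of_nat (Suc n) * (of_real (1 / (fact (Suc k) * fact (Suc n + Suc k))) * z ^ Suc k)
     = z * (of_real (1 / (fact k * fact (Suc (Suc n) + k))) * z ^ k)" for k
  proof -
    have "1 / (fact (Suc k) * fact (n + Suc k)) - real (Suc n) * (1 / (fact (Suc k) * fact (Suc n + Suc k))) = (1 / (fact k * fact (Suc (Suc n) + k)) :: real)"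
    proof -
      have f: "fact (Suc n + Suc k) = (real n + real k + 2) * fact (Suc n + k)" "fact (n + Suc k) = (fact (Suc n + k) :: real)"
        "fact (Suc (Suc n) + k) = (real n + real k + 2) * fact (Suc n + k)" "fact (Suc k) = (real k + 1) * fact k"
        by (simp_all add: algebra_simps)
      have "a > 0 \<Longrightarrow> b > 0 \<Longrightarrow> 1 / ((real k + 1) * a * b) - (real n + 1) * (1 / ((real k + 1) * a * ((real n + real k + 2) * b))) = 1 / (a * ((real n + real k + 2) * b))" for a b :: real
        by (simp add: divide_simps)
      from this[of "fact k" "fact (Suc n + k)"] show ?thesis unfolding f by (simp add: add.commute)
    qed
    then have "of_real (1 / (fact (Suc k) * fact (n + Suc k))) - of_nat (Suc n) * of_real (1 / (fact (Suc k) * fact (Suc n + Suc k))) = (of_real (1 / (fact k * fact (Suc (Suc n) + k))) :: complex)"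
      by (metis of_real_diff of_real_mult of_real_of_nat_eq)
    then have "(of_real (1 / (fact (Suc k) * fact (n + Suc k))) - of_nat (Suc n) * of_real (1 / (fact (Suc k) * fact (Suc n + Suc k)))) * z ^ Suc k = of_real (1 / (fact k * fact (Suc (Suc n) + k))) * z ^ Suc k"
      by simp
    then have "of_real (1 / (fact (Suc k) * fact (n + Suc k))) * z ^ Suc k - of_nat (Suc n) * of_real (1 / (fact (Suc k) * fact (Suc n + Suc k))) * z ^ Suc k = of_real (1 / (fact k * fact (Suc (Suc n) + k))) * z ^ Suc k"
      by (simp only: left_diff_distrib)
    then show ?thesis by (simp only: mult.assoc power_Suc) (simp only: mult_ac)
  qed
  moreover have "(\<lambda>k. z * (of_real (1 / (fact k * fact (Suc (Suc n) + k))) * z ^ k)) sums (z * bI (Suc (Suc n)) z)"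
    by (intro sums_mult bI_sums)
  ultimately show ?thesis by (metis (no_types, lifting) sums_unique2 sums_cong)
qed

abbreviation harm_coeff :: "nat \<Rightarrow> real" where "harm_coeff k \<equiv> - 2 * harm k / (fact k)\<^sup>2"

definition bharm' :: "complex \<Rightarrow> complex" where
  "bharm' z = (\<Sum>k. of_real (diffs harm_coeff k) * z ^ k)"

lemma summable_harm_coeff: "summable (\<lambda>k. of_real (harm_coeff k) * (z::complex) ^ k)"
  by (rule summable_factorial_bound[OF bharm_bound])

lemmas summable_harm_coeff' = entire_real_power_series(2)[OF summable_harm_coeff]

lemma bharm_deriv: "(bharm has_field_derivative bharm' z) (at z)"
  using entire_real_power_series(1)[OF summable_harm_coeff] unfolding bharm_def[abs_def] bharm'_def .

lemma bharm_cnj: "bharm (cnj z) = cnj (bharm z)" "bharm' (cnj z) = cnj (bharm' z)"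
  using entire_real_power_series(4)[OF summable_harm_coeff] entire_real_power_series(4)[OF summable_harm_coeff']
  unfolding bharm_def bharm'_def by auto

lemma bharm_ode: "((\<lambda>z. z * bharm' z) has_field_derivative bharm z - 2 * bI 1 z) (at z)"
proof -
  define c where "c k = real k * harm_coeff k + 2 * (1 / (fact k * fact (0 + k)))" for k :: nat
  have ds: "(\<lambda>k. of_real (diffs harm_coeff k) * z ^ k) sums bharm' z" for z :: complex
    unfolding bharm'_def by (rule summable_sums[OF summable_harm_coeff'])
  have "(\<lambda>k. of_real (real k * harm_coeff k) * z ^ k) sums (z * bharm' z)" for z :: complex
  proof -
    have "(\<lambda>k. z * (of_real (diffs harm_coeff k) * z ^ k)) sums (z * bharm' z)" by (intro sums_mult ds)
    then have "(\<lambda>k. of_real (real (Suc k) * harm_coeff (Suc k)) * z ^ Suc k) sums (z * bharm' z)"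
      by (simp only: diffs_def of_nat_Suc power_Suc mult_ac)
    then show ?thesis by (subst (asm) sums_Suc_iff) simp
  qed
  then have cs: "(\<lambda>k. of_real (real k * harm_coeff k) * z ^ k + 2 * (of_real (1 / (fact k * fact (0 + k))) * z ^ k)) sums (z * bharm' z + 2 * bI 0 z)" for z :: complex
    by (intro sums_add sums_mult bI_sums)
  have ceq: "of_real (real k * harm_coeff k) * z ^ k + 2 * (of_real (1 / (fact k * fact (0 + k))) * z ^ k) = of_real (c k) * z ^ k" for k and z :: complex
    unfolding c_def by (simp only: of_real_add of_real_mult of_real_numeral distrib_right mult.assoc)
  have cs: "(\<lambda>k. of_real (c k) * z ^ k) sums (z * bharm' z + 2 * bI 0 z)" for z :: complex
    using cs unfolding ceq .
  have dc: "diffs c = harm_coeff"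
  proof
    fix k
    have "real (Suc k) * (real (Suc k) * (- 2 * (h + 1 / real (Suc k)) / (real (Suc k) * f)\<^sup>2) + 2 * (1 / ((real (Suc k) * f) * (real (Suc k) * f)))) = - 2 * h / f\<^sup>2"
      if "f > 0" for f h :: real
      using that by (simp add: divide_simps power2_eq_square del: of_nat_Suc)
    from this[of "fact k" "harm k"] show "diffs c k = harm_coeff k"
      by (simp add: diffs_def c_def harm_Suc inverse_eq_divide)
  qed
  have "((\<lambda>z. \<Sum>k. of_real (c k) * z ^ k) has_field_derivative (\<Sum>k. of_real (diffs c k) * z ^ k)) (at z)"
    by (rule entire_real_power_series(1)) (rule sums_summable[OF cs])
  then have "((\<lambda>z. z * bharm' z + 2 * bI 0 z) has_field_derivative bharm z) (at z)"
    using cs unfolding dc bharm_def[symmetric] by (simp add: sums_iff)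
  from DERIV_diff[OF this DERIV_cmult[OF bI_deriv, of 2 0 z]] show ?thesis by simp
qed

lemma connected_slit: "connected (- \<real>\<^sub>\<le>\<^sub>0 :: complex set)"
proof (rule starlike_imp_connected)
  show "starlike (- \<real>\<^sub>\<le>\<^sub>0 :: complex set)"
    unfolding starlike_def
  proof (intro bexI[of _ 1] ballI subsetI)
    fix z w :: complex assume z: "z \<in> - \<real>\<^sub>\<le>\<^sub>0" and w: "w \<in> closed_segment 1 z"
    then obtain u where u: "0 \<le> u" "u \<le> 1" "w = (1 - u) *\<^sub>R 1 + u *\<^sub>R z" by (auto simp: in_segment)
    show "w \<in> - \<real>\<^sub>\<le>\<^sub>0"
    proof
      assume "w \<in> \<real>\<^sub>\<le>\<^sub>0"
      then have 1: "Re w \<le> 0" "Im w = 0" by (auto simp: complex_nonpos_Reals_iff)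
      then have "u * Im z = 0" "(1 - u) + u * Re z \<le> 0" using u by auto
      moreover have "u \<noteq> 0" using calculation by auto
      ultimately have "Im z = 0" "u * Re z \<le> 0" using u by auto
      then have "z \<in> \<real>\<^sub>\<le>\<^sub>0" using \<open>u \<noteq> 0\<close> u by (auto simp: complex_nonpos_Reals_iff mult_le_0_iff)
      then show False using z by simp
    qed
  qed (simp add: complex_nonpos_Reals_iff)
qed

text \<open>Both functions solve \<open>(z f')' = f\<close>, so the derivative of the Wronskian cancels.\<close>

lemma wronskian_const:
  assumes f: "\<And>z. z \<notin> \<real>\<^sub>\<le>\<^sub>0 \<Longrightarrow> (f has_field_derivative f' z) (at z)"
    "\<And>z. z \<notin> \<real>\<^sub>\<le>\<^sub>0 \<Longrightarrow> ((\<lambda>z. z * f' z) has_field_derivative f z) (at z)"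
    and g: "\<And>z. z \<notin> \<real>\<^sub>\<le>\<^sub>0 \<Longrightarrow> (g has_field_derivative g' z) (at z)"
    "\<And>z. z \<notin> \<real>\<^sub>\<le>\<^sub>0 \<Longrightarrow> ((\<lambda>z. z * g' z) has_field_derivative g z) (at z)"
    and z: "z \<notin> \<real>\<^sub>\<le>\<^sub>0"
  shows "f z * (z * g' z) - g z * (z * f' z) = f 1 * g' 1 - g 1 * (f' 1 :: complex)"
proof -
  let ?W = "\<lambda>z. f z * (z * g' z) - g z * (z * f' z)"
  obtain c where c: "\<And>z. z \<in> - \<real>\<^sub>\<le>\<^sub>0 \<Longrightarrow> ?W z = c"
  proof (rule DERIV_zero_connected_constant[of "- \<real>\<^sub>\<le>\<^sub>0" "{}" ?W])
    show "continuous_on (- \<real>\<^sub>\<le>\<^sub>0) ?W"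
      by (rule continuous_at_imp_continuous_on)
         (auto intro!: continuous_diff continuous_mult' DERIV_isCont[OF f(1)] DERIV_isCont[OF g(1)] DERIV_isCont[OF f(2)] DERIV_isCont[OF g(2)])
    have "(?W has_field_derivative 0) (at z)" if z: "z \<notin> \<real>\<^sub>\<le>\<^sub>0" for z
      by (rule DERIV_cong[OF DERIV_diff[OF DERIV_mult[OF f(1)[OF z] g(2)[OF z]] DERIV_mult[OF g(1)[OF z] f(2)[OF z]]]])
         (simp add: algebra_simps)
    then show "\<forall>z\<in>- \<real>\<^sub>\<le>\<^sub>0 - {}. (?W has_field_derivative 0) (at z)" by simp
  qed (use connected_slit closed_nonpos_Reals_complex in \<open>auto simp: open_Compl\<close>)
  from c[of z] c[of 1] z show ?thesis by (simp add: complex_nonpos_Reals_iff)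
qed

lemma bI0_ode: "((\<lambda>z. z * bI 1 z) has_field_derivative bI 0 z) (at z)"
  using bI_recurrence[of z 0] by (auto intro!: derivative_eq_intros bI_deriv simp: algebra_simps)

definition blog :: "complex \<Rightarrow> complex" where "blog z = bI 0 z * Ln z + bharm z"
definition blog' :: "complex \<Rightarrow> complex" where "blog' z = bI 1 z * Ln z + bI 0 z / z + bharm' z"

lemma blog_deriv:
  assumes z: "z \<notin> \<real>\<^sub>\<le>\<^sub>0"
  shows "(blog has_field_derivative blog' z) (at z)"
    and "((\<lambda>z. z * blog' z) has_field_derivative blog z) (at z)"
proof -
  have z0: "z \<noteq> 0" using z by auto
  show "(blog has_field_derivative blog' z) (at z)"
    unfolding blog_def[abs_def] blog'_def using z0
    by (auto intro!: derivative_eq_intros bI_deriv bharm_deriv has_field_derivative_Ln z simp: field_simps)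
  have "((\<lambda>z. (z * bI 1 z) * Ln z + bI 0 z + z * bharm' z) has_field_derivative
      (bI 0 z * Ln z + inverse z * (z * bI 1 z) + bI (Suc 0) z + (bharm z - 2 * bI 1 z))) (at z)"
    by (intro DERIV_add DERIV_mult bI0_ode has_field_derivative_Ln z bI_deriv bharm_ode)
  also have "(bI 0 z * Ln z + inverse z * (z * bI 1 z) + bI (Suc 0) z + (bharm z - 2 * bI 1 z)) = blog z"
    using z0 unfolding blog_def by simp
  finally have "((\<lambda>z. (z * bI 1 z) * Ln z + bI 0 z + z * bharm' z) has_field_derivative blog z) (at z)" .
  moreover have "eventually (\<lambda>w. (w * bI 1 w) * Ln w + bI 0 w + w * bharm' w = w * blog' w) (nhds z)"
    using t1_space_nhds[OF z0] by (rule eventually_mono) (simp add: blog'_def field_simps)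
  ultimately show "((\<lambda>z. z * blog' z) has_field_derivative blog z) (at z)"
    by (subst (asm) DERIV_cong_ev[OF refl _ refl]) auto
qed

text \<open>The logarithmic terms of the Wronskian cancel; what remains is an entire function, whose
  constant value can be read off at the origin.\<close>

lemma wronskian_bI_blog: "bI 0 1 * blog' 1 - blog 1 * bI 1 1 = 1"
proof -
  define E where "E z = bI 0 z * bI 0 z + z * (bI 0 z * bharm' z - bharm z * bI 1 z)" for z
  have W: "bI 0 z * (z * blog' z) - blog z * (z * bI 1 z) = E z" if "z \<notin> \<real>\<^sub>\<le>\<^sub>0" for z
    using that by (auto simp: E_def blog_def blog'_def field_simps)
  have "E z = bI 0 1 * blog' 1 - blog 1 * bI 1 1" if "z \<notin> \<real>\<^sub>\<le>\<^sub>0" for z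
    using wronskian_const[of "bI 0" "bI 1" blog blog' z] bI_deriv[of 0] bI0_ode blog_deriv W[OF that] that by simp
  then have ev: "eventually (\<lambda>x. E (of_real x) = bI 0 1 * blog' 1 - blog 1 * bI 1 1) (at_right (0::real))"
    by (auto simp: eventually_at_filter complex_nonpos_Reals_iff)
  have "isCont E 0"
    unfolding E_def using DERIV_isCont[OF bI_deriv] DERIV_isCont[OF bharm_deriv] DERIV_isCont[OF entire_real_power_series(1)[OF summable_harm_coeff'], folded bharm'_def[abs_def]]
    by (intro continuous_intros) auto
  then have "((\<lambda>x. E (of_real x)) \<longlongrightarrow> E (of_real 0)) (at_right (0::real))"
    by (intro isCont_tendsto_compose[of _ E] tendsto_of_real) (auto simp: tendsto_ident_at)
  then have "((\<lambda>x::real. bI 0 1 * blog' 1 - blog 1 * bI 1 1) \<longlongrightarrow> E 0) (at_right (0::real))"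
    using ev by (simp add: tendsto_cong)
  then have "bI 0 1 * blog' 1 - blog 1 * bI 1 1 = E 0" by (simp add: tendsto_const_iff)
  then show ?thesis by (simp add: E_def bI_0)
qed

text \<open>The coordinates of \<open>\<phi>\<^sub>0\<close> in the basis of solutions \<open>bI 0\<close>, \<open>blog\<close>, as given by Cramer's rule at
  \<open>z = 1\<close>; \<open>bbeta\<close> is the coefficient of the logarithm.\<close>

definition balpha :: real where "balpha = Re (bphi 0 1 * blog' 1 + blog 1 * bphi 1 1)"
definition bbeta :: real where "bbeta = - Re (bphi 0 1 * bI 1 1 + bI 0 1 * bphi 1 1)"

lemma Reals_cnjI: "f (cnj z) = cnj (f z) \<Longrightarrow> z \<in> \<real> \<Longrightarrow> f z \<in> \<real>"
  by (metis Reals_cnj_iff)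

lemma bphi_1_Reals: "bphi n 1 \<in> \<real>"
  using bphi_of_real[of 1 n] by (metis Reals_of_real of_real_1 zero_le_one)

lemma Reals_at_1: "bI n 1 \<in> \<real>" "bharm 1 \<in> \<real>" "bharm' 1 \<in> \<real>"
  using Reals_cnjI[of "bI n" 1] Reals_cnjI[of bharm 1] Reals_cnjI[of bharm' 1] bI_cnj[of n 1] bharm_cnj[of 1] by simp_all

text \<open>The three pairwise Wronskians of \<open>\<phi>\<^sub>0\<close>, \<open>bI 0\<close> and \<open>blog\<close> are constant, and one of them is \<open>1\<close>;
  solving for \<open>\<phi>\<^sub>0\<close> gives the linear combination.\<close>

lemma bphi_0_eq:
  assumes z: "z \<notin> \<real>\<^sub>\<le>\<^sub>0"
  shows "bphi 0 z = of_real balpha * bI 0 z + of_real bbeta * blog z"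
proof -
  have d1: "((\<lambda>z. z * (- bphi 1 z / z)) has_field_derivative bphi 0 z) (at z)" if "z \<notin> \<real>\<^sub>\<le>\<^sub>0" for z
  proof -
    have "((\<lambda>z. - bphi 1 z) has_field_derivative bphi 0 z) (at z)"
      using DERIV_minus[OF bphi_Suc_deriv[OF that, of 0]] by simp
    moreover have "eventually (\<lambda>w. - bphi 1 w = w * (- bphi 1 w / w)) (nhds z)"
          proof -
      have "z \<noteq> 0" using that by auto
      from t1_space_nhds[OF this] show ?thesis by (rule eventually_mono) simp
    qed
    ultimately show ?thesis by (subst (asm) DERIV_cong_ev[OF refl _ refl]) auto
  qed
  have W1: "bphi 0 z * (z * bI 1 z) - bI 0 z * (z * (- bphi 1 z / z)) = bphi 0 1 * bI 1 1 - bI 0 1 * (- bphi 1 1 / 1)"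
    by (rule wronskian_const[OF bphi_0_deriv d1 _ bI0_ode z]) (use bI_deriv[of 0] in auto)
  have W2: "bphi 0 z * (z * blog' z) - blog z * (z * (- bphi 1 z / z)) = bphi 0 1 * blog' 1 - blog 1 * (- bphi 1 1 / 1)"
    by (rule wronskian_const[OF bphi_0_deriv d1 blog_deriv z])
  have W3: "bI 0 z * (z * blog' z) - blog z * (z * bI 1 z) = 1"
    using wronskian_const[OF _ bI0_ode blog_deriv z, of ] bI_deriv[of 0] wronskian_bI_blog by simp
  have "bphi 0 z = bphi 0 z * (bI 0 z * (z * blog' z) - blog z * (z * bI 1 z))" unfolding W3 by simp
  also have "\<dots> = bI 0 z * (bphi 0 z * (z * blog' z) - blog z * (z * (- bphi 1 z / z))) - blog z * (bphi 0 z * (z * bI 1 z) - bI 0 z * (z * (- bphi 1 z / z)))"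
    by (simp add: algebra_simps)
  also have "\<dots> = (bphi 0 1 * blog' 1 + blog 1 * bphi 1 1) * bI 0 z - (bphi 0 1 * bI 1 1 + bI 0 1 * bphi 1 1) * blog z"
    unfolding W1 W2 by simp
  also have "bphi 0 1 * blog' 1 + blog 1 * bphi 1 1 = of_real balpha"
  proof -
    have "blog' 1 \<in> \<real>" "blog 1 \<in> \<real>"
      unfolding blog_def blog'_def using Reals_at_1 by auto
    then have "bphi 0 1 * blog' 1 + blog 1 * bphi 1 1 \<in> \<real>" using bphi_1_Reals by (intro Reals_add Reals_mult)
    then show ?thesis unfolding balpha_def by (simp only: of_real_Re)
  qed
  also have "bphi 0 1 * bI 1 1 + bI 0 1 * bphi 1 1 = - of_real bbeta"
  proof -
    have "bphi 0 1 * bI 1 1 + bI 0 1 * bphi 1 1 \<in> \<real>" using bphi_1_Reals Reals_at_1 by (intro Reals_add Reals_mult)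
    then show ?thesis unfolding bbeta_def by (simp only: of_real_Re of_real_minus minus_minus)
  qed
  finally show ?thesis by simp
qed

lemma Re_bI_1_pos: "Re (bI n 1) > 0"
proof -
  have s: "(\<lambda>k. 1 / (fact k * fact (n + k)) :: real) sums Re (bI n 1)"
    using bounded_linear.sums[OF bounded_linear_Re bI_sums[of n 1]]
    by (simp only: power_one mult_1_right Re_complex_of_real)
  have "0 < (\<Sum>k. 1 / (fact k * fact (n + k)) :: real)"
    by (rule suminf_pos[OF sums_summable[OF s]]) simp
  then show ?thesis using s by (simp add: sums_iff)
qed

lemma bbeta_neg: "bbeta < 0"
proof -
  have "bphi n 1 = of_real (bphi_real n 1)" for n using bphi_of_real[of 1 n] by simp
  moreover have "bphi_real 0 1 > 0" "bphi_real 1 1 > 0" by (rule bphi_real_pos, simp)+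
  ultimately show ?thesis unfolding bbeta_def
    using mult_pos_pos[OF \<open>bphi_real 0 1 > 0\<close> Re_bI_1_pos[of 1]] mult_pos_pos[OF Re_bI_1_pos[of 0] \<open>bphi_real 1 1 > 0\<close>] by simp
qed

text \<open>The entire part of \<open>\<phi>\<^sub>n\<close>, defined by the recurrence of \<open>\<phi>\<close> itself.\<close>

fun bphi_reg :: "nat \<Rightarrow> complex \<Rightarrow> complex" where
  "bphi_reg 0 z = of_real balpha * bI 0 z + of_real bbeta * bharm z"
| "bphi_reg (Suc 0) z = - z * (of_real balpha * bI 1 z + of_real bbeta * bharm' z) - of_real bbeta * bI 0 z"
| "bphi_reg (Suc (Suc n)) z = of_nat (Suc n) * bphi_reg (Suc n) z + z * bphi_reg n z"

lemma bharm'_holomorphic: "bharm' holomorphic_on A" and bharm_holomorphic: "bharm holomorphic_on A"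
  using bharm_deriv entire_real_power_series(1)[OF summable_harm_coeff']
  by (auto simp: bharm'_def[abs_def] holomorphic_on_def field_differentiable_def intro: has_field_derivative_at_within)

lemma bphi_reg_holomorphic [holomorphic_intros]: "bphi_reg n holomorphic_on A"
  by (induction n rule: induct_nat_012) (auto intro!: holomorphic_intros bharm_holomorphic bharm'_holomorphic)

lemma bphi_reg_cnj: "bphi_reg n (cnj z) = cnj (bphi_reg n z)"
  by (induction n rule: induct_nat_012) (auto simp: bI_cnj bharm_cnj)

lemma bphi_reg_Suc_0: "bphi_reg (Suc n) 0 = - of_real bbeta * fact n"
  by (induction n) (auto simp: bI_0)

text \<open>The recurrences of \<open>\<phi>\<close> and of \<open>(- z)\<^sup>n bI\<close> agree, so the coefficient \<open>bbeta\<close> of the logarithm is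
  the same for all orders.\<close>

lemma bphi_eq_bphi_reg:
  assumes z: "z \<notin> \<real>\<^sub>\<le>\<^sub>0"
  shows "bphi n z = bphi_reg n z + of_real bbeta * (- z) ^ n * bI n z * Ln z"
proof (induction n rule: induct_nat_012)
  case 0 show ?case using bphi_0_eq[OF z] by (simp add: blog_def algebra_simps)
next
  case 1
  have z0: "z \<noteq> 0" using z by auto
  have ev: "eventually (\<lambda>w. bphi 0 w = of_real balpha * bI 0 w + of_real bbeta * blog w) (nhds z)"
    using eventually_nhds_in_open[of "- \<real>\<^sub>\<le>\<^sub>0" z] z closed_nonpos_Reals_complex bphi_0_eq
    by (auto elim!: eventually_mono simp: open_Compl)
  have "((\<lambda>w. of_real balpha * bI 0 w + of_real bbeta * blog w) has_field_derivative of_real balpha * bI 1 z + of_real bbeta * blog' z) (at z)"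
    using bI_deriv[of 0 z] by (auto intro!: derivative_eq_intros blog_deriv[OF z])
  then have "(bphi 0 has_field_derivative of_real balpha * bI 1 z + of_real bbeta * blog' z) (at z)"
    using DERIV_cong_ev[OF refl ev refl] by blast
  with bphi_0_deriv[OF z] have "- bphi 1 z / z = of_real balpha * bI 1 z + of_real bbeta * blog' z"
    by (rule DERIV_unique)
  then have "bphi 1 z = - z * (of_real balpha * bI 1 z + of_real bbeta * blog' z)"
  proof -
    assume "- bphi 1 z / z = of_real balpha * bI 1 z + of_real bbeta * blog' z"
    then have "z * (- bphi 1 z / z) = z * (of_real balpha * bI 1 z + of_real bbeta * blog' z)" by (simp only:)
    then have "- bphi 1 z = z * (of_real balpha * bI 1 z + of_real bbeta * blog' z)" using z0 by simp
    then show ?thesis by (metis minus_minus mult_minus_left)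
  qed
  also have "\<dots> = bphi_reg 1 z + of_real bbeta * (- z) ^ 1 * bI 1 z * Ln z"
    using z0 unfolding blog'_def by (simp add: field_simps)
  finally show ?case by simp
next
  case (ge2 n)
  have r: "bI n z = z * bI (Suc (Suc n)) z + of_nat (Suc n) * bI (Suc n) z" using bI_recurrence[of z n] by (simp add: algebra_simps)
  show ?case unfolding bphi_recurrence[OF z] ge2 bphi_reg.simps(3) r by (simp add: algebra_simps)
qed

section \<open>Boundary values and zeros in the upper half plane\<close>

text \<open>The formula for \<open>\<phi>\<^sub>n\<close> off the cut, read with the principal logarithm also on the negative
  axis; there it gives the boundary values of \<open>\<phi>\<^sub>n\<close> from the upper half plane.\<close>

definition bphi_ext :: "nat \<Rightarrow> complex \<Rightarrow> complex" where
  "bphi_ext n z = bphi_reg n z + of_real bbeta * bI n z * ((- z) ^ n * Ln z)"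

lemma bphi_ext_eq_bphi: "z \<notin> \<real>\<^sub>\<le>\<^sub>0 \<Longrightarrow> bphi_ext n z = bphi n z"
  using bphi_eq_bphi_reg by (simp add: bphi_ext_def mult_ac)

lemma continuous_on_upper_Ln: "continuous_on ({z. Im z \<ge> 0} - {0}) Ln"
proof -
  have eq: "Ln z = Ln (- \<i> * z) + \<i> * pi / 2" if "Im z \<ge> 0" "z \<noteq> 0" for z
  proof (rule Ln_unique)
    have nz: "- \<i> * z \<noteq> 0" using that by simp
    have "exp (\<i> * pi / 2) = \<i>" by (simp add: exp_eq_polar complex_eq_iff)
    then show "exp (Ln (- \<i> * z) + \<i> * pi / 2) = z" unfolding exp_add exp_Ln[OF nz] by (simp add: complex_eq_iff)
    have "\<bar>Im (Ln (- \<i> * z))\<bar> \<le> pi / 2" using Re_Ln_pos_le[OF nz] that by simp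
    moreover have "Im (Ln (- \<i> * z) + \<i> * pi / 2) = Im (Ln (- \<i> * z)) + pi / 2" by simp
    ultimately show "- pi < Im (Ln (- \<i> * z) + \<i> * pi / 2)" "Im (Ln (- \<i> * z) + \<i> * pi / 2) \<le> pi"
      using pi_gt_zero by linarith+
  qed
  have "continuous_on ({z. Im z \<ge> 0} - {0}) (\<lambda>z. Ln (- \<i> * z) + \<i> * pi / 2)"
    by (intro continuous_intros) (auto simp: complex_nonpos_Reals_iff complex_eq_iff)
  then show ?thesis by (rule continuous_on_eq) (use eq in auto)
qed

lemma power_Ln_tendsto_0:
  assumes "n \<ge> 1"
  shows "((\<lambda>z. (- z) ^ n * Ln z) \<longlongrightarrow> 0) (at 0)"
proof (rule Lim_null_comparison)
  show "((\<lambda>z. norm z * (\<bar>ln (norm z)\<bar> + pi)) \<longlongrightarrow> 0) (at (0::complex))"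
  proof -
    have "((\<lambda>x. x * (\<bar>ln x\<bar> + pi)) \<longlongrightarrow> 0) (at_right (0::real))" by real_asymp
    moreover have "filterlim (norm :: complex \<Rightarrow> real) (at_right 0) (at 0)"
      unfolding filterlim_at by (auto intro!: tendsto_norm_zero simp: eventually_at_filter)
    ultimately show ?thesis by (rule filterlim_compose)
  qed
  have "eventually (\<lambda>z::complex. z \<in> ball 0 1 - {0}) (at 0)"
    using eventually_at_ball'[of 1 "0::complex" UNIV] by (auto elim!: eventually_mono)
  then show "\<forall>\<^sub>F z in at 0. norm ((- z) ^ n * Ln z) \<le> norm z * (\<bar>ln (norm z)\<bar> + pi)"
  proof (rule eventually_mono)
    fix z :: complex assume z: "z \<in> ball 0 1 - {0}"
    have "norm (Ln z) \<le> \<bar>Re (Ln z)\<bar> + \<bar>Im (Ln z)\<bar>" by (rule cmod_le)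
    also have "\<dots> \<le> \<bar>ln (norm z)\<bar> + pi" using z mpi_less_Im_Ln[of z] Im_Ln_le_pi[of z] by auto
    finally have 1: "norm (Ln z) \<le> \<bar>ln (norm z)\<bar> + pi" .
    have "norm z ^ n \<le> norm z ^ 1" using z assms by (intro power_decreasing) auto
    with 1 show "norm ((- z) ^ n * Ln z) \<le> norm z * (\<bar>ln (norm z)\<bar> + pi)"
      unfolding norm_mult norm_power norm_minus_cancel by (intro mult_mono) auto
  qed
qed

lemma bphi_ext_continuous_upper:
  assumes "n \<ge> 1"
  shows "continuous_on {z. Im z \<ge> 0} (bphi_ext n)"
proof -
  have "continuous (at z within {z. Im z \<ge> 0}) (\<lambda>z. (- z) ^ n * Ln z)" if "Im z \<ge> 0" for z
  proof (cases "z = 0")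
    case True
    have "((\<lambda>z. (- z) ^ n * Ln z) \<longlongrightarrow> 0) (at 0 within {z. Im z \<ge> 0})"
      by (rule tendsto_within_subset[OF power_Ln_tendsto_0[OF assms]]) simp
    then show ?thesis unfolding continuous_within True using assms by (simp add: power_0_left)
  next
    case False
    have "continuous (at z within {z. Im z \<ge> 0} - {0}) (\<lambda>z. (- z) ^ n * Ln z)"
    proof (rule continuous_mult)
      show "continuous (at z within {z. Im z \<ge> 0} - {0}) Ln"
        using continuous_on_upper_Ln that False by (simp add: continuous_on_eq_continuous_within)
    qed (intro continuous_intros)
    moreover have "at z within {z. Im z \<ge> 0} - {0} = at z within {z. Im z \<ge> 0}"
      by (rule at_within_nhd[of z "- {0}"]) (use False in auto)
    ultimately show ?thesis by simp
  qed
  then have "continuous_on {z. Im z \<ge> 0} (\<lambda>z. (- z) ^ n * Ln z)"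
    by (auto simp: continuous_on_eq_continuous_within)
  moreover have "continuous_on {z. Im z \<ge> 0} (bphi_reg n)" "continuous_on {z. Im z \<ge> 0} (bI n)"
    by (intro holomorphic_on_imp_continuous_on bphi_reg_holomorphic bI_holomorphic)+
  ultimately show ?thesis unfolding bphi_ext_def[abs_def]
    by (intro continuous_on_add continuous_on_mult[OF continuous_on_mult] continuous_on_const)
qed

lemma csqrt_scale: "x > 0 \<Longrightarrow> csqrt (of_real x * z) = of_real (sqrt x) * csqrt z"
proof (rule csqrt_unique)
  assume x: "x > 0"
  show "(complex_of_real (sqrt x) * csqrt z)\<^sup>2 = of_real x * z"
    using x by (simp add: power_mult_distrib flip: of_real_power)
  show "0 < Re (complex_of_real (sqrt x) * csqrt z) \<or> Re (complex_of_real (sqrt x) * csqrt z) = 0 \<and> 0 \<le> Im (complex_of_real (sqrt x) * csqrt z)"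
    using x csqrt_principal[of z] by (auto simp: zero_less_mult_iff)
qed

lemma bphi_ray_nonzero:
  assumes z: "z \<notin> \<real>\<^sub>\<le>\<^sub>0"
  shows "\<exists>X>1. bphi n (of_real X * z) \<noteq> 0"
proof -
  let ?s = "csqrt z"
  have s: "Re ?s > 0" by (rule Re_csqrt_pos[OF z])
  have ns: "norm ?s > 0" using s by auto
  obtain R C where RC: "C > 0" "\<And>s. norm s \<ge> R \<Longrightarrow> Re s \<ge> (Re ?s / norm ?s) * norm s \<Longrightarrow> C \<le> norm (exp (2 * s) * sqrt (norm s) * besselint (real n) s)"
    using besselint_lower[of "Re ?s / norm ?s"] s ns by (metis divide_pos_pos)
  define q where "q = max 2 (R / norm ?s)"
  have q: "q \<ge> 2" "q * norm ?s \<ge> R" using ns by (auto simp: q_def le_max_iff_disj max_def field_simps split: if_splits)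
  have qs: "csqrt (of_real (q\<^sup>2) * z) = of_real q * ?s" using q by (subst csqrt_scale) auto
  have "norm (of_real q * ?s) \<ge> R" using q by (simp add: norm_mult)
  moreover have "Re (of_real q * ?s) \<ge> (Re ?s / norm ?s) * norm (of_real q * ?s)" using q ns by (simp add: norm_mult)
  ultimately have "C \<le> norm (exp (2 * (of_real q * ?s)) * sqrt (norm (of_real q * ?s)) * besselint (real n) (of_real q * ?s))" by (rule RC(2))
  with RC(1) have "besselint (real n) (of_real q * ?s) \<noteq> 0" by auto
  then have "bphi n (of_real (q\<^sup>2) * z) \<noteq> 0" unfolding bphi_def qs using q ns by auto
  moreover have "q\<^sup>2 > 1" using q by (simp add: one_less_power)
  ultimately show ?thesis by blast
qed

lemma bphi_ray_tendsto_0: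
  assumes z: "z \<notin> \<real>\<^sub>\<le>\<^sub>0"
  shows "((\<lambda>x. bphi n (of_real x * z)) \<longlongrightarrow> 0) at_top"
proof -
  let ?s = "csqrt z"
  have s: "Re ?s > 0" by (rule Re_csqrt_pos[OF z])
  show ?thesis
  proof (rule Lim_null_comparison)
    let ?b = "\<lambda>x. (sqrt x * norm ?s) ^ n * (exp (- 2 * (sqrt x * Re ?s - 1)) * besselint_real n 1)"
    have "eventually (\<lambda>x. x > 0 \<and> sqrt x * Re ?s \<ge> 1) at_top"
    proof (intro eventually_conj eventually_gt_at_top)
      have "eventually (\<lambda>x. 1 / Re ?s \<le> sqrt x) at_top" using sqrt_at_top unfolding filterlim_at_top by blast
      then show "eventually (\<lambda>x. 1 \<le> sqrt x * Re ?s) at_top" using s by (simp add: field_simps)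
    qed
    then show "\<forall>\<^sub>F x in at_top. norm (bphi n (of_real x * z)) \<le> ?b x"
    proof eventually_elim
      case (elim x)
      have "norm (bphi n (of_real x * z)) = (sqrt x * norm ?s) ^ n * norm (besselint n (of_real (sqrt x) * ?s))"
        unfolding bphi_def csqrt_scale[OF conjunct1[OF elim]] using elim by (simp add: norm_mult norm_power)
      also have "norm (besselint n (of_real (sqrt x) * ?s)) \<le> besselint_real n (Re (of_real (sqrt x) * ?s))"
        using elim s by (intro norm_besselint_le) auto
      also have "\<dots> \<le> exp (- 2 * (sqrt x * Re ?s - 1)) * besselint_real n 1"
        using besselint_real_le[of "sqrt x * Re ?s" n] elim by simp
      finally show ?case using elim by (simp add: mult_left_mono)
    qed
    show "(?b \<longlongrightarrow> 0) at_top"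
    proof -
      have "((\<lambda>x. (sqrt x * a) ^ n * (exp (- 2 * (sqrt x * b - 1)) * c)) \<longlongrightarrow> 0) at_top" if "b > 0" for a b c :: real
      proof -
        have "((\<lambda>y. (y * a) ^ n * (exp (- 2 * (y * b - 1)) * c)) \<longlongrightarrow> 0) at_top"
        proof -
          have "((\<lambda>y. y ^ n * exp (- 2 * (y * b - 1))) \<longlongrightarrow> 0) at_top" using that by real_asymp
          from tendsto_mult_right[OF this, of "a ^ n * c"] show ?thesis
            by (simp add: power_mult_distrib mult_ac)
        qed
        from filterlim_compose[OF this sqrt_at_top] show ?thesis .
      qed
      from this[OF s] show ?thesis .
    qed
  qed
qed

lemma Im_mult_of_real: "Im (z * of_real r) = Im z * r" by simp

text \<open>Along the ray through a zero \<open>z\<close>, \<open>y(x) = \<phi>\<^sub>n\<^sub>+\<^sub>1(x z)\<close> satisfies a second-order equation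
  \<open>(x\<^bsup>- n\<^esup> y')' = z x\<^bsup>- n - 1\<^esup> y\<close>.  Multiplying by the conjugate of \<open>y\<close> and taking imaginary parts, the
  boundary terms \<open>W\<close> increase at rate \<open>Im z x\<^bsup>- n - 1\<^esup> |y|\<^sup>2\<close>.  They vanish at \<open>x = 1\<close>, where \<open>y\<close> does,
  and at infinity, where \<open>\<phi>\<close> decays; so \<open>y\<close> vanishes on the whole ray beyond \<open>x = 1\<close>, which
  contradicts the lower bound on the Bessel integral.\<close>

lemma bphi_nonzero_upper:
  assumes z: "Im z > 0" and n: "n \<ge> 1"
  shows "bphi (Suc n) z \<noteq> 0"
proof
  assume y0: "bphi (Suc n) z = 0"
  have zs: "of_real x * z \<notin> \<real>\<^sub>\<le>\<^sub>0" if "x > 0" for x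
    using z that by (auto simp: complex_nonpos_Reals_iff)
  obtain m where m: "n = Suc m" using n by (cases n) auto
  let ?y = "\<lambda>x::real. bphi (Suc n) (of_real x * z)"
  let ?p = "\<lambda>x::real. inverse (of_real x ^ n) * bphi n (of_real x * z)"
  define W where "W x = Im (- z * ?p x * cnj (?y x))" for x
  define W' where "W' x = Im z * inverse (x ^ Suc n) * (norm (?y x))\<^sup>2" for x
  have dy: "(?y has_vector_derivative (- z * bphi n (of_real x * z))) (at x)" if "x > 0" for x
  proof -
    have "((\<lambda>w. bphi (Suc n) (w * z)) has_field_derivative - bphi n (of_real x * z) * (1 * z)) (at (of_real x))"
      by (rule DERIV_chain2[OF bphi_Suc_deriv[OF zs[OF that]] DERIV_cmult_right[OF DERIV_ident]])
    from has_vector_derivative_real_field[OF this] show ?thesis by (simp add: mult_ac)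
  qed
  have dp: "(?p has_vector_derivative (- inverse (of_real x ^ Suc n) * ?y x)) (at x)" if x: "x > 0" for x
  proof -
    have x0: "of_real x \<noteq> (0::complex)" using x by simp
    have "((\<lambda>w. inverse (w ^ n) * bphi n (w * z)) has_field_derivative
      (- (inverse (of_real x ^ n) * (of_nat n * of_real x ^ (n - Suc 0)) * inverse (of_real x ^ n)) * bphi n (of_real x * z) + (- bphi m (of_real x * z) * (1 * z)) * inverse (of_real x ^ n))) (at (of_real x))"
    proof -
      have "((\<lambda>w. bphi n (w * z)) has_field_derivative (- bphi m (of_real x * z) * (1 * z))) (at (of_real x))"
        unfolding m by (rule DERIV_chain2[OF bphi_Suc_deriv[OF zs[OF x]] DERIV_cmult_right[OF DERIV_ident]])
      moreover have "((\<lambda>w. w ^ n) has_field_derivative (of_nat n * of_real x ^ (n - Suc 0))) (at (of_real x :: complex))"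
        by (rule derivative_eq_intros refl)+ simp
      then have "((\<lambda>w. inverse (w ^ n)) has_field_derivative (- (inverse (of_real x ^ n) * (of_nat n * of_real x ^ (n - Suc 0)) * inverse (of_real x ^ n)))) (at (of_real x :: complex))"
        by (rule DERIV_inverse') (use x0 in simp)
      ultimately show ?thesis by (rule DERIV_mult[rotated])
    qed
    also have "(- (inverse (of_real x ^ n) * (of_nat n * of_real x ^ (n - Suc 0)) * inverse (of_real x ^ n)) * bphi n (of_real x * z) + (- bphi m (of_real x * z) * (1 * z)) * inverse (of_real x ^ n))
      = - inverse (of_real x ^ Suc n) * ?y x"
      unfolding m bphi_recurrence[OF zs[OF x], of m] using x0 by (simp add: field_simps)
    finally show ?thesis by (rule has_vector_derivative_real_field)
  qed
  have dW: "(W has_real_derivative W' x) (at x)" if x: "x > 0" for x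
  proof -
    have d: "((\<lambda>x. - z * ?p x * cnj (?y x)) has_vector_derivative
       (- z * ?p x * cnj (- z * bphi n (of_real x * z)) + - z * (- inverse (of_real x ^ Suc n) * ?y x) * cnj (?y x))) (at x)"
      by (rule has_vector_derivative_mult has_vector_derivative_mult_right has_vector_derivative_cnj dy[OF x] dp[OF x])+
    have "(W has_vector_derivative Im (- z * ?p x * cnj (- z * bphi n (of_real x * z)) + - z * (- inverse (of_real x ^ Suc n) * ?y x) * cnj (?y x))) (at x)"
      unfolding W_def using bounded_linear.has_vector_derivative[OF bounded_linear_Im d] .
    also have "Im (- z * ?p x * cnj (- z * bphi n (of_real x * z)) + - z * (- inverse (of_real x ^ Suc n) * ?y x) * cnj (?y x)) = W' x"
    proof -
      have "- z * ?p x * cnj (- z * bphi n (of_real x * z)) = inverse (of_real x ^ n) * ((z * cnj z) * (bphi n (of_real x * z) * cnj (bphi n (of_real x * z))))"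
        by (simp add: mult_ac)
      also have "\<dots> = of_real (inverse (x ^ n) * ((norm z)\<^sup>2 * (norm (bphi n (of_real x * z)))\<^sup>2))"
        by (simp only: complex_norm_square[symmetric] of_real_mult of_real_inverse of_real_power)
      finally have 1: "Im (- z * ?p x * cnj (- z * bphi n (of_real x * z))) = 0" by (simp only: Im_complex_of_real)
      have "- z * (- inverse (of_real x ^ Suc n) * ?y x) * cnj (?y x) = z * (inverse (of_real x ^ Suc n) * (?y x * cnj (?y x)))"
        by (simp add: mult_ac)
      also have "\<dots> = z * of_real (inverse (x ^ Suc n) * (norm (?y x))\<^sup>2)"
        by (simp only: complex_norm_square[symmetric] of_real_mult of_real_inverse of_real_power)
      finally have 2: "Im (- z * (- inverse (of_real x ^ Suc n) * ?y x) * cnj (?y x)) = W' x"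
        by (simp only: W'_def Im_mult_of_real mult.assoc)
      show ?thesis unfolding plus_complex.sel 1 2 by simp
    qed
    finally show ?thesis by (simp add: has_real_derivative_iff_has_vector_derivative)
  qed
  have W'0: "W' x \<ge> 0" if "x > 0" for x using that z by (simp add: W'_def)
  have mono: "W a \<le> W b" if "1 \<le> a" "a \<le> b" for a b
  proof (rule DERIV_nonneg_imp_nondecreasing[OF that(2)])
    fix x assume "a \<le> x" "x \<le> b"
    then have "x > 0" using that by linarith
    then show "\<exists>y. (W has_real_derivative y) (at x) \<and> 0 \<le> y" using dW W'0 by blast
  qed
  have W1: "W 1 = 0" using y0 by (simp add: W_def)
  have lim: "(W \<longlongrightarrow> 0) at_top"
  proof -
    have "((\<lambda>x. - z * (inverse (of_real x ^ n) * bphi n (of_real x * z)) * cnj (?y x)) \<longlongrightarrow> - z * (0 * 0) * cnj 0) at_top"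
    proof (intro tendsto_mult tendsto_const tendsto_cnj bphi_ray_tendsto_0)
      show "((\<lambda>x. inverse (complex_of_real x ^ n)) \<longlongrightarrow> 0) at_top"
      proof -
        have "((\<lambda>x::real. inverse (x ^ n)) \<longlongrightarrow> 0) at_top" using n by real_asymp
        from tendsto_of_real[OF this, where 'a = complex] show ?thesis by simp
      qed
    qed (use z in \<open>auto simp: complex_nonpos_Reals_iff\<close>)
    from tendsto_Im[OF this] show ?thesis unfolding W_def by simp
  qed
  have Wz: "W x = 0" if "x \<ge> 1" for x
  proof (rule antisym)
    show "W x \<le> 0"
      by (rule tendsto_lowerbound[OF lim]) (auto intro!: eventually_mono[OF eventually_ge_at_top[of x]] mono that)
    show "0 \<le> W x" using mono[of 1 x] W1 that by simp
  qed
  obtain X where X: "X > 1" "?y X \<noteq> 0"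
    using bphi_ray_nonzero[of z "Suc n"] z by (auto simp: complex_nonpos_Reals_iff)
  have "eventually (\<lambda>x. x \<in> {1<..}) (nhds X)" by (rule eventually_nhds_in_open) (use X in auto)
  then have "eventually (\<lambda>x. W x = 0) (nhds X)" by (rule eventually_mono) (use Wz in auto)
  then have "(W has_real_derivative 0) (at X)" by (subst DERIV_cong_ev[OF refl _ refl]) auto
  with dW[of X] X have "W' X = 0" by (auto dest: DERIV_unique)
  with X z show False by (simp add: W'_def)
qed

definition bratio :: "nat \<Rightarrow> complex \<Rightarrow> complex" where "bratio n z = bphi_ext n z / bphi_ext (Suc n) z"

text \<open>In the region \<open>Re z + Im z \<ge> - 1\<close> the argument of \<open>z\<close> stays away from \<open>pi\<close> for large \<open>z\<close>, so the
  square root of \<open>z\<close> lies in a proper sector of the right half plane, where the upper and the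
  lower bound on the Bessel integrals apply.  Their exponential factors cancel in the quotient,
  and the extra factor \<open>\<surd>z\<close> of the denominator remains.\<close>

lemma bratio_decay:
  obtains R C where "C > 0" "R > 0" "\<And>z. norm z \<ge> R \<Longrightarrow> Im z \<ge> 0 \<Longrightarrow> z \<notin> \<real>\<^sub>\<le>\<^sub>0 \<Longrightarrow> Re z + Im z \<ge> - 1 \<Longrightarrow> norm (bratio n z) \<le> C / sqrt (norm z)"
proof -
  \<comment> \<open>any constant below \<open>cos (arccos (- 4/5) / 2)\<close>, the square root of \<open>1/10\<close>, will do\<close>
  define c :: real where "c = 3/10"
  have c: "c > 0" by (simp add: c_def)
  obtain C1 where C1: "\<And>s. norm s \<ge> 1 \<Longrightarrow> Re s \<ge> c * norm s \<Longrightarrow> norm (exp (2 * s) * sqrt (norm s) * besselint (real n) s) \<le> C1"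
    using besselint_upper[OF c] by metis
  obtain R2 C2 where C2: "C2 > 0" "\<And>s. norm s \<ge> R2 \<Longrightarrow> Re s \<ge> c * norm s \<Longrightarrow> C2 \<le> norm (exp (2 * s) * sqrt (norm s) * besselint (real (Suc n)) s)"
    using besselint_lower[OF c, of "real (Suc n)"] by metis
  show ?thesis
  proof (rule that)
    show "(\<bar>C1\<bar> + 1) / C2 > 0" using C2 by simp
    show "max 5 (R2\<^sup>2) > 0" by simp
    fix z assume z: "norm z \<ge> max 5 (R2\<^sup>2)" "Im z \<ge> 0" and zs: "z \<notin> \<real>\<^sub>\<le>\<^sub>0" and z': "Re z + Im z \<ge> - 1"
    let ?s = "csqrt z"
    have n2: "(norm ?s)\<^sup>2 = norm z" by (metis norm_power power2_csqrt)
    then have ns: "norm ?s = sqrt (norm z)" by (metis norm_ge_zero real_sqrt_unique)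
    have Res: "Re z \<ge> - (4/5) * norm z"
    proof (rule ccontr)
      assume "\<not> ?thesis"
      then have 1: "- Re z > (4/5) * norm z" by simp
      have "(- Re z)\<^sup>2 > ((4/5) * norm z)\<^sup>2" using 1 by (intro power_strict_mono) auto
      moreover have "(norm z)\<^sup>2 = (Re z)\<^sup>2 + (Im z)\<^sup>2" by (rule cmod_power2)
      ultimately have "(Im z)\<^sup>2 < ((3/5) * norm z)\<^sup>2" by (simp add: power_mult_distrib power_divide)
      then have "Im z < (3/5) * norm z" by (rule power_less_imp_less_base) simp
      with 1 z z' show False by simp
    qed
    have "Re ?s = sqrt ((norm z + Re z) / 2)" by (simp add: csqrt.simps(1))
    also have "\<dots> \<ge> sqrt (c\<^sup>2 * norm z)"
    proof (rule real_sqrt_le_mono)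
      show "c\<^sup>2 * norm z \<le> (norm z + Re z) / 2"
      proof -
        have "c\<^sup>2 = 9/100" by (simp add: c_def power2_eq_square)
        moreover have "- (4 * norm z) \<le> 5 * Re z" using Res by (simp add: field_simps)
        ultimately show ?thesis using norm_ge_zero[of z] by (simp only:) argo
      qed
    qed
    finally have Rs: "Re ?s \<ge> c * norm ?s" unfolding ns using c by (simp add: real_sqrt_mult)
    have s1: "norm ?s \<ge> 1" unfolding ns using z by simp
    have sR: "norm ?s \<ge> R2" unfolding ns using z by (intro real_le_rsqrt) simp
    let ?e = "norm (exp (2 * ?s) * sqrt (norm ?s))"
    have e: "?e > 0" using s1 by auto
    have a: "?e * norm (besselint (real n) ?s) \<le> C1" using C1[OF s1 Rs] by (simp only: norm_mult)
    have b: "C2 \<le> ?e * norm (besselint (real (Suc n)) ?s)" using C2(2)[OF sR Rs] by (simp only: norm_mult)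
    have bp: "norm (besselint (real (Suc n)) ?s) > 0" using b C2(1) by (cases "besselint (real (Suc n)) ?s = 0") auto
    have "norm (bratio n z) = norm (besselint (real n) ?s) / (norm ?s * norm (besselint (real (Suc n)) ?s))"
      unfolding bratio_def bphi_ext_eq_bphi[OF zs] bphi_def using s1 by (simp add: norm_divide norm_mult norm_power)
    also have "\<dots> = (?e * norm (besselint (real n) ?s)) / (?e * norm (besselint (real (Suc n)) ?s)) / norm ?s"
      using e by simp
    also have "\<dots> \<le> (\<bar>C1\<bar> + 1) / C2 / norm ?s"
      using a b C2(1) e by (intro divide_right_mono frac_le) auto
    finally show "norm (bratio n z) \<le> (\<bar>C1\<bar> + 1) / C2 / sqrt (norm z)" unfolding ns .
  qed
qed

section \<open>The ratio as a Cauchy integral\<close>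

definition bratio_real :: "nat \<Rightarrow> real \<Rightarrow> real" where "bratio_real n x = bphi_real n x / bphi_real (Suc n) x"

lemma bratio_of_real: "x > 0 \<Longrightarrow> bratio n (of_real x) = of_real (bratio_real n x)"
  unfolding bratio_def bratio_real_def by (simp add: bphi_ext_eq_bphi bphi_of_real complex_nonpos_Reals_iff)

lemma bphi_ext_Suc_0: "bphi_ext (Suc n) 0 = - of_real bbeta * fact n"
  by (simp add: bphi_ext_def bphi_reg_Suc_0)

text \<open>Inside the upper half plane and on the positive axis \<open>\<phi>\<close> has no zeros; a neighbourhood of the
  origin is free of them because the value at the origin is \<open>- bbeta n! > 0\<close>.\<close>

lemma bphi_ext_Suc_nonzero:
  assumes n: "n \<ge> 1"
  obtains \<delta> where "0 < \<delta>" "\<delta> \<le> 1" "\<And>z. Im z \<ge> 0 \<Longrightarrow> Re z + Im z \<ge> - \<delta> \<Longrightarrow> bphi_ext (Suc n) z \<noteq> 0"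
proof -
  have 0: "bphi_ext (Suc n) 0 \<noteq> 0" using bbeta_neg by (simp add: bphi_ext_Suc_0)
  have "\<exists>e>0. \<forall>z. Im z \<ge> 0 \<and> dist 0 z < e \<longrightarrow> bphi_ext (Suc n) z \<noteq> 0"
    using continuous_on_open_avoid[OF bphi_ext_continuous_upper[of "Suc n"], of 0 0] 0
    by (metis (mono_tags, lifting) continuous_on_avoid[OF bphi_ext_continuous_upper[of "Suc n"], of 0 0] le_add1 mem_Collect_eq plus_1_eq_Suc order_refl zero_complex.simps(2))
  then obtain e where e: "e > 0" "\<And>z. Im z \<ge> 0 \<Longrightarrow> norm z < e \<Longrightarrow> bphi_ext (Suc n) z \<noteq> 0" by auto
  show ?thesis
  proof (rule that)
    show "0 < min 1 (e/2)" "min 1 (e/2) \<le> 1" using e by auto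
    fix z assume z: "Im z \<ge> 0" "Re z + Im z \<ge> - min 1 (e/2)"
    show "bphi_ext (Suc n) z \<noteq> 0"
    proof (cases "z \<in> \<real>\<^sub>\<le>\<^sub>0")
      case True
      then have "Im z = 0" "\<bar>Re z\<bar> \<le> e/2" using z by (auto simp: complex_nonpos_Reals_iff)
      then have "norm z \<le> e/2" using cmod_le[of z] by simp
      then show ?thesis using e z by auto
    next
      case zs: False
      show ?thesis
      proof (cases "Im z > 0")
        case True then show ?thesis using bphi_nonzero_upper[OF True n] bphi_ext_eq_bphi[OF zs] by simp
      next
        case False
        then have "z = of_real (Re z)" "Re z > 0" using z zs by (auto simp: complex_eq_iff complex_nonpos_Reals_iff)
        then show ?thesis using bphi_ext_eq_bphi[OF zs] bphi_of_real[of "Re z" "Suc n"] bphi_real_pos[of "Re z" "Suc n"] by auto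
      qed
    qed
  qed
qed

text \<open>The domain on which the quotient \<open>H = bratio n\<close> is continuous up to the boundary: the closed
  upper half plane, cut off by the diagonal line through \<open>- \<delta>\<close> so that only the segment
  \<open>[- \<delta>, 0]\<close> of the cut, where the denominator is known not to vanish, belongs to it.\<close>

locale ratio =
  fixes n :: nat and \<delta> :: real
  assumes n: "n \<ge> 1" and \<delta>: "0 < \<delta>" "\<delta> \<le> 1"
    and nz: "\<And>z. Im z \<ge> 0 \<Longrightarrow> Re z + Im z \<ge> - \<delta> \<Longrightarrow> bphi_ext (Suc n) z \<noteq> 0"
begin

definition sector :: "complex set" where "sector = {z. Im z \<ge> 0 \<and> Re z + Im z \<ge> - \<delta>}"

lemma H_cont: "continuous_on sector (bratio n)"
  unfolding bratio_def[abs_def]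
  by (intro continuous_on_divide continuous_on_subset[OF bphi_ext_continuous_upper]) (use n nz in \<open>auto simp: sector_def\<close>)

lemma H_diff:
  assumes "z \<in> sector" "z \<notin> \<real>\<^sub>\<le>\<^sub>0"
  shows "bratio n field_differentiable (at z)"
proof -
  have "bphi_ext m field_differentiable (at z)" for m
  proof -
    obtain D where "(bphi m has_field_derivative D) (at z)"
      using bphi_holomorphic[of m] assms(2) closed_nonpos_Reals_complex
      by (auto simp: holomorphic_on_open open_Compl)
    then have "(bphi_ext m has_field_derivative D) (at z)"
    proof (rule has_field_derivative_transform_within_open[of _ _ _ "- \<real>\<^sub>\<le>\<^sub>0"])
      show "open (- \<real>\<^sub>\<le>\<^sub>0 :: complex set)" using closed_nonpos_Reals_complex by (simp add: open_Compl)
    qed (use assms bphi_ext_eq_bphi in auto)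
    then show ?thesis by (auto simp: field_differentiable_def)
  qed
  then show ?thesis unfolding bratio_def[abs_def]
    using nz[of z] assms by (intro field_differentiable_divide) (auto simp: sector_def)
qed

text \<open>The diagonal side of the sector.\<close>

definition diag :: "real \<Rightarrow> complex" where "diag y = of_real (- \<delta>) + of_real y * (- 1 + \<i>)"

lemma diag_simps: "Re (diag y) = - \<delta> - y" "Im (diag y) = y" by (simp_all add: diag_def)

lemma diag_sector: "y \<ge> 0 \<Longrightarrow> diag y \<in> sector" by (simp add: sector_def diag_simps)

lemma diag_cont: "continuous_on A diag" unfolding diag_def by (intro continuous_intros)

lemma H_diag_cont: "continuous_on {0..} (\<lambda>y. bratio n (diag y))"
  by (rule continuous_on_compose2[OF H_cont diag_cont]) (use diag_sector in auto)

lemma H_decay: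
  obtains R C where "C > 0" "R > 0" "\<And>z. z \<in> sector \<Longrightarrow> norm z \<ge> R \<Longrightarrow> z \<notin> \<real>\<^sub>\<le>\<^sub>0 \<Longrightarrow> norm (bratio n z) \<le> C / sqrt (norm z)"
proof -
  obtain R C where "C > 0" "R > 0" "\<And>z. norm z \<ge> R \<Longrightarrow> Im z \<ge> 0 \<Longrightarrow> z \<notin> \<real>\<^sub>\<le>\<^sub>0 \<Longrightarrow> Re z + Im z \<ge> - 1 \<Longrightarrow> norm (bratio n z) \<le> C / sqrt (norm z)"
    using bratio_decay[of n] by metis
  then show ?thesis using \<delta> by (intro that[of C R]) (auto simp: sector_def)
qed

text \<open>Compactness near the corner, decay of \<open>H\<close> far away.\<close>

lemma H_diag_bound:
  obtains C where "C > 0" "\<And>y. y \<ge> 0 \<Longrightarrow> norm (bratio n (diag y)) \<le> C / sqrt (1 + y)"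
proof -
  obtain R C where RC: "C > 0" "R > 0" "\<And>z. z \<in> sector \<Longrightarrow> norm z \<ge> R \<Longrightarrow> z \<notin> \<real>\<^sub>\<le>\<^sub>0 \<Longrightarrow> norm (bratio n z) \<le> C / sqrt (norm z)"
    using H_decay by metis
  have "compact ((\<lambda>y. bratio n (diag y)) ` {0..R})"
    by (intro compact_continuous_image continuous_on_subset[OF H_diag_cont]) auto
  then obtain K where K: "\<And>y. 0 \<le> y \<Longrightarrow> y \<le> R \<Longrightarrow> norm (bratio n (diag y)) \<le> K"
    by (meson compact_imp_bounded bounded_iff imageI atLeastAtMost_iff)
  have K0: "K \<ge> 0" by (rule order_trans[OF norm_ge_zero K[of 0]]) (use RC(2) in auto)
  show ?thesis
  proof (rule that)
    show "K * sqrt (1 + R) + C / sqrt \<delta> > 0" using K0 RC \<delta> by (intro add_nonneg_pos) auto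
    fix y :: real assume y: "y \<ge> 0"
    show "norm (bratio n (diag y)) \<le> (K * sqrt (1 + R) + C / sqrt \<delta>) / sqrt (1 + y)"
    proof (cases "y \<le> R")
      case True
      have "1 \<le> sqrt (1 + R) / sqrt (1 + y)" using True y by simp
      then have "K * 1 \<le> K * (sqrt (1 + R) / sqrt (1 + y))" using K0 by (rule mult_left_mono)
      then have "norm (bratio n (diag y)) \<le> K * (sqrt (1 + R) / sqrt (1 + y))" using K[OF y True] by linarith
      also have "\<dots> \<le> (K * sqrt (1 + R) + C / sqrt \<delta>) / sqrt (1 + y)"
        using RC \<delta> y by (simp add: add_divide_distrib)
      finally show ?thesis .
    next
      case False
      have "\<bar>Im (diag y)\<bar> \<le> norm (diag y)" "\<bar>Re (diag y)\<bar> \<le> norm (diag y)" by (rule abs_Im_le_cmod abs_Re_le_cmod)+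
      then have nr: "norm (diag y) \<ge> R" "norm (diag y) \<ge> \<delta> + y" using False y \<delta> by (auto simp: diag_simps)
      have d: "\<delta> * (1 + y) \<le> norm (diag y)" using nr \<delta> y mult_right_mono[OF \<delta>(2) y] by (simp add: algebra_simps)
      have "norm (bratio n (diag y)) \<le> C / sqrt (norm (diag y))"
        using RC(3)[OF diag_sector[OF y] nr(1)] False RC(2) by (auto simp: complex_nonpos_Reals_iff diag_simps)
      also have "\<dots> \<le> C / sqrt (\<delta> * (1 + y))"
      proof (rule divide_left_mono)
        have p: "0 < \<delta> * (1 + y)" using \<delta> y by simp
        with d have "0 < norm (diag y)" by linarith
        with p show "0 < sqrt (norm (diag y)) * sqrt (\<delta> * (1 + y))" by (simp only: real_sqrt_gt_0_iff mult_pos_pos)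
      qed (use d RC(1) in auto)
      also have "\<dots> = C / sqrt \<delta> / sqrt (1 + y)" by (simp add: real_sqrt_mult)
      also have "\<dots> \<le> (K * sqrt (1 + R) + C / sqrt \<delta>) / sqrt (1 + y)"
        using K0 RC(2) y by (intro divide_right_mono) auto
      finally show ?thesis .
    qed
  qed
qed

lemma norm_minus_diag: "0 \<le> y \<Longrightarrow> 0 \<le> l \<Longrightarrow> \<delta> * (1 + y) \<le> norm (of_real l - diag y)"
proof -
  assume y: "0 \<le> y" "0 \<le> l"
  have "\<delta> * (1 + y) \<le> \<delta> + y" using mult_right_mono[OF \<delta>(2) y(1)] by (simp add: algebra_simps)
  also have "\<dots> \<le> \<bar>Re (of_real l - diag y)\<bar>" using y \<delta> by (simp add: diag_simps)
  also have "\<dots> \<le> norm (of_real l - diag y)" by (rule abs_Re_le_cmod)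
  finally show ?thesis .
qed

lemma set_integrable_power32: "set_integrable lborel {0..} (\<lambda>y::real. 1 / ((1 + y) * sqrt (1 + y)))"
  unfolding set_integrable_def
proof (rule integrableI_nonneg)
  show "(\<lambda>y. indicator {0..} y *\<^sub>R (1 / ((1 + y) * sqrt (1 + y)))) \<in> borel_measurable lborel" by measurable
  show "AE x in lborel. (0::real) \<le> indicator {0..} x *\<^sub>R (1 / ((1 + x) * sqrt (1 + x)))"
    by (auto split: split_indicator)
  have "(\<integral>\<^sup>+ y. ennreal (1 / ((1 + y) * sqrt (1 + y))) * indicator {0..} y \<partial>lborel) = ennreal (0 - (- 2 / sqrt (1 + 0)))"
  proof (rule nn_integral_FTC_atLeast)
    show "((\<lambda>y. - 2 / sqrt (1 + y)) has_real_derivative 1 / ((1 + y) * sqrt (1 + y))) (at y)" if "0 \<le> y" for y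
      using that by (auto intro!: derivative_eq_intros simp: field_simps)
    show "((\<lambda>y::real. - 2 / sqrt (1 + y)) \<longlongrightarrow> 0) at_top" by real_asymp
  qed auto
  then show "(\<integral>\<^sup>+ x. ennreal (indicator {0..} x *\<^sub>R (1 / ((1 + x) * sqrt (1 + x)))) \<partial>lborel) < \<infinity>"
  proof -
    assume h: "(\<integral>\<^sup>+ y. ennreal (1 / ((1 + y) * sqrt (1 + y))) * indicator {0..} y \<partial>lborel) = ennreal (0 - (- 2 / sqrt (1 + 0)))"
    have "(\<integral>\<^sup>+ x. ennreal (indicator {0..} x *\<^sub>R (1 / ((1 + x) * sqrt (1 + x)))) \<partial>lborel) = (\<integral>\<^sup>+ y. ennreal (1 / ((1 + y) * sqrt (1 + y))) * indicator {0..} y \<partial>lborel)"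
      by (intro nn_integral_cong) (auto split: split_indicator)
    then show ?thesis unfolding h by simp
  qed
qed

lemma set_integrable_diag:
  assumes l: "l \<ge> 0"
  shows "set_integrable lborel {0..} (\<lambda>y. (- 1 + \<i>) * bratio n (diag y) / (of_real l - diag y))"
proof -
  obtain C where C: "C > 0" "\<And>y. y \<ge> 0 \<Longrightarrow> norm (bratio n (diag y)) \<le> C / sqrt (1 + y)" using H_diag_bound by metis
  let ?f = "\<lambda>y. (- 1 + \<i>) * bratio n (diag y) / (of_real l - diag y)"
  show ?thesis
  proof (rule set_integrable_bound[OF set_integrable_mult_right[OF set_integrable_power32, of "2 * C / \<delta>"]])
    have nz': "of_real l - diag y \<noteq> 0" if "y \<ge> 0" for y
    proof -
      have "0 < \<delta> * (1 + y)" using \<delta> that by simp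
      then have "0 < norm (of_real l - diag y)" using norm_minus_diag[OF that l] by linarith
      then show ?thesis by simp
    qed
    have "continuous_on {0..} ?f"
      by (intro continuous_intros H_diag_cont diag_cont) (use nz' in auto)
    then have "?f \<in> borel_measurable (restrict_space borel {0..})" by (rule borel_measurable_continuous_on_restrict)
    then show "set_borel_measurable lborel {0..} ?f"
      by (simp add: set_borel_measurable_def borel_measurable_restrict_space_iff)
    show "AE y in lborel. y \<in> {0..} \<longrightarrow> norm (?f y) \<le> norm (2 * C / \<delta> * (1 / ((1 + y) * sqrt (1 + y))))"
    proof (intro AE_I2 impI)
      fix y :: real assume "y \<in> {0..}"
      then have y: "y \<ge> 0" by simp
      have "norm (- 1 + \<i>) \<le> 2" using cmod_le[of "- 1 + \<i>"] by simp
      then have "norm (?f y) \<le> 2 * (C / sqrt (1 + y)) / (\<delta> * (1 + y))"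
        unfolding norm_mult norm_divide using C y norm_minus_diag[OF y l] \<delta> by (intro frac_le mult_mono) auto
      also have "\<dots> = 2 * C / \<delta> * (1 / ((1 + y) * sqrt (1 + y)))" by (simp add: field_simps)
      finally show "norm (?f y) \<le> norm (2 * C / \<delta> * (1 / ((1 + y) * sqrt (1 + y))))" using C y \<delta> by simp
    qed
  qed
qed

text \<open>The jump of \<open>H\<close> across the cut, up to a factor: by reflection the values of \<open>H\<close> on the lower side
  are the conjugates of those on the upper side.\<close>

definition density :: "real \<Rightarrow> real" where "density x = - Im (bratio n (of_real (- x)))"

lemma density_cont: "continuous_on {0..\<delta>} density"
  unfolding density_def by (intro continuous_intros continuous_on_compose2[OF H_cont]) (auto simp: sector_def)

lemma convex_sector: "convex sector"
proof -
  have "sector = {z. Im z \<ge> 0} \<inter> {z. (1 + \<i>) \<bullet> z \<ge> - \<delta>}" by (auto simp: sector_def inner_complex_def)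
  then show ?thesis by (simp add: convex_Int convex_halfspace_Im_ge convex_halfspace_ge)
qed

lemma interior_sector: "interior sector \<subseteq> {z. Im z > 0}"
proof -
  have "interior sector \<subseteq> interior {z. Im z \<ge> 0}" by (rule interior_mono) (auto simp: sector_def)
  also have "{z. Im z \<ge> 0} = {z. \<i> \<bullet> z \<ge> 0}" by (auto simp: inner_complex_def)
  also have "interior {z. \<i> \<bullet> z \<ge> 0} = {z. \<i> \<bullet> z > 0}" by (rule interior_halfspace_ge) simp
  finally show ?thesis by (simp add: inner_complex_def)
qed

text \<open>Since \<open>l\<close> lies on the boundary of the sector, Cauchy's formula is not available directly.  The
  difference quotient at \<open>l\<close> is continuous on the closed sector and holomorphic inside it, so its
  integral around a triangle vanishes.\<close>

definition slope :: "real \<Rightarrow> complex \<Rightarrow> complex" where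
  "slope l z = (if z = of_real l then deriv (bratio n) (of_real l) else (bratio n z - of_real (bratio_real n l)) / (z - of_real l))"

lemma slope_cont:
  assumes l: "l > 0"
  shows "continuous_on sector (slope l)"
  unfolding continuous_on_eq_continuous_within
proof
  fix z assume z: "z \<in> sector"
  show "continuous (at z within sector) (slope l)"
  proof (cases "z = of_real l")
    case True
    have lU: "of_real l \<in> sector" "of_real l \<notin> (\<real>\<^sub>\<le>\<^sub>0 :: complex set)" using l \<delta> by (auto simp: sector_def complex_nonpos_Reals_iff)
    have "(bratio n has_field_derivative deriv (bratio n) (of_real l)) (at (of_real l))"
      using H_diff[OF lU] by (rule field_differentiable_derivI)
    then have "((\<lambda>z. (bratio n z - of_real (bratio_real n l)) / (z - of_real l)) \<longlongrightarrow> deriv (bratio n) (of_real l)) (at (of_real l))"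
      using l by (simp add: has_field_derivative_iff bratio_of_real)
    then have "(slope l \<longlongrightarrow> deriv (bratio n) (of_real l)) (at (of_real l))"
      by (rule Lim_transform_eventually) (auto simp: slope_def eventually_at_filter)
    then have "(slope l \<longlongrightarrow> deriv (bratio n) (of_real l)) (at (of_real l) within sector)"
      by (rule tendsto_within_subset) simp
    then show ?thesis unfolding True continuous_within by (simp add: slope_def)
  next
    case False
    have "continuous (at z within sector) (bratio n)" using H_cont z by (simp add: continuous_on_eq_continuous_within)
    then have "continuous (at z within sector) (\<lambda>z. (bratio n z - of_real (bratio_real n l)) / (z - of_real l))"
      using False by (intro continuous_intros) auto
    then show ?thesis
    proof (rule continuous_transform_within[where \<delta> = "dist z (of_real l)"])
      show "0 < dist z (of_real l)" using False by simp
      fix w assume "w \<in> sector" "dist w z < dist z (of_real l)"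
      then show "(bratio n w - of_real (bratio_real n l)) / (w - of_real l) = slope l w" by (auto simp: slope_def dist_commute)
    qed (use z in auto)
  qed
qed

lemma slope_diff:
  assumes "z \<in> interior sector" "l > 0"
  shows "slope l field_differentiable (at z)"
proof -
  have z: "Im z > 0" "z \<in> sector" using assms interior_sector interior_subset by auto
  have "bratio n field_differentiable (at z)" by (rule H_diff[OF z(2)]) (use z in \<open>auto simp: complex_nonpos_Reals_iff\<close>)
  then obtain D where D: "(bratio n has_field_derivative D) (at z)" by (auto simp: field_differentiable_def)
  have zl: "z \<noteq> of_real l" using z by auto
  have "((\<lambda>z. (bratio n z - of_real (bratio_real n l)) / (z - of_real l)) has_field_derivative
      ((D - 0) * (z - of_real l) - (bratio n z - of_real (bratio_real n l)) * (1 - 0)) / ((z - of_real l) * (z - of_real l))) (at z)"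
    by (intro DERIV_divide DERIV_diff D DERIV_const DERIV_ident) (use zl in simp)
  then have "(slope l has_field_derivative
      ((D - 0) * (z - of_real l) - (bratio n z - of_real (bratio_real n l)) * (1 - 0)) / ((z - of_real l) * (z - of_real l))) (at z)"
    by (rule has_field_derivative_transform_within_open[where S = "- {of_real l}"]) (use zl in \<open>auto simp: slope_def\<close>)
  then show ?thesis by (auto simp: field_differentiable_def)
qed

text \<open>On the positive axis \<open>H\<close> is real; only the segment \<open>[- \<delta>, 0]\<close> contributes to the imaginary part.\<close>

lemma real_side:
  assumes l: "l > 0" and R: "R > 0"
  shows "Im (contour_integral (linepath (of_real (- \<delta>)) (of_real R)) (slope l)) = (LINT x:{0..\<delta>}|lborel. density x / (l + x))"
proof -
  let ?a = "of_real (- \<delta>) :: complex" and ?b = "of_real R :: complex"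
  have seg: "of_real x \<in> sector" if "- \<delta> \<le> x" for x using that by (auto simp: sector_def)
  have cr: "continuous_on {- \<delta>..R} (\<lambda>x. slope l (of_real x))"
    by (intro continuous_on_compose2[OF slope_cont[OF l]] continuous_intros) (use seg in auto)
  have "contour_integral (linepath ?a ?b) (slope l) = integral {- \<delta>..R} (\<lambda>x. slope l (of_real x))"
    using R \<delta> by (subst contour_integral_linepath_Reals_eq) auto
  then have "Im (contour_integral (linepath ?a ?b) (slope l)) = integral {- \<delta>..R} (\<lambda>x. Im (slope l (of_real x)))"
    using integral_linear[OF integrable_continuous_real[OF cr] bounded_linear_Im] by (simp add: comp_def)
  also have "\<dots> = integral {- \<delta>..0} (\<lambda>x. Im (slope l (of_real x))) + integral {0..R} (\<lambda>x. Im (slope l (of_real x)))"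
    using R \<delta> by (intro Henstock_Kurzweil_Integration.integral_combine[symmetric] integrable_continuous_real continuous_on_Im cr) auto
  also have "integral {0..R} (\<lambda>x. Im (slope l (of_real x))) = 0"
  proof -
    have *: "Im (slope l (of_real x)) = 0" if "x > 0" "x \<noteq> l" for x
    proof -
      have "slope l (of_real x) = of_real ((bratio_real n x - bratio_real n l) / (x - l))" using that by (simp add: slope_def bratio_of_real)
      then show ?thesis by (simp only: Im_complex_of_real)
    qed
    have "integral {0..R} (\<lambda>x. Im (slope l (of_real x))) = integral {0..R} (\<lambda>x. 0::real)"
      by (rule integral_spike[where S = "{0, l}"]) (use * in auto)
    then show ?thesis by simp
  qed
  also have "integral {- \<delta>..0} (\<lambda>x. Im (slope l (of_real x))) = (LINT x:{- \<delta>..0}|lborel. Im (slope l (of_real x)))"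
  proof (rule set_borel_integral_eq_integral(2)[symmetric])
    have "continuous_on {- \<delta>..0} (\<lambda>x. Im (slope l (of_real x)))"
      by (intro continuous_on_Im continuous_on_subset[OF cr]) (use R in auto)
    then show "set_integrable lborel {- \<delta>..0} (\<lambda>x. Im (slope l (of_real x)))" by (rule borel_integrable_atLeastAtMost')
  qed
  also have "\<dots> = (LINT x|lborel. indicator {- \<delta>..0} (0 + (-1) * x) *\<^sub>R Im (slope l (of_real (0 + (-1) * x))))"
    unfolding set_lebesgue_integral_def by (subst lborel_integral_real_affine[where c = "-1" and t = 0]) auto
  also have "\<dots> = (LINT x:{0..\<delta>}|lborel. density x / (l + x))"
    unfolding set_lebesgue_integral_def
  proof (rule Bochner_Integration.integral_cong[OF refl])
    fix x :: real
    have "Im (slope l (of_real (- x))) = density x / (l + x)" if "0 \<le> x"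
    proof -
      have ne: "of_real (- x) \<noteq> (of_real l :: complex)" unfolding of_real_eq_iff using that l by simp
      have "slope l (of_real (- x)) = (bratio n (of_real (- x)) - of_real (bratio_real n l)) / of_real (- x - l)"
        unfolding slope_def using ne by simp
      also have "Im \<dots> = Im (bratio n (of_real (- x)) - of_real (bratio_real n l)) / (- x - l)" by (simp only: Im_divide_of_real)
      finally show ?thesis using that l by (simp add: density_def field_simps)
    qed
    then show "indicator {- \<delta>..0} (0 + (-1) * x) *\<^sub>R Im (slope l (of_real (0 + (-1) * x))) = indicator {0..\<delta>} x *\<^sub>R (density x / (l + x))"
      by (auto split: split_indicator)
  qed
  finally show ?thesis by simp
qed

lemma diag_side:
  assumes l: "l > 0" and R: "R > 0"
  shows "contour_integral (linepath (diag R) (of_real (- \<delta>))) (\<lambda>z. bratio n z / (z - of_real l)) =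
    (LINT y:{0..R}|lborel. (- 1 + \<i>) * bratio n (diag y) / (of_real l - diag y))"
proof -
  let ?f = "\<lambda>z. bratio n z / (z - of_real l)"
  let ?g = "\<lambda>y. (- 1 + \<i>) * bratio n (diag y) / (of_real l - diag y)"
  let ?a = "of_real (- \<delta>) :: complex"
  have lp: "linepath ?a (diag R) u = diag (R * u)" for u by (simp add: linepath_def diag_def scaleR_conv_of_real algebra_simps)
  have d: "diag R - ?a = of_real R * (- 1 + \<i>)" by (simp add: diag_def)
  have nz': "of_real l - diag y \<noteq> 0" if "y \<ge> 0" for y
  proof
    assume "of_real l - diag y = 0"
    then have "l = Re (diag y)" by (metis Re_complex_of_real eq_iff_diff_eq_0)
    then show False using l that \<delta> by (simp add: diag_simps)
  qed
  have seg: "\<exists>y\<ge>0. z = diag y" if "z \<in> closed_segment (diag R) ?a" for z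
  proof -
    have "z \<in> linepath ?a (diag R) ` {0..1}"
      using that path_image_linepath[of ?a "diag R"] by (simp add: path_image_def closed_segment_commute)
    then obtain u where "0 \<le> u" "z = diag (R * u)" using lp by auto
    then show ?thesis using R by (intro exI[of _ "R * u"]) auto
  qed
  have "contour_integral (linepath (diag R) ?a) ?f = - contour_integral (linepath ?a (diag R)) ?f"
  proof (rule contour_integral_reverse_linepath)
    show "continuous_on (closed_segment (diag R) ?a) ?f"
      by (intro continuous_intros continuous_on_subset[OF H_cont]) (use seg diag_sector nz' in fastforce)+
  qed
  also have "contour_integral (linepath ?a (diag R)) ?f = integral {0..1} (\<lambda>u. ?f (linepath ?a (diag R) u) * (diag R - ?a))"
    by (simp add: contour_integral_integral)
  also have "\<dots> = integral {0..1} (\<lambda>u. - (of_real R * ?g (R * u)))"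
  proof (rule Henstock_Kurzweil_Integration.integral_cong)
    fix u :: real assume u: "u \<in> {0..1}"
    have "of_real l - diag (R * u) \<noteq> 0" using u R by (intro nz') simp
    then show "?f (linepath ?a (diag R) u) * (diag R - ?a) = - (of_real R * ?g (R * u))"
      unfolding lp d by (simp add: divide_simps) (simp add: algebra_simps)
  qed
  also have "\<dots> = (LINT u:{0..1}|lborel. - (of_real R * ?g (R * u)))"
  proof (rule set_borel_integral_eq_integral(2)[symmetric])
    have "continuous_on {0..1} (\<lambda>u. - (of_real R * ?g (R * u)))"
      by (intro continuous_intros continuous_on_compose2[OF H_diag_cont] continuous_on_compose2[OF diag_cont]) (use R nz' in auto)
    then show "set_integrable lborel {0..1} (\<lambda>u. - (of_real R * ?g (R * u)))" by (rule borel_integrable_atLeastAtMost')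
  qed
  also have "\<dots> = - (of_real R * (LINT u|lborel. indicator {0..R} (0 + R * u) *\<^sub>R ?g (0 + R * u)))"
  proof -
    have "(LINT u:{0..1}|lborel. - (of_real R * ?g (R * u))) = (LINT u|lborel. (- of_real R) * (indicator {0..R} (0 + R * u) *\<^sub>R ?g (0 + R * u)))"
      unfolding set_lebesgue_integral_def
      by (rule Bochner_Integration.integral_cong[OF refl])
         (use R in \<open>auto split: split_indicator simp: zero_le_mult_iff mult_le_cancel_left1\<close>)
    then show ?thesis by (simp only: integral_mult_right_zero mult_minus_left Bochner_Integration.integral_minus)
  qed
  also have "of_real R * (LINT u|lborel. indicator {0..R} (0 + R * u) *\<^sub>R ?g (0 + R * u)) = (LINT y:{0..R}|lborel. ?g y)"
    unfolding set_lebesgue_integral_def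
    by (subst lborel_integral_real_affine[where c = R and t = 0]) (use R in \<open>auto simp: scaleR_conv_of_real\<close>)
  finally show ?thesis by simp
qed

lemma segment_far:
  assumes R: "R \<ge> 1" and z: "z \<in> closed_segment (of_real R) (diag R)"
  shows "norm z \<ge> R / 4" "z \<in> sector"
proof -
  obtain u where u: "0 \<le> u" "u \<le> 1" "z = (1 - u) *\<^sub>R of_real R + u *\<^sub>R diag R" using z by (auto simp: in_segment)
  have re: "Re z = R - u * (2 * R + \<delta>)" "Im z = u * R" unfolding u(3) by (simp_all add: diag_simps algebra_simps)
  show "norm z \<ge> R / 4"
  proof (cases "u \<ge> 1/4")
    case True
    have "R / 4 \<le> u * R" using True R mult_right_mono[OF True, of R] by simp
    also have "\<dots> \<le> norm z" using re(2) abs_Im_le_cmod[of z] by simp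
    finally show ?thesis .
  next
    case False
    have "u * (2 * R + \<delta>) \<le> (1/4) * (3 * R)" using False R \<delta> u by (intro mult_mono) auto
    then have "R / 4 \<le> Re z" unfolding re by simp
    then show ?thesis using complex_Re_le_cmod[of z] by linarith
  qed
  have "of_real R \<in> sector" "diag R \<in> sector" using R \<delta> diag_sector by (auto simp: sector_def)
  then show "z \<in> sector" using z convex_contains_segment convex_sector by blast
qed

text \<open>The triangle has the corners \<open>- \<delta>\<close>, \<open>R\<close> and \<open>diag R\<close>.  Taking imaginary parts of the vanishing
  integral of the difference quotient, the constant \<open>H(l)\<close> is multiplied by the change of the
  argument of \<open>z - l\<close> along the two sides off the real axis, which is \<open>pi\<close>.\<close>

lemma cauchy_identity:
  assumes l: "l > 0" and R: "R > l" "R \<ge> 1"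
  shows "(LINT x:{0..\<delta>}|lborel. density x / (l + x))
     + Im (contour_integral (linepath (of_real R) (diag R)) (\<lambda>z. bratio n z / (z - of_real l)))
     + Im (LINT y:{0..R}|lborel. (- 1 + \<i>) * bratio n (diag y) / (of_real l - diag y)) = pi * bratio_real n l"
proof -
  let ?a = "of_real (- \<delta>) :: complex" and ?b = "of_real R :: complex"
  let ?f = "\<lambda>z. bratio n z / (z - of_real l)" and ?h = "\<lambda>z. 1 / (z - of_real l)"
  have inU: "?a \<in> sector" "?b \<in> sector" "diag R \<in> sector" using R \<delta> diag_sector by (auto simp: sector_def)
  have sub: "convex hull {?a, ?b, diag R} \<subseteq> sector" by (rule hull_minimal) (use inU convex_sector in auto)
  have "(slope l has_contour_integral 0) (linepath ?a ?b +++ linepath ?b (diag R) +++ linepath (diag R) ?a)"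
    by (rule Cauchy_theorem_triangle_cofinite[where S = "{}"])
       (use sub slope_cont[OF l] slope_diff[OF _ l] interior_mono[OF sub] in \<open>auto intro: continuous_on_subset\<close>)
  then have c0: "contour_integral (linepath ?a ?b) (slope l) + contour_integral (linepath ?b (diag R)) (slope l) + contour_integral (linepath (diag R) ?a) (slope l) = 0"
    by (rule has_chain_integral_chain_integral3)
  have off: "z \<noteq> of_real l" if "z \<in> closed_segment ?b (diag R) \<union> closed_segment (diag R) ?a" for z
  proof
    assume zl: "z = of_real l"
    from that show False
    proof
      assume "z \<in> closed_segment ?b (diag R)"
      then obtain u where u: "0 \<le> u" "u \<le> 1" "z = (1 - u) *\<^sub>R ?b + u *\<^sub>R diag R" by (auto simp: in_segment)
      have "Im z = u * R" "Re z = R - u * (2 * R + \<delta>)" unfolding u(3) by (simp_all add: diag_simps algebra_simps)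
      then show False using R l zl by auto
    next
      assume "z \<in> closed_segment (diag R) ?a"
      then obtain u where u: "0 \<le> u" "u \<le> 1" "z = (1 - u) *\<^sub>R diag R + u *\<^sub>R ?a" by (auto simp: in_segment)
      have "Im z = (1 - u) * R" "Re z = (1 - u) * (- \<delta> - R) - u * \<delta>" unfolding u(3) by (simp_all add: diag_simps)
      then have "(1 - u) * R = 0" "l = (1 - u) * (- \<delta> - R) - u * \<delta>" using zl by simp_all
      then have "u = 1" "l = (1 - u) * (- \<delta> - R) - u * \<delta>" using R by auto
      then show False using l \<delta> by simp
    qed
  qed
  have sb: "closed_segment ?b (diag R) \<subseteq> sector" "closed_segment (diag R) ?a \<subseteq> sector"
    using inU convex_contains_segment convex_sector by blast+
  have split: "contour_integral (linepath x y) (slope l) = contour_integral (linepath x y) ?f - of_real (bratio_real n l) * contour_integral (linepath x y) ?h"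
    "?h contour_integrable_on linepath x y"
    if xy: "closed_segment x y \<subseteq> sector" "\<And>z. z \<in> closed_segment x y \<Longrightarrow> z \<noteq> of_real l" for x y
  proof -
    have f: "?f contour_integrable_on linepath x y"
      by (rule contour_integrable_continuous_linepath)
         (intro continuous_intros continuous_on_subset[OF H_cont], use xy in auto)
    show h: "?h contour_integrable_on linepath x y"
      by (rule contour_integrable_continuous_linepath) (intro continuous_intros, use xy in auto)
    have "contour_integral (linepath x y) (slope l) = contour_integral (linepath x y) (\<lambda>z. ?f z - of_real (bratio_real n l) * ?h z)"
      by (rule contour_integral_cong) (use xy in \<open>auto simp: slope_def diff_divide_distrib\<close>)
    also have "\<dots> = contour_integral (linepath x y) ?f - of_real (bratio_real n l) * contour_integral (linepath x y) ?h"
      by (simp only: contour_integral_diff[OF f contour_integrable_lmul[OF h]] contour_integral_lmul[OF h])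
    finally show "contour_integral (linepath x y) (slope l) = contour_integral (linepath x y) ?f - of_real (bratio_real n l) * contour_integral (linepath x y) ?h" .
  qed
  have s1: "contour_integral (linepath ?b (diag R)) (slope l) = contour_integral (linepath ?b (diag R)) ?f - of_real (bratio_real n l) * contour_integral (linepath ?b (diag R)) ?h"
    using split(1)[OF sb(1)] off by blast
  have s2: "contour_integral (linepath (diag R) ?a) (slope l) = contour_integral (linepath (diag R) ?a) ?f - of_real (bratio_real n l) * contour_integral (linepath (diag R) ?a) ?h"
    using split(1)[OF sb(2)] off by blast
  \<comment> \<open>rotating by \<open>- \<i>\<close> moves the branch cut of the logarithm below the real axis\<close>
  let ?F = "\<lambda>z. Ln (- \<i> * (z - of_real l))"
  have dF: "(?F has_field_derivative ?h z) (at z)" if "Im z \<ge> 0" "z \<noteq> of_real l" for z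
  proof -
    have "- \<i> * (z - of_real l) \<notin> \<real>\<^sub>\<le>\<^sub>0" using that by (auto simp: complex_nonpos_Reals_iff complex_eq_iff)
    then show ?thesis using that by (auto intro!: derivative_eq_intros simp: field_simps)
  qed
  have prim: "contour_integral (linepath x y) ?h = ?F y - ?F x"
    if xy: "closed_segment x y \<subseteq> sector" "\<And>z. z \<in> closed_segment x y \<Longrightarrow> z \<noteq> of_real l" for x y
  proof -
    have "(?h has_contour_integral (?F (pathfinish (linepath x y)) - ?F (pathstart (linepath x y)))) (linepath x y)"
    proof (rule contour_integral_primitive)
      show "(?F has_field_derivative ?h z) (at z within closed_segment x y)" if "z \<in> closed_segment x y" for z
        using dF[of z] xy that by (auto simp: sector_def intro: has_field_derivative_at_within)
    qed auto
    then show ?thesis by (simp add: contour_integral_unique)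
  qed
  have Fa: "Im (?F ?a) = pi / 2"
  proof -
    have "- \<i> * (?a - of_real l) = of_real (\<delta> + l) * \<i>" by (simp add: algebra_simps)
    then have "?F ?a = Ln (of_real (\<delta> + l) * \<i>)" by (simp only:)
    also have "\<dots> = of_real (ln (\<delta> + l)) + Ln \<i>" using l \<delta> Ln_times_of_real[of "\<delta> + l" \<i>] Ln_of_real[of "\<delta> + l"] by (simp del: of_real_add)
    finally show ?thesis by simp
  qed
  have Fb: "Im (?F ?b) = - pi / 2"
  proof -
    have "- \<i> * (?b - of_real l) = of_real (R - l) * (- \<i>)" by (simp add: algebra_simps)
    then have "?F ?b = Ln (of_real (R - l) * (- \<i>))" by (simp only:)
    also have "\<dots> = of_real (ln (R - l)) + Ln (- \<i>)" using R Ln_times_of_real[of "R - l" "- \<i>"] Ln_of_real[of "R - l"] by (simp del: of_real_diff)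
    finally show ?thesis by simp
  qed
  have p1: "contour_integral (linepath ?b (diag R)) ?h = ?F (diag R) - ?F ?b" using prim[OF sb(1)] off by blast
  have p2: "contour_integral (linepath (diag R) ?a) ?h = ?F ?a - ?F (diag R)" using prim[OF sb(2)] off by blast
  have "Im (contour_integral (linepath ?b (diag R)) ?h) + Im (contour_integral (linepath (diag R) ?a) ?h) = pi"
    unfolding p1 p2 minus_complex.sel Fa Fb by simp
  then have hpi: "Im (of_real (bratio_real n l) * contour_integral (linepath ?b (diag R)) ?h) + Im (of_real (bratio_real n l) * contour_integral (linepath (diag R) ?a) ?h) = pi * bratio_real n l"
    unfolding Im_complex_of_real by (simp flip: distrib_left)
  have "Im (contour_integral (linepath ?a ?b) (slope l)) + Im (contour_integral (linepath ?b (diag R)) (slope l)) + Im (contour_integral (linepath (diag R) ?a) (slope l)) = 0"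
    using arg_cong[OF c0, of Im] by simp
  then show ?thesis
    unfolding s1 s2 minus_complex.sel using hpi real_side[OF l, of R] diag_side[OF l, of R] R l by simp
qed

text \<open>The length of the side is of order \<open>R\<close>, and the integrand is of order \<open>R\<^bsup>- 3/2\<^esup>\<close>.\<close>

lemma far_side_tendsto:
  assumes l: "l > 0"
  shows "((\<lambda>R. contour_integral (linepath (of_real R) (diag R)) (\<lambda>z. bratio n z / (z - of_real l))) \<longlongrightarrow> 0) at_top"
proof -
  obtain R0 C where RC: "C > 0" "R0 > 0" "\<And>z. z \<in> sector \<Longrightarrow> norm z \<ge> R0 \<Longrightarrow> z \<notin> \<real>\<^sub>\<le>\<^sub>0 \<Longrightarrow> norm (bratio n z) \<le> C / sqrt (norm z)"
    using H_decay by metis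
  show ?thesis
  proof (rule Lim_null_comparison)
    show "((\<lambda>R. C / sqrt (R/4) / (R/8) * (4 * R)) \<longlongrightarrow> 0) at_top" by real_asymp
    have "eventually (\<lambda>R. R \<ge> max 1 (max (4 * R0) (8 * l))) at_top" by (rule eventually_ge_at_top)
    then show "\<forall>\<^sub>F R in at_top. norm (contour_integral (linepath (of_real R) (diag R)) (\<lambda>z. bratio n z / (z - of_real l))) \<le> C / sqrt (R/4) / (R/8) * (4 * R)"
    proof eventually_elim
      case (elim R)
      then have R: "R \<ge> 1" "R / 4 \<ge> R0" "R \<ge> 8 * l" by auto
      have bd: "norm (bratio n z / (z - of_real l)) \<le> C / sqrt (R/4) / (R/8)" "z \<noteq> of_real l" if z: "z \<in> closed_segment (of_real R) (diag R)" for z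
      proof -
        note sf = segment_far[OF R(1) z]
        have zl: "norm (z - of_real l) \<ge> R / 8" using norm_triangle_ineq2[of z "of_real l"] sf(1) R l by simp
        then show "z \<noteq> of_real l" using R by auto
        have zs: "z \<notin> \<real>\<^sub>\<le>\<^sub>0"
        proof
          assume "z \<in> \<real>\<^sub>\<le>\<^sub>0"
          moreover obtain u where u: "0 \<le> u" "u \<le> 1" "z = (1 - u) *\<^sub>R of_real R + u *\<^sub>R diag R" using z by (auto simp: in_segment)
          ultimately have "u * R = 0" "Re z \<le> 0" by (auto simp: diag_simps complex_nonpos_Reals_iff)
          then show False using u R by auto
        qed
        have "norm (bratio n z) \<le> C / sqrt (norm z)" using RC(3)[OF sf(2) _ zs] sf(1) R by linarith
        also have "\<dots> \<le> C / sqrt (R/4)"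
          using sf(1) RC(1) R by (intro divide_left_mono mult_pos_pos) auto
        finally show "norm (bratio n z / (z - of_real l)) \<le> C / sqrt (R/4) / (R/8)"
          unfolding norm_divide using zl R RC(1) by (intro frac_le) auto
      qed
      have sU: "closed_segment (of_real R) (diag R) \<subseteq> sector" using segment_far(2)[OF R(1)] by blast
      have len: "norm (diag R - of_real R) \<le> 4 * R" using cmod_le[of "diag R - of_real R"] R \<delta> by (simp add: diag_simps)
      have "norm (contour_integral (linepath (of_real R) (diag R)) (\<lambda>z. bratio n z / (z - of_real l))) \<le> C / sqrt (R/4) / (R/8) * norm (diag R - of_real R)"
        by (rule contour_integral_bound_linepath)
           (use bd RC(1) R sU in \<open>auto intro!: contour_integrable_continuous_linepath continuous_intros continuous_on_subset[OF H_cont]\<close>)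
      also have "\<dots> \<le> C / sqrt (R/4) / (R/8) * (4 * R)" using len RC(1) R by (intro mult_left_mono) auto
      finally show ?case .
    qed
  qed
qed

theorem H_representation:
  assumes l: "l > 0"
  shows "pi * bratio_real n l = (LINT x:{0..\<delta>}|lborel. density x / (l + x))
     + Im (LINT y:{0..}|lborel. (- 1 + \<i>) * bratio n (diag y) / (of_real l - diag y))"
proof -
  let ?A = "LINT x:{0..\<delta>}|lborel. density x / (l + x)"
  let ?g = "\<lambda>y. (- 1 + \<i>) * bratio n (diag y) / (of_real l - diag y)"
  have "((\<lambda>R. LINT y:{0..R}|lborel. ?g y) \<longlongrightarrow> (LINT y:{0..}|lborel. ?g y)) at_top"
    by (rule tendsto_set_lebesgue_integral_at_top[OF _ set_integrable_diag]) (use l in auto)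
  from tendsto_add[OF tendsto_add[OF tendsto_const[of ?A] tendsto_Im[OF far_side_tendsto[OF l]]] tendsto_Im[OF this]]
  have "((\<lambda>R. ?A + Im (contour_integral (linepath (of_real R) (diag R)) (\<lambda>z. bratio n z / (z - of_real l)))
     + Im (LINT y:{0..R}|lborel. ?g y)) \<longlongrightarrow> ?A + Im 0 + Im (LINT y:{0..}|lborel. ?g y)) at_top" .
  moreover have "eventually (\<lambda>R. ?A + Im (contour_integral (linepath (of_real R) (diag R)) (\<lambda>z. bratio n z / (z - of_real l)))
     + Im (LINT y:{0..R}|lborel. ?g y) = pi * bratio_real n l) at_top"
    using eventually_gt_at_top[of l] eventually_ge_at_top[of 1] by eventually_elim (rule cauchy_identity[OF l])
  ultimately have "((\<lambda>R::real. pi * bratio_real n l) \<longlongrightarrow> ?A + Im 0 + Im (LINT y:{0..}|lborel. ?g y)) at_top"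
    by (simp add: tendsto_cong)
  then show ?thesis by (simp add: tendsto_const_iff)
qed

end

section \<open>Logarithmic expansions and Watson's lemma\<close>

text \<open>Functions with an expansion at \<open>0+\<close> in which every power of the logarithm is accompanied by at
  least \<open>N\<close> powers of \<open>x\<close>.  The truncation error has the exponent \<open>P - 1/2\<close> rather than \<open>P\<close>, which
  swallows all logarithms of order \<open>P\<close> and keeps the class closed under products.\<close>

definition logexp :: "nat \<Rightarrow> nat \<Rightarrow> (real \<Rightarrow> real) \<Rightarrow> bool" where
  "logexp N P f \<longleftrightarrow> (\<exists>c :: nat \<Rightarrow> nat \<Rightarrow> real.
     (\<lambda>x. f x - (\<Sum>p<P. \<Sum>m\<le>p div N. c p m * (x ^ p * ln x ^ m))) \<in> O[at_right 0](\<lambda>x. x powr (real P - 1/2)))"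

lemma logexp_add:
  assumes "logexp N P f" "logexp N P g"
  shows "logexp N P (\<lambda>x. f x + g x)"
proof -
  obtain c d where "(\<lambda>x. f x - (\<Sum>p<P. \<Sum>m\<le>p div N. c p m * (x ^ p * ln x ^ m))) \<in> O[at_right 0](\<lambda>x. x powr (real P - 1/2))"
    "(\<lambda>x. g x - (\<Sum>p<P. \<Sum>m\<le>p div N. d p m * (x ^ p * ln x ^ m))) \<in> O[at_right 0](\<lambda>x. x powr (real P - 1/2))"
    using assms unfolding logexp_def by auto
  from sum_in_bigo(1)[OF this] show ?thesis unfolding logexp_def
    by (intro exI[of _ "\<lambda>p m. c p m + d p m"]) (simp add: sum.distrib algebra_simps)
qed

lemma logexp_cmult:
  assumes "logexp N P f"
  shows "logexp N P (\<lambda>x. a * f x)"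
proof (cases "a = 0")
  case True then show ?thesis unfolding logexp_def by (intro exI[of _ "\<lambda>_ _. 0"]) simp
next
  case False
  obtain c where "(\<lambda>x. f x - (\<Sum>p<P. \<Sum>m\<le>p div N. c p m * (x ^ p * ln x ^ m))) \<in> O[at_right 0](\<lambda>x. x powr (real P - 1/2))"
    using assms unfolding logexp_def by auto
  then have "(\<lambda>x. a * (f x - (\<Sum>p<P. \<Sum>m\<le>p div N. c p m * (x ^ p * ln x ^ m)))) \<in> O[at_right 0](\<lambda>x. x powr (real P - 1/2))"
    using False by simp
  then show ?thesis unfolding logexp_def
    by (intro exI[of _ "\<lambda>p m. a * c p m"]) (simp add: sum_distrib_left algebra_simps)
qed

lemma logexp_bigo:
  assumes "f \<in> O[at_right 0](\<lambda>x. x powr (real P - 1/2))"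
  shows "logexp N P f"
  unfolding logexp_def by (rule exI[of _ "\<lambda>_ _. 0"]) (simp add: assms)

lemma logexp_sum:
  assumes "\<And>i. i \<in> A \<Longrightarrow> logexp N P (f i)"
  shows "logexp N P (\<lambda>x. \<Sum>i\<in>A. f i x)"
proof (cases "finite A")
  case True then show ?thesis using assms
    by (induction A rule: finite_induct) (auto intro: logexp_bigo logexp_add)
qed (auto intro: logexp_bigo)

lemma logexp_monom:
  assumes "N * m \<le> p" "N \<ge> 1"
  shows "logexp N P (\<lambda>x. x ^ p * ln x ^ m)"
proof (cases "p < P")
  case True
  have m: "m \<le> p div N" using assms by (simp add: less_eq_div_iff_mult_less_eq mult.commute)
  have "(\<Sum>q<P. \<Sum>k\<le>q div N. (if q = p \<and> k = m then 1 else 0) * (x ^ q * ln x ^ k)) = x ^ p * ln x ^ m" for x :: real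
  proof -
    have "(\<Sum>q<P. \<Sum>k\<le>q div N. (if q = p \<and> k = m then 1 else 0) * (x ^ q * ln x ^ k))
      = (\<Sum>q<P. \<Sum>k\<le>q div N. if q = p \<and> k = m then x ^ q * ln x ^ k else 0)"
      by (intro sum.cong refl) simp
    also have "\<dots> = (\<Sum>q<P. if q = p then (\<Sum>k\<le>q div N. if k = m then x ^ q * ln x ^ k else 0) else 0)"
      by (intro sum.cong refl) simp
    also have "\<dots> = (\<Sum>k\<le>p div N. if k = m then x ^ p * ln x ^ k else 0)" using True by (simp only: sum.delta finite_lessThan lessThan_iff if_True)
    also have "\<dots> = x ^ p * ln x ^ m" using m by (simp only: sum.delta finite_atMost atMost_iff if_True)
    finally show ?thesis .
  qed
  then show ?thesis unfolding logexp_def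
    by (intro exI[of _ "\<lambda>q k. if q = p \<and> k = m then 1 else 0"]) simp
next
  case False
  have "(\<lambda>x::real. x ^ p * ln x ^ m) \<in> O[at_right 0](\<lambda>x. x powr (real P - 1/2))"
  proof -
    have "(\<lambda>x::real. x powr real p * ln x ^ m) \<in> O[at_right 0](\<lambda>x. x powr (real P - 1/2))"
    proof -
      have "(\<lambda>x::real. x powr (real p - (real P - 1/2)) * ln x ^ m) \<in> O[at_right 0](\<lambda>_. 1)"
      proof (rule landau_o.small_imp_big, rule smalloI_tendsto)
        have "real p - (real P - 1/2) > 0" using False by simp
        then show "((\<lambda>x. x powr (real p - (real P - 1/2)) * ln x ^ m / 1) \<longlongrightarrow> 0) (at_right 0)"
          by real_asymp
      qed simp
      from landau_o.big.mult[OF this landau_o.big_refl[of "\<lambda>x. x powr (real P - 1/2)"]]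
      have "(\<lambda>x::real. x powr (real p - (real P - 1/2)) * ln x ^ m * x powr (real P - 1/2)) \<in> O[at_right 0](\<lambda>x. x powr (real P - 1/2))"
        by simp
      moreover have "x powr (real p - (real P - 1/2)) * ln x ^ m * x powr (real P - 1/2) = x powr real p * ln x ^ m" for x :: real
        by (simp add: mult_ac flip: powr_add mult.assoc)
      ultimately show ?thesis by simp
    qed
    moreover have "eventually (\<lambda>x::real. x powr real p * ln x ^ m = x ^ p * ln x ^ m) (at_right 0)"
      by (auto simp: eventually_at_filter powr_realpow)
    ultimately show ?thesis by (subst (asm) landau_o.big.in_cong) auto
  qed
  then show ?thesis by (rule logexp_bigo)
qed

lemma logexp_const: "N \<ge> 1 \<Longrightarrow> logexp N P (\<lambda>x. a)"
  using logexp_cmult[OF logexp_monom[of N 0 0 P], of a] by simp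

lemma monom_bounded:
  assumes "N * m \<le> p" "N \<ge> 1"
  shows "(\<lambda>x::real. x ^ p * ln x ^ m) \<in> O[at_right 0](\<lambda>_. 1)"
proof (cases "m = 0")
  case True
  have "((\<lambda>x::real. x ^ p) \<longlongrightarrow> 0 ^ p) (at_right 0)" by (intro tendsto_intros)
  then show ?thesis using True by (intro bigoI_tendsto[of _ _ "0 ^ p"]) auto
next
  case False
  then have "p \<ge> 1" using assms by (metis One_nat_def Suc_leI le_trans mult_is_0 neq0_conv not_one_le_zero)
  have "((\<lambda>x::real. x ^ p * ln x ^ m) \<longlongrightarrow> 0) (at_right 0)" using \<open>p \<ge> 1\<close> by real_asymp
  then show ?thesis by (intro bigoI_tendsto[of _ _ 0]) auto
qed

lemma logexp_bounded:
  assumes "logexp N P f" "N \<ge> 1" "P \<ge> 1"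
  shows "f \<in> O[at_right 0](\<lambda>_. 1)"
proof -
  obtain c where c: "(\<lambda>x. f x - (\<Sum>p<P. \<Sum>m\<le>p div N. c p m * (x ^ p * ln x ^ m))) \<in> O[at_right 0](\<lambda>x. x powr (real P - 1/2))"
    using assms unfolding logexp_def by auto
  have "real P - 1/2 > 0" using assms by simp
  then have "(\<lambda>x. x powr (real P - 1/2)) \<in> O[at_right 0](\<lambda>_. 1::real)"
    by (intro landau_o.small_imp_big smalloI_tendsto) (real_asymp | simp)+
  with c have 1: "(\<lambda>x. f x - (\<Sum>p<P. \<Sum>m\<le>p div N. c p m * (x ^ p * ln x ^ m))) \<in> O[at_right 0](\<lambda>_. 1)"
    by (rule landau_o.big_trans)
  have "(\<lambda>x. \<Sum>p<P. \<Sum>m\<le>p div N. c p m * (x ^ p * ln x ^ m)) \<in> O[at_right 0](\<lambda>_. 1)"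
  proof (intro big_sum_in_bigo)
    fix p m assume "m \<in> {..p div N}"
    then have "N * m \<le> p" using assms(2) by (simp add: less_eq_div_iff_mult_less_eq mult.commute)
    from monom_bounded[OF this assms(2)] show "(\<lambda>x. c p m * (x ^ p * ln x ^ m)) \<in> O[at_right 0](\<lambda>_. 1)"
      by (cases "c p m = 0") auto
  qed
  from sum_in_bigo(1)[OF 1 this] show ?thesis by simp
qed

text \<open>Since \<open>N m \<le> p\<close> is additive in \<open>(p, m)\<close>, products of admissible monomials are admissible.\<close>

lemma logexp_mult:
  assumes f: "logexp N P f" and g: "logexp N P g" and N: "N \<ge> 1" "P \<ge> 1"
  shows "logexp N P (\<lambda>x. f x * g x)"
proof -
  let ?E = "\<lambda>x. x powr (real P - 1/2)"
  obtain c d where c: "(\<lambda>x. f x - (\<Sum>p<P. \<Sum>m\<le>p div N. c p m * (x ^ p * ln x ^ m))) \<in> O[at_right 0](?E)"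
    and d: "(\<lambda>x. g x - (\<Sum>p<P. \<Sum>m\<le>p div N. d p m * (x ^ p * ln x ^ m))) \<in> O[at_right 0](?E)"
    using f g unfolding logexp_def by auto
  let ?F = "\<lambda>x. \<Sum>p<P. \<Sum>m\<le>p div N. c p m * (x ^ p * ln x ^ m)"
  let ?G = "\<lambda>x. \<Sum>p<P. \<Sum>m\<le>p div N. d p m * (x ^ p * ln x ^ m)"
  have le: "N * m \<le> p" if "m \<le> p div N" for m p using that N by (simp add: less_eq_div_iff_mult_less_eq mult.commute)
  have G: "logexp N P ?G"
    by (intro logexp_sum logexp_cmult logexp_monom N le) auto
  have FG: "logexp N P (\<lambda>x. ?F x * ?G x)"
  proof -
    have "?F x * ?G x = (\<Sum>p<P. \<Sum>m\<le>p div N. \<Sum>q<P. \<Sum>k\<le>q div N. (c p m * d q k) * (x ^ (p + q) * ln x ^ (m + k)))" for x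
      unfolding sum_distrib_right unfolding sum_distrib_left by (simp add: power_add mult_ac)
    moreover have "logexp N P (\<lambda>x. \<Sum>p<P. \<Sum>m\<le>p div N. \<Sum>q<P. \<Sum>k\<le>q div N. (c p m * d q k) * (x ^ (p + q) * ln x ^ (m + k)))"
      by (intro logexp_sum logexp_cmult logexp_monom N) (auto simp: distrib_left intro!: add_mono le)
    ultimately show ?thesis by simp
  qed
  have 1: "(\<lambda>x. (f x - ?F x) * ?G x) \<in> O[at_right 0](?E)"
    using landau_o.big.mult[OF c logexp_bounded[OF G N]] by simp
  have 2: "(\<lambda>x. f x * (g x - ?G x)) \<in> O[at_right 0](?E)"
    using landau_o.big.mult[OF logexp_bounded[OF f N] d] by simp
  have "logexp N P (\<lambda>x. ?F x * ?G x + ((f x - ?F x) * ?G x + f x * (g x - ?G x)))"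
    by (intro logexp_add FG logexp_bigo sum_in_bigo 1 2)
  then show ?thesis by (simp add: algebra_simps)
qed

lemma logexp_power:
  assumes "logexp N P f" "N \<ge> 1" "P \<ge> 1"
  shows "logexp N P (\<lambda>x. f x ^ k)"
  by (induction k) (auto intro: logexp_const logexp_mult assms)

text \<open>Every monomial but the constant one is \<open>O(\<surd>x)\<close>.\<close>

lemma logexp_small:
  assumes f: "logexp N P f" and N: "N \<ge> 1" "P \<ge> 1" and lim: "(f \<longlongrightarrow> 0) (at_right 0)"
  shows "f \<in> O[at_right 0](\<lambda>x. x powr (1/2))"
proof -
  obtain c where c: "(\<lambda>x. f x - (\<Sum>p<P. \<Sum>m\<le>p div N. c p m * (x ^ p * ln x ^ m))) \<in> O[at_right 0](\<lambda>x. x powr (real P - 1/2))"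
    using f unfolding logexp_def by auto
  have "(\<lambda>x. x powr (real P - 1/2)) \<in> O[at_right 0](\<lambda>x::real. x powr (1/2))"
  proof (cases "P = 1")
    case False
    then have "real P - 1/2 > 1/2" using N by auto
    then show ?thesis by real_asymp
  qed simp
  with c have r: "(\<lambda>x. f x - (\<Sum>p<P. \<Sum>m\<le>p div N. c p m * (x ^ p * ln x ^ m))) \<in> O[at_right 0](\<lambda>x. x powr (1/2))"
    by (rule landau_o.big_trans)
  obtain Q where Q: "P = Suc Q" using N by (cases P) auto
  have s: "(\<lambda>x. \<Sum>p<Q. \<Sum>m\<le>Suc p div N. c (Suc p) m * (x ^ Suc p * ln x ^ m)) \<in> O[at_right 0](\<lambda>x. x powr (1/2))"
  proof (intro big_sum_in_bigo)
    fix p m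
    have "(\<lambda>x::real. x ^ Suc p * ln x ^ m) \<in> O[at_right 0](\<lambda>x. x powr (1/2))"
    proof -
      have "(\<lambda>x::real. x powr (1 + real p) * ln x ^ m) \<in> O[at_right 0](\<lambda>x. x powr (1/2))" by real_asymp
      moreover have "eventually (\<lambda>x::real. x powr (1 + real p) * ln x ^ m = x ^ Suc p * ln x ^ m) (at_right 0)"
        by (auto simp: eventually_at_filter powr_add powr_realpow)
      ultimately show ?thesis by (subst (asm) landau_o.big.in_cong) auto
    qed
    then show "(\<lambda>x. c (Suc p) m * (x ^ Suc p * ln x ^ m)) \<in> O[at_right 0](\<lambda>x. x powr (1/2))"
      by (cases "c (Suc p) m = 0") auto
  qed
  have r2: "(\<lambda>x. f x - c 0 0) \<in> O[at_right 0](\<lambda>x. x powr (1/2))"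
    using sum_in_bigo(1)[OF r s] unfolding Q sum.lessThan_Suc_shift by simp
  have c0: "c 0 0 = 0"
  proof -
    have z: "((\<lambda>x. x powr (1/2)) \<longlongrightarrow> 0) (at_right (0::real))" by real_asymp
    obtain K where "eventually (\<lambda>x. norm (f x - c 0 0) \<le> K * norm (x powr (1/2))) (at_right 0)"
      using r2 by (rule landau_o.bigE) auto
    then have "((\<lambda>x. f x - c 0 0) \<longlongrightarrow> 0) (at_right 0)"
      by (rule Lim_null_comparison) (use tendsto_mult_left[OF tendsto_norm[OF z], of K] in simp)
    moreover have "((\<lambda>x. f x - c 0 0) \<longlongrightarrow> 0 - c 0 0) (at_right 0)" by (intro tendsto_intros lim)
    ultimately show ?thesis using tendsto_unique[OF trivial_limit_at_right_real] by fastforce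
  qed
  show ?thesis using r2 unfolding c0 by simp
qed

text \<open>A geometric series in \<open>u = 1 - f / a = O(\<surd>x)\<close>, whose remainder after \<open>2 P\<close> terms is \<open>O(x\<^sup>P)\<close>.\<close>

lemma logexp_inverse:
  assumes f: "logexp N P f" and N: "N \<ge> 1" "P \<ge> 1" and lim: "(f \<longlongrightarrow> a) (at_right 0)" and a: "a \<noteq> 0"
  shows "logexp N P (\<lambda>x. 1 / f x)"
proof -
  define u where "u x = 1 + (- 1 / a) * f x" for x
  have u: "logexp N P u" unfolding u_def by (intro logexp_add logexp_cmult logexp_const f N)
  have ul: "(u \<longlongrightarrow> 0) (at_right 0)"
    unfolding u_def using tendsto_add[OF tendsto_const[of 1] tendsto_mult_left[OF lim, of "- 1 / a"]] a by simp
  have us: "u \<in> O[at_right 0](\<lambda>x. x powr (1/2))" by (rule logexp_small[OF u N ul])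
  have up: "(\<lambda>x. u x ^ (2 * P)) \<in> O[at_right 0](\<lambda>x. x powr (real P - 1/2))"
  proof -
    have "(\<lambda>x. u x ^ (2 * P)) \<in> O[at_right 0](\<lambda>x. (x powr (1/2)) ^ (2 * P))" using us by (rule landau_o.big_power)
    also have "(\<lambda>x::real. (x powr (1/2)) ^ (2 * P)) \<in> O[at_right 0](\<lambda>x. x powr (real P - 1/2))"
    proof -
      have "(\<lambda>x::real. x powr (real P)) \<in> O[at_right 0](\<lambda>x. x powr (real P - 1/2))" by real_asymp
      moreover have "eventually (\<lambda>x::real. x powr (real P) = (x powr (1/2)) ^ (2 * P)) (at_right 0)"
        by (auto simp: eventually_at_filter powr_powr simp flip: powr_realpow)
      ultimately show ?thesis by (subst (asm) landau_o.big.in_cong) auto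
    qed
    finally show ?thesis .
  qed
  have inv: "(\<lambda>x. 1 / (1 - u x)) \<in> O[at_right 0](\<lambda>_. 1)"
    by (rule bigoI_tendsto[of _ _ "1 / (1 - 0)"]) (auto intro!: tendsto_eq_intros ul)
  have "(\<lambda>x. u x ^ (2 * P) * (1 / (1 - u x))) \<in> O[at_right 0](\<lambda>x. x powr (real P - 1/2))"
    using landau_o.big.mult[OF up inv] by simp
  then have L: "logexp N P (\<lambda>x. (1/a) * ((\<Sum>k<2*P. u x ^ k) + u x ^ (2 * P) * (1 / (1 - u x))))"
    by (intro logexp_cmult logexp_add logexp_sum logexp_power u N logexp_bigo) auto
  have "eventually (\<lambda>x. u x \<noteq> 1) (at_right 0)"
    using tendsto_imp_eventually_ne[OF ul, of 1] by simp
  then have ev: "eventually (\<lambda>x. (1/a) * ((\<Sum>k<2*P. u x ^ k) + u x ^ (2 * P) * (1 / (1 - u x))) = 1 / f x) (at_right 0)"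
  proof eventually_elim
    case (elim x)
    have f: "f x = a * (1 - u x)" using a by (simp add: u_def)
    have "(\<Sum>k<2*P. u x ^ k) = (1 - u x ^ (2*P)) / (1 - u x)" using elim by (subst geometric_sum) (auto simp: field_simps)
    then show ?case unfolding f using elim a by (simp add: field_simps)
  qed
  obtain c where "(\<lambda>x. (1/a) * ((\<Sum>k<2*P. u x ^ k) + u x ^ (2 * P) * (1 / (1 - u x))) - (\<Sum>p<P. \<Sum>m\<le>p div N. c p m * (x ^ p * ln x ^ m))) \<in> O[at_right 0](\<lambda>x. x powr (real P - 1/2))"
    using L unfolding logexp_def by blast
  then have "(\<lambda>x. 1 / f x - (\<Sum>p<P. \<Sum>m\<le>p div N. c p m * (x ^ p * ln x ^ m))) \<in> O[at_right 0](\<lambda>x. x powr (real P - 1/2))"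
    by (subst (asm) landau_o.big.in_cong) (use ev in \<open>auto elim!: eventually_mono\<close>)
  then show ?thesis unfolding logexp_def by blast
qed

text \<open>Taylor's theorem at the origin.\<close>

lemma logexp_entire:
  fixes g :: "complex \<Rightarrow> complex"
  assumes g: "g holomorphic_on UNIV" and N: "N \<ge> 1" "P \<ge> 1"
  shows "logexp N P (\<lambda>x. Re (g (of_real (- x))))"
proof -
  define d where "d i = (deriv ^^ i) g" for i
  have dd: "(d i has_field_derivative d (Suc i) z) (at z)" for i z
    using has_field_derivative_higher_deriv[OF g open_UNIV UNIV_I, of i z] by (simp add: d_def)
  obtain Q where Q: "P = Suc Q" using N by (cases P) auto
  have "continuous_on (cball 0 1) (d (Suc Q))"
    by (intro continuous_at_imp_continuous_on ballI DERIV_isCont[OF dd])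
  then have "compact (d (Suc Q) ` cball 0 1)" by (intro compact_continuous_image compact_cball)
  then obtain K where K: "\<And>z. norm z \<le> 1 \<Longrightarrow> norm (d (Suc Q) z) \<le> K"
    by (force simp: bounded_iff dest!: compact_imp_bounded)
  have T: "norm (g z - (\<Sum>i\<le>Q. d i 0 * z ^ i / fact i)) \<le> K * norm z ^ Suc Q / fact Q" if z: "norm z \<le> 1" for z
  proof -
    have "norm (d 0 z - (\<Sum>i\<le>Q. d i 0 * (z - 0) ^ i / fact i)) \<le> K * norm (z - 0) ^ Suc Q / fact Q"
      by (rule complex_Taylor[where S = "cball 0 1"])
         (use K z dd in \<open>auto intro: has_field_derivative_at_within\<close>)
    then show ?thesis by (simp add: d_def)
  qed
  define c where "c i = Re (d i 0) * (- 1) ^ i / fact i" for i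
  have "(\<lambda>x. Re (g (of_real (- x))) - (\<Sum>i\<le>Q. c i * x ^ i)) \<in> O[at_right 0](\<lambda>x. x ^ P)"
  proof (rule bigoI[where c = "K / fact Q"])
    have "eventually (\<lambda>x::real. x \<in> {0<..<1}) (at_right 0)" by (rule eventually_at_right_real) simp
    then show "\<forall>\<^sub>F x in at_right 0. norm (Re (g (of_real (- x))) - (\<Sum>i\<le>Q. c i * x ^ i)) \<le> K / fact Q * norm (x ^ P)"
    proof eventually_elim
      case (elim x)
      have "Re (\<Sum>i\<le>Q. d i 0 * of_real (- x) ^ i / fact i) = (\<Sum>i\<le>Q. c i * x ^ i)"
      proof -
        have "Re (d i 0 * of_real (- x) ^ i / fact i) = c i * x ^ i" for i
        proof -
          have "d i 0 * of_real (- x) ^ i / fact i = d i 0 * of_real ((- x) ^ i / fact i)" by simp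
          also have "Re \<dots> = Re (d i 0) * ((- x) ^ i / fact i)" by (simp only: Re_complex_of_real times_complex.sel Im_complex_of_real mult_zero_right diff_zero)
          finally show ?thesis by (simp add: c_def power_minus[of x])
        qed
        then show ?thesis by simp
      qed
      then have "\<bar>Re (g (of_real (- x))) - (\<Sum>i\<le>Q. c i * x ^ i)\<bar> = \<bar>Re (g (of_real (- x)) - (\<Sum>i\<le>Q. d i 0 * of_real (- x) ^ i / fact i))\<bar>"
        by (simp only: minus_complex.sel)
      also have "\<dots> \<le> norm (g (of_real (- x)) - (\<Sum>i\<le>Q. d i 0 * of_real (- x) ^ i / fact i))" by (rule abs_Re_le_cmod)
      also have "\<dots> \<le> K * norm (of_real (- x) :: complex) ^ Suc Q / fact Q" using elim by (intro T) auto
      finally show ?case using elim by (simp add: Q)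
    qed
  qed
  also have "(\<lambda>x::real. x ^ P) \<in> O[at_right 0](\<lambda>x. x powr (real P - 1/2))"
  proof -
    have "(\<lambda>x::real. x powr (real P)) \<in> O[at_right 0](\<lambda>x. x powr (real P - 1/2))" by real_asymp
    moreover have "eventually (\<lambda>x::real. x powr (real P) = x ^ P) (at_right 0)"
      by (auto simp: eventually_at_filter powr_realpow)
    ultimately show ?thesis by (subst (asm) landau_o.big.in_cong) auto
  qed
  finally have "logexp N P (\<lambda>x. (Re (g (of_real (- x))) - (\<Sum>i\<le>Q. c i * x ^ i)) + (\<Sum>i\<le>Q. c i * (x ^ i * ln x ^ 0)))"
    by (intro logexp_add logexp_bigo logexp_sum logexp_cmult logexp_monom N) auto
  then show ?thesis by simp
qed

lemma Gamma_type_integrable: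
  assumes "s > 0"
  shows "set_integrable lborel {0<..} (\<lambda>u::real. u powr (s - 1) * exp (- u))"
proof -
  have "set_integrable lebesgue {0<..} (\<lambda>u::real. u powr (s - 1) / exp u)"
  proof (rule set_integrable_subset)
    show "set_integrable lebesgue {0..} (\<lambda>u::real. u powr (s - 1) / exp u)"
      by (rule nonnegative_absolutely_integrable_1) (use Gamma_integral_real[OF assms] in \<open>auto simp: has_integral_integrable\<close>)
  qed auto
  then have "set_integrable lborel {0<..} (\<lambda>u::real. u powr (s - 1) / exp u)"
    unfolding set_integrable_def by (subst (asm) integrable_completion) measurable
  then show ?thesis by (simp add: exp_minus field_simps)
qed

lemma abs_ln_le:
  fixes x :: real
  assumes "x > 0" "a > 0"
  shows "\<bar>ln x\<bar> \<le> x powr a / a + x powr (- a) / a"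
proof (cases "x \<ge> 1")
  case True
  have "ln x \<le> x powr a / a" by (rule ln_powr_bound[OF True assms(2)])
  moreover have "0 \<le> x powr (- a) / a" using assms by simp
  ultimately show ?thesis using True by simp
next
  case False
  have "ln (1/x) \<le> (1/x) powr a / a" using False assms by (intro ln_powr_bound) auto
  also have "(1/x) powr a = x powr (- a)" using assms by (simp add: powr_divide powr_minus_divide)
  finally have "- ln x \<le> x powr (- a) / a" using assms by (simp add: ln_div)
  moreover have "0 \<le> x powr a / a" using assms by simp
  moreover have "ln x < 0" using False assms by simp
  ultimately show ?thesis by linarith
qed

lemma log_moment_integrable:
  "set_integrable lborel {0<..} (\<lambda>u::real. u ^ p * ln u ^ m * exp (- u))"
proof -
  define a where "a = 1 / (2 * real (Suc m))"
  have a: "a > 0" by (simp add: a_def)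
  have am: "a * real m < 1/2" by (simp add: a_def field_simps)
  let ?g = "\<lambda>u::real. (2/a) ^ m * (u powr ((real p + 3/2) - 1) * exp (- u) + u powr ((real p + 1/2) - 1) * exp (- u))"
  show ?thesis
  proof (rule set_integrable_bound)
    show "set_integrable lborel {0<..} ?g"
      by (intro set_integrable_mult_right set_integral_add Gamma_type_integrable) auto
    show "set_borel_measurable lborel {0<..} (\<lambda>u::real. u ^ p * ln u ^ m * exp (- u))"
      unfolding set_borel_measurable_def by measurable
    show "AE u in lborel. u \<in> {0<..} \<longrightarrow> norm (u ^ p * ln u ^ m * exp (- u)) \<le> norm (?g u)"
    proof (intro AE_I2 impI)
      fix u :: real assume "u \<in> {0<..}"
      then have u: "u > 0" by simp
      let ?M = "max (u powr a) (u powr (- a))"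
      have "\<bar>ln u\<bar> \<le> u powr a / a + u powr (- a) / a" by (rule abs_ln_le[OF u a])
      also have "\<dots> \<le> ?M / a + ?M / a" using a by (intro add_mono divide_right_mono) auto
      finally have "\<bar>ln u\<bar> \<le> (2/a) * ?M" by simp
      then have "\<bar>ln u\<bar> ^ m \<le> ((2/a) * ?M) ^ m" by (intro power_mono) auto
      also have "\<dots> = (2/a) ^ m * ?M ^ m" by (rule power_mult_distrib)
      also have "?M ^ m \<le> u powr (1/2) + u powr (-1/2)"
      proof (cases "u \<ge> 1")
        case True
        then have "?M = u powr a" using a powr_mono[of "- a" a u] by (simp add: max_def)
        then have "?M ^ m = u powr (a * real m)" using u by (simp add: powr_powr flip: powr_realpow)
        also have "\<dots> \<le> u powr (1/2)" using True am by (intro powr_mono) auto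
        finally show ?thesis by (simp add: add_increasing2)
      next
        case False
        then have "?M = u powr (- a)" using a u powr_mono'[of "- a" a u] by (simp add: max_def)
        then have "?M ^ m = u powr (- (a * real m))" using u by (simp add: powr_powr flip: powr_realpow)
        also have "\<dots> \<le> u powr (- 1/2)" using False am u by (intro powr_mono') auto
        finally show ?thesis by (simp add: add_increasing)
      qed
      finally have 1: "\<bar>ln u\<bar> ^ m \<le> (2/a) ^ m * (u powr (1/2) + u powr (-1/2))" using a by (simp add: mult_left_mono)
      have "norm (u ^ p * ln u ^ m * exp (- u)) = u ^ p * \<bar>ln u\<bar> ^ m * exp (- u)" using u by (simp add: abs_mult power_abs)
      also have "\<dots> \<le> u ^ p * ((2/a) ^ m * (u powr (1/2) + u powr (-1/2))) * exp (- u)"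
        using 1 u by (intro mult_right_mono mult_left_mono) auto
      also have "\<dots> = ?g u"
      proof -
        have "u powr ((real p + 3/2) - 1) = u ^ p * u powr (1/2)" "u powr ((real p + 1/2) - 1) = u ^ p * u powr (-1/2)"
          using u by (simp_all add: add.commute flip: powr_realpow powr_add)
        then show ?thesis by (simp add: algebra_simps)
      qed
      finally show "norm (u ^ p * ln u ^ m * exp (- u)) \<le> norm (?g u)" by simp
    qed
  qed
qed

text \<open>The derivative of order \<open>m\<close> of the Gamma function at \<open>p + 1\<close>.\<close>

definition log_moment :: "nat \<Rightarrow> nat \<Rightarrow> real" where
  "log_moment p m = (LINT u:{0<..}|lborel. u ^ p * ln u ^ m * exp (- u))"

text \<open>Rescaling by \<open>t\<close> replaces \<open>ln x\<close> by \<open>ln u - ln t\<close>; the binomial expansion gives a polynomial in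
  \<open>ln t\<close> of the same degree.\<close>

lemma laplace_log_monomial:
  assumes t: "t > 0"
  shows "set_integrable lborel {0<..} (\<lambda>x::real. x ^ p * ln x ^ m * exp (- t * x))"
    and "(LINT x:{0<..}|lborel. x ^ p * ln x ^ m * exp (- t * x)) =
      (1 / t ^ Suc p) * (\<Sum>k\<le>m. (of_nat (m choose k) * (-1) ^ k * log_moment p (m - k)) * ln t ^ k)"
proof -
  let ?f = "\<lambda>x::real. indicator {0<..} x *\<^sub>R (x ^ p * ln x ^ m * exp (- t * x))"
  let ?h = "\<lambda>k u::real. (of_nat (m choose k) * (-1) ^ k * ln t ^ k / t ^ p) * (indicator {0<..} u *\<^sub>R (u ^ p * ln u ^ (m - k) * exp (- u)))"
  have sc: "?f (0 + (1/t) * u) = (\<Sum>k\<le>m. ?h k u)" for u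
  proof (cases "u > 0")
    case True
    have "(ln u - ln t) ^ m = (- ln t + ln u) ^ m" by simp
    also have "\<dots> = (\<Sum>k\<le>m. of_nat (m choose k) * (- ln t) ^ k * ln u ^ (m - k))" by (rule binomial_ring)
    finally have "ln (u / t) ^ m = (\<Sum>k\<le>m. of_nat (m choose k) * (- ln t) ^ k * ln u ^ (m - k))"
      using True t by (simp add: ln_div)
    then have "?f (0 + (1/t) * u) = (u / t) ^ p * (\<Sum>k\<le>m. of_nat (m choose k) * (- ln t) ^ k * ln u ^ (m - k)) * exp (- u)"
      using True t by simp
    also have "\<dots> = (\<Sum>k\<le>m. ?h k u)" unfolding sum_distrib_left sum_distrib_right
      using True by (intro sum.cong refl) (simp add: power_divide power_minus[of "ln t"] field_simps)
    finally show ?thesis .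
  next
    case False then show ?thesis using t by (auto simp: zero_less_mult_iff zero_less_divide_iff split: split_indicator)
  qed
  have ih: "integrable lborel (?h k)" for k
    using log_moment_integrable[of p "m - k"] unfolding set_integrable_def by (rule integrable_mult_right)
  have i: "integrable lborel (\<lambda>u. ?f (0 + (1/t) * u))" unfolding sc by (intro Bochner_Integration.integrable_sum ih)
  then show "set_integrable lborel {0<..} (\<lambda>x::real. x ^ p * ln x ^ m * exp (- t * x))"
    unfolding set_integrable_def by (subst (asm) lborel_integrable_real_affine_iff) (use t in auto)
  have "(LINT x:{0<..}|lborel. x ^ p * ln x ^ m * exp (- t * x)) = (1/t) * (LINT u|lborel. ?f (0 + (1/t) * u))"
    unfolding set_lebesgue_integral_def by (subst lborel_integral_real_affine[where c = "1/t" and t = 0]) (use t in auto)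
  also have "\<dots> = (1/t) * (\<Sum>k\<le>m. of_nat (m choose k) * (-1) ^ k * ln t ^ k / t ^ p * log_moment p (m - k))"
    unfolding sc log_moment_def set_lebesgue_integral_def
    by (subst Bochner_Integration.integral_sum[OF ih]) (simp only: integral_mult_right_zero)
  also have "\<dots> = (1 / t ^ Suc p) * (\<Sum>k\<le>m. (of_nat (m choose k) * (-1) ^ k * log_moment p (m - k)) * ln t ^ k)"
    unfolding sum_distrib_left by (intro sum.cong refl) (use t in \<open>simp add: field_simps\<close>)
  finally show "(LINT x:{0<..}|lborel. x ^ p * ln x ^ m * exp (- t * x)) =
      (1 / t ^ Suc p) * (\<Sum>k\<le>m. (of_nat (m choose k) * (-1) ^ k * log_moment p (m - k)) * ln t ^ k)" .
qed

lemma laplace_log_monomial_tail: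
  fixes \<delta> :: real
  assumes \<delta>: "\<delta> > 0"
  shows "(\<lambda>t. LINT x:{\<delta><..}|lborel. x ^ p * ln x ^ m * exp (- t * x)) \<in> O[at_top](\<lambda>t. exp (- \<delta> * t))"
proof (rule bigoI)
  let ?C = "LINT x:{0<..}|lborel. \<bar>x ^ p * ln x ^ m * exp (- 1 * (x::real))\<bar>"
  have i1: "set_integrable lborel {0<..} (\<lambda>x::real. \<bar>x ^ p * ln x ^ m * exp (- 1 * x)\<bar>)"
    by (intro set_integrable_abs laplace_log_monomial(1)) simp
  show "\<forall>\<^sub>F t in at_top. norm (LINT x:{\<delta><..}|lborel. x ^ p * ln x ^ m * exp (- t * x)) \<le> (exp \<delta> * ?C) * norm (exp (- \<delta> * t))"
    using eventually_ge_at_top[of 1]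
  proof eventually_elim
    case (elim t)
    have it: "set_integrable lborel {\<delta><..} (\<lambda>x. x ^ p * ln x ^ m * exp (- t * x))"
      by (rule set_integrable_subset[OF laplace_log_monomial(1)]) (use elim \<delta> in auto)
    have "norm (LINT x:{\<delta><..}|lborel. x ^ p * ln x ^ m * exp (- t * x)) \<le> (LINT x:{\<delta><..}|lborel. norm (x ^ p * ln x ^ m * exp (- t * x)))"
      by (rule set_integral_norm_bound[OF it])
    also have "\<dots> \<le> (LINT x:{0<..}|lborel. exp (- \<delta> * (t - 1)) * \<bar>x ^ p * ln x ^ m * exp (- 1 * x)\<bar>)"
      unfolding set_lebesgue_integral_def
    proof (rule integral_mono)
      show "integrable lborel (\<lambda>x. indicator {\<delta><..} x *\<^sub>R norm (x ^ p * ln x ^ m * exp (- t * x)))"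
        using set_integrable_norm[OF it] unfolding set_integrable_def .
      show "integrable lborel (\<lambda>x. indicator {0<..} x *\<^sub>R (exp (- \<delta> * (t - 1)) * \<bar>x ^ p * ln x ^ m * exp (- 1 * x)\<bar>))"
        using set_integrable_mult_right[OF i1] unfolding set_integrable_def .
      fix x :: real
      have "exp (- t * x) \<le> exp (- \<delta> * (t - 1)) * exp (- 1 * x)" if "x > \<delta>"
      proof -
        have "\<delta> * (t - 1) \<le> x * (t - 1)" using that elim by (intro mult_right_mono) auto
        then show ?thesis by (simp add: algebra_simps flip: exp_add)
      qed
      then have "norm (x ^ p * ln x ^ m * exp (- t * x)) \<le> exp (- \<delta> * (t - 1)) * \<bar>x ^ p * ln x ^ m * exp (- 1 * x)\<bar>" if "x > \<delta>"
      proof -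
        assume h: "x > \<delta> \<Longrightarrow> exp (- t * x) \<le> exp (- \<delta> * (t - 1)) * exp (- 1 * x)"
        have "norm (x ^ p * ln x ^ m * exp (- t * x)) = \<bar>x ^ p * ln x ^ m\<bar> * exp (- t * x)" by (simp add: abs_mult)
        also have "\<dots> \<le> \<bar>x ^ p * ln x ^ m\<bar> * (exp (- \<delta> * (t - 1)) * exp (- 1 * x))"
          by (intro mult_left_mono h that) auto
        also have "\<dots> = exp (- \<delta> * (t - 1)) * \<bar>x ^ p * ln x ^ m * exp (- 1 * x)\<bar>" by (simp add: abs_mult)
        finally show ?thesis .
      qed
      then show "indicator {\<delta><..} x *\<^sub>R norm (x ^ p * ln x ^ m * exp (- t * x)) \<le> indicator {0<..} x *\<^sub>R (exp (- \<delta> * (t - 1)) * \<bar>x ^ p * ln x ^ m * exp (- 1 * x)\<bar>)"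
        using \<delta> by (auto split: split_indicator)
    qed
    also have "\<dots> = exp (- \<delta> * (t - 1)) * ?C" by (rule set_integral_mult_right)
    also have "exp (- \<delta> * (t - 1)) = exp \<delta> * exp (- \<delta> * t)" by (simp add: algebra_simps flip: exp_add)
    also have "exp \<delta> * exp (- \<delta> * t) * ?C = (exp \<delta> * ?C) * exp (- \<delta> * t)" by (simp only: mult_ac)
    finally show ?case by simp
  qed
qed

lemma laplace_powr:
  assumes t: "t > 0" and s: "s > 0"
  shows "set_integrable lborel {0<..} (\<lambda>x::real. x powr (s - 1) * exp (- t * x))"
    and "(LINT x:{0<..}|lborel. x powr (s - 1) * exp (- t * x)) = t powr (- s) * (LINT u:{0<..}|lborel. u powr (s - 1) * exp (- u))"
proof -
  let ?f = "\<lambda>x::real. indicator {0<..} x *\<^sub>R (x powr (s - 1) * exp (- t * x))"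
  let ?h = "\<lambda>u::real. t powr (1 - s) * (indicator {0<..} u *\<^sub>R (u powr (s - 1) * exp (- u)))"
  have sc: "?f (0 + (1/t) * u) = ?h u" for u
  proof (cases "u > 0")
    case True
    have "(u / t) powr (s - 1) = u powr (s - 1) * t powr (1 - s)"
      using True t by (simp add: powr_divide powr_minus_divide[of t "s - 1", simplified])
    then show ?thesis using True t by simp
  next
    case False then show ?thesis using t by (auto simp: zero_less_mult_iff zero_less_divide_iff split: split_indicator)
  qed
  have "integrable lborel ?h"
    using Gamma_type_integrable[OF s] unfolding set_integrable_def by (rule integrable_mult_right)
  then have "integrable lborel (\<lambda>u. ?f (0 + (1/t) * u))" unfolding sc .
  then show "set_integrable lborel {0<..} (\<lambda>x::real. x powr (s - 1) * exp (- t * x))"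
    unfolding set_integrable_def by (subst (asm) lborel_integrable_real_affine_iff) (use t in auto)
  have "(LINT x:{0<..}|lborel. x powr (s - 1) * exp (- t * x)) = (1/t) * (LINT u|lborel. ?f (0 + (1/t) * u))"
    unfolding set_lebesgue_integral_def by (subst lborel_integral_real_affine[where c = "1/t" and t = 0]) (use t in auto)
  also have "\<dots> = (1/t * t powr (1 - s)) * (LINT u:{0<..}|lborel. u powr (s - 1) * exp (- u))"
    unfolding sc set_lebesgue_integral_def by simp
  also have "1/t * t powr (1 - s) = t powr (- s)" using t by (simp add: powr_diff powr_minus field_simps)
  finally show "(LINT x:{0<..}|lborel. x powr (s - 1) * exp (- t * x)) = t powr (- s) * (LINT u:{0<..}|lborel. u powr (s - 1) * exp (- u))" .
qed

text \<open>Watson's lemma for the expansions above.  Extending each monomial from \<open>(0, \<delta>]\<close> to the half-line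
  costs an exponentially small error, and the remainder \<open>O(x\<^bsup>P - 1/2\<^esup>)\<close> has a transform of the order
  of the Gamma integral with that exponent.\<close>

lemma watson:
  fixes f :: "real \<Rightarrow> real" and c :: "nat \<Rightarrow> nat \<Rightarrow> real"
  assumes \<delta>: "\<delta> > 0" and P: "P \<ge> 1" and meas: "set_borel_measurable borel {0<..\<delta>} f"
    and bd: "\<And>x. 0 < x \<Longrightarrow> x \<le> \<delta> \<Longrightarrow> \<bar>f x - (\<Sum>p<P. \<Sum>m\<le>p div N. c p m * (x ^ p * ln x ^ m))\<bar> \<le> C * x powr (real P - 1/2)"
  shows "\<exists>d. (\<lambda>t. (LINT x:{0<..\<delta>}|lborel. x ^ a * f x * exp (- t * x)) -
      (\<Sum>p<P. 1 / t ^ Suc (a + p) * (\<Sum>k\<le>p div N. d p k * ln t ^ k))) \<in> O[at_top](\<lambda>t. 1 / t powr (real (a + P) + 1/2))"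
proof -
  define s where "s = real (a + P) + 1/2"
  have s: "s > 0" by (simp add: s_def)
  define S where "S x = (\<Sum>p<P. \<Sum>m\<le>p div N. c p m * (x ^ p * ln x ^ m))" for x :: real
  define I where "I q m t = (LINT x:{0<..}|lborel. x ^ q * ln x ^ m * exp (- t * (x::real)))" for q m t
  define T where "T q m t = (LINT x:{\<delta><..}|lborel. x ^ q * ln x ^ m * exp (- t * (x::real)))" for q m t
  define d where "d p k = (\<Sum>m\<le>p div N. c p m * (of_nat (m choose k) * (-1) ^ k * log_moment (a + p) (m - k)))" for p k
  have C: "C \<ge> 0" using order_trans[OF abs_ge_zero bd[OF \<delta> order_refl]] \<delta> by (simp add: zero_le_mult_iff)
  have main: "(LINT x:{0<..\<delta>}|lborel. x ^ a * f x * exp (- t * x)) - (\<Sum>p<P. 1 / t ^ Suc (a + p) * (\<Sum>k\<le>p div N. d p k * ln t ^ k))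
     = (LINT x:{0<..\<delta>}|lborel. x ^ a * (f x - S x) * exp (- t * x)) - (\<Sum>p<P. \<Sum>m\<le>p div N. c p m * T (a + p) m t)" (is ?main)
    and rem: "\<bar>LINT x:{0<..\<delta>}|lborel. x ^ a * (f x - S x) * exp (- t * x)\<bar> \<le> C * (LINT u:{0<..}|lborel. u powr (s - 1) * exp (- u)) * (1 / t powr s)" (is ?rem)
    if t: "t > 0" for t
  proof -
    have iI: "set_integrable lborel A (\<lambda>x::real. x ^ q * ln x ^ m * exp (- t * x))" if "A \<in> sets borel" "A \<subseteq> {0<..}" for q m A
      by (rule set_integrable_subset[OF laplace_log_monomial(1)[OF t]]) (use that in auto)
    have split: "(LINT x:{0<..\<delta>}|lborel. x ^ q * ln x ^ m * exp (- t * x)) = I q m t - T q m t" for q m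
    proof -
      have u: "{0<..\<delta>} \<union> {\<delta><..} = {0<..}" using \<delta> by auto
      have "(LINT x:{0<..\<delta>} \<union> {\<delta><..}|lborel. x ^ q * ln x ^ m * exp (- t * x)) = (LINT x:{0<..\<delta>}|lborel. x ^ q * ln x ^ m * exp (- t * x)) + T q m t"
        unfolding T_def
      proof (rule set_integral_Un)
        show "{0<..\<delta>} \<inter> {\<delta><..} = {}" by auto
        show "set_integrable lborel {0<..\<delta>} (\<lambda>x. x ^ q * ln x ^ m * exp (- t * x))" by (rule iI) auto
        show "set_integrable lborel {\<delta><..} (\<lambda>x. x ^ q * ln x ^ m * exp (- t * x))" by (rule iI) (use \<delta> in auto)
      qed
      then show ?thesis unfolding u I_def by simp
    qed
    have Seq: "x ^ a * S x * exp (- t * x) = (\<Sum>p<P. \<Sum>m\<le>p div N. c p m * (x ^ (a + p) * ln x ^ m * exp (- t * x)))" for x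
      unfolding S_def sum_distrib_left sum_distrib_right by (simp add: power_add mult_ac)
    have ipm: "set_integrable lborel {0<..\<delta>} (\<lambda>x. c p m * (x ^ (a + p) * ln x ^ m * exp (- t * x)))" for p m
      by (intro set_integrable_mult_right iI) auto
    have iS: "set_integrable lborel {0<..\<delta>} (\<lambda>x. x ^ a * S x * exp (- t * x))"
      unfolding Seq using ipm unfolding set_integrable_def scaleR_sum_right by (intro Bochner_Integration.integrable_sum)
    have LS: "(LINT x:{0<..\<delta>}|lborel. x ^ a * S x * exp (- t * x)) = (\<Sum>p<P. \<Sum>m\<le>p div N. c p m * (I (a + p) m t - T (a + p) m t))"
    proof -
      note ip = ipm[unfolded set_integrable_def]
      have "(LINT x:{0<..\<delta>}|lborel. x ^ a * S x * exp (- t * x)) = (\<Sum>p<P. \<Sum>m\<le>p div N. LINT x:{0<..\<delta>}|lborel. c p m * (x ^ (a + p) * ln x ^ m * exp (- t * x)))"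
        unfolding Seq set_lebesgue_integral_def scaleR_sum_right
        by (subst Bochner_Integration.integral_sum, intro Bochner_Integration.integrable_sum ip,
            intro sum.cong refl, subst Bochner_Integration.integral_sum, rule ip, rule refl)
      then show ?thesis by (simp only: set_integral_mult_right split)
    qed
    let ?b = "\<lambda>x. C * (x powr (s - 1) * exp (- t * x))"
    have ib0: "set_integrable lborel {0<..} ?b"
      by (intro set_integrable_mult_right laplace_powr(1) t s)
    have ib: "set_integrable lborel {0<..\<delta>} ?b"
      by (rule set_integrable_subset[OF ib0]) auto
    have pb: "\<bar>x ^ a * (f x - S x) * exp (- t * x)\<bar> \<le> ?b x" if "0 < x" "x \<le> \<delta>" for x
    proof -
      have "\<bar>x ^ a * (f x - S x) * exp (- t * x)\<bar> = x ^ a * \<bar>f x - S x\<bar> * exp (- t * x)" using that by (simp add: abs_mult)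
      also have "\<dots> \<le> x ^ a * (C * x powr (real P - 1/2)) * exp (- t * x)"
        using bd[OF that] that unfolding S_def by (intro mult_right_mono mult_left_mono) auto
      also have "\<dots> = ?b x" using that by (simp add: s_def algebra_simps powr_realpow[symmetric] flip: powr_add)
      finally show ?thesis .
    qed
    have iR: "set_integrable lborel {0<..\<delta>} (\<lambda>x. x ^ a * (f x - S x) * exp (- t * x))"
    proof (rule set_integrable_bound[OF ib])
      have "set_borel_measurable borel {0<..\<delta>} (\<lambda>x. x ^ a * exp (- t * x) * f x - x ^ a * S x * exp (- t * x))"
      proof -
        have "(\<lambda>x. (x ^ a * exp (- t * x)) * (indicator {0<..\<delta>} x *\<^sub>R f x)) \<in> borel_measurable borel"
          by (rule borel_measurable_times) (use meas in \<open>auto simp: set_borel_measurable_def\<close>)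
        moreover have "(\<lambda>x. indicator {0<..\<delta>} x *\<^sub>R (x ^ a * S x * exp (- t * x))) \<in> borel_measurable borel"
          unfolding S_def by measurable
        ultimately have "(\<lambda>x. (x ^ a * exp (- t * x)) * (indicator {0<..\<delta>} x *\<^sub>R f x) - indicator {0<..\<delta>} x *\<^sub>R (x ^ a * S x * exp (- t * x))) \<in> borel_measurable borel"
          by (rule borel_measurable_diff)
        then show ?thesis unfolding set_borel_measurable_def by (simp add: algebra_simps)
      qed
      then show "set_borel_measurable lborel {0<..\<delta>} (\<lambda>x. x ^ a * (f x - S x) * exp (- t * x))"
        by (simp add: set_borel_measurable_def algebra_simps)
      show "AE x in lborel. x \<in> {0<..\<delta>} \<longrightarrow> norm (x ^ a * (f x - S x) * exp (- t * x)) \<le> norm (?b x)"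
        using pb by (auto intro: order_trans[OF _ abs_ge_self])
    qed
    have "(LINT x:{0<..\<delta>}|lborel. x ^ a * f x * exp (- t * x)) = (LINT x:{0<..\<delta>}|lborel. x ^ a * (f x - S x) * exp (- t * x) + x ^ a * S x * exp (- t * x))"
      by (simp add: algebra_simps)
    also have "\<dots> = (LINT x:{0<..\<delta>}|lborel. x ^ a * (f x - S x) * exp (- t * x)) + (LINT x:{0<..\<delta>}|lborel. x ^ a * S x * exp (- t * x))"
      by (rule set_integral_add(2)[OF iR iS])
    finally have 1: "(LINT x:{0<..\<delta>}|lborel. x ^ a * f x * exp (- t * x)) = (LINT x:{0<..\<delta>}|lborel. x ^ a * (f x - S x) * exp (- t * x))
       + (\<Sum>p<P. \<Sum>m\<le>p div N. c p m * I (a + p) m t) - (\<Sum>p<P. \<Sum>m\<le>p div N. c p m * T (a + p) m t)"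
      unfolding LS by (simp add: right_diff_distrib sum_subtractf)
    have 2: "(\<Sum>m\<le>p div N. c p m * I (a + p) m t) = 1 / t ^ Suc (a + p) * (\<Sum>k\<le>p div N. d p k * ln t ^ k)" for p
    proof -
      have "I (a + p) m t = 1 / t ^ Suc (a + p) * (\<Sum>k\<le>p div N. of_nat (m choose k) * (-1) ^ k * log_moment (a + p) (m - k) * ln t ^ k)" if "m \<le> p div N" for m
      proof -
        have "(\<Sum>k\<le>m. of_nat (m choose k) * (-1) ^ k * log_moment (a + p) (m - k) * ln t ^ k) = (\<Sum>k\<le>p div N. of_nat (m choose k) * (-1) ^ k * log_moment (a + p) (m - k) * ln t ^ k)"
          by (rule sum.mono_neutral_left) (use that in \<open>auto simp: binomial_eq_0\<close>)
        then show ?thesis unfolding I_def laplace_log_monomial(2)[OF t] by simp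
      qed
      then have "(\<Sum>m\<le>p div N. c p m * I (a + p) m t) = (\<Sum>m\<le>p div N. c p m * (1 / t ^ Suc (a + p) * (\<Sum>k\<le>p div N. of_nat (m choose k) * (-1) ^ k * log_moment (a + p) (m - k) * ln t ^ k)))"
        by (intro sum.cong refl) simp
      also have "\<dots> = (\<Sum>m\<le>p div N. \<Sum>k\<le>p div N. 1 / t ^ Suc (a + p) * (c p m * (of_nat (m choose k) * (-1) ^ k * log_moment (a + p) (m - k)) * ln t ^ k))"
        unfolding sum_distrib_left by (intro sum.cong refl) simp
      also have "\<dots> = (\<Sum>k\<le>p div N. \<Sum>m\<le>p div N. 1 / t ^ Suc (a + p) * (c p m * (of_nat (m choose k) * (-1) ^ k * log_moment (a + p) (m - k)) * ln t ^ k))"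
        by (rule sum.swap)
      also have "\<dots> = 1 / t ^ Suc (a + p) * (\<Sum>k\<le>p div N. d p k * ln t ^ k)"
        unfolding d_def sum_distrib_left sum_distrib_right by simp
      finally show ?thesis .
    qed
    show ?main unfolding 1 2 by simp
    have "\<bar>LINT x:{0<..\<delta>}|lborel. x ^ a * (f x - S x) * exp (- t * x)\<bar> \<le> (LINT x:{0<..\<delta>}|lborel. norm (x ^ a * (f x - S x) * exp (- t * x)))"
      using set_integral_norm_bound[OF iR] by simp
    also have "\<dots> \<le> (LINT x:{0<..}|lborel. ?b x)"
      unfolding set_lebesgue_integral_def
    proof (rule integral_mono)
      show "integrable lborel (\<lambda>x. indicator {0<..\<delta>} x *\<^sub>R norm (x ^ a * (f x - S x) * exp (- t * x)))"
        using set_integrable_norm[OF iR] unfolding set_integrable_def .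
      show "integrable lborel (\<lambda>x. indicator {0<..} x *\<^sub>R ?b x)" using ib0 unfolding set_integrable_def .
      show "indicator {0<..\<delta>} x *\<^sub>R norm (x ^ a * (f x - S x) * exp (- t * x)) \<le> indicator {0<..} x *\<^sub>R ?b x" for x
        using pb[of x] C by (auto split: split_indicator)
    qed
    also have "\<dots> = C * (LINT u:{0<..}|lborel. u powr (s - 1) * exp (- u)) * (1 / t powr s)"
      using laplace_powr(2)[OF t s] by (simp add: powr_minus_divide)
    finally show ?rem .
  qed
  have b1: "(\<lambda>t. LINT x:{0<..\<delta>}|lborel. x ^ a * (f x - S x) * exp (- t * x)) \<in> O[at_top](\<lambda>t. 1 / t powr s)"
    by (rule bigoI[where c = "C * (LINT u:{0<..}|lborel. u powr (s - 1) * exp (- u))"])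
       (use rem in \<open>auto intro!: eventually_mono[OF eventually_gt_at_top[of 0]]\<close>)
  have b2: "(\<lambda>t. \<Sum>p<P. \<Sum>m\<le>p div N. c p m * T (a + p) m t) \<in> O[at_top](\<lambda>t. 1 / t powr s)"
  proof (intro big_sum_in_bigo)
    fix p m
    have "(\<lambda>t. T (a + p) m t) \<in> O[at_top](\<lambda>t. exp (- \<delta> * t))"
      unfolding T_def by (rule laplace_log_monomial_tail[OF \<delta>])
    also have "(\<lambda>t. exp (- \<delta> * t)) \<in> O[at_top](\<lambda>t. 1 / t powr s)" using \<delta> s by real_asymp
    finally show "(\<lambda>t. c p m * T (a + p) m t) \<in> O[at_top](\<lambda>t. 1 / t powr s)"
      by (cases "c p m = 0") auto
  qed
  have "(\<lambda>t. (LINT x:{0<..\<delta>}|lborel. x ^ a * (f x - S x) * exp (- t * x)) - (\<Sum>p<P. \<Sum>m\<le>p div N. c p m * T (a + p) m t)) \<in> O[at_top](\<lambda>t. 1 / t powr s)"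
    by (rule sum_in_bigo(2)[OF b1 b2])
  then have "(\<lambda>t. (LINT x:{0<..\<delta>}|lborel. x ^ a * f x * exp (- t * x)) - (\<Sum>p<P. 1 / t ^ Suc (a + p) * (\<Sum>k\<le>p div N. d p k * ln t ^ k))) \<in> O[at_top](\<lambda>t. 1 / t powr s)"
    by (rule landau_o.big.in_cong[THEN iffD1, rotated]) (use main in \<open>auto intro!: eventually_mono[OF eventually_gt_at_top[of 0]]\<close>)
  then show ?thesis unfolding s_def by blast
qed

lemma laplace_exp:
  assumes w: "Re w > 0"
  shows "set_integrable lborel {0..} (\<lambda>t. exp (- w * of_real t) :: complex)"
    and "(LINT t:{0..}|lborel. exp (- w * of_real t)) = 1 / w"
proof -
  have w0: "w \<noteq> 0" using w by auto
  have nn: "(\<integral>\<^sup>+ t. ennreal (exp (- Re w * t)) * indicator {0..} t \<partial>lborel) = ennreal (0 - (- exp (- Re w * 0) / Re w))"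
  proof (rule nn_integral_FTC_atLeast)
    show "((\<lambda>t. - exp (- Re w * t) / Re w) has_real_derivative exp (- Re w * t)) (at t)" for t
      using w by (auto intro!: derivative_eq_intros)
    show "((\<lambda>t. - exp (- Re w * t) / Re w) \<longlongrightarrow> 0) at_top" using w by real_asymp
  qed auto
  show int: "set_integrable lborel {0..} (\<lambda>t. exp (- w * of_real t) :: complex)"
    unfolding set_integrable_def
  proof (rule integrableI_bounded)
    have "(\<integral>\<^sup>+ t. ennreal (norm (indicator {0..} t *\<^sub>R exp (- w * of_real t))) \<partial>lborel) = (\<integral>\<^sup>+ t. ennreal (exp (- Re w * t)) * indicator {0..} t \<partial>lborel)"
      by (intro nn_integral_cong) (auto split: split_indicator)
    then show "(\<integral>\<^sup>+ t. ennreal (norm (indicator {0..} t *\<^sub>R exp (- w * of_real t))) \<partial>lborel) < \<infinity>" unfolding nn by simp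
  qed measurable
  have "(LBINT t=0..\<infinity>. exp (- w * of_real t)) = 0 - (- exp (- w * of_real 0) / w)"
  proof (rule interval_integral_FTC_integrable)
    show "((\<lambda>t. - exp (- w * of_real t) / w) has_vector_derivative exp (- w * of_real t)) (at t)" for t :: real
    proof -
      have "((\<lambda>t. - exp (- w * t) / w) has_field_derivative exp (- w * of_real t)) (at (of_real t))"
        using w0 by (auto intro!: derivative_eq_intros)
      then show ?thesis by (rule has_vector_derivative_real_field)
    qed
    show "isCont (\<lambda>t. exp (- w * of_real t)) t" for t :: real by (intro continuous_intros)
    show "set_integrable lborel (einterval 0 \<infinity>) (\<lambda>t. exp (- w * of_real t))"
      by (rule set_integrable_subset[OF int]) (auto simp: einterval_def)
    show "(((\<lambda>t. - exp (- w * of_real t) / w) \<circ> real_of_ereal) \<longlongrightarrow> - exp (- w * of_real 0) / w) (at_right 0)"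
      unfolding zero_ereal_def ereal_tendsto_simps by (intro tendsto_intros) (use w0 in auto)
    have "((\<lambda>t. - exp (- w * of_real t) / w) \<longlongrightarrow> 0) at_top"
    proof (rule Lim_null_comparison)
      show "\<forall>\<^sub>F t in at_top. norm (- exp (- w * of_real t) / w) \<le> exp (- Re w * t) / norm w"
        by (simp add: norm_divide)
      show "((\<lambda>t. exp (- Re w * t) / norm w) \<longlongrightarrow> 0) at_top"
      proof -
        have "norm w > 0" using w0 by simp
        then show ?thesis using w by real_asymp
      qed
    qed
    then show "(((\<lambda>t. - exp (- w * of_real t) / w) \<circ> real_of_ereal) \<longlongrightarrow> 0) (at_left \<infinity>)"
      by (simp add: ereal_tendsto_simps)
  qed auto
  moreover have "(LBINT t=0..\<infinity>. exp (- w * of_real t)) = (LINT t:{0<..}|lborel. exp (- w * of_real t))"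
    by (simp add: interval_lebesgue_integral_def zero_ereal_def einterval_def greaterThan_def)
  moreover have "(LINT t:{0<..}|lborel. exp (- w * of_real t)) = (LINT t:{0..}|lborel. exp (- w * of_real t))"
    unfolding set_lebesgue_integral_def
    by (rule integral_cong_AE) (use AE_lborel_singleton[of "0::real"] in \<open>auto elim!: eventually_mono split: split_indicator\<close>)
  ultimately show "(LINT t:{0..}|lborel. exp (- w * of_real t)) = 1 / w" by simp
qed

text \<open>By Fubini, a superposition of decaying exponentials \<open>exp (\<zeta> t)\<close> has as its Laplace transform the
  same superposition of the functions \<open>1 / (l - \<zeta>)\<close>.\<close>

lemma laplace_superposition:
  fixes \<phi> \<zeta> :: "real \<Rightarrow> complex"
  assumes A: "A \<in> sets borel" and int: "set_integrable lborel A \<phi>"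
    and \<zeta>: "\<zeta> \<in> borel_measurable borel" and neg: "\<And>y. y \<in> A \<Longrightarrow> Re (\<zeta> y) \<le> 0"
  defines "G \<equiv> \<lambda>t::real. (LINT y:A|lborel. \<phi> y * exp (\<zeta> y * of_real t))"
  shows "continuous_on {0..} G"
    and "l > 0 \<Longrightarrow> set_integrable lborel {0..} (\<lambda>t. exp (- of_real l * of_real t) * G t)"
    and "l > 0 \<Longrightarrow> (LINT t:{0..}|lborel. exp (- of_real l * of_real t) * G t) = (LINT y:A|lborel. \<phi> y / (of_real l - \<zeta> y))"
proof -
  note [measurable] = A \<zeta>
  define p where "p y = indicator A y *\<^sub>R \<phi> y" for y
  have [measurable]: "p \<in> borel_measurable borel" using int unfolding set_integrable_def p_def[abs_def] by (simp add: borel_measurable_integrable)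
  have ip: "integrable lborel (\<lambda>y. norm (p y))" using int unfolding set_integrable_def p_def[abs_def] by (rule integrable_norm)
  have ipe: "indicator A y *\<^sub>R (\<phi> y * exp (\<zeta> y * of_real t)) = p y * exp (\<zeta> y * of_real t)" for y t by (simp add: p_def)
  have bd: "norm (p y * exp (\<zeta> y * of_real t)) \<le> norm (p y)" if "t \<ge> 0" for y t
  proof (cases "y \<in> A")
    case True
    have "norm (exp (\<zeta> y * of_real t)) \<le> 1" using neg[OF True] that by (simp add: mult_nonpos_nonneg)
    then show ?thesis unfolding norm_mult by (intro mult_left_le) auto
  qed (simp add: p_def)
  have ii: "integrable lborel (\<lambda>y. p y * exp (\<zeta> y * of_real t))" if "t \<ge> 0" for t
    by (rule Bochner_Integration.integrable_bound[OF ip]) (use bd[OF that] in auto)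
  show "continuous_on {0..} G"
    unfolding continuous_on_sequentially comp_def
  proof (intro allI ballI impI)
    fix x and t :: "nat \<Rightarrow> real" assume h: "x \<in> {0..}" "(\<forall>n. t n \<in> {0..}) \<and> t \<longlonglongrightarrow> x"
    show "(\<lambda>n. G (t n)) \<longlonglongrightarrow> G x"
      unfolding G_def set_lebesgue_integral_def ipe
    proof (rule integral_dominated_convergence[where w = "\<lambda>y. norm (p y)"])
      show "AE y in lborel. (\<lambda>n. p y * exp (\<zeta> y * of_real (t n))) \<longlonglongrightarrow> p y * exp (\<zeta> y * of_real x)"
        using h by (auto intro!: tendsto_intros)
      show "AE y in lborel. norm (p y * exp (\<zeta> y * of_real (t n))) \<le> norm (p y)" for n
        using h bd by auto
    qed (use ip in auto)
  qed
  assume l: "l > 0"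
  define e where "e t = (indicator {0..} t *\<^sub>R exp (- of_real l * of_real t) :: complex)" for t :: real
  have [measurable]: "e \<in> borel_measurable borel" unfolding e_def by measurable
  define F where "F t y = e t * (p y * exp (\<zeta> y * of_real t))" for t y :: real
  have ie: "integrable lborel e" using laplace_exp(1)[of "of_real l"] l unfolding set_integrable_def e_def[abs_def] by simp
  have hm: "(\<lambda>(t, y). F t y) \<in> borel_measurable (lborel \<Otimes>\<^sub>M lborel)" unfolding F_def by measurable
  have Fe: "F t y = 0" if "t < 0" for t y using that by (simp add: F_def e_def)
  have hi: "integrable (lborel \<Otimes>\<^sub>M lborel) (\<lambda>(t, y). F t y)"
  proof (rule lborel_pair.Fubini_integrable[OF hm], unfold prod.case)
    show "AE x in lborel. integrable lborel (\<lambda>y. F x y)"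
    proof (rule AE_I2)
      fix x :: real
      show "integrable lborel (\<lambda>y. F x y)"
      proof (cases "x \<ge> 0")
        case True then show ?thesis unfolding F_def by (intro integrable_mult_right ii)
      next
        case False then show ?thesis using Fe by simp
      qed
    qed
    show "integrable lborel (\<lambda>x. \<integral>y. norm (F x y) \<partial>lborel)"
    proof (rule Bochner_Integration.integrable_bound)
      show "integrable lborel (\<lambda>x. norm (e x) * (\<integral>y. norm (p y) \<partial>lborel))"
        by (intro integrable_mult_left integrable_norm ie)
      show "(\<lambda>x. \<integral>y. norm (F x y) \<partial>lborel) \<in> borel_measurable lborel" unfolding F_def by measurable
      show "AE x in lborel. norm (\<integral>y. norm (F x y) \<partial>lborel) \<le> norm (norm (e x) * (\<integral>y. norm (p y) \<partial>lborel))"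
      proof (rule AE_I2)
        fix x :: real
        have "(\<integral>y. norm (F x y) \<partial>lborel) \<le> norm (e x) * (\<integral>y. norm (p y) \<partial>lborel)"
        proof (cases "x \<ge> 0")
          case True
          have "(\<integral>y. norm (F x y) \<partial>lborel) = norm (e x) * (\<integral>y. norm (p y * exp (\<zeta> y * of_real x)) \<partial>lborel)"
            by (simp only: F_def norm_mult[of "e x"] integral_mult_right_zero)
          also have "\<dots> \<le> norm (e x) * (\<integral>y. norm (p y) \<partial>lborel)"
            by (intro mult_left_mono integral_mono ip integrable_norm ii True bd) auto
          finally show ?thesis .
        qed (simp add: Fe)
        moreover have "0 \<le> (\<integral>y. norm (F x y) \<partial>lborel)" by (rule Bochner_Integration.integral_nonneg) simp
        ultimately show "norm (\<integral>y. norm (F x y) \<partial>lborel) \<le> norm (norm (e x) * (\<integral>y. norm (p y) \<partial>lborel))"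
          by simp
      qed
    qed
  qed
  have i1: "(\<integral>y. F t y \<partial>lborel) = indicator {0..} t *\<^sub>R (exp (- of_real l * of_real t) * G t)" for t
    unfolding G_def set_lebesgue_integral_def ipe F_def integral_mult_right_zero e_def by simp
  have i2: "(\<integral>t. F t y \<partial>lborel) = indicator A y *\<^sub>R (\<phi> y / (of_real l - \<zeta> y))" for y
  proof (cases "y \<in> A")
    case True
    have R: "Re (of_real l - \<zeta> y) > 0" using neg[OF True] l by simp
    have "F t y = p y * (indicator {0..} t *\<^sub>R exp (- (of_real l - \<zeta> y) * of_real t))" for t
    proof -
      have "exp (- of_real l * of_real t) * exp (\<zeta> y * of_real t) = exp (- (of_real l - \<zeta> y) * of_real t)"
        by (simp add: algebra_simps flip: exp_add)
      then show ?thesis unfolding F_def e_def by (auto split: split_indicator)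
    qed
    then have "(\<integral>t. F t y \<partial>lborel) = p y * (LINT t:{0..}|lborel. exp (- (of_real l - \<zeta> y) * of_real t))"
      unfolding set_lebesgue_integral_def by (simp only: integral_mult_right_zero)
    then show ?thesis unfolding laplace_exp(2)[OF R] using True by (simp add: p_def)
  qed (simp add: F_def p_def)
  show "set_integrable lborel {0..} (\<lambda>t. exp (- of_real l * of_real t) * G t)"
    using lborel_pair.integrable_fst'[OF hi] unfolding set_integrable_def prod.case i1 .
  show "(LINT t:{0..}|lborel. exp (- of_real l * of_real t) * G t) = (LINT y:A|lborel. \<phi> y / (of_real l - \<zeta> y))"
    using lborel_pair.Fubini_integral[OF hi] unfolding i1 i2 set_lebesgue_integral_def by simp
qed

section \<open>The Laplace original of the ratio\<close>

lemma greaterThanAtMost_pos: "x \<in> {0<..b} \<Longrightarrow> (0::real) < x" by simp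

lemma indicator_notin: "x \<notin> A \<Longrightarrow> indicator A x = (0::real)" by simp

text \<open>The restrictions of the entire functions \<open>bI\<close> and \<open>bphi_reg\<close> to the negative axis, with \<open>x > 0\<close> standing
  for the point \<open>- x\<close>.\<close>

definition rI :: "nat \<Rightarrow> real \<Rightarrow> real" where "rI m x = Re (bI m (of_real (- x)))"
definition rb :: "nat \<Rightarrow> real \<Rightarrow> real" where "rb m x = Re (bphi_reg m (of_real (- x)))"

lemma bI_neg_real: "bI m (of_real (- x)) = of_real (rI m x)"
proof -
  have "cnj (bI m (of_real (- x))) = bI m (of_real (- x))" using bI_cnj[of m "of_real (- x)"] by simp
  then have "Im (bI m (of_real (- x))) = 0" by (simp add: complex_eq_iff)
  then show ?thesis unfolding rI_def by (simp add: complex_eq_iff)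
qed

lemma bphi_reg_neg_real: "bphi_reg m (of_real (- x)) = of_real (rb m x)"
proof -
  have "cnj (bphi_reg m (of_real (- x))) = bphi_reg m (of_real (- x))" using bphi_reg_cnj[of m "of_real (- x)"] by simp
  then have "Im (bphi_reg m (of_real (- x))) = 0" by (simp add: complex_eq_iff)
  then show ?thesis unfolding rb_def by (simp add: complex_eq_iff)
qed

lemma bphi_ext_neg_real:
  assumes "x > 0"
  shows "bphi_ext m (of_real (- x)) = Complex (rb m x + bbeta * rI m x * (x ^ m * ln x)) (pi * bbeta * rI m x * x ^ m)"
proof -
  have "Ln (of_real (- x)) = of_real (ln x) + \<i> * of_real pi"
    using Ln_of_real'[of "- x"] assms by simp
  then have "bphi_ext m (of_real (- x)) = of_real (rb m x) + of_real bbeta * of_real (rI m x) * ((- of_real (- x)) ^ m * (of_real (ln x) + \<i> * of_real pi))"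
    unfolding bphi_ext_def bI_neg_real bphi_reg_neg_real by (simp only:)
  also have "- of_real (- x) = (of_real x :: complex)" by simp
  finally show ?thesis by (simp add: complex_eq_iff algebra_simps flip: of_real_power)
qed

text \<open>Numerator and denominator of \<open>- Im H(- x) / x\<^sup>n\<close>.  In the numerator the logarithms cancel; in the
  denominator they come with \<open>x\<^bsup>n + 1\<^esup>\<close>.\<close>

definition density_num :: "nat \<Rightarrow> real \<Rightarrow> real" where
  "density_num n x = pi * bbeta * (x * rb n x * rI (Suc n) x - rI n x * rb (Suc n) x)"

definition density_den :: "nat \<Rightarrow> real \<Rightarrow> real" where
  "density_den n x = (rb (Suc n) x + bbeta * rI (Suc n) x * (x ^ Suc n * ln x))\<^sup>2 + (pi * bbeta * rI (Suc n) x * x ^ Suc n)\<^sup>2"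

lemma Im_bratio_neg_real:
  assumes "x > 0"
  shows "- Im (bratio n (of_real (- x))) = x ^ n * (density_num n x * (1 / density_den n x))"
proof -
  let ?p = "rb n x + bbeta * rI n x * (x ^ n * ln x)" and ?q = "pi * bbeta * rI n x * x ^ n"
  let ?P = "rb (Suc n) x + bbeta * rI (Suc n) x * (x ^ Suc n * ln x)" and ?Q = "pi * bbeta * rI (Suc n) x * x ^ Suc n"
  have "- Im (bratio n (of_real (- x))) = (?p * ?Q - ?q * ?P) / density_den n x"
    unfolding bratio_def bphi_ext_neg_real[OF assms] Im_divide density_den_def by (simp add: diff_divide_distrib)
  also have "?p * ?Q - ?q * ?P = x ^ n * density_num n x" unfolding density_num_def by (simp add: algebra_simps)
  finally show ?thesis by simp
qed

lemma rb_Suc_0: "rb (Suc n) 0 = - bbeta * fact n" by (simp add: rb_def bphi_reg_Suc_0)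

lemma rI_rb_tendsto: "(rI m \<longlongrightarrow> rI m 0) (at_right 0)" "(rb m \<longlongrightarrow> rb m 0) (at_right 0)"
proof -
  have c: "continuous_on UNIV (\<lambda>x. Re (g (of_real (- x))))" if "g holomorphic_on UNIV" for g :: "complex \<Rightarrow> complex"
    by (intro continuous_on_Re continuous_on_compose2[OF holomorphic_on_imp_continuous_on[OF that]] continuous_intros) auto
  have "continuous_on UNIV (rI m)" "continuous_on UNIV (rb m)"
    unfolding rI_def[abs_def] rb_def[abs_def] by (intro c bI_holomorphic bphi_reg_holomorphic)+
  then have "isCont (rI m) 0" "isCont (rb m) 0" by (simp_all add: continuous_on_eq_continuous_at)
  then show "(rI m \<longlongrightarrow> rI m 0) (at_right 0)" "(rb m \<longlongrightarrow> rb m 0) (at_right 0)"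
    unfolding isCont_def by (auto intro: tendsto_within_subset)
qed

text \<open>All ingredients have expansions of the required type, and the denominator tends to the nonzero
  square of \<open>bbeta n!\<close>.\<close>

lemma density_logexp:
  assumes P: "P \<ge> 1"
  shows "logexp (Suc n) P (\<lambda>x. density_num n x * (1 / density_den n x))"
proof -
  have I: "logexp (Suc n) P (rI m)" and b: "logexp (Suc n) P (rb m)" for m
    unfolding rI_def[abs_def] rb_def[abs_def] using P
    by (intro logexp_entire bI_holomorphic bphi_reg_holomorphic; simp)+
  have x: "logexp (Suc n) P (\<lambda>x. x)" using logexp_monom[of "Suc n" 0 1 P] by simp
  have xN: "logexp (Suc n) P (\<lambda>x. x ^ Suc n)" using logexp_monom[of "Suc n" 0 "Suc n" P] by simp
  have xl: "logexp (Suc n) P (\<lambda>x. x ^ Suc n * ln x)" using logexp_monom[of "Suc n" 1 "Suc n" P] by simp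
  have num: "logexp (Suc n) P (density_num n)"
  proof -
    have "logexp (Suc n) P (\<lambda>x. (pi * bbeta) * (x * rb n x * rI (Suc n) x + (-1) * (rI n x * rb (Suc n) x)))"
      using P by (intro logexp_cmult logexp_add logexp_mult x I b) auto
    then show ?thesis by (simp add: density_num_def[abs_def])
  qed
  have den: "logexp (Suc n) P (density_den n)"
  proof -
    have "logexp (Suc n) P (\<lambda>x. (rb (Suc n) x + bbeta * (rI (Suc n) x * (x ^ Suc n * ln x)))\<^sup>2 + ((pi * bbeta) * (rI (Suc n) x * x ^ Suc n))\<^sup>2)"
      using P by (intro logexp_power logexp_cmult logexp_add logexp_mult x I b xN xl) auto
    then show ?thesis by (simp add: density_den_def[abs_def] mult.assoc)
  qed
  have lim: "(density_den n \<longlongrightarrow> (rb (Suc n) 0)\<^sup>2) (at_right 0)"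
  proof -
    have l: "((\<lambda>x::real. x ^ Suc n * ln x) \<longlongrightarrow> 0) (at_right 0)" by real_asymp
    have x: "((\<lambda>x::real. x ^ Suc n) \<longlongrightarrow> 0) (at_right 0)" by real_asymp
    have "(density_den n \<longlongrightarrow> (rb (Suc n) 0 + bbeta * rI (Suc n) 0 * 0)\<^sup>2 + (pi * bbeta * rI (Suc n) 0 * 0)\<^sup>2) (at_right 0)"
      unfolding density_den_def[abs_def] by (intro tendsto_intros rI_rb_tendsto l x)
    then show ?thesis by simp
  qed
  have "(rb (Suc n) 0)\<^sup>2 \<noteq> 0" using bbeta_neg by (simp add: rb_Suc_0)
  then have "logexp (Suc n) P (\<lambda>x. 1 / density_den n x)"
    using P by (intro logexp_inverse[OF den _ _ lim]) auto
  then show ?thesis using P by (intro logexp_mult num) auto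
qed

lemma set_integral_Re:
  assumes "set_integrable M A f"
  shows "set_integrable M A (\<lambda>x. Re (f x))" "(LINT x:A|M. Re (f x)) = Re (LINT x:A|M. f x)"
  using integrable_Re[OF assms[unfolded set_integrable_def]] integral_Re[OF assms[unfolded set_integrable_def]]
  unfolding set_integrable_def set_lebesgue_integral_def by simp_all

lemma set_integral_Im:
  assumes "set_integrable M A f"
  shows "set_integrable M A (\<lambda>x. Im (f x))" "(LINT x:A|M. Im (f x)) = Im (LINT x:A|M. f x)"
  using integrable_Im[OF assms[unfolded set_integrable_def]] integral_Im[OF assms[unfolded set_integrable_def]]
  unfolding set_integrable_def set_lebesgue_integral_def by simp_all

context ratio
begin

text \<open>The representation of \<open>H\<close>, divided by \<open>l\<close>: \<open>\<phi>1\<close> and \<open>\<phi>2\<close> are the weights on the cut and on the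
  diagonal, \<open>G1\<close> and \<open>G2\<close> the corresponding superpositions of exponentials, and \<open>K\<close> the original of
  \<open>(1 / n - H(l)) / l\<close>.\<close>

definition \<phi>1 :: "real \<Rightarrow> complex" where "\<phi>1 x = of_real (density x / x)"
definition \<phi>2 :: "real \<Rightarrow> complex" where "\<phi>2 y = (- 1 + \<i>) * bratio n (diag y) / (- diag y)"
definition G1 :: "real \<Rightarrow> complex" where "G1 t = (LINT x:{0<..\<delta>}|lborel. \<phi>1 x * exp (of_real (- x) * of_real t))"
definition G2 :: "real \<Rightarrow> complex" where "G2 t = (LINT y:{0..}|lborel. \<phi>2 y * exp (diag y * of_real t))"
definition K :: "real \<Rightarrow> real" where "K t = (Re (G1 t) + Im (G2 t)) / pi"

lemma \<phi>2_int: "set_integrable lborel {0..} \<phi>2"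
  using set_integrable_diag[of 0] by (simp add: \<phi>2_def[abs_def])

lemma diag_measurable: "diag \<in> borel_measurable borel"
  by (rule borel_measurable_continuous_onI[OF diag_cont])

lemma norm_diag_le:
  assumes "0 \<le> y" "0 \<le> l"
  shows "norm (- diag y) \<le> norm (of_real l - diag y)" "norm (- diag y) > 0"
proof -
  have "(norm (- diag y))\<^sup>2 \<le> (norm (of_real l - diag y))\<^sup>2"
    unfolding cmod_power2 using assms \<delta> by (auto simp: diag_simps intro!: add_mono power_mono)
  then show "norm (- diag y) \<le> norm (of_real l - diag y)" by (rule power2_le_imp_le) simp
  have "Re (diag y) \<noteq> 0" using assms \<delta> by (simp add: diag_simps)
  then show "norm (- diag y) > 0" by auto
qed

context
  assumes \<phi>1_int: "set_integrable lborel {0<..\<delta>} (\<lambda>x. density x / x)"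
begin

lemma \<phi>1_int': "set_integrable lborel {0<..\<delta>} \<phi>1"
proof -
  have "integrable lborel (\<lambda>x. of_real (indicator {0<..\<delta>} x *\<^sub>R (density x / x)) :: complex)"
    using \<phi>1_int unfolding set_integrable_def by (rule integrable_of_real)
  then show ?thesis unfolding set_integrable_def \<phi>1_def by (simp add: scaleR_conv_of_real)
qed

lemmas G1 = laplace_superposition[of "{0<..\<delta>}" \<phi>1 "\<lambda>x. of_real (- x)", folded G1_def]
lemmas G2 = laplace_superposition[of "{0..}" \<phi>2 diag, folded G2_def]

lemma K_cont: "continuous_on {0..} K"
proof -
  have "continuous_on {0..} G1" by (rule G1(1)) (use \<phi>1_int' in auto)
  moreover have "continuous_on {0..} G2" by (rule G2(1)) (use \<phi>2_int diag_measurable \<delta> in \<open>auto simp: diag_simps\<close>)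
  ultimately show ?thesis unfolding K_def[abs_def] by (intro continuous_intros) auto
qed

text \<open>Every exponent on the diagonal has real part at most \<open>- \<delta>\<close>.\<close>

lemma G2_bound:
  assumes t: "t \<ge> 0"
  shows "norm (G2 t) \<le> exp (- \<delta> * t) * (LINT y:{0..}|lborel. norm (\<phi>2 y))"
proof -
  let ?e = "\<lambda>y. \<phi>2 y * exp (diag y * of_real t)"
  have bd: "norm (?e y) \<le> exp (- \<delta> * t) * norm (\<phi>2 y)" if "y \<ge> 0" for y
  proof -
    have "norm (exp (diag y * of_real t)) \<le> exp (- \<delta> * t)"
      using that t by (simp add: diag_simps algebra_simps)
    then show ?thesis by (simp add: norm_mult mult_left_mono mult.commute[of "norm (\<phi>2 y)"] mult_right_mono)
  qed
  have i0: "set_integrable lborel {0..} (\<lambda>y. exp (- \<delta> * t) * norm (\<phi>2 y))"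
    by (intro set_integrable_mult_right set_integrable_norm \<phi>2_int)
  have m: "set_borel_measurable lborel {0..} ?e"
  proof -
    have "(\<lambda>y. (indicator {0..} y *\<^sub>R \<phi>2 y) * exp (diag y * of_real t)) \<in> borel_measurable lborel"
      using \<phi>2_int diag_measurable unfolding set_integrable_def by (intro borel_measurable_times) auto
    then show ?thesis unfolding set_borel_measurable_def by simp
  qed
  have i: "set_integrable lborel {0..} ?e"
    by (rule set_integrable_bound[OF i0 m]) (use bd in auto)
  have "norm (G2 t) \<le> (LINT y:{0..}|lborel. norm (?e y))" unfolding G2_def by (rule set_integral_norm_bound[OF i])
  also have "\<dots> \<le> (LINT y:{0..}|lborel. exp (- \<delta> * t) * norm (\<phi>2 y))"
    by (rule set_integral_mono[OF set_integrable_norm[OF i] i0]) (use bd in auto)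
  finally show ?thesis by simp
qed

lemma K_at_0: "pi * K 0 = (LINT x:{0<..\<delta>}|lborel. density x / x) + Im (LINT y:{0..}|lborel. \<phi>2 y)"
proof -
  have "G1 0 = of_real (LINT x:{0<..\<delta>}|lborel. density x / x)"
    unfolding G1_def \<phi>1_def set_lebesgue_integral_def
    by (subst integral_complex_of_real[symmetric]) (simp add: scaleR_conv_of_real)
  then show ?thesis unfolding K_def G2_def by simp
qed

lemma H_representation_open:
  assumes l: "l > 0"
  shows "pi * bratio_real n l = (LINT x:{0<..\<delta>}|lborel. density x / (l + x))
     + Im (LINT y:{0..}|lborel. (- 1 + \<i>) * bratio n (diag y) / (of_real l - diag y))"
proof -
  have "(LINT x:{0..\<delta>}|lborel. density x / (l + x)) = (LINT x:{0<..\<delta>}|lborel. density x / (l + x))"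
    unfolding set_lebesgue_integral_def
  proof (rule integral_cong_AE)
    have "(\<lambda>x. indicator {0..\<delta>} x *\<^sub>R density x) \<in> borel_measurable borel"
      using borel_measurable_continuous_on_indicator[OF _ density_cont] by simp
    then have m: "(\<lambda>x. (indicator {0..\<delta>} x *\<^sub>R density x) / (l + x)) \<in> borel_measurable borel"
      by (intro borel_measurable_divide) auto
    then show "(\<lambda>x. indicator {0..\<delta>} x *\<^sub>R (density x / (l + x))) \<in> borel_measurable lborel" by simp
    have "(\<lambda>x. indicator {0<..} x * ((indicator {0..\<delta>} x *\<^sub>R density x) / (l + x))) \<in> borel_measurable borel"
      using m by (intro borel_measurable_times) auto
    moreover have "indicator {0<..} x * ((indicator {0..\<delta>} x *\<^sub>R density x) / (l + x)) = indicator {0<..\<delta>} x *\<^sub>R (density x / (l + x))" for x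
      by (auto split: split_indicator)
    ultimately have "(\<lambda>x. indicator {0<..\<delta>} x *\<^sub>R (density x / (l + x))) \<in> borel_measurable borel" by (simp only:)
    then show "(\<lambda>x. indicator {0<..\<delta>} x *\<^sub>R (density x / (l + x))) \<in> borel_measurable lborel" by simp
    show "AE x in lborel. indicator {0..\<delta>} x *\<^sub>R (density x / (l + x)) = indicator {0<..\<delta>} x *\<^sub>R (density x / (l + x))"
      using AE_lborel_singleton[of "0::real"] by eventually_elim (auto split: split_indicator)
  qed
  then show ?thesis using H_representation[OF l] by simp
qed

lemma density_l_int:
  assumes l: "l > 0"
  shows "set_integrable lborel {0<..\<delta>} (\<lambda>x. density x / (l + x))"
proof (rule set_integrable_bound[OF \<phi>1_int])
  have "(\<lambda>x. (indicator {0<..\<delta>} x *\<^sub>R (density x / x)) * (x / (l + x))) \<in> borel_measurable lborel"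
    using \<phi>1_int unfolding set_integrable_def by (intro borel_measurable_times) auto
  moreover have "(indicator {0<..\<delta>} x *\<^sub>R (density x / x)) * (x / (l + x)) = indicator {0<..\<delta>} x *\<^sub>R (density x / (l + x))" for x
    by (auto split: split_indicator)
  ultimately show "set_borel_measurable lborel {0<..\<delta>} (\<lambda>x. density x / (l + x))" unfolding set_borel_measurable_def by (simp only:)
  have "norm (density x / (l + x)) \<le> norm (density x / x)" if "x > 0" for x
    using that l by (auto simp: abs_divide intro!: divide_left_mono)
  then show "AE x in lborel. x \<in> {0<..\<delta>} \<longrightarrow> norm (density x / (l + x)) \<le> norm (density x / x)" by auto
qed

text \<open>Partial fractions: \<open>1 / (- \<zeta> (l - \<zeta>)) = (1 / (- \<zeta>) - 1 / (l - \<zeta>)) / l\<close> turns the weights of \<open>K\<close> into the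
  difference of the representations at \<open>0\<close> and at \<open>l\<close>.\<close>

lemma K_laplace:
  assumes l: "l > 0"
  shows "set_integrable lborel {0..} (\<lambda>t. exp (- l * t) * K t)"
    and "(LINT t:{0..}|lborel. exp (- l * t) * K t) = (K 0 - bratio_real n l) / l"
proof -
  have e: "exp (- of_real l * of_real t) = (of_real (exp (- l * t)) :: complex)" for t by (simp add: exp_of_real[symmetric])
  have i1: "set_integrable lborel {0..} (\<lambda>t. exp (- of_real l * of_real t) * G1 t)"
    and L1: "(LINT t:{0..}|lborel. exp (- of_real l * of_real t) * G1 t) = (LINT y:{0<..\<delta>}|lborel. \<phi>1 y / (of_real l - of_real (- y)))"
    by (rule G1(2,3); use \<phi>1_int' l in auto)+
  have i2: "set_integrable lborel {0..} (\<lambda>t. exp (- of_real l * of_real t) * G2 t)"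
    and L2: "(LINT t:{0..}|lborel. exp (- of_real l * of_real t) * G2 t) = (LINT y:{0..}|lborel. \<phi>2 y / (of_real l - diag y))"
    by (rule G2(2,3); use \<phi>2_int diag_measurable \<delta> l in \<open>auto simp: diag_simps\<close>)+
  have Keq: "exp (- l * t) * K t = (1 / pi) * (Re (exp (- of_real l * of_real t) * G1 t) + Im (exp (- of_real l * of_real t) * G2 t))" for t
    unfolding K_def e by (simp add: field_simps)
  show "set_integrable lborel {0..} (\<lambda>t. exp (- l * t) * K t)"
    unfolding Keq by (intro set_integrable_mult_right set_integral_add(1) set_integral_Re(1) set_integral_Im(1) i1 i2)
  have "(LINT t:{0..}|lborel. exp (- l * t) * K t) = (1 / pi) * (Re (LINT y:{0<..\<delta>}|lborel. \<phi>1 y / (of_real l - of_real (- y))) + Im (LINT y:{0..}|lborel. \<phi>2 y / (of_real l - diag y)))"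
    unfolding Keq set_integral_mult_right
    by (subst set_integral_add(2)[OF set_integral_Re(1)[OF i1] set_integral_Im(1)[OF i2]])
       (simp only: set_integral_Re(2)[OF i1] set_integral_Im(2)[OF i2] L1 L2)
  also have "Re (LINT y:{0<..\<delta>}|lborel. \<phi>1 y / (of_real l - of_real (- y))) = (1 / l) * ((LINT x:{0<..\<delta>}|lborel. density x / x) - (LINT x:{0<..\<delta>}|lborel. density x / (l + x)))"
  proof -
    have "(LINT y:{0<..\<delta>}|lborel. \<phi>1 y / (of_real l - of_real (- y))) = of_real (LINT y:{0<..\<delta>}|lborel. (1/l) * (density y / y - density y / (l + y)))"
      unfolding set_lebesgue_integral_def
    proof (subst integral_complex_of_real[symmetric], rule Bochner_Integration.integral_cong[OF refl])
      fix y :: real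
      have "density y / y / (l + y) = (1/l) * (density y / y - density y / (l + y))" if "y > 0" using that l by (simp add: field_simps)
      moreover have "\<phi>1 y / (of_real l - of_real (- y)) = of_real (density y / y / (l + y))" unfolding \<phi>1_def by simp
      ultimately show "indicator {0<..\<delta>} y *\<^sub>R (\<phi>1 y / (of_real l - of_real (- y))) = complex_of_real (indicator {0<..\<delta>} y *\<^sub>R ((1/l) * (density y / y - density y / (l + y))))"
        by (cases "y \<in> {0<..\<delta>}") (simp_all only: indicator_simps indicator_notin not_False_eq_True scaleR_one scaleR_zero_left of_real_0 greaterThanAtMost_pos)
    qed
    then show ?thesis using set_integral_diff(2)[OF \<phi>1_int density_l_int[OF l]] by (simp only: Re_complex_of_real set_integral_mult_right)
  qed
  also have "(LINT y:{0..}|lborel. \<phi>2 y / (of_real l - diag y)) = of_real (1 / l) * ((LINT y:{0..}|lborel. \<phi>2 y) - (LINT y:{0..}|lborel. (- 1 + \<i>) * bratio n (diag y) / (of_real l - diag y)))"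
  proof -
    have "(LINT y:{0..}|lborel. \<phi>2 y / (of_real l - diag y)) = (LINT y:{0..}|lborel. of_real (1 / l) * (\<phi>2 y - (- 1 + \<i>) * bratio n (diag y) / (of_real l - diag y)))"
      unfolding set_lebesgue_integral_def
    proof (rule Bochner_Integration.integral_cong[OF refl])
      fix y :: real
      have "\<phi>2 y / (of_real l - diag y) = of_real (1 / l) * (\<phi>2 y - (- 1 + \<i>) * bratio n (diag y) / (of_real l - diag y))" if "y \<ge> 0"
      proof -
        have nz: "diag y \<noteq> 0" "of_real l - diag y \<noteq> 0" using norm_diag_le[OF that, of l] l by auto
        have "a / (- z) / (l' - z) = (1 / l') * (a / (- z) - a / (l' - z))" if "z \<noteq> 0" "l' - z \<noteq> 0" "l' \<noteq> 0" for a z l' :: complex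
          using that by (simp add: divide_simps) (simp add: algebra_simps)
        from this[OF nz, of "(- 1 + \<i>) * bratio n (diag y)"] show ?thesis unfolding \<phi>2_def using l by simp
      qed
      then show "indicator {0..} y *\<^sub>R (\<phi>2 y / (of_real l - diag y)) = indicator {0..} y *\<^sub>R (of_real (1 / l) * (\<phi>2 y - (- 1 + \<i>) * bratio n (diag y) / (of_real l - diag y)))"
        by (auto split: split_indicator)
    qed
    then show ?thesis using set_integral_diff(2)[OF \<phi>2_int set_integrable_diag[of l]] l by (simp only: set_integral_mult_right less_imp_le)
  qed
  finally have "(LINT t:{0..}|lborel. exp (- l * t) * K t) = (1 / pi) * ((1 / l) * (pi * K 0 - pi * bratio_real n l))"
    unfolding K_at_0 H_representation_open[OF l] Im_complex_of_real times_complex.sel by (simp add: algebra_simps add_divide_distrib diff_divide_distrib)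
  then show "(LINT t:{0..}|lborel. exp (- l * t) * K t) = (K 0 - bratio_real n l) / l" by (simp add: right_diff_distrib[symmetric])
qed

lemma bratio_0: "bratio n 0 = of_real (1 / real n)"
proof -
  obtain m where m: "n = Suc m" using n by (cases n) auto
  have "bratio n 0 = (of_real bbeta * fact m) / (of_real bbeta * fact n)"
    unfolding bratio_def m bphi_ext_Suc_0 by simp
  also have "\<dots> = 1 / of_nat n" using bbeta_neg by (simp add: m field_simps del: of_nat_Suc)
  finally show ?thesis by simp
qed

text \<open>Letting \<open>l\<close> tend to \<open>0\<close> in the representation of \<open>H(l)\<close> gives \<open>K(0) = H(0)\<close>, and \<open>H(0) = (n - 1)! / n!\<close>.\<close>

lemma K_0_value: "K 0 = 1 / real n"
proof -
  define L where "L k = inverse (real (Suc k))" for k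
  have L: "L k > 0" "L \<longlonglongrightarrow> 0" for k unfolding L_def using LIMSEQ_inverse_real_of_nat by auto
  have "(\<lambda>k. bratio n (of_real (L k))) \<longlonglongrightarrow> bratio n 0"
  proof (rule continuous_on_tendsto_compose[OF H_cont])
    show "(\<lambda>k. of_real (L k) :: complex) \<longlonglongrightarrow> 0" using tendsto_of_real[OF L(2), where 'a = complex] by simp
    have "complex_of_real (L k) \<in> sector" for k using L(1)[of k] \<delta> by (simp add: sector_def)
    then show "\<forall>\<^sub>F k in sequentially. complex_of_real (L k) \<in> sector" by simp
  qed (use \<delta> in \<open>auto simp: sector_def\<close>)
  then have "(\<lambda>k. of_real (bratio_real n (L k)) :: complex) \<longlonglongrightarrow> of_real (1 / real n)" using bratio_of_real[OF L(1)] bratio_0 by simp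
  then have h1: "(\<lambda>k. pi * bratio_real n (L k)) \<longlonglongrightarrow> pi * (1 / real n)" unfolding tendsto_of_real_iff by (intro tendsto_intros)
  have a: "(\<lambda>k. LINT x:{0<..\<delta>}|lborel. density x / (L k + x)) \<longlonglongrightarrow> (LINT x:{0<..\<delta>}|lborel. density x / x)"
    unfolding set_lebesgue_integral_def
  proof (rule integral_dominated_convergence)
    show "integrable lborel (\<lambda>x. norm (indicator {0<..\<delta>} x *\<^sub>R (density x / x)))" using \<phi>1_int unfolding set_integrable_def by (rule integrable_norm)
    show "AE x in lborel. (\<lambda>k. indicator {0<..\<delta>} x *\<^sub>R (density x / (L k + x))) \<longlonglongrightarrow> indicator {0<..\<delta>} x *\<^sub>R (density x / x)"
    proof (rule AE_I2)
      fix x :: real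
      show "(\<lambda>k. indicator {0<..\<delta>} x *\<^sub>R (density x / (L k + x))) \<longlonglongrightarrow> indicator {0<..\<delta>} x *\<^sub>R (density x / x)"
      proof (cases "x \<in> {0<..\<delta>}")
        case True
        then have "(\<lambda>k. density x / (L k + x)) \<longlonglongrightarrow> density x / (0 + x)" by (intro tendsto_intros L(2)) auto
        then show ?thesis using True by simp
      qed simp
    qed
    show "AE x in lborel. norm (indicator {0<..\<delta>} x *\<^sub>R (density x / (L k + x))) \<le> norm (indicator {0<..\<delta>} x *\<^sub>R (density x / x))" for k
    proof (rule AE_I2)
      fix x :: real
      have "\<bar>density x / (L k + x)\<bar> \<le> \<bar>density x / x\<bar>" if "x > 0"
        using that L(1)[of k] by (auto simp: abs_divide intro!: divide_left_mono)
      then show "norm (indicator {0<..\<delta>} x *\<^sub>R (density x / (L k + x))) \<le> norm (indicator {0<..\<delta>} x *\<^sub>R (density x / x))"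
        by (auto split: split_indicator)
    qed
    show "(\<lambda>x. indicator {0<..\<delta>} x *\<^sub>R (density x / x)) \<in> borel_measurable lborel" using \<phi>1_int unfolding set_integrable_def by simp
    show "(\<lambda>x. indicator {0<..\<delta>} x *\<^sub>R (density x / (L k + x))) \<in> borel_measurable lborel" for k using density_l_int[OF L(1)] unfolding set_integrable_def by simp
  qed
  have c: "(\<lambda>k. LINT y:{0..}|lborel. (- 1 + \<i>) * bratio n (diag y) / (of_real (L k) - diag y)) \<longlonglongrightarrow> (LINT y:{0..}|lborel. \<phi>2 y)"
    unfolding set_lebesgue_integral_def
  proof (rule integral_dominated_convergence)
    show "integrable lborel (\<lambda>y. norm (indicator {0..} y *\<^sub>R \<phi>2 y))" using \<phi>2_int unfolding set_integrable_def by (rule integrable_norm)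
    show "AE y in lborel. (\<lambda>k. indicator {0..} y *\<^sub>R ((- 1 + \<i>) * bratio n (diag y) / (of_real (L k) - diag y))) \<longlonglongrightarrow> indicator {0..} y *\<^sub>R \<phi>2 y"
    proof (rule AE_I2)
      fix y :: real
      show "(\<lambda>k. indicator {0..} y *\<^sub>R ((- 1 + \<i>) * bratio n (diag y) / (of_real (L k) - diag y))) \<longlonglongrightarrow> indicator {0..} y *\<^sub>R \<phi>2 y"
      proof (cases "y \<ge> 0")
        case True
        then have "(\<lambda>k. (- 1 + \<i>) * bratio n (diag y) / (of_real (L k) - diag y)) \<longlonglongrightarrow> (- 1 + \<i>) * bratio n (diag y) / (of_real 0 - diag y)"
          using norm_diag_le(2)[OF True order_refl] by (intro tendsto_intros L(2)) auto
        then show ?thesis using True by (simp add: \<phi>2_def)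
      qed simp
    qed
    show "AE y in lborel. norm (indicator {0..} y *\<^sub>R ((- 1 + \<i>) * bratio n (diag y) / (of_real (L k) - diag y))) \<le> norm (indicator {0..} y *\<^sub>R \<phi>2 y)" for k
    proof (rule AE_I2)
      fix y :: real
      have "norm ((- 1 + \<i>) * bratio n (diag y) / (of_real (L k) - diag y)) \<le> norm (\<phi>2 y)" if "y \<ge> 0"
      proof -
        note z = norm_diag_le[OF that less_imp_le[OF L(1)[of k]]]
        have "0 < norm (of_real (L k) - diag y)" using z by linarith
        with z show ?thesis unfolding \<phi>2_def norm_divide by (intro divide_left_mono mult_pos_pos norm_ge_zero)
      qed
      then show "norm (indicator {0..} y *\<^sub>R ((- 1 + \<i>) * bratio n (diag y) / (of_real (L k) - diag y))) \<le> norm (indicator {0..} y *\<^sub>R \<phi>2 y)"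
        by (cases "y \<ge> 0") auto
    qed
    show "(\<lambda>y. indicator {0..} y *\<^sub>R \<phi>2 y) \<in> borel_measurable lborel" using \<phi>2_int unfolding set_integrable_def by simp
    show "(\<lambda>y. indicator {0..} y *\<^sub>R ((- 1 + \<i>) * bratio n (diag y) / (of_real (L k) - diag y))) \<in> borel_measurable lborel" for k
      using set_integrable_diag[OF less_imp_le[OF L(1)]] unfolding set_integrable_def by simp
  qed
  have "(\<lambda>k. pi * bratio_real n (L k)) \<longlonglongrightarrow> pi * K 0"
    unfolding H_representation_open[OF L(1)] K_at_0 by (intro tendsto_add a tendsto_Im c)
  from LIMSEQ_unique[OF this h1] show ?thesis by (metis mult_left_cancel pi_neq_zero)
qed

end

end

text \<open>The cut contributes the transform of \<open>x\<^bsup>n - 1\<^esup>\<close> times a function with an expansion in admissible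
  monomials, to which Watson's lemma applies; the diagonal contribution is exponentially small.\<close>

theorem bessel_ratio_tail:
  assumes n: "n \<ge> 1" and P: "P \<ge> 1"
  shows "\<exists>K d. continuous_on {0..} K \<and>
    (\<forall>l>0. set_integrable lborel {0..} (\<lambda>t. exp (- l * t) * K t) \<and> (LINT t:{0..}|lborel. exp (- l * t) * K t) = (1 / real n - bratio_real n l) / l) \<and>
    (\<lambda>t. K t - (\<Sum>p<P. 1 / t ^ (n + p) * (\<Sum>k\<le>p div Suc n. d p k * ln t ^ k))) \<in> O[at_top](\<lambda>t. 1 / t powr (real (n + P) - 1/2))"
proof -
  obtain \<delta>0 where \<delta>0: "0 < \<delta>0" "\<delta>0 \<le> 1" "\<And>z. Im z \<ge> 0 \<Longrightarrow> Re z + Im z \<ge> - \<delta>0 \<Longrightarrow> bphi_ext (Suc n) z \<noteq> 0"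
    using bphi_ext_Suc_nonzero[OF n] by metis
  let ?R = "\<lambda>x. density_num n x * (1 / density_den n x)"
  have le: "logexp (Suc n) P ?R" by (rule density_logexp[OF P])
  obtain c where c: "(\<lambda>x. ?R x - (\<Sum>p<P. \<Sum>m\<le>p div Suc n. c p m * (x ^ p * ln x ^ m))) \<in> O[at_right 0](\<lambda>x. x powr (real P - 1/2))"
    using le unfolding logexp_def by blast
  obtain C where C: "eventually (\<lambda>x. norm (?R x - (\<Sum>p<P. \<Sum>m\<le>p div Suc n. c p m * (x ^ p * ln x ^ m))) \<le> C * norm (x powr (real P - 1/2))) (at_right 0)"
    using c by (rule landau_o.bigE) auto
  obtain B where B: "eventually (\<lambda>x. norm (?R x) \<le> B * norm (1::real)) (at_right 0)"
    using logexp_bounded[OF le _ P] by (rule landau_o.bigE) auto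
  obtain b where b: "b > 0" "\<And>x. 0 < x \<Longrightarrow> x < b \<Longrightarrow> norm (?R x) \<le> B"
    "\<And>x. 0 < x \<Longrightarrow> x < b \<Longrightarrow> norm (?R x - (\<Sum>p<P. \<Sum>m\<le>p div Suc n. c p m * (x ^ p * ln x ^ m))) \<le> C * norm (x powr (real P - 1/2))"
    using eventually_conj[OF B C] unfolding eventually_at_right_field by auto
  \<comment> \<open>small enough for the zero-free region and for the bounds on \<open>?R\<close>\<close>
  define \<delta> where "\<delta> = min \<delta>0 (b/2)"
  interpret ratio n \<delta>
    by standard (use n \<delta>0 b in \<open>auto simp: \<delta>_def\<close>)
  have w: "density x = x ^ n * ?R x" if "x > 0" for x unfolding density_def by (rule Im_bratio_neg_real[OF that])
  obtain a where a: "n = Suc a" using n by (cases n) auto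
  have wx: "density x / x = x ^ a * ?R x" if "x > 0" for x unfolding w[OF that] using that by (simp add: a)
  have Rm: "set_borel_measurable borel {0<..\<delta>} ?R"
  proof -
    have "continuous_on {0<..\<delta>} (\<lambda>x. density x / x ^ n)"
      by (intro continuous_intros continuous_on_subset[OF density_cont]) auto
    then have "(\<lambda>x. indicator {0<..\<delta>} x *\<^sub>R (density x / x ^ n)) \<in> borel_measurable borel"
      by (intro borel_measurable_continuous_on_indicator) auto
    moreover have "indicator {0<..\<delta>} x *\<^sub>R (density x / x ^ n) = indicator {0<..\<delta>} x *\<^sub>R ?R x" for x
      using w[of x] by (auto split: split_indicator)
    ultimately show ?thesis unfolding set_borel_measurable_def by simp
  qed
  have i1: "set_integrable lborel {0<..\<delta>} (\<lambda>x. density x / x)"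
  proof (rule set_integrable_bound)
    show "set_integrable lborel {0<..\<delta>} (\<lambda>x. B)"
      by (rule set_integrable_subset[of _ "{0..\<delta>}"], rule borel_integrable_atLeastAtMost') auto
    have "(\<lambda>x. x ^ a * (indicator {0<..\<delta>} x *\<^sub>R ?R x)) \<in> borel_measurable borel"
      using Rm unfolding set_borel_measurable_def by (intro borel_measurable_times) auto
    moreover have "x ^ a * (indicator {0<..\<delta>} x *\<^sub>R ?R x) = indicator {0<..\<delta>} x *\<^sub>R (density x / x)" for x
      using wx[of x] by (auto split: split_indicator)
    ultimately show "set_borel_measurable lborel {0<..\<delta>} (\<lambda>x. density x / x)" unfolding set_borel_measurable_def by simp
    have "norm (density x / x) \<le> norm B" if x: "0 < x" "x \<le> \<delta>" for x
    proof -
      have "x ^ a \<le> 1" using x \<delta> by (intro power_le_one) auto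
      moreover have "norm (?R x) \<le> B" using x b by (intro b(2)) (auto simp: \<delta>_def)
      ultimately have "x ^ a * norm (?R x) \<le> 1 * B" using x by (intro mult_mono) auto
      then show ?thesis unfolding wx[OF x(1)] using x by (simp add: abs_mult)
    qed
    then show "AE x in lborel. x \<in> {0<..\<delta>} \<longrightarrow> norm (density x / x) \<le> norm B" by auto
  qed
  have "\<exists>d. (\<lambda>t. (LINT x:{0<..\<delta>}|lborel. x ^ a * ?R x * exp (- t * x)) -
      (\<Sum>p<P. 1 / t ^ Suc (a + p) * (\<Sum>k\<le>p div Suc n. d p k * ln t ^ k))) \<in> O[at_top](\<lambda>t. 1 / t powr (real (a + P) + 1/2))"
  proof (rule watson[OF _ P Rm])
    show "\<bar>?R x - (\<Sum>p<P. \<Sum>m\<le>p div Suc n. c p m * (x ^ p * ln x ^ m))\<bar> \<le> C * x powr (real P - 1/2)" if "0 < x" "x \<le> \<delta>" for x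
      using b(3)[of x] that b(1) by (auto simp: \<delta>_def)
  qed (rule \<delta>(1))
  then obtain d where d: "(\<lambda>t. (LINT x:{0<..\<delta>}|lborel. x ^ a * ?R x * exp (- t * x)) -
      (\<Sum>p<P. 1 / t ^ Suc (a + p) * (\<Sum>k\<le>p div Suc n. d p k * ln t ^ k))) \<in> O[at_top](\<lambda>t. 1 / t powr (real (a + P) + 1/2))" by blast
  have G1: "Re (G1 t) = (LINT x:{0<..\<delta>}|lborel. x ^ a * ?R x * exp (- t * x))" for t
  proof -
    have "G1 t = of_real (LINT x:{0<..\<delta>}|lborel. x ^ a * ?R x * exp (- t * x))"
      unfolding G1_def set_lebesgue_integral_def
    proof (subst integral_complex_of_real[symmetric], rule Bochner_Integration.integral_cong[OF refl])
      fix x :: real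
      have "\<phi>1 x * exp (of_real (- x) * of_real t) = of_real (x ^ a * ?R x * exp (- t * x))" if "x > 0"
      proof -
        have "exp (of_real (- x) * of_real t) = (of_real (exp (- t * x)) :: complex)"
          unfolding exp_of_real[symmetric] by (simp add: mult.commute)
        then show ?thesis unfolding \<phi>1_def wx[OF that] by simp
      qed
      then show "indicator {0<..\<delta>} x *\<^sub>R (\<phi>1 x * exp (of_real (- x) * of_real t)) = complex_of_real (indicator {0<..\<delta>} x *\<^sub>R (x ^ a * ?R x * exp (- t * x)))"
        by (cases "x \<in> {0<..\<delta>}") (simp_all only: indicator_simps indicator_notin not_False_eq_True scaleR_one scaleR_zero_left of_real_0 greaterThanAtMost_pos)
    qed
    then show ?thesis by (simp only: Re_complex_of_real)
  qed
  have G2: "(\<lambda>t. Im (G2 t)) \<in> O[at_top](\<lambda>t. 1 / t powr (real (a + P) + 1/2))"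
  proof -
    have "(\<lambda>t. Im (G2 t)) \<in> O[at_top](\<lambda>t. exp (- \<delta> * t))"
    proof (rule bigoI[where c = "LINT y:{0..}|lborel. norm (\<phi>2 y)"])
      show "\<forall>\<^sub>F t in at_top. norm (Im (G2 t)) \<le> (LINT y:{0..}|lborel. norm (\<phi>2 y)) * norm (exp (- \<delta> * t))"
        using eventually_ge_at_top[of 0]
      proof eventually_elim
        case (elim t)
        show ?case using order_trans[OF abs_Im_le_cmod[of "G2 t"] G2_bound[OF i1 elim]] by (simp add: mult.commute)
      qed
    qed
    also have "(\<lambda>t. exp (- \<delta> * t)) \<in> O[at_top](\<lambda>t. 1 / t powr (real (a + P) + 1/2))" using \<delta>(1) by real_asymp
    finally show ?thesis .
  qed
  have "(\<lambda>t. (1 / pi) * (((LINT x:{0<..\<delta>}|lborel. x ^ a * ?R x * exp (- t * x)) -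
      (\<Sum>p<P. 1 / t ^ Suc (a + p) * (\<Sum>k\<le>p div Suc n. d p k * ln t ^ k))) + Im (G2 t))) \<in> O[at_top](\<lambda>t. 1 / t powr (real (a + P) + 1/2))"
    using sum_in_bigo(1)[OF d G2] by simp
  also have "(\<lambda>t. (1 / pi) * (((LINT x:{0<..\<delta>}|lborel. x ^ a * ?R x * exp (- t * x)) -
      (\<Sum>p<P. 1 / t ^ Suc (a + p) * (\<Sum>k\<le>p div Suc n. d p k * ln t ^ k))) + Im (G2 t))) =
     (\<lambda>t. K t - (\<Sum>p<P. 1 / t ^ (n + p) * (\<Sum>k\<le>p div Suc n. (d p k / pi) * ln t ^ k)))"
  proof
    fix t
    have "(\<Sum>p<P. 1 / t ^ (n + p) * (\<Sum>k\<le>p div Suc n. (d p k / pi) * ln t ^ k)) = (1 / pi) * (\<Sum>p<P. 1 / t ^ Suc (a + p) * (\<Sum>k\<le>p div Suc n. d p k * ln t ^ k))"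
      unfolding sum_distrib_left by (intro sum.cong refl) (simp add: a sum_distrib_left)
    then show "(1 / pi) * (((LINT x:{0<..\<delta>}|lborel. x ^ a * ?R x * exp (- t * x)) -
      (\<Sum>p<P. 1 / t ^ Suc (a + p) * (\<Sum>k\<le>p div Suc n. d p k * ln t ^ k))) + Im (G2 t)) = K t - (\<Sum>p<P. 1 / t ^ (n + p) * (\<Sum>k\<le>p div Suc n. (d p k / pi) * ln t ^ k))"
      unfolding K_def G1 by (simp add: algebra_simps add_divide_distrib diff_divide_distrib)
  qed
  also have "real (a + P) + 1/2 = real (n + P) - 1/2" by (simp add: a)
  finally have exp: "(\<lambda>t. K t - (\<Sum>p<P. 1 / t ^ (n + p) * (\<Sum>k\<le>p div Suc n. (d p k / pi) * ln t ^ k))) \<in> O[at_top](\<lambda>t. 1 / t powr (real (n + P) - 1/2))" .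
  show ?thesis
    using K_cont[OF i1] K_laplace[OF i1] K_0_value[OF i1] exp
    by (intro exI[of _ K] exI[of _ "\<lambda>p k. d p k / pi"]) auto
qed

section \<open>The heat kernel, its resolvent and the Markov property\<close>

definition heat_kernel :: "real \<Rightarrow> real ^ 'd \<Rightarrow> real" where
  "heat_kernel t y = (\<Prod>i\<in>UNIV. normal_density 0 (sqrt t) (y $ i))"

lemma heat_kernel_nonneg [simp]: "heat_kernel t y \<ge> 0"
  unfolding heat_kernel_def by (intro prod_nonneg) (auto simp: normal_density_nonneg)

lemma heat_kernel_eq:
  assumes "t > 0"
  shows "heat_kernel t (y :: real ^ 'd) = (1 / sqrt (2 * pi * t)) ^ CARD('d) * exp (- (norm y)\<^sup>2 / (2 * t))"
proof -
  have "(norm y)\<^sup>2 = (\<Sum>i\<in>UNIV. (y $ i)\<^sup>2)"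
    unfolding norm_eq_sqrt_inner inner_vec_def by (simp add: sum_nonneg power2_eq_square)
  then have "- (norm y)\<^sup>2 / (2 * t) = (\<Sum>i\<in>UNIV. - (y $ i)\<^sup>2 / (2 * t))"
    by (simp add: sum_negf sum_divide_distrib)
  then show ?thesis using assms
    by (simp add: heat_kernel_def normal_density_def prod_dividef exp_sum power_divide)
qed

lemma heat_kernel_mono_norm: "t > 0 \<Longrightarrow> norm y \<le> norm z \<Longrightarrow> heat_kernel t (z :: real ^ 'd) \<le> heat_kernel t (y :: real ^ 'd)"
  unfolding heat_kernel_eq by (intro mult_left_mono) (auto simp: divide_right_mono power_mono)

lemma vec_nth_measurable [measurable (raw)]:
  fixes f :: "'a \<Rightarrow> real ^ 'd"
  assumes "f \<in> borel_measurable M"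
  shows "(\<lambda>x. f x $ i) \<in> borel_measurable M"
proof -
  have "(\<lambda>y :: real ^ 'd. y $ i) \<in> borel_measurable borel"
    by (intro borel_measurable_continuous_onI continuous_intros)
  from measurable_compose[OF assms this] show ?thesis .
qed

lemma heat_kernel_measurable [measurable]:
  "(\<lambda>(t, y). heat_kernel t (y :: real ^ 'd)) \<in> borel_measurable (borel \<Otimes>\<^sub>M borel)"
  unfolding heat_kernel_def normal_density_def by measurable

lemma heat_kernel_measurable' [measurable (raw)]:
  assumes "f \<in> borel_measurable M" "g \<in> borel_measurable M"
  shows "(\<lambda>x. heat_kernel (f x) (g x :: real ^ 'd)) \<in> borel_measurable M"
  using measurable_compose[OF measurable_Pair[OF assms] heat_kernel_measurable] by simp

lemma prod_UNIV_Basis: "(\<Prod>i\<in>UNIV. h (axis i 1)) = (\<Prod>b\<in>(Basis :: (real ^ 'd) set). h b)"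
proof -
  have B: "(Basis :: (real ^ 'd) set) = range (\<lambda>i. axis i 1)" by (auto simp: Basis_vec_def)
  have "inj (\<lambda>i::'d. axis i (1::real))" by (auto simp: inj_on_def axis_eq_axis)
  then show ?thesis unfolding B by (subst prod.reindex) auto
qed

lemma normal_density_conv:
  assumes "0 < \<sigma>" "0 < \<tau>"
  shows "(\<integral>\<^sup>+z. ennreal (normal_density 0 \<sigma> z * normal_density 0 \<tau> (a + z)) \<partial>lborel) = ennreal (normal_density 0 (sqrt (\<sigma>\<^sup>2 + \<tau>\<^sup>2)) a)"
proof -
  have "(\<integral>\<^sup>+z. ennreal (normal_density 0 \<sigma> z * normal_density 0 \<tau> (a + z)) \<partial>lborel)
    = (\<integral>\<^sup>+y. ennreal (normal_density 0 \<sigma> (- a + 1 * y) * normal_density 0 \<tau> (a + (- a + 1 * y))) \<partial>lborel)"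
    by (subst nn_integral_real_affine[where c = 1 and t = "- a"]) auto
  also have "\<dots> = (\<integral>\<^sup>+y. ennreal (normal_density 0 \<sigma> (a - y) * normal_density 0 \<tau> y) \<partial>lborel)"
    by (intro nn_integral_cong) (simp add: normal_density_def power2_commute)
  also have "\<dots> = ennreal (normal_density 0 (sqrt (\<sigma>\<^sup>2 + \<tau>\<^sup>2)) a)"
    using fun_cong[OF conv_normal_density_zero_mean[OF assms], of a] .
  finally show ?thesis .
qed

text \<open>The coordinates separate, and in each coordinate two centred Gaussians are convolved.\<close>

lemma heat_kernel_semigroup:
  assumes s: "s > 0" and t: "t > 0"
  shows "(\<integral>\<^sup>+y. ennreal (heat_kernel s y * heat_kernel t (x + y)) \<partial>lborel) = ennreal (heat_kernel (s + t) (x :: real ^ 'd))"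
proof -
  let ?f = "\<lambda>b z. ennreal (normal_density 0 (sqrt s) z * normal_density 0 (sqrt t) (x \<bullet> b + z))"
  have "(\<integral>\<^sup>+y. ennreal (heat_kernel s y * heat_kernel t (x + y)) \<partial>lborel) = (\<integral>\<^sup>+y. (\<Prod>b\<in>Basis. ?f b (y \<bullet> b)) \<partial>lborel)"
  proof (intro nn_integral_cong)
    fix y :: "real ^ 'd"
    have "heat_kernel s y * heat_kernel t (x + y) = (\<Prod>i\<in>UNIV. normal_density 0 (sqrt s) (y \<bullet> axis i 1) * normal_density 0 (sqrt t) (x \<bullet> axis i 1 + y \<bullet> axis i 1))"
      by (simp add: heat_kernel_def prod.distrib inner_axis)
    also have "\<dots> = (\<Prod>b\<in>Basis. normal_density 0 (sqrt s) (y \<bullet> b) * normal_density 0 (sqrt t) (x \<bullet> b + y \<bullet> b))"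
      by (rule prod_UNIV_Basis)
    finally show "ennreal (heat_kernel s y * heat_kernel t (x + y)) = (\<Prod>b\<in>Basis. ?f b (y \<bullet> b))"
      by (simp add: prod_ennreal normal_density_nonneg)
  qed
  also have "\<dots> = (\<Prod>b\<in>Basis. (\<integral>\<^sup>+z. ?f b z \<partial>lborel))"
    by (rule nn_integral_lborel_prod) (auto simp: normal_density_nonneg)
  also have "\<dots> = (\<Prod>b\<in>Basis. ennreal (normal_density 0 (sqrt (s + t)) (x \<bullet> b)))"
    using normal_density_conv[of "sqrt s" "sqrt t"] s t by simp
  also have "\<dots> = ennreal (\<Prod>i\<in>UNIV. normal_density 0 (sqrt (s + t)) (x \<bullet> axis i 1))"
    by (subst prod_UNIV_Basis) (simp add: prod_ennreal normal_density_nonneg)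
  also have "\<dots> = ennreal (heat_kernel (s + t) x)" by (simp add: heat_kernel_def inner_axis)
  finally show ?thesis .
qed

text \<open>The lower cutoff \<open>e\<close> makes the integral finite also at \<open>x = 0\<close> and records elapsed time: one step
  of length \<open>h\<close> of the walk moves it from \<open>e\<close> to \<open>e + h\<close>.\<close>

definition resolvent :: "real \<Rightarrow> real \<Rightarrow> real ^ 'd \<Rightarrow> ennreal" where
  "resolvent l e x = (\<integral>\<^sup>+t. ennreal (exp (- l * t) * heat_kernel t x) * indicator {e<..} t \<partial>lborel)"

lemma resolvent_measurable [measurable]: "resolvent l e \<in> borel_measurable borel"
  unfolding resolvent_def[abs_def] by measurable

lemma resolvent_step:
  assumes h: "h > 0" and e: "e \<ge> 0"
  shows "ennreal (exp (- l * h)) * (\<integral>\<^sup>+y. ennreal (heat_kernel h y) * resolvent l e (x + y) \<partial>lborel) = resolvent l (e + h) (x :: real ^ 'd)"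
proof -
  have "ennreal (exp (- l * h)) * (\<integral>\<^sup>+y. ennreal (heat_kernel h y) * resolvent l e (x + y) \<partial>lborel)
    = (\<integral>\<^sup>+y. \<integral>\<^sup>+t. ennreal (exp (- l * (t + h))) * ennreal (heat_kernel h y * heat_kernel t (x + y)) * indicator {e<..} t \<partial>lborel \<partial>lborel)"
  proof (subst nn_integral_cmult[symmetric], measurable, intro nn_integral_cong)
    fix y :: "real ^ 'd"
    have "ennreal (exp (- l * h)) * (ennreal (heat_kernel h y) * resolvent l e (x + y))
      = (\<integral>\<^sup>+t. (ennreal (exp (- l * h)) * ennreal (heat_kernel h y)) * (ennreal (exp (- l * t) * heat_kernel t (x + y)) * indicator {e<..} t) \<partial>lborel)"
      unfolding resolvent_def by (subst nn_integral_cmult, measurable) (simp add: mult.assoc)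
    also have "\<dots> = (\<integral>\<^sup>+t. ennreal (exp (- l * (t + h))) * ennreal (heat_kernel h y * heat_kernel t (x + y)) * indicator {e<..} t \<partial>lborel)"
    proof (intro nn_integral_cong)
      fix t :: real
      have "exp (- l * (t + h)) = exp (- l * h) * exp (- l * t)" by (simp add: algebra_simps flip: exp_add)
      then show "(ennreal (exp (- l * h)) * ennreal (heat_kernel h y)) * (ennreal (exp (- l * t) * heat_kernel t (x + y)) * indicator {e<..} t)
        = ennreal (exp (- l * (t + h))) * ennreal (heat_kernel h y * heat_kernel t (x + y)) * indicator {e<..} t"
        by (simp only: ennreal_mult exp_ge_zero heat_kernel_nonneg mult_nonneg_nonneg mult_ac)
    qed
    finally show "ennreal (exp (- l * h)) * (ennreal (heat_kernel h y) * resolvent l e (x + y)) = (\<integral>\<^sup>+t. ennreal (exp (- l * (t + h))) * ennreal (heat_kernel h y * heat_kernel t (x + y)) * indicator {e<..} t \<partial>lborel)" .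
  qed
  also have "\<dots> = (\<integral>\<^sup>+t. \<integral>\<^sup>+y. ennreal (exp (- l * (t + h))) * ennreal (heat_kernel h y * heat_kernel t (x + y)) * indicator {e<..} t \<partial>lborel \<partial>lborel)"
    by (rule lborel_pair.Fubini') measurable
  also have "\<dots> = (\<integral>\<^sup>+t. ennreal (exp (- l * (t + h)) * heat_kernel (t + h) x) * indicator {e<..} t \<partial>lborel)"
  proof (intro nn_integral_cong)
    fix t :: real
    show "(\<integral>\<^sup>+y. ennreal (exp (- l * (t + h))) * ennreal (heat_kernel h y * heat_kernel t (x + y)) * indicator {e<..} t \<partial>lborel) = ennreal (exp (- l * (t + h)) * heat_kernel (t + h) x) * indicator {e<..} t"
    proof (cases "t > e")
      case True
      then show ?thesis using heat_kernel_semigroup[of h t x] h e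
        by (subst nn_integral_multc, measurable, subst nn_integral_cmult, measurable) (simp add: ennreal_mult' add.commute)
    qed simp
  qed
  also have "\<dots> = resolvent l (e + h) x"
    unfolding resolvent_def
    by (subst nn_integral_real_affine[where c = 1 and t = "h" and f = "\<lambda>t. ennreal (exp (- l * t) * heat_kernel t x) * indicator {e + h<..} t"])
       (measurable, auto intro!: nn_integral_cong simp: add.commute split: split_indicator)
  finally show ?thesis .
qed

lemma resolvent_mono_norm:
  assumes "norm y \<le> norm z" "e \<ge> 0"
  shows "resolvent l e (z :: real ^ 'd) \<le> resolvent l e (y :: real ^ 'd)"
  unfolding resolvent_def using assms
  by (intro nn_integral_mono) (auto split: split_indicator intro!: ennreal_leI mult_left_mono heat_kernel_mono_norm)

lemma resolvent_antimono: "e \<le> e' \<Longrightarrow> resolvent l e' x \<le> resolvent l e x"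
  unfolding resolvent_def by (intro nn_integral_mono) (auto split: split_indicator)

context standard_brownian_motion
begin

definition incr :: "real \<Rightarrow> nat \<Rightarrow> 'w \<Rightarrow> real ^ 'd" where
  "incr h i \<omega> = B (real (Suc i) * h) \<omega> - B (real i * h) \<omega>"

text \<open>The motion started at \<open>x\<close> and observed at the multiples of \<open>h\<close>.  Subtracting \<open>B 0\<close>, which vanishes
  almost surely, makes it a sum of increments for every outcome.\<close>

definition walk :: "real \<Rightarrow> real ^ 'd \<Rightarrow> nat \<Rightarrow> 'w \<Rightarrow> real ^ 'd" where
  "walk h x k \<omega> = x + (\<Sum>i<k. incr h i \<omega>)"

lemma incr_measurable [measurable]: "h > 0 \<Longrightarrow> incr h i \<in> borel_measurable \<Omega>"
  unfolding incr_def using measurable_B[of "real (Suc i) * h"] measurable_B[of "real i * h"] by simp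

lemma walk_measurable [measurable]: "h > 0 \<Longrightarrow> walk h x k \<in> borel_measurable \<Omega>"
  unfolding walk_def by simp

lemma walk_eq: "walk h x k \<omega> = x + B (real k * h) \<omega> - B 0 \<omega>"
proof -
  have "(\<Sum>i<k. incr h i \<omega>) = B (real k * h) \<omega> - B 0 \<omega>"
    unfolding incr_def by (subst sum_lessThan_telescope[of "\<lambda>i. B (real i * h) \<omega>"]) simp
  then show ?thesis by (simp add: walk_def)
qed

lemma walk_Suc: "walk h x (Suc k) \<omega> = walk h x k \<omega> + incr h k \<omega>" by (simp add: walk_def)

lemma distr_incr:
  assumes h: "h > 0"
  shows "distr \<Omega> borel (incr h k) = density lborel (\<lambda>y. ennreal (heat_kernel h y))"
proof -
  have "distributed \<Omega> lborel (incr h k) (\<lambda>y. ennreal (heat_kernel h y))"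
    using gaussian_increments[of "real k * h" "real (Suc k) * h"] h
    by (simp add: incr_def[abs_def] heat_kernel_def algebra_simps)
  from distributed_distr_eq_density[OF this] show ?thesis
    by (metis distr_cong sets_lborel)
qed

text \<open>The next increment is independent of the earlier ones, so it can be integrated out first.\<close>

lemma markov_step:
  fixes \<phi> :: "real ^ 'd \<Rightarrow> ennreal"
  assumes h: "h > 0" and \<phi> [measurable]: "\<phi> \<in> borel_measurable borel"
    and Q: "Measurable.pred (PiM {..<n} (\<lambda>_. borel)) Q"
  shows "(\<integral>\<^sup>+\<omega>. indicator {\<omega>. Q (\<lambda>i\<in>{..<n}. incr h i \<omega>)} \<omega> * \<phi> (walk h x (Suc n) \<omega>) \<partial>\<Omega>)
    = (\<integral>\<^sup>+\<omega>. indicator {\<omega>. Q (\<lambda>i\<in>{..<n}. incr h i \<omega>)} \<omega> * (\<integral>\<^sup>+y. ennreal (heat_kernel h y) * \<phi> (walk h x n \<omega> + y) \<partial>lborel) \<partial>\<Omega>)"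
proof -
  note [measurable] = Q
  let ?P = "PiM {..<n} (\<lambda>_. borel) :: (nat \<Rightarrow> real ^ 'd) measure"
  let ?T = "PiM {n} (\<lambda>_. borel) :: (nat \<Rightarrow> real ^ 'd) measure"
  define R where "R = (\<lambda>\<omega>. \<lambda>i\<in>{..<n}. incr h i \<omega>)"
  define R2 where "R2 = (\<lambda>\<omega>. \<lambda>i\<in>{n}. incr h i \<omega>)"
  define S where "S f = x + (\<Sum>i<n. f i)" for f :: "nat \<Rightarrow> real ^ 'd"
  define G where "G = (\<lambda>(f, g :: nat \<Rightarrow> real ^ 'd). indicator {f. Q f} f * \<phi> (S f + g n))"
  have R [measurable]: "R \<in> measurable \<Omega> ?P" using h unfolding R_def by (intro measurable_restrict) simp
  have R2 [measurable]: "R2 \<in> measurable \<Omega> ?T" using h unfolding R2_def by (intro measurable_restrict) simp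
  have incrn [measurable]: "incr h n \<in> borel_measurable \<Omega>" using h by simp
  have iv: "indep_vars (\<lambda>_. borel) (incr h) {..<Suc n}"
    using indep_increments[of "\<lambda>i. real i * h" "Suc n"] h
    by (simp add: incr_def[abs_def] strict_mono_on_def)
  have ind: "indep_var ?P R ?T R2"
    unfolding R_def R2_def by (rule indep_var_restrict[OF iv]) auto
  have S [measurable]: "S \<in> borel_measurable ?P" unfolding S_def by measurable
  have gn [measurable]: "(\<lambda>g. g n) \<in> borel_measurable ?T" by measurable
  have G [measurable]: "G \<in> borel_measurable (?P \<Otimes>\<^sub>M ?T)" unfolding G_def by measurable
  have SR: "S (R \<omega>) = walk h x n \<omega>" and R2n: "R2 \<omega> n = incr h n \<omega>" for \<omega> by (simp_all add: S_def R_def R2_def walk_def)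
  interpret D: prob_space "distr \<Omega> ?T R2" by (rule prob_space_distr) simp
  have "(\<integral>\<^sup>+\<omega>. indicator {\<omega>. Q (R \<omega>)} \<omega> * \<phi> (walk h x (Suc n) \<omega>) \<partial>\<Omega>) = (\<integral>\<^sup>+\<omega>. G (R \<omega>, R2 \<omega>) \<partial>\<Omega>)"
    by (intro nn_integral_cong) (auto simp: G_def SR R2n walk_Suc split: split_indicator)
  also have "\<dots> = (\<integral>\<^sup>+p. G p \<partial>(distr \<Omega> (?P \<Otimes>\<^sub>M ?T) (\<lambda>\<omega>. (R \<omega>, R2 \<omega>))))"
    by (rule nn_integral_distr[symmetric]) (use R R2 G in simp_all)
  also have "distr \<Omega> (?P \<Otimes>\<^sub>M ?T) (\<lambda>\<omega>. (R \<omega>, R2 \<omega>)) = distr \<Omega> ?P R \<Otimes>\<^sub>M distr \<Omega> ?T R2"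
    using ind unfolding indep_var_distribution_eq by simp
  also have "(\<integral>\<^sup>+p. G p \<partial>(distr \<Omega> ?P R \<Otimes>\<^sub>M distr \<Omega> ?T R2)) = (\<integral>\<^sup>+f. \<integral>\<^sup>+g. G (f, g) \<partial>distr \<Omega> ?T R2 \<partial>distr \<Omega> ?P R)"
    by (rule D.nn_integral_fst[symmetric]) (use G in \<open>simp cong: measurable_cong_sets\<close>)
  also have "\<dots> = (\<integral>\<^sup>+\<omega>. \<integral>\<^sup>+g. G (R \<omega>, g) \<partial>distr \<Omega> ?T R2 \<partial>\<Omega>)"
  proof (rule nn_integral_distr)
    show "(\<lambda>f. \<integral>\<^sup>+g. G (f, g) \<partial>distr \<Omega> ?T R2) \<in> borel_measurable (distr \<Omega> ?P R)"
      using D.borel_measurable_nn_integral_fst[of G ?P] G by (simp cong: measurable_cong_sets)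
  qed simp
  also have "\<dots> = (\<integral>\<^sup>+\<omega>. indicator {\<omega>. Q (R \<omega>)} \<omega> * (\<integral>\<^sup>+y. ennreal (heat_kernel h y) * \<phi> (walk h x n \<omega> + y) \<partial>lborel) \<partial>\<Omega>)"
  proof (intro nn_integral_cong)
    fix \<omega>
    have m: "(\<lambda>g. \<phi> (S (R \<omega>) + g n)) \<in> borel_measurable ?T" by measurable
    have m2: "(\<lambda>y. \<phi> (S (R \<omega>) + y)) \<in> borel_measurable borel" by measurable
    have "(\<integral>\<^sup>+g. G (R \<omega>, g) \<partial>distr \<Omega> ?T R2) = indicator {f. Q f} (R \<omega>) * (\<integral>\<^sup>+g. \<phi> (S (R \<omega>) + g n) \<partial>distr \<Omega> ?T R2)"
      unfolding G_def prod.case by (rule nn_integral_cmult) (use m in simp)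
    also have "(\<integral>\<^sup>+g. \<phi> (S (R \<omega>) + g n) \<partial>distr \<Omega> ?T R2) = (\<integral>\<^sup>+\<omega>'. \<phi> (S (R \<omega>) + incr h n \<omega>') \<partial>\<Omega>)"
      unfolding R2n[symmetric] by (rule nn_integral_distr[OF R2]) (use m in simp)
    also have "\<dots> = (\<integral>\<^sup>+y. \<phi> (S (R \<omega>) + y) \<partial>distr \<Omega> borel (incr h n))"
      by (rule nn_integral_distr[OF incrn, symmetric]) (use m2 in simp)
    also have "\<dots> = (\<integral>\<^sup>+y. ennreal (heat_kernel h y) * \<phi> (walk h x n \<omega> + y) \<partial>lborel)"
      unfolding distr_incr[OF h] SR[symmetric] by (rule nn_integral_density) (use m2 in simp_all)
    finally show "(\<integral>\<^sup>+g. G (R \<omega>, g) \<partial>distr \<Omega> ?T R2) = indicator {\<omega>. Q (R \<omega>)} \<omega> * (\<integral>\<^sup>+y. ennreal (heat_kernel h y) * \<phi> (walk h x n \<omega> + y) \<partial>lborel)"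
      by (simp add: indicator_def)
  qed
  finally show ?thesis unfolding R_def .
qed

definition alive :: "real \<Rightarrow> real \<Rightarrow> real ^ 'd \<Rightarrow> nat \<Rightarrow> 'w set" where
  "alive h \<rho> x k = {\<omega>. \<forall>j\<le>k. norm (walk h x j \<omega>) > \<rho>}"

definition first_hit :: "real \<Rightarrow> real \<Rightarrow> real ^ 'd \<Rightarrow> nat \<Rightarrow> 'w set" where
  "first_hit h \<rho> x k = {\<omega>. (\<forall>j<k. norm (walk h x j \<omega>) > \<rho>) \<and> norm (walk h x k \<omega>) \<le> \<rho>}"

lemma alive_step:
  assumes h: "h > 0" and \<phi>: "\<phi> \<in> borel_measurable borel"
  shows "(\<integral>\<^sup>+\<omega>. indicator (alive h \<rho> x n) \<omega> * \<phi> (walk h x (Suc n) \<omega>) \<partial>\<Omega>)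
    = (\<integral>\<^sup>+\<omega>. indicator (alive h \<rho> x n) \<omega> * (\<integral>\<^sup>+y. ennreal (heat_kernel h y) * \<phi> (walk h x n \<omega> + y) \<partial>lborel) \<partial>\<Omega>)"
proof -
  let ?Q = "\<lambda>f :: nat \<Rightarrow> real ^ 'd. \<forall>j\<in>{..n}. norm (x + (\<Sum>i<j. f i)) > \<rho>"
  have Q: "Measurable.pred (PiM {..<n} (\<lambda>_. borel)) ?Q"
  proof (rule pred_intros_finite)
    fix j assume j: "j \<in> {..n}"
    have "(\<lambda>f. norm (x + (\<Sum>i<j. f i :: real ^ 'd))) \<in> borel_measurable (PiM {..<n} (\<lambda>_. borel))"
    proof -
      have "(\<lambda>f. x + (\<Sum>i<j. f i :: real ^ 'd)) \<in> borel_measurable (PiM {..<n} (\<lambda>_. borel))"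
        using j by (intro borel_measurable_add borel_measurable_const borel_measurable_sum measurable_component_singleton) auto
      then show ?thesis by measurable
    qed
    then show "Measurable.pred (PiM {..<n} (\<lambda>_. borel)) (\<lambda>f. norm (x + (\<Sum>i<j. f i :: real ^ 'd)) > \<rho>)" by measurable
  qed simp
  have "alive h \<rho> x n = {\<omega>. ?Q (\<lambda>i\<in>{..<n}. incr h i \<omega>)}"
  proof -
    have "(\<Sum>i<j. (\<lambda>i\<in>{..<n}. incr h i \<omega>) i) = (\<Sum>i<j. incr h i \<omega>)" if "j \<in> {..n}" for j \<omega>
      using that by (intro sum.cong) auto
    then show ?thesis unfolding alive_def walk_def by auto
  qed
  then show ?thesis using markov_step[OF h \<phi> Q] by simp
qed

end

section \<open>Hitting a ball at grid times\<close>

lemma resolvent_finite: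
  assumes l: "l > 0" and e: "e > 0"
  shows "resolvent l e (x :: real ^ 'd) < \<infinity>"
proof -
  let ?C = "(1 / sqrt (2 * pi * e)) ^ CARD('d)"
  have pkC: "heat_kernel t x \<le> ?C" if t: "t > e" for t
  proof -
    have "(1 / sqrt (2 * pi * t)) ^ CARD('d) \<le> ?C"
      using t e by (intro power_mono divide_left_mono mult_pos_pos) auto
    moreover have "exp (- (norm x)\<^sup>2 / (2 * t)) \<le> 1" using t e by simp
    ultimately have "(1 / sqrt (2 * pi * t)) ^ CARD('d) * exp (- (norm x)\<^sup>2 / (2 * t)) \<le> ?C * 1"
      by (intro mult_mono) (use e in auto)
    then show ?thesis using heat_kernel_eq[of t x] t e by simp
  qed
  have C0: "?C \<ge> 0" using e by simp
  have E: "(\<integral>\<^sup>+t. ennreal (exp (- l * t)) * indicator {e..} t \<partial>lborel) = ennreal (0 - (- exp (- l * e) / l))"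
  proof (rule nn_integral_FTC_atLeast)
    show "((\<lambda>t. - exp (- l * t) / l) has_real_derivative exp (- l * t)) (at t)" for t
      using l by (auto intro!: derivative_eq_intros)
    show "((\<lambda>t. - exp (- l * t) / l) \<longlongrightarrow> 0) at_top" using l by real_asymp
  qed auto
  have "resolvent l e x \<le> (\<integral>\<^sup>+t. ennreal ?C * (ennreal (exp (- l * t)) * indicator {e..} t) \<partial>lborel)"
    unfolding resolvent_def
  proof (intro nn_integral_mono)
    fix t :: real
    show "ennreal (exp (- l * t) * heat_kernel t x) * indicator {e<..} t \<le> ennreal ?C * (ennreal (exp (- l * t)) * indicator {e..} t)"
    proof (cases "t > e")
      case True
      have "exp (- l * t) * heat_kernel t x \<le> ?C * exp (- l * t)" using pkC[OF True] by (simp add: mult.commute mult_left_mono)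
      then show ?thesis using True C0 by (simp add: ennreal_mult[symmetric] ennreal_leI)
    qed simp
  qed
  also have "\<dots> = ennreal ?C * ennreal (0 - (- exp (- l * e) / l))" unfolding E[symmetric] by (rule nn_integral_cmult) simp
  also have "\<dots> < \<infinity>" by (simp add: ennreal_mult_less_top)
  finally show ?thesis .
qed

text \<open>The exponential beats every power of \<open>t\<close>.  Moving the cutoff of the resolvent from \<open>e\<close>
  to \<open>e + h\<close> therefore costs at most \<open>C (e + h) h\<close> away from the origin, little enough to be summed
  over the steps of the walk.\<close>

lemma heat_kernel_small_time:
  assumes \<rho>: "\<rho> > 0"
  shows "\<exists>C\<ge>0. \<forall>t y. 0 < t \<longrightarrow> t \<le> 1 \<longrightarrow> \<rho> \<le> norm (y :: real ^ 'd) \<longrightarrow> heat_kernel t y \<le> C * t"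
proof -
  define m where "m = CARD('d) + 1"
  define a where "a = \<rho>\<^sup>2 / 2"
  have a: "a > 0" using \<rho> by (simp add: a_def)
  define C where "C = fact m / a ^ m"
  show ?thesis
  proof (intro exI[of _ C] conjI allI impI)
    show "C \<ge> 0" using a by (simp add: C_def)
    fix t :: real and y :: "real ^ 'd" assume t: "0 < t" "t \<le> 1" and y: "\<rho> \<le> norm y"
    have "\<rho>\<^sup>2 \<le> (norm y)\<^sup>2" using y \<rho> by (intro power_mono) auto
    then have "a / t \<le> (norm y)\<^sup>2 / (2 * t)" using t by (simp add: a_def field_simps)
    then have 1: "exp (- (norm y)\<^sup>2 / (2 * t)) \<le> exp (- (a / t))" by simp
    have "(a / t) ^ m / fact m \<le> exp (a / t)"
    proof -
      have s: "(\<lambda>k. (a/t) ^ k /\<^sub>R fact k) sums exp (a/t)" by (rule exp_converges)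
      have "(\<Sum>k\<in>{m}. (a/t) ^ k /\<^sub>R fact k) \<le> (\<Sum>k. (a/t) ^ k /\<^sub>R fact k)"
        using a t by (intro sum_le_suminf sums_summable[OF s]) auto
      then show ?thesis using s by (simp add: sums_iff field_simps)
    qed
    then have "exp (- (a / t)) \<le> fact m / (a / t) ^ m"
      using a t by (simp add: exp_minus field_simps)
    also have "\<dots> = C * t ^ m" using t by (simp add: C_def power_divide)
    finally have 2: "exp (- (norm y)\<^sup>2 / (2 * t)) \<le> C * t ^ m" by (rule order_trans[OF 1])
    have "1 / sqrt (2 * pi * t) \<le> 1 / t"
    proof (rule divide_left_mono)
      have "t * t \<le> 2 * pi * t"
        using t pi_gt3 by (intro mult_right_mono) auto
      then show "t \<le> sqrt (2 * pi * t)" using t by (intro real_le_rsqrt) (simp add: power2_eq_square)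
    qed (use t in auto)
    then have "(1 / sqrt (2 * pi * t)) ^ CARD('d) \<le> (1 / t) ^ CARD('d)" using t by (intro power_mono) auto
    then have "heat_kernel t y \<le> (1 / t) ^ CARD('d) * (C * t ^ m)"
      unfolding heat_kernel_eq[OF t(1)] using 2 t by (intro mult_mono) auto
    also have "\<dots> = C * t" using t by (simp add: m_def power_divide)
    finally show "heat_kernel t y \<le> C * t" .
  qed
qed

context standard_brownian_motion
begin

lemma alive_sets [measurable]: "h > 0 \<Longrightarrow> alive h \<rho> x k \<inter> space \<Omega> \<in> sets \<Omega>"
proof -
  assume "h > 0"
  then have [measurable]: "walk h x j \<in> borel_measurable \<Omega>" for j by simp
  have "alive h \<rho> x k \<inter> space \<Omega> = {\<omega> \<in> space \<Omega>. \<forall>j\<in>{..k}. norm (walk h x j \<omega>) > \<rho>}" by (auto simp: alive_def)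
  also have "\<dots> \<in> sets \<Omega>" by measurable
  finally show ?thesis .
qed

lemma first_hit_sets [measurable]: "h > 0 \<Longrightarrow> first_hit h \<rho> x k \<inter> space \<Omega> \<in> sets \<Omega>"
proof -
  assume "h > 0"
  then have [measurable]: "walk h x j \<in> borel_measurable \<Omega>" for j by simp
  have "first_hit h \<rho> x k \<inter> space \<Omega> = {\<omega> \<in> space \<Omega>. (\<forall>j\<in>{..<k}. norm (walk h x j \<omega>) > \<rho>) \<and> norm (walk h x k \<omega>) \<le> \<rho>}" by (auto simp: first_hit_def)
  also have "\<dots> \<in> sets \<Omega>" by measurable
  finally show ?thesis .
qed

lemma indicator_measurable_Int:
  assumes "A \<inter> space \<Omega> \<in> sets \<Omega>"
  shows "(indicator A :: _ \<Rightarrow> ennreal) \<in> borel_measurable \<Omega>"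
  using borel_measurable_indicator_iff[of A \<Omega>] assms by auto

lemma alive_first_hit_measurable [measurable]:
  assumes "h > 0"
  shows "(indicator (alive h \<rho> x k) :: _ \<Rightarrow> ennreal) \<in> borel_measurable \<Omega>" "(indicator (first_hit h \<rho> x k) :: _ \<Rightarrow> ennreal) \<in> borel_measurable \<Omega>"
  using alive_sets[OF assms] first_hit_sets[OF assms] indicator_measurable_Int by auto

lemma alive_split: "(indicator (alive h \<rho> x n) \<omega> :: ennreal) = indicator (alive h \<rho> x (Suc n)) \<omega> + indicator (first_hit h \<rho> x (Suc n)) \<omega>"
  by (auto simp: alive_def first_hit_def indicator_def le_Suc_eq less_Suc_eq_le)

text \<open>The expected resolvent at the walk's position at step \<open>n\<close>, split by whether the walk still
  survives or enters the ball at that step.\<close>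

definition survive_part :: "real \<Rightarrow> real \<Rightarrow> real \<Rightarrow> real \<Rightarrow> real ^ 'd \<Rightarrow> nat \<Rightarrow> ennreal" where
  "survive_part l h \<rho> e x n = (\<integral>\<^sup>+\<omega>. indicator (alive h \<rho> x n) \<omega> * resolvent l e (walk h x n \<omega>) \<partial>\<Omega>)"
definition hit_part :: "real \<Rightarrow> real \<Rightarrow> real \<Rightarrow> real \<Rightarrow> real ^ 'd \<Rightarrow> nat \<Rightarrow> ennreal" where
  "hit_part l h \<rho> e x n = (\<integral>\<^sup>+\<omega>. indicator (first_hit h \<rho> x n) \<omega> * resolvent l e (walk h x n \<omega>) \<partial>\<Omega>)"

text \<open>One step of the walk moves the cutoff by \<open>h\<close> and discounts by \<open>exp (- l h)\<close>.\<close>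

lemma survive_part_step:
  assumes h: "h > 0" and e: "e \<ge> 0"
  shows "ennreal (exp (- l * h)) * (survive_part l h \<rho> e x (Suc n) + hit_part l h \<rho> e x (Suc n)) = survive_part l h \<rho> (e + h) x n"
proof -
  note [measurable] = alive_first_hit_measurable[OF h] walk_measurable[OF h]
  have "survive_part l h \<rho> e x (Suc n) + hit_part l h \<rho> e x (Suc n) = (\<integral>\<^sup>+\<omega>. indicator (alive h \<rho> x n) \<omega> * resolvent l e (walk h x (Suc n) \<omega>) \<partial>\<Omega>)"
    unfolding survive_part_def hit_part_def by (subst nn_integral_add[symmetric]) (measurable, simp add: alive_split[of _ _ _ n] distrib_right)
  also have "\<dots> = (\<integral>\<^sup>+\<omega>. indicator (alive h \<rho> x n) \<omega> * (\<integral>\<^sup>+y. ennreal (heat_kernel h y) * resolvent l e (walk h x n \<omega> + y) \<partial>lborel) \<partial>\<Omega>)"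
    by (rule alive_step[OF h]) simp
  finally have "ennreal (exp (- l * h)) * (survive_part l h \<rho> e x (Suc n) + hit_part l h \<rho> e x (Suc n)) =
     (\<integral>\<^sup>+\<omega>. ennreal (exp (- l * h)) * (indicator (alive h \<rho> x n) \<omega> * (\<integral>\<^sup>+y. ennreal (heat_kernel h y) * resolvent l e (walk h x n \<omega> + y) \<partial>lborel)) \<partial>\<Omega>)"
  proof -
    assume eq: "survive_part l h \<rho> e x (Suc n) + hit_part l h \<rho> e x (Suc n) = (\<integral>\<^sup>+\<omega>. indicator (alive h \<rho> x n) \<omega> * (\<integral>\<^sup>+y. ennreal (heat_kernel h y) * resolvent l e (walk h x n \<omega> + y) \<partial>lborel) \<partial>\<Omega>)"
    have "(\<lambda>v. \<integral>\<^sup>+y. ennreal (heat_kernel h y) * resolvent l e (v + y) \<partial>lborel) \<in> borel_measurable borel" by measurable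
    from measurable_compose[OF walk_measurable[OF h] this]
    have "(\<lambda>\<omega>. indicator (alive h \<rho> x n) \<omega> * (\<integral>\<^sup>+y. ennreal (heat_kernel h y) * resolvent l e (walk h x n \<omega> + y) \<partial>lborel)) \<in> borel_measurable \<Omega>"
      by measurable
    from nn_integral_cmult[OF this] show ?thesis unfolding eq by simp
  qed
  also have "\<dots> = survive_part l h \<rho> (e + h) x n"
    unfolding survive_part_def
    by (intro nn_integral_cong) (simp add: resolvent_step[OF h e, symmetric] mult.left_commute)
  finally show ?thesis .
qed

lemma survive_part_0: "survive_part l h \<rho> e x 0 = (if norm x > \<rho> then resolvent l e x else 0)"
  unfolding survive_part_def alive_def walk_def by (simp add: emeasure_space_1)

text \<open>Iterating one-step conditioning; dropping the time between \<open>e\<close> and \<open>e + h\<close> in each step only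
  decreases the resolvent.\<close>

lemma survive_part_sum_le:
  assumes h: "h > 0" and e: "e \<ge> 0"
  shows "ennreal (exp (- l * h)) ^ n * survive_part l h \<rho> e x n + (\<Sum>k<n. ennreal (exp (- l * h)) ^ Suc k * hit_part l h \<rho> e x (Suc k)) \<le> resolvent l e x"
proof (induction n)
  case 0 show ?case by (simp add: survive_part_0)
next
  case (Suc n)
  let ?a = "ennreal (exp (- l * h))"
  have "?a * (survive_part l h \<rho> e x (Suc n) + hit_part l h \<rho> e x (Suc n)) \<le> survive_part l h \<rho> e x n"
    unfolding survive_part_step[OF h e] unfolding survive_part_def using h by (intro nn_integral_mono mult_left_mono resolvent_antimono) auto
  then have "?a ^ n * (?a * (survive_part l h \<rho> e x (Suc n) + hit_part l h \<rho> e x (Suc n))) \<le> ?a ^ n * survive_part l h \<rho> e x n"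
    by (rule mult_left_mono) simp
  then have "?a ^ Suc n * survive_part l h \<rho> e x (Suc n) + ?a ^ Suc n * hit_part l h \<rho> e x (Suc n) \<le> ?a ^ n * survive_part l h \<rho> e x n"
    by (simp add: distrib_left mult_ac)
  then have "?a ^ Suc n * survive_part l h \<rho> e x (Suc n) + ?a ^ Suc n * hit_part l h \<rho> e x (Suc n) + (\<Sum>k<n. ?a ^ Suc k * hit_part l h \<rho> e x (Suc k))
     \<le> ?a ^ n * survive_part l h \<rho> e x n + (\<Sum>k<n. ?a ^ Suc k * hit_part l h \<rho> e x (Suc k))"
    by (rule add_right_mono)
  from order_trans[OF this Suc.IH] show ?case unfolding sum.lessThan_Suc by (simp only: ac_simps)
qed

text \<open>The expectation of \<open>exp (- l T)\<close> for the first grid time \<open>T\<close> at which the walk is in the ball.\<close>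

definition walk_hit_laplace :: "real \<Rightarrow> real \<Rightarrow> real \<Rightarrow> real ^ 'd \<Rightarrow> ennreal" where
  "walk_hit_laplace l h \<rho> x = (\<Sum>k. ennreal (exp (- l * h)) ^ k * emeasure \<Omega> (first_hit h \<rho> x k \<inter> space \<Omega>))"

lemma emeasure_first_hit:
  assumes "h > 0"
  shows "(\<integral>\<^sup>+\<omega>. indicator (first_hit h \<rho> x k) \<omega> \<partial>\<Omega>) = emeasure \<Omega> (first_hit h \<rho> x k \<inter> space \<Omega>)"
proof -
  have "(\<integral>\<^sup>+\<omega>. indicator (first_hit h \<rho> x k) \<omega> \<partial>\<Omega>) = (\<integral>\<^sup>+\<omega>. indicator (first_hit h \<rho> x k \<inter> space \<Omega>) \<omega> \<partial>\<Omega>)"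
    by (intro nn_integral_cong) (auto simp: indicator_def)
  then show ?thesis using first_hit_sets[OF assms] by simp
qed

lemma first_hit_0: "norm x > \<rho> \<Longrightarrow> first_hit h \<rho> x 0 = {}"
  by (auto simp: first_hit_def walk_def)

text \<open>At the moment of entrance the walk is in the ball, where the resolvent is at least its value on
  the sphere.\<close>

lemma walk_hit_laplace_upper:
  fixes z :: "real ^ 'd"
  assumes h: "h > 0" and x: "norm x > \<rho>" and z: "norm z = \<rho>"
  shows "resolvent l 0 z * walk_hit_laplace l h \<rho> x \<le> resolvent l 0 (x :: real ^ 'd)"
proof -
  let ?a = "ennreal (exp (- l * h))" let ?P = "\<lambda>k. emeasure \<Omega> (first_hit h \<rho> x k \<inter> space \<Omega>)"
  have W: "resolvent l 0 z * ?P k \<le> hit_part l h \<rho> 0 x k" for k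
  proof -
    have "resolvent l 0 z * ?P k = (\<integral>\<^sup>+\<omega>. resolvent l 0 z * indicator (first_hit h \<rho> x k) \<omega> \<partial>\<Omega>)"
      unfolding emeasure_first_hit[OF h, symmetric] using h by (subst nn_integral_cmult) auto
    also have "\<dots> \<le> hit_part l h \<rho> 0 x k" unfolding hit_part_def
      by (intro nn_integral_mono) (auto simp: first_hit_def z indicator_def intro!: resolvent_mono_norm)
    finally show ?thesis .
  qed
  have "(\<Sum>k<n. ?a ^ k * (resolvent l 0 z * ?P k)) \<le> resolvent l 0 x" for n
  proof (cases n)
    case (Suc m)
    have "(\<Sum>k<Suc m. ?a ^ k * (resolvent l 0 z * ?P k)) = (\<Sum>k<m. ?a ^ Suc k * (resolvent l 0 z * ?P (Suc k)))"
      unfolding sum.lessThan_Suc_shift using first_hit_0[OF x] by simp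
    also have "\<dots> \<le> (\<Sum>k<m. ?a ^ Suc k * hit_part l h \<rho> 0 x (Suc k))" by (intro sum_mono mult_left_mono W) auto
    also have "\<dots> \<le> ?a ^ m * survive_part l h \<rho> 0 x m + (\<Sum>k<m. ?a ^ Suc k * hit_part l h \<rho> 0 x (Suc k))" by (simp add: add_increasing)
    also have "\<dots> \<le> resolvent l 0 x" by (rule survive_part_sum_le[OF h]) simp
    finally show ?thesis unfolding Suc .
  qed simp
  then have "(\<Sum>k. ?a ^ k * (resolvent l 0 z * ?P k)) \<le> resolvent l 0 x" by (intro suminf_le_const) auto
  also have "(\<Sum>k. ?a ^ k * (resolvent l 0 z * ?P k)) = resolvent l 0 z * walk_hit_laplace l h \<rho> x"
    unfolding walk_hit_laplace_def by (subst ennreal_suminf_cmult[symmetric]) (simp add: mult.left_commute)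
  finally show ?thesis .
qed

lemma resolvent_increment:
  assumes h: "h > 0" and e: "e \<ge> 0" and l: "l > 0" and s: "s \<ge> 0" and bd: "\<And>t. e < t \<Longrightarrow> t \<le> e + h \<Longrightarrow> heat_kernel t y \<le> s"
  shows "resolvent l e y \<le> resolvent l (e + h) y + ennreal (h * s)"
proof -
  have "resolvent l e y \<le> (\<integral>\<^sup>+t. ennreal (exp (- l * t) * heat_kernel t y) * indicator {e + h<..} t + ennreal s * indicator {e..e + h} t \<partial>lborel)"
    unfolding resolvent_def
  proof (intro nn_integral_mono)
    fix t :: real
    have "exp (- l * t) * heat_kernel t y \<le> s" if "e < t" "t \<le> e + h"
    proof -
      have "exp (- l * t) \<le> 1" using that e l by (simp add: mult_nonneg_nonneg)
      then have "exp (- l * t) * heat_kernel t y \<le> 1 * s" using bd[OF that] s by (intro mult_mono) auto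
      then show ?thesis by simp
    qed
    then show "ennreal (exp (- l * t) * heat_kernel t y) * indicator {e<..} t \<le> ennreal (exp (- l * t) * heat_kernel t y) * indicator {e + h<..} t + ennreal s * indicator {e..e + h} t"
      by (auto split: split_indicator intro!: ennreal_leI)
  qed
  also have "\<dots> = resolvent l (e + h) y + ennreal s * ennreal h"
    unfolding resolvent_def using h by (subst nn_integral_add) (auto simp: nn_integral_cmult)
  finally show ?thesis using h s by (simp add: ennreal_mult mult.commute)
qed

text \<open>Before entrance the walk is outside the ball, where the heat kernel is small for small times;
  the time lost in a step costs at most \<open>h s\<close>.\<close>

lemma survive_part_sum_ge:
  assumes h: "h > 0" and e: "e \<ge> 0" and l: "l > 0" and s: "s \<ge> 0" and x: "norm x > \<rho>"
    and bd: "\<And>t y. e < t \<Longrightarrow> t \<le> e + h \<Longrightarrow> \<rho> \<le> norm (y :: real ^ 'd) \<Longrightarrow> heat_kernel t y \<le> s"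
  shows "resolvent l e x \<le> ennreal (exp (- l * h)) ^ n * survive_part l h \<rho> e x n + (\<Sum>k<n. ennreal (exp (- l * h)) ^ Suc k * hit_part l h \<rho> e x (Suc k))
     + (\<Sum>k<n. ennreal (exp (- l * h)) ^ k * ennreal (h * s))"
proof (induction n)
  case 0 show ?case using x by (simp add: survive_part_0)
next
  case (Suc n)
  note [measurable] = alive_first_hit_measurable[OF h] walk_measurable[OF h]
  let ?a = "ennreal (exp (- l * h))"
  have "survive_part l h \<rho> e x n \<le> (\<integral>\<^sup>+\<omega>. indicator (alive h \<rho> x n) \<omega> * resolvent l (e + h) (walk h x n \<omega>) + ennreal (h * s) \<partial>\<Omega>)"
    unfolding survive_part_def
  proof (intro nn_integral_mono)
    fix \<omega>
    show "indicator (alive h \<rho> x n) \<omega> * resolvent l e (walk h x n \<omega>) \<le> indicator (alive h \<rho> x n) \<omega> * resolvent l (e + h) (walk h x n \<omega>) + ennreal (h * s)"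
    proof (cases "\<omega> \<in> alive h \<rho> x n")
      case True
      then have "norm (walk h x n \<omega>) > \<rho>" by (auto simp: alive_def)
      then show ?thesis using True bd by (simp add: resolvent_increment[OF h e l s])
    qed simp
  qed
  also have "\<dots> = survive_part l h \<rho> (e + h) x n + ennreal (h * s)"
    unfolding survive_part_def by (subst nn_integral_add) (auto simp: emeasure_space_1)
  finally have "survive_part l h \<rho> e x n \<le> ?a * (survive_part l h \<rho> e x (Suc n) + hit_part l h \<rho> e x (Suc n)) + ennreal (h * s)"
    unfolding survive_part_step[OF h e] .
  then have "?a ^ n * survive_part l h \<rho> e x n \<le> ?a ^ n * (?a * (survive_part l h \<rho> e x (Suc n) + hit_part l h \<rho> e x (Suc n)) + ennreal (h * s))"
    by (rule mult_left_mono) simp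
  also have "\<dots> = ?a ^ Suc n * survive_part l h \<rho> e x (Suc n) + ?a ^ Suc n * hit_part l h \<rho> e x (Suc n) + ?a ^ n * ennreal (h * s)"
    by (simp add: distrib_left mult_ac add_ac)
  finally have "?a ^ n * survive_part l h \<rho> e x n + (\<Sum>k<n. ?a ^ Suc k * hit_part l h \<rho> e x (Suc k)) + (\<Sum>k<n. ?a ^ k * ennreal (h * s))
    \<le> (?a ^ Suc n * survive_part l h \<rho> e x (Suc n) + ?a ^ Suc n * hit_part l h \<rho> e x (Suc n) + ?a ^ n * ennreal (h * s)) + (\<Sum>k<n. ?a ^ Suc k * hit_part l h \<rho> e x (Suc k)) + (\<Sum>k<n. ?a ^ k * ennreal (h * s))"
    by (intro add_right_mono)
  from order_trans[OF Suc.IH this] show ?case unfolding sum.lessThan_Suc by (simp only: ac_simps)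
qed

text \<open>Some increment that starts before time \<open>T\<close> is large; by continuity of paths this is unlikely on
  fine grids.\<close>

definition big_step :: "real \<Rightarrow> real \<Rightarrow> real \<Rightarrow> 'w set" where
  "big_step h T \<eta> = {\<omega> \<in> space \<Omega>. \<exists>k. real k * h \<le> T \<and> norm (incr h k \<omega>) \<ge> \<eta>}"

lemma big_step_sets [measurable]: "h > 0 \<Longrightarrow> big_step h T \<eta> \<in> sets \<Omega>"
proof -
  assume "h > 0"
  then have [measurable]: "incr h k \<in> borel_measurable \<Omega>" for k by simp
  show ?thesis unfolding big_step_def by measurable
qed

lemma first_hit_disjoint: "k \<noteq> j \<Longrightarrow> first_hit h \<rho> x k \<inter> first_hit h \<rho> x j = {}"
proof -
  have "first_hit h \<rho> x k \<inter> first_hit h \<rho> x j = {}" if "k < j" for k j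
    using that by (force simp: first_hit_def)
  then show "k \<noteq> j \<Longrightarrow> ?thesis" by (metis Int_commute linorder_neqE_nat)
qed

text \<open>At the moment of entrance the walk may have jumped deep into the ball, where the resolvent is
  larger than on the sphere of radius \<open>\<rho>'\<close>.  That requires an increment of size \<open>\<rho> - \<rho>'\<close>, hence either
  a big step before time \<open>T\<close> or an entrance after \<open>T\<close>, which is discounted by \<open>exp (- l T)\<close>.\<close>

lemma walk_hit_laplace_lower:
  fixes z :: "real ^ 'd"
  assumes h: "0 < h" and e: "0 < e" and l: "l > 0" and s: "s \<ge> 0" and x: "norm x > \<rho>"
    and bd: "\<And>t y. e < t \<Longrightarrow> t \<le> e + h \<Longrightarrow> \<rho> \<le> norm (y :: real ^ 'd) \<Longrightarrow> heat_kernel t y \<le> s"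
    and z: "norm z = \<rho>'" and \<rho>': "0 \<le> \<rho>'" "\<rho>' < \<rho>"
  shows "resolvent l e x \<le> resolvent l e z * walk_hit_laplace l h \<rho> x + resolvent l e (0 :: real ^ 'd) * (emeasure \<Omega> (big_step h T (\<rho> - \<rho>')) + ennreal (exp (- l * T))) + ennreal (s * (1 / l + h))"
proof -
  note [measurable] = alive_first_hit_measurable[OF h] walk_measurable[OF h]
  let ?a = "ennreal (exp (- l * h))" let ?P = "\<lambda>k. emeasure \<Omega> (first_hit h \<rho> x k \<inter> space \<Omega>)"
  let ?U = "resolvent l e (0 :: real ^ 'd)"
  have U: "resolvent l e y \<le> ?U" for y :: "real ^ 'd" using e by (intro resolvent_mono_norm) auto
  have fin: "?U < \<infinity>" by (rule resolvent_finite[OF l e])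
  \<comment> \<open>entrance at step \<open>k\<close> with a jump beyond the sphere of radius \<open>\<rho>'\<close>\<close>
  define D where "D k = first_hit h \<rho> x k \<inter> {\<omega> \<in> space \<Omega>. norm (walk h x k \<omega>) < \<rho>'}" for k
  have Dm: "D k \<in> sets \<Omega>" for k
  proof -
    have "D k = (first_hit h \<rho> x k \<inter> space \<Omega>) \<inter> {\<omega> \<in> space \<Omega>. norm (walk h x k \<omega>) < \<rho>'}" by (auto simp: D_def)
    also have "\<dots> \<in> sets \<Omega>" by (rule sets.Int[OF first_hit_sets[OF h]]) measurable
    finally show ?thesis .
  qed
  have W: "hit_part l h \<rho> e x k \<le> resolvent l e z * ?P k + ?U * emeasure \<Omega> (D k)" for k
  proof -
    have "hit_part l h \<rho> e x k \<le> (\<integral>\<^sup>+\<omega>. resolvent l e z * indicator (first_hit h \<rho> x k) \<omega> + ?U * indicator (D k) \<omega> \<partial>\<Omega>)"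
      unfolding hit_part_def
    proof (intro nn_integral_mono)
      fix \<omega> assume \<omega>: "\<omega> \<in> space \<Omega>"
      show "indicator (first_hit h \<rho> x k) \<omega> * resolvent l e (walk h x k \<omega>) \<le> resolvent l e z * indicator (first_hit h \<rho> x k) \<omega> + ?U * indicator (D k) \<omega>"
      proof (cases "norm (walk h x k \<omega>) < \<rho>'")
        case True
        show ?thesis
        proof (cases "\<omega> \<in> first_hit h \<rho> x k")
          case f: True
          then have "\<omega> \<in> D k" using True \<omega> by (simp add: D_def)
          then show ?thesis using f U[of "walk h x k \<omega>"] by (simp add: add_increasing)
        qed simp
      next
        case False
        then have "resolvent l e (walk h x k \<omega>) \<le> resolvent l e z" using e by (intro resolvent_mono_norm) (auto simp: z)
        then show ?thesis by (auto simp: indicator_def intro: add_increasing2)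
      qed
    qed
    also have "\<dots> = resolvent l e z * ?P k + ?U * emeasure \<Omega> (D k)"
    proof -
      have "(\<integral>\<^sup>+\<omega>. resolvent l e z * indicator (first_hit h \<rho> x k) \<omega> + ?U * indicator (D k) \<omega> \<partial>\<Omega>)
        = (\<integral>\<^sup>+\<omega>. resolvent l e z * indicator (first_hit h \<rho> x k) \<omega> \<partial>\<Omega>) + (\<integral>\<^sup>+\<omega>. ?U * indicator (D k) \<omega> \<partial>\<Omega>)"
      proof (rule nn_integral_add)
        show "(\<lambda>\<omega>. resolvent l e z * indicator (first_hit h \<rho> x k) \<omega>) \<in> borel_measurable \<Omega>"
          by (intro borel_measurable_times_ennreal borel_measurable_const alive_first_hit_measurable h)
        show "(\<lambda>\<omega>. ?U * indicator (D k) \<omega>) \<in> borel_measurable \<Omega>"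
          by (intro borel_measurable_times_ennreal borel_measurable_const borel_measurable_indicator Dm)
      qed
      also have "(\<integral>\<^sup>+\<omega>. resolvent l e z * indicator (first_hit h \<rho> x k) \<omega> \<partial>\<Omega>) = resolvent l e z * ?P k"
        unfolding emeasure_first_hit[OF h, symmetric] by (rule nn_integral_cmult) measurable
      also have "(\<integral>\<^sup>+\<omega>. ?U * indicator (D k) \<omega> \<partial>\<Omega>) = ?U * emeasure \<Omega> (D k)"
        by (rule nn_integral_cmult_indicator[OF Dm])
      finally show ?thesis .
    qed
    finally show ?thesis .
  qed
  have disj: "disjoint_family D"
  proof -
    have "D i \<inter> D j \<subseteq> first_hit h \<rho> x i \<inter> first_hit h \<rho> x j" for i j unfolding D_def by blast
    then show ?thesis unfolding disjoint_family_on_def using first_hit_disjoint by blast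
  qed
  have DT: "(\<Sum>k. ?a ^ k * emeasure \<Omega> (D k)) \<le> emeasure \<Omega> (big_step h T (\<rho> - \<rho>')) + ennreal (exp (- l * T))"
  proof -
    define J where "J k = (if real k * h \<le> T then emeasure \<Omega> (D k) else 0)" for k
    have "?a ^ k * emeasure \<Omega> (D k) \<le> J k + ennreal (exp (- l * T)) * emeasure \<Omega> (D k)" for k
    proof (cases "real k * h \<le> T")
      case True
      have "?a \<le> 1" using l h by simp
      then have "?a ^ k * emeasure \<Omega> (D k) \<le> 1 * emeasure \<Omega> (D k)" by (intro mult_right_mono power_le_one) auto
      then show ?thesis using True by (simp add: J_def add_increasing2)
    next
      case False
      have "?a ^ k = ennreal (exp (- l * (real k * h)))" by (simp add: ennreal_power exp_of_nat_mult[symmetric] mult_ac)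
      also have "\<dots> \<le> ennreal (exp (- l * T))" using False l by (intro ennreal_leI) simp
      finally show ?thesis by (simp add: J_def False mult_right_mono)
    qed
    then have "(\<Sum>k. ?a ^ k * emeasure \<Omega> (D k)) \<le> (\<Sum>k. J k + ennreal (exp (- l * T)) * emeasure \<Omega> (D k))"
      by (intro suminf_le) auto
    also have "\<dots> = (\<Sum>k. J k) + ennreal (exp (- l * T)) * (\<Sum>k. emeasure \<Omega> (D k))"
      by (subst suminf_add[symmetric]) auto
    also have "(\<Sum>k. emeasure \<Omega> (D k)) = emeasure \<Omega> (\<Union>k. D k)" using Dm disj by (intro suminf_emeasure) auto
    also have "ennreal (exp (- l * T)) * emeasure \<Omega> (\<Union>k. D k) \<le> ennreal (exp (- l * T)) * 1"
      by (intro mult_left_mono emeasure_le_1) auto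
    also have "(\<Sum>k. J k) \<le> emeasure \<Omega> (big_step h T (\<rho> - \<rho>'))"
    proof -
      define D' where "D' k = (if real k * h \<le> T then D k else {})" for k
      have "(\<Sum>k. J k) = (\<Sum>k. emeasure \<Omega> (D' k))" by (intro suminf_cong) (simp add: J_def D'_def)
      also have "\<dots> = emeasure \<Omega> (\<Union>k. D' k)"
        using Dm disj by (intro suminf_emeasure) (auto simp: D'_def disjoint_family_on_def)
      also have "\<dots> \<le> emeasure \<Omega> (big_step h T (\<rho> - \<rho>'))"
      proof (rule emeasure_mono)
        show "(\<Union>k. D' k) \<subseteq> big_step h T (\<rho> - \<rho>')"
        proof
          fix \<omega> assume "\<omega> \<in> (\<Union>k. D' k)"
          then obtain k where k: "real k * h \<le> T" "\<omega> \<in> D k" by (auto simp: D'_def split: if_splits)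
          then have "k \<noteq> 0" using first_hit_0[OF x] by (auto simp: D_def intro: ccontr)
          then obtain j where j: "k = Suc j" by (cases k) auto
          have "norm (walk h x j \<omega>) > \<rho>" "norm (walk h x k \<omega>) < \<rho>'" "\<omega> \<in> space \<Omega>" using k by (auto simp: D_def first_hit_def j)
          moreover have "norm (walk h x j \<omega>) \<le> norm (walk h x k \<omega>) + norm (incr h j \<omega>)"
            unfolding j walk_Suc by (rule norm_triangle_sub[of "walk h x j \<omega>" "walk h x j \<omega> + incr h j \<omega>", THEN order_trans]) simp
          ultimately have "norm (incr h j \<omega>) \<ge> \<rho> - \<rho>'" by linarith
          moreover have "real j * h \<le> T" using k h unfolding j by (simp add: algebra_simps)
          ultimately show "\<omega> \<in> big_step h T (\<rho> - \<rho>')" using \<open>\<omega> \<in> space \<Omega>\<close> by (auto simp: big_step_def)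
        qed
      qed (rule big_step_sets[OF h])
      finally show ?thesis .
    qed
    finally show ?thesis by (simp add: add_right_mono)
  qed
  have geo: "(\<Sum>k<n. ?a ^ k * ennreal (h * s)) \<le> ennreal (s * (1 / l + h))" for n
  proof -
    let ?r = "exp (- l * h)"
    have r: "0 < ?r" "?r < 1" using l h by auto
    have "(\<Sum>k<n. ?a ^ k * ennreal (h * s)) = ennreal (\<Sum>k<n. ?r ^ k * (h * s))"
      using h s by (subst sum_ennreal[symmetric]) (auto simp: ennreal_power ennreal_mult[symmetric] simp del: sum_ennreal)
    also have "\<dots> \<le> ennreal (s * (1 / l + h))"
    proof (rule ennreal_leI)
      have "(\<Sum>k<n. ?r ^ k) \<le> 1 / (1 - ?r)"
      proof -
        have "(\<Sum>k<n. r ^ k) \<le> 1 / (1 - r)" if "0 < r" "r < 1" for r :: real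
          using that by (simp add: sum_gp_strict divide_right_mono)
        from this[OF r] show ?thesis .
      qed
      also have "\<dots> \<le> (1 + l * h) / (l * h)"
      proof -
        have "1 + l * h \<le> exp (l * h)" by (rule exp_ge_add_one_self)
        then have "?r * (1 + l * h) \<le> 1" using mult_left_mono[of "1 + l * h" "exp (l * h)" ?r] by (simp flip: exp_add)
        then have "1 * (l * h) \<le> (1 + l * h) * (1 - ?r)" by (simp add: algebra_simps)
        then show ?thesis using r l h by (simp add: frac_le_eq divide_le_eq le_divide_eq)
      qed
      finally have "(\<Sum>k<n. ?r ^ k) * (h * s) \<le> (1 + l * h) / (l * h) * (h * s)" using h s by (intro mult_right_mono) auto
      also have "\<dots> = s * (1 / l + h)" using l h by (simp add: field_simps)
      finally show "(\<Sum>k<n. ?r ^ k * (h * s)) \<le> s * (1 / l + h)" by (simp add: sum_distrib_right)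
    qed
    finally show ?thesis .
  qed
  let ?R = "resolvent l e z * walk_hit_laplace l h \<rho> x + ?U * (emeasure \<Omega> (big_step h T (\<rho> - \<rho>')) + ennreal (exp (- l * T))) + ennreal (s * (1 / l + h))"
  have main: "resolvent l e x \<le> ?a ^ n * ?U + ?R" for n
  proof -
    have Vn: "survive_part l h \<rho> e x n \<le> ?U"
    proof -
      have "survive_part l h \<rho> e x n \<le> (\<integral>\<^sup>+\<omega>. ?U \<partial>\<Omega>)" unfolding survive_part_def
        by (intro nn_integral_mono) (use U in \<open>auto simp: indicator_def\<close>)
      then show ?thesis by (simp add: emeasure_space_1)
    qed
    have "(\<Sum>k<n. ?a ^ Suc k * hit_part l h \<rho> e x (Suc k)) \<le> (\<Sum>k<n. ?a ^ Suc k * (resolvent l e z * ?P (Suc k) + ?U * emeasure \<Omega> (D (Suc k))))"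
      by (intro sum_mono mult_left_mono W) auto
    also have "\<dots> \<le> (\<Sum>k<Suc n. ?a ^ k * (resolvent l e z * ?P k + ?U * emeasure \<Omega> (D k)))"
      unfolding sum.lessThan_Suc_shift by simp
    also have "\<dots> \<le> (\<Sum>k. ?a ^ k * (resolvent l e z * ?P k + ?U * emeasure \<Omega> (D k)))"
      by (intro sum_le_suminf) auto
    also have "\<dots> = (\<Sum>k. resolvent l e z * (?a ^ k * ?P k) + ?U * (?a ^ k * emeasure \<Omega> (D k)))"
      by (simp add: distrib_left mult_ac)
    also have "\<dots> = resolvent l e z * walk_hit_laplace l h \<rho> x + ?U * (\<Sum>k. ?a ^ k * emeasure \<Omega> (D k))"
      unfolding walk_hit_laplace_def by (subst suminf_add[symmetric]) auto
    also have "\<dots> \<le> resolvent l e z * walk_hit_laplace l h \<rho> x + ?U * (emeasure \<Omega> (big_step h T (\<rho> - \<rho>')) + ennreal (exp (- l * T)))"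
      by (intro add_left_mono mult_left_mono DT) auto
    finally have 1: "(\<Sum>k<n. ?a ^ Suc k * hit_part l h \<rho> e x (Suc k)) \<le> resolvent l e z * walk_hit_laplace l h \<rho> x + ?U * (emeasure \<Omega> (big_step h T (\<rho> - \<rho>')) + ennreal (exp (- l * T)))" .
    have "resolvent l e x \<le> ?a ^ n * survive_part l h \<rho> e x n + (\<Sum>k<n. ?a ^ Suc k * hit_part l h \<rho> e x (Suc k)) + (\<Sum>k<n. ?a ^ k * ennreal (h * s))"
      by (rule survive_part_sum_ge[OF h less_imp_le[OF e] l s x bd])
    also have "\<dots> \<le> ?a ^ n * ?U + (resolvent l e z * walk_hit_laplace l h \<rho> x + ?U * (emeasure \<Omega> (big_step h T (\<rho> - \<rho>')) + ennreal (exp (- l * T)))) + ennreal (s * (1 / l + h))"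
      by (intro add_mono 1 geo mult_left_mono Vn) auto
    finally show ?thesis by (simp add: add_ac)
  qed
  have "(\<lambda>n. ?a ^ n * ?U + ?R) \<longlonglongrightarrow> 0 * ?U + ?R"
  proof (intro tendsto_add tendsto_const)
    obtain u where u: "?U = ennreal u" "u \<ge> 0" using fin by (cases ?U) auto
    have "(\<lambda>n. exp (- l * h) ^ n * u) \<longlonglongrightarrow> 0 * u"
      using l h by (intro tendsto_mult_right LIMSEQ_power_zero) simp
    then have "(\<lambda>n. ennreal (exp (- l * h) ^ n * u)) \<longlonglongrightarrow> ennreal (0 * u)" by (rule tendsto_ennrealI)
    then show "(\<lambda>n. ?a ^ n * ?U) \<longlonglongrightarrow> 0 * ?U" unfolding u using u by (simp add: ennreal_power ennreal_mult)
  qed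
  then have "resolvent l e x \<le> 0 * ?U + ?R" by (rule LIMSEQ_le_const) (use main in auto)
  then show ?thesis by simp
qed

end

section \<open>From grid times to continuous time\<close>

context standard_brownian_motion
begin

definition hits :: "real \<Rightarrow> real ^ 'd \<Rightarrow> real \<Rightarrow> 'w \<Rightarrow> bool" where
  "hits r x t \<omega> \<longleftrightarrow> (\<exists>s. 0 \<le> s \<and> s \<le> t \<and> norm (x + B s \<omega>) \<le> r)"

lemma path_cont: "\<omega> \<in> space \<Omega> \<Longrightarrow> continuous_on {0..t} (\<lambda>s. x + B s \<omega>)"
  by (intro continuous_intros continuous_on_subset[OF continuous_paths]) auto

lemma hitting_time_le_iff:
  assumes \<omega>: "\<omega> \<in> space \<Omega>" and t: "t \<ge> 0"
  shows "hitting_time (cball 0 r) (\<lambda>s. x + B s \<omega>) \<le> ereal t \<longleftrightarrow> hits r x t \<omega>"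
proof
  assume "hits r x t \<omega>"
  then obtain s where s: "0 \<le> s" "s \<le> t" "norm (x + B s \<omega>) \<le> r" by (auto simp: hits_def)
  then show "hitting_time (cball 0 r) (\<lambda>s. x + B s \<omega>) \<le> ereal t"
    unfolding hitting_time_def by (intro INF_lower2[of s]) auto
next
  let ?S = "{s. 0 \<le> s \<and> x + B s \<omega> \<in> cball 0 r}"
  assume le: "hitting_time (cball 0 r) (\<lambda>s. x + B s \<omega>) \<le> ereal t"
  then have "(INF s\<in>?S. ereal s) < ereal (t + 1)" unfolding hitting_time_def
    by (rule order.strict_trans1) simp
  then obtain s1 where s1: "s1 \<in> ?S" "s1 < t + 1" unfolding INF_less_iff by auto
  have "closedin (top_of_set {0..t+1}) ({0..t+1} \<inter> (\<lambda>s. x + B s \<omega>) -` cball 0 r)"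
    by (rule continuous_closedin_preimage[OF path_cont[OF \<omega>]]) auto
  then have "compact ({0..t+1} \<inter> (\<lambda>s. x + B s \<omega>) -` cball 0 r)"
    using closedin_compact compact_Icc by blast
  moreover have "s1 \<in> {0..t+1} \<inter> (\<lambda>s. x + B s \<omega>) -` cball 0 r" using s1 by auto
  then have "{0..t+1} \<inter> (\<lambda>s. x + B s \<omega>) -` cball 0 r \<noteq> {}" by blast
  ultimately obtain s0 where s0: "s0 \<in> {0..t+1} \<inter> (\<lambda>s. x + B s \<omega>) -` cball 0 r"
    "\<And>s. s \<in> {0..t+1} \<inter> (\<lambda>s. x + B s \<omega>) -` cball 0 r \<Longrightarrow> s0 \<le> s"
    using compact_attains_inf by metis
  have "ereal s0 \<le> (INF s\<in>?S. ereal s)"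
  proof (rule INF_greatest)
    fix s assume "s \<in> ?S"
    then have s: "0 \<le> s" "x + B s \<omega> \<in> cball 0 r" by auto
    show "ereal s0 \<le> ereal s"
    proof (cases "s \<le> t + 1")
      case True
      then have "s \<in> {0..t+1} \<inter> (\<lambda>s. x + B s \<omega>) -` cball 0 r" using s by simp
      then show ?thesis using s0(2) by simp
    next
      case False
      then show ?thesis using s0(1) by simp
    qed
  qed
  from order_trans[OF this le[unfolded hitting_time_def]] have "s0 \<le> t" by simp
  then show "hits r x t \<omega>" using s0(1) by (auto simp: hits_def)
qed

text \<open>Continuity of the path lets the closed condition be tested at rational times with open
  neighbourhoods, which makes the event measurable.\<close>

lemma hits_rational:
  assumes \<omega>: "\<omega> \<in> space \<Omega>" and t: "t \<ge> 0"
  shows "hits r x t \<omega> \<longleftrightarrow> (\<forall>n::nat. \<exists>q\<in>\<rat> \<inter> {0..}. q \<le> t \<and> norm (x + B q \<omega>) < r + 1 / real (Suc n))"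
proof
  assume "hits r x t \<omega>"
  then obtain s where s: "0 \<le> s" "s \<le> t" "norm (x + B s \<omega>) \<le> r" by (auto simp: hits_def)
  show "\<forall>n::nat. \<exists>q\<in>\<rat> \<inter> {0..}. q \<le> t \<and> norm (x + B q \<omega>) < r + 1 / real (Suc n)"
  proof
    fix n
    have "continuous_on {0..t} (\<lambda>s. norm (x + B s \<omega>))" by (intro continuous_on_norm path_cont[OF \<omega>])
    moreover have "s \<in> {0..t}" using s by simp
    moreover have e: "0 < 1 / real (Suc n)" by simp
    ultimately obtain d where d: "d > 0" "\<And>s'. s' \<in> {0..t} \<Longrightarrow> dist s' s < d \<Longrightarrow> dist (norm (x + B s' \<omega>)) (norm (x + B s \<omega>)) < 1 / real (Suc n)"
      unfolding continuous_on_iff by meson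
    have "\<exists>q\<in>\<rat>. q \<in> {0..t} \<and> dist q s < d"
    proof (cases "t = 0")
      case True then show ?thesis using s d by (intro bexI[of _ 0]) auto
    next
      case False
      then have "max 0 (s - d) < min t (s + d)" using s d t by auto
      then obtain q where "q \<in> \<rat>" "max 0 (s - d) < q" "q < min t (s + d)" using Rats_dense_in_real by blast
      then show ?thesis by (intro bexI[of _ q]) (auto simp: dist_real_def)
    qed
    then obtain q where q: "q \<in> \<rat>" "q \<in> {0..t}" "dist q s < d" by auto
    then have "norm (x + B q \<omega>) < r + 1 / real (Suc n)" using d(2)[of q] s by (auto simp: dist_real_def)
    then show "\<exists>q\<in>\<rat> \<inter> {0..}. q \<le> t \<and> norm (x + B q \<omega>) < r + 1 / real (Suc n)" using q by auto
  qed
next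
  assume h: "\<forall>n::nat. \<exists>q\<in>\<rat> \<inter> {0..}. q \<le> t \<and> norm (x + B q \<omega>) < r + 1 / real (Suc n)"
  obtain s where s: "s \<in> {0..t}" "\<And>s'. s' \<in> {0..t} \<Longrightarrow> norm (x + B s \<omega>) \<le> norm (x + B s' \<omega>)"
    using continuous_attains_inf[of "{0..t}" "\<lambda>s. norm (x + B s \<omega>)"] continuous_on_norm[OF path_cont[OF \<omega>]] t by auto
  have "norm (x + B s \<omega>) \<le> r"
  proof (rule field_le_epsilon)
    fix e :: real assume "e > 0"
    then obtain n where n: "1 / real (Suc n) < e" using nat_approx_posE by metis
    obtain q where "q \<in> {0..t}" "norm (x + B q \<omega>) < r + 1 / real (Suc n)" using h by fastforce
    then show "norm (x + B s \<omega>) \<le> r + e" using s(2)[of q] n by simp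
  qed
  then show "hits r x t \<omega>" using s by (auto simp: hits_def)
qed

text \<open>The hitting probability, defined through the countable description of the event so that it is
  jointly measurable in \<open>t\<close> and \<open>x\<close>.\<close>

definition hit_prob :: "real \<Rightarrow> real \<Rightarrow> real ^ 'd \<Rightarrow> ennreal" where
  "hit_prob r t x = emeasure \<Omega> {\<omega> \<in> space \<Omega>. \<forall>n::nat. \<exists>q\<in>\<rat> \<inter> {0..}. q \<le> t \<and> norm (x + B q \<omega>) < r + 1 / real (Suc n)}"

lemma hit_prob_eq: "t \<ge> 0 \<Longrightarrow> hit_prob r t x = emeasure \<Omega> {\<omega> \<in> space \<Omega>. hits r x t \<omega>}"
  unfolding hit_prob_def using hits_rational by (intro arg_cong[of _ _ "emeasure \<Omega>"]) auto

lemma hits_set_joint: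
  "{p \<in> space ((borel \<Otimes>\<^sub>M borel) \<Otimes>\<^sub>M \<Omega>). \<forall>n::nat. \<exists>q\<in>\<rat> \<inter> {0..}. q \<le> fst (fst p) \<and> norm (snd (fst p) + B q (snd p)) < r + 1 / real (Suc n)} \<in> sets ((borel \<Otimes>\<^sub>M borel) \<Otimes>\<^sub>M \<Omega>)"
proof -
  have c: "countable (\<rat> \<inter> {0..} :: real set)" by (intro countable_Int1 countable_rat)
  have "Measurable.pred ((borel \<Otimes>\<^sub>M borel) \<Otimes>\<^sub>M \<Omega>) (\<lambda>p. \<forall>n::nat. \<exists>q\<in>\<rat> \<inter> {0..}. q \<le> fst (fst p) \<and> norm (snd (fst p) + B q (snd p)) < r + 1 / real (Suc n))"
  proof (rule pred_intros_countable(1), rule measurable_pred_countable(2)[OF c])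
    fix n :: nat and q :: real assume "q \<in> \<rat> \<inter> {0..}"
    then have [measurable]: "B q \<in> borel_measurable \<Omega>" using measurable_B by auto
    show "Measurable.pred ((borel \<Otimes>\<^sub>M borel) \<Otimes>\<^sub>M \<Omega>) (\<lambda>p. q \<le> fst (fst p) \<and> norm (snd (fst p) + B q (snd p)) < r + 1 / real (Suc n))"
      by measurable
  qed
  then show ?thesis by measurable
qed

lemma hit_prob_measurable: "(\<lambda>(t, x). hit_prob r t x) \<in> borel_measurable (borel \<Otimes>\<^sub>M borel)"
proof -
  have "(\<lambda>p. emeasure \<Omega> (Pair p -` {p \<in> space ((borel \<Otimes>\<^sub>M borel) \<Otimes>\<^sub>M \<Omega>). \<forall>n::nat. \<exists>q\<in>\<rat> \<inter> {0..}. q \<le> fst (fst p) \<and> norm (snd (fst p) + B q (snd p)) < r + 1 / real (Suc n)})) \<in> borel_measurable (borel \<Otimes>\<^sub>M borel)"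
    by (rule measurable_emeasure_Pair[OF hits_set_joint])
  moreover have "emeasure \<Omega> (Pair p -` {p \<in> space ((borel \<Otimes>\<^sub>M borel) \<Otimes>\<^sub>M \<Omega>). \<forall>n::nat. \<exists>q\<in>\<rat> \<inter> {0..}. q \<le> fst (fst p) \<and> norm (snd (fst p) + B q (snd p)) < r + 1 / real (Suc n)}) = hit_prob r (fst p) (snd p)" for p
    unfolding hit_prob_def by (intro arg_cong[of _ _ "emeasure \<Omega>"]) (auto simp: space_pair_measure)
  ultimately show ?thesis by (simp add: case_prod_beta')
qed

lemma hit_prob_measurable' [measurable (raw)]:
  assumes "f \<in> borel_measurable M" "g \<in> borel_measurable M"
  shows "(\<lambda>x. hit_prob r (f x) (g x)) \<in> borel_measurable M"
  using measurable_compose[OF measurable_Pair[OF assms] hit_prob_measurable] by simp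

lemma hits_sets:
  assumes "t \<ge> 0"
  shows "{\<omega> \<in> space \<Omega>. hits r x t \<omega>} \<in> sets \<Omega>"
proof -
  have c: "countable (\<rat> \<inter> {0..} :: real set)" by (intro countable_Int1 countable_rat)
  have "Measurable.pred \<Omega> (\<lambda>\<omega>. \<forall>n::nat. \<exists>q\<in>\<rat> \<inter> {0..}. q \<le> t \<and> norm (x + B q \<omega>) < r + 1 / real (Suc n))"
  proof (rule pred_intros_countable(1), rule measurable_pred_countable(2)[OF c])
    fix n :: nat and q :: real assume "q \<in> \<rat> \<inter> {0..}"
    then have [measurable]: "B q \<in> borel_measurable \<Omega>" using measurable_B by auto
    show "Measurable.pred \<Omega> (\<lambda>\<omega>. q \<le> t \<and> norm (x + B q \<omega>) < r + 1 / real (Suc n))" by measurable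
  qed
  then have "{\<omega> \<in> space \<Omega>. \<forall>n::nat. \<exists>q\<in>\<rat> \<inter> {0..}. q \<le> t \<and> norm (x + B q \<omega>) < r + 1 / real (Suc n)} \<in> sets \<Omega>" by measurable
  also have "{\<omega> \<in> space \<Omega>. \<forall>n::nat. \<exists>q\<in>\<rat> \<inter> {0..}. q \<le> t \<and> norm (x + B q \<omega>) < r + 1 / real (Suc n)} = {\<omega> \<in> space \<Omega>. hits r x t \<omega>}"
    using hits_rational[OF _ assms] by auto
  finally show ?thesis .
qed

lemma hitting_prob_eq: "t \<ge> 0 \<Longrightarrow> ennreal (hitting_prob \<Omega> B (cball 0 r) x t) = hit_prob r t x"
proof -
  assume t: "t \<ge> 0"
  have "{\<omega> \<in> space \<Omega>. hitting_time (cball 0 r) (\<lambda>s. x + B s \<omega>) \<le> ereal t} = {\<omega> \<in> space \<Omega>. hits r x t \<omega>}"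
    using hitting_time_le_iff[OF _ t] by auto
  then show ?thesis unfolding hitting_prob_def hit_prob_eq[OF t] by (simp add: emeasure_eq_measure)
qed

text \<open>The Laplace transform of the distribution of the hitting time: for a distribution function \<open>F\<close> on
  the half-line, \<open>l \<integral> exp (- l t) F(t) dt = \<integral> exp (- l t) dF(t)\<close>.\<close>

definition hit_laplace :: "real \<Rightarrow> real \<Rightarrow> real ^ 'd \<Rightarrow> ennreal" where
  "hit_laplace l r x = (\<integral>\<^sup>+t. ennreal (l * exp (- l * t)) * hit_prob r t x * indicator {0<..} t \<partial>lborel)"

definition walk_hits :: "real \<Rightarrow> real \<Rightarrow> real ^ 'd \<Rightarrow> real \<Rightarrow> 'w set" where
  "walk_hits h \<rho> x t = {\<omega> \<in> space \<Omega>. \<exists>k. real k * h \<le> t \<and> norm (walk h x k \<omega>) \<le> \<rho>}"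

lemma walk_hits_sets: "h > 0 \<Longrightarrow> walk_hits h \<rho> x t \<in> sets \<Omega>"
proof -
  assume "h > 0"
  then have [measurable]: "walk h x k \<in> borel_measurable \<Omega>" for k by simp
  show ?thesis unfolding walk_hits_def by measurable
qed

lemma emeasure_walk_hits:
  assumes h: "h > 0"
  shows "emeasure \<Omega> (walk_hits h \<rho> x t) = (\<Sum>k. indicator {real k * h..} t * emeasure \<Omega> (first_hit h \<rho> x k \<inter> space \<Omega>))"
proof -
  define F where "F k = (if real k * h \<le> t then first_hit h \<rho> x k \<inter> space \<Omega> else {})" for k
  have "walk_hits h \<rho> x t = (\<Union>k. F k)"
  proof (intro equalityI subsetI)
    fix \<omega> assume "\<omega> \<in> walk_hits h \<rho> x t"
    then obtain k where k: "\<omega> \<in> space \<Omega>" "real k * h \<le> t" "norm (walk h x k \<omega>) \<le> \<rho>" by (auto simp: walk_hits_def)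
    define j where "j = (LEAST k. norm (walk h x k \<omega>) \<le> \<rho>)"
    have j: "norm (walk h x j \<omega>) \<le> \<rho>" "j \<le> k" unfolding j_def
      by (rule LeastI[of "\<lambda>k. norm (walk h x k \<omega>) \<le> \<rho>" k, OF k(3)], rule Least_le[of "\<lambda>k. norm (walk h x k \<omega>) \<le> \<rho>" k, OF k(3)])
    have "norm (walk h x i \<omega>) > \<rho>" if "i < j" for i using not_less_Least[OF that[unfolded j_def]] by simp
    then have "\<omega> \<in> first_hit h \<rho> x j" unfolding first_hit_def using j by simp
    moreover have "real j * h \<le> t" using j(2) k(2) h by (meson mult_right_mono of_nat_le_iff less_imp_le order_trans)
    ultimately show "\<omega> \<in> (\<Union>k. F k)" using k by (auto simp: F_def)
  qed (auto simp: F_def walk_hits_def first_hit_def split: if_splits)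
  moreover have "(\<Sum>k. emeasure \<Omega> (F k)) = emeasure \<Omega> (\<Union>k. F k)"
  proof (rule suminf_emeasure)
    show "range F \<subseteq> sets \<Omega>" using first_hit_sets[OF h] by (auto simp: F_def)
    have "F i \<inter> F j \<subseteq> first_hit h \<rho> x i \<inter> first_hit h \<rho> x j" for i j unfolding F_def by auto
    then show "disjoint_family F" unfolding disjoint_family_on_def using first_hit_disjoint by blast
  qed
  moreover have "emeasure \<Omega> (F k) = indicator {real k * h..} t * emeasure \<Omega> (first_hit h \<rho> x k \<inter> space \<Omega>)" for k by (simp add: F_def indicator_def)
  ultimately show ?thesis by simp
qed

lemma exp_tail:
  assumes l: "l > 0"
  shows "(\<integral>\<^sup>+t. ennreal (l * exp (- l * t)) * indicator {a..} t \<partial>lborel) = ennreal (exp (- l * a))"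
proof -
  have "(\<integral>\<^sup>+t. ennreal (l * exp (- l * t)) * indicator {a..} t \<partial>lborel) = ennreal (0 - (- exp (- l * a)))"
  proof (rule nn_integral_FTC_atLeast)
    show "((\<lambda>t. - exp (- l * t)) has_real_derivative l * exp (- l * t)) (at t)" for t
      by (auto intro!: derivative_eq_intros)
    show "((\<lambda>t. - exp (- l * t)) \<longlongrightarrow> 0) at_top" using l by real_asymp
  qed (use l in auto)
  then show ?thesis by simp
qed

text \<open>Fubini: \<open>exp (- l k h)\<close> is the integral of \<open>l exp (- l t)\<close> over
  \<open>t \<ge> k h\<close>.\<close>

lemma walk_hit_laplace_eq:
  assumes h: "h > 0" and l: "l > 0"
  shows "walk_hit_laplace l h \<rho> x = (\<integral>\<^sup>+t. ennreal (l * exp (- l * t)) * emeasure \<Omega> (walk_hits h \<rho> x t) * indicator {0<..} t \<partial>lborel)"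
proof -
  let ?P = "\<lambda>k. emeasure \<Omega> (first_hit h \<rho> x k \<inter> space \<Omega>)"
  have "(\<integral>\<^sup>+t. ennreal (l * exp (- l * t)) * emeasure \<Omega> (walk_hits h \<rho> x t) * indicator {0<..} t \<partial>lborel)
    = (\<integral>\<^sup>+t. (\<Sum>k. ?P k * (ennreal (l * exp (- l * t)) * indicator {real k * h..} t * indicator {0<..} t)) \<partial>lborel)"
  proof (intro nn_integral_cong)
    fix t :: real
    have "(\<Sum>k. ?P k * (ennreal (l * exp (- l * t)) * indicator {real k * h..} t * indicator {0<..} t))
      = (\<Sum>k. (ennreal (l * exp (- l * t)) * indicator {0<..} t) * (indicator {real k * h..} t * ?P k))"
      by (intro suminf_cong) (simp only: mult_ac)
    also have "\<dots> = (ennreal (l * exp (- l * t)) * indicator {0<..} t) * emeasure \<Omega> (walk_hits h \<rho> x t)"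
      unfolding emeasure_walk_hits[OF h] by (rule ennreal_suminf_cmult)
    finally show "ennreal (l * exp (- l * t)) * emeasure \<Omega> (walk_hits h \<rho> x t) * indicator {0<..} t = (\<Sum>k. ?P k * (ennreal (l * exp (- l * t)) * indicator {real k * h..} t * indicator {0<..} t))"
      by (simp only: mult_ac)
  qed
  also have "\<dots> = (\<Sum>k. (\<integral>\<^sup>+t. ?P k * (ennreal (l * exp (- l * t)) * indicator {real k * h..} t * indicator {0<..} t) \<partial>lborel))"
    by (rule nn_integral_suminf) measurable
  also have "\<dots> = (\<Sum>k. ?P k * (\<integral>\<^sup>+t. (ennreal (l * exp (- l * t)) * indicator {real k * h..} t * indicator {0<..} t) \<partial>lborel))"
    by (intro suminf_cong nn_integral_cmult) measurable
  also have "\<dots> = (\<Sum>k. ?P k * ennreal (exp (- l * (real k * h))))"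
  proof (intro suminf_cong)
    fix k
    have "(\<integral>\<^sup>+t. (ennreal (l * exp (- l * t)) * indicator {real k * h..} t * indicator {0<..} t) \<partial>lborel) = (\<integral>\<^sup>+t. ennreal (l * exp (- l * t)) * indicator {real k * h..} t \<partial>lborel)"
    proof (rule nn_integral_cong_AE)
      have "AE t in lborel. t \<noteq> (0::real)" by (rule AE_lborel_singleton)
      then show "AE t in lborel. (ennreal (l * exp (- l * t)) * indicator {real k * h..} t * indicator {0<..} t) = ennreal (l * exp (- l * t)) * indicator {real k * h..} t"
      proof eventually_elim
        case (elim t)
        have "real k * h \<ge> 0" using h by simp
        then show ?case using elim by (auto simp: indicator_def)
      qed
    qed
    then show "?P k * (\<integral>\<^sup>+t. (ennreal (l * exp (- l * t)) * indicator {real k * h..} t * indicator {0<..} t) \<partial>lborel) = ?P k * ennreal (exp (- l * (real k * h)))"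
      unfolding exp_tail[OF l] by simp
  qed
  also have "\<dots> = walk_hit_laplace l h \<rho> x" unfolding walk_hit_laplace_def
    by (intro suminf_cong) (simp add: ennreal_power exp_of_nat_mult[symmetric] mult_ac)
  finally show ?thesis by simp
qed

lemma AE_B0: "AE \<omega> in \<Omega>. \<forall>k. walk h x k \<omega> = x + B (real k * h) \<omega>"
  using B_start by eventually_elim (simp add: walk_eq)

lemma walk_hits_le_hit_prob:
  assumes h: "h > 0" and t: "t > 0"
  shows "emeasure \<Omega> (walk_hits h \<rho> x t) \<le> hit_prob \<rho> t x"
  unfolding hit_prob_eq[OF less_imp_le[OF t]]
proof (rule emeasure_mono_AE)
  show "AE \<omega> in \<Omega>. \<omega> \<in> walk_hits h \<rho> x t \<longrightarrow> \<omega> \<in> {\<omega> \<in> space \<Omega>. hits \<rho> x t \<omega>}"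
    using AE_B0[of h x]
  proof eventually_elim
    case (elim \<omega>)
    show ?case
    proof
      assume "\<omega> \<in> walk_hits h \<rho> x t"
      then obtain k where k: "\<omega> \<in> space \<Omega>" "real k * h \<le> t" "norm (x + B (real k * h) \<omega>) \<le> \<rho>" using elim by (auto simp: walk_hits_def)
      then show "\<omega> \<in> {\<omega> \<in> space \<Omega>. hits \<rho> x t \<omega>}" using h by (auto simp: hits_def intro!: exI[of _ "real k * h"])
    qed
  qed
qed (use hits_sets t in simp)

lemma walk_hit_laplace_le: "h > 0 \<Longrightarrow> l > 0 \<Longrightarrow> walk_hit_laplace l h \<rho> x \<le> hit_laplace l \<rho> x"
  unfolding walk_hit_laplace_eq hit_laplace_def
  by (intro nn_integral_mono) (auto simp: indicator_def intro!: mult_left_mono walk_hits_le_hit_prob)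

lemma walk_hits_dyadic_mono: "walk_hits (1 / 2 ^ m) \<rho> x t \<subseteq> walk_hits (1 / 2 ^ Suc m) \<rho> x t"
proof
  fix \<omega> assume "\<omega> \<in> walk_hits (1 / 2 ^ m) \<rho> x t"
  then obtain k where k: "\<omega> \<in> space \<Omega>" "real k * (1 / 2 ^ m) \<le> t" "norm (walk (1 / 2 ^ m) x k \<omega>) \<le> \<rho>" by (auto simp: walk_hits_def)
  have e: "real (2 * k) * (1 / 2 ^ Suc m) = real k * (1 / 2 ^ m)" by simp
  have "walk (1 / 2 ^ Suc m) x (2 * k) \<omega> = walk (1 / 2 ^ m) x k \<omega>" unfolding walk_eq e ..
  then show "\<omega> \<in> walk_hits (1 / 2 ^ Suc m) \<rho> x t" using k e unfolding walk_hits_def by (intro CollectI conjI exI[of _ "2 * k"]) auto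
qed

lemma dyadic_near:
  assumes t: "0 < t" and s: "0 \<le> s" "s \<le> t" and d: "d > 0"
  shows "\<exists>m k. real k * (1 / 2 ^ m) \<le> t \<and> \<bar>real k * (1 / 2 ^ m) - s\<bar> < d"
proof -
  obtain m where m: "(1/2) ^ m < d" using real_arch_pow_inv[OF d, of "1/2"] by auto
  define k where "k = nat \<lfloor>s * 2 ^ m\<rfloor>"
  have "real k \<le> s * 2 ^ m" "s * 2 ^ m < real k + 1" unfolding k_def using s by (auto simp: of_nat_nat)
  then have "real k * (1 / 2 ^ m) \<le> s" "s < real k * (1 / 2 ^ m) + 1 / 2 ^ m" by (simp_all add: field_simps)
  then show ?thesis using m s by (intro exI[of _ m] exI[of _ k]) (auto simp: power_one_over)
qed

text \<open>Dyadic grids are nested, and a path that touches the ball of radius \<open>r\<close> is in the larger ball of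
  radius \<open>\<rho>\<close> at some dyadic time.\<close>

lemma hit_prob_le_SUP:
  assumes t: "t > 0" and r: "r < \<rho>"
  shows "hit_prob r t x \<le> (SUP m. emeasure \<Omega> (walk_hits (1 / 2 ^ m) \<rho> x t))"
proof -
  have "hit_prob r t x \<le> emeasure \<Omega> (\<Union>m. walk_hits (1 / 2 ^ m) \<rho> x t)"
    unfolding hit_prob_eq[OF less_imp_le[OF t]]
  proof (rule emeasure_mono_AE)
    have "AE \<omega> in \<Omega>. \<forall>m k. walk (1 / 2 ^ m) x k \<omega> = x + B (real k * (1 / 2 ^ m)) \<omega>"
      by (subst AE_all_countable) (intro allI AE_B0)
    then show "AE \<omega> in \<Omega>. \<omega> \<in> {\<omega> \<in> space \<Omega>. hits r x t \<omega>} \<longrightarrow> \<omega> \<in> (\<Union>m. walk_hits (1 / 2 ^ m) \<rho> x t)"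
    proof eventually_elim
      case (elim \<omega>)
      show ?case
      proof
        assume "\<omega> \<in> {\<omega> \<in> space \<Omega>. hits r x t \<omega>}"
        then obtain s where s: "\<omega> \<in> space \<Omega>" "0 \<le> s" "s \<le> t" "norm (x + B s \<omega>) \<le> r" by (auto simp: hits_def)
        have "continuous_on {0..t} (\<lambda>s. norm (x + B s \<omega>))" by (intro continuous_on_norm path_cont s)
        moreover have "s \<in> {0..t}" using s by simp
        moreover have e: "0 < \<rho> - r" using r by simp
        ultimately obtain d where d: "d > 0" "\<And>s'. s' \<in> {0..t} \<Longrightarrow> dist s' s < d \<Longrightarrow> dist (norm (x + B s' \<omega>)) (norm (x + B s \<omega>)) < \<rho> - r"
          unfolding continuous_on_iff by meson
        obtain m k where mk: "real k * (1 / 2 ^ m) \<le> t" "\<bar>real k * (1 / 2 ^ m) - s\<bar> < d"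
          using dyadic_near[OF t s(2,3) d(1)] by blast
        have "norm (x + B (real k * (1 / 2 ^ m)) \<omega>) \<le> \<rho>"
          using d(2)[of "real k * (1 / 2 ^ m)"] mk s(4) by (auto simp: dist_real_def)
        then show "\<omega> \<in> (\<Union>m. walk_hits (1 / 2 ^ m) \<rho> x t)" using mk s elim unfolding walk_hits_def by auto
      qed
    qed
    show "(\<Union>m. walk_hits (1 / 2 ^ m) \<rho> x t) \<in> sets \<Omega>" using walk_hits_sets by auto
  qed
  also have "\<dots> = (SUP m. emeasure \<Omega> (walk_hits (1 / 2 ^ m) \<rho> x t))"
  proof (rule SUP_emeasure_incseq[symmetric])
    show "range (\<lambda>m. walk_hits (1 / 2 ^ m) \<rho> x t) \<subseteq> sets \<Omega>" using walk_hits_sets by auto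
  qed (intro incseq_SucI walk_hits_dyadic_mono)
  finally show ?thesis .
qed

text \<open>The bound for the walks survives the limit of finer dyadic grids by monotone convergence.\<close>

lemma hit_laplace_upper:
  fixes z :: "real ^ 'd"
  assumes l: "l > 0" and r: "r < \<rho>" "\<rho> < norm x" and z: "norm z = \<rho>"
  shows "resolvent l 0 z * hit_laplace l r x \<le> resolvent l 0 x"
proof -
  let ?f = "\<lambda>m t. ennreal (l * exp (- l * t)) * emeasure \<Omega> (walk_hits (1 / 2 ^ m) \<rho> x t) * indicator {0<..} t"
  have fm: "?f m \<in> borel_measurable lborel" for m
  proof -
    have "(\<lambda>t. emeasure \<Omega> (walk_hits (1 / 2 ^ m) \<rho> x t)) \<in> borel_measurable borel" by (subst emeasure_walk_hits) (simp, measurable)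
    then show ?thesis by measurable
  qed
  have "hit_laplace l r x \<le> (\<integral>\<^sup>+t. (SUP m. ?f m t) \<partial>lborel)"
    unfolding hit_laplace_def
  proof (intro nn_integral_mono)
    fix t :: real
    have "ennreal (l * exp (- l * t)) * hit_prob r t x \<le> (SUP m. ennreal (l * exp (- l * t)) * emeasure \<Omega> (walk_hits (1 / 2 ^ m) \<rho> x t))" if "t > 0"
      using mult_left_mono[OF hit_prob_le_SUP[OF that r(1), of x]] by (simp add: SUP_mult_left_ennreal)
    then show "ennreal (l * exp (- l * t)) * hit_prob r t x * indicator {0<..} t \<le> (SUP m. ?f m t)"
      by (cases "t > 0") auto
  qed
  also have "\<dots> = (SUP m. \<integral>\<^sup>+t. ?f m t \<partial>lborel)"
  proof (rule nn_integral_monotone_convergence_SUP)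
    show "incseq ?f"
      by (intro incseq_SucI le_funI mult_right_mono mult_left_mono emeasure_mono walk_hits_dyadic_mono walk_hits_sets) auto
  qed (rule fm)
  also have "\<dots> = (SUP m. walk_hit_laplace l (1 / 2 ^ m) \<rho> x)" using l by (simp add: walk_hit_laplace_eq)
  finally have "resolvent l 0 z * hit_laplace l r x \<le> resolvent l 0 z * (SUP m. walk_hit_laplace l (1 / 2 ^ m) \<rho> x)" by (rule mult_left_mono) simp
  also have "\<dots> = (SUP m. resolvent l 0 z * walk_hit_laplace l (1 / 2 ^ m) \<rho> x)" by (simp add: SUP_mult_left_ennreal)
  also have "\<dots> \<le> resolvent l 0 x" by (intro SUP_least walk_hit_laplace_upper r z) simp
  finally show ?thesis .
qed

lemma big_step_tendsto_0:
  assumes \<eta>: "\<eta> > 0" and T: "T \<ge> 0"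
  shows "(\<lambda>m. emeasure \<Omega> (big_step (1 / 2 ^ m) T \<eta>)) \<longlonglongrightarrow> 0"
proof -
  have s: "big_step (1 / 2 ^ m) T \<eta> \<in> sets \<Omega>" for m by simp
  have "(\<lambda>m. \<integral>\<^sup>+\<omega>. indicator (big_step (1 / 2 ^ m) T \<eta>) \<omega> \<partial>\<Omega>) \<longlonglongrightarrow> (\<integral>\<^sup>+\<omega>. 0 \<partial>\<Omega>)"
  proof (rule nn_integral_dominated_convergence[where w = "\<lambda>_. 1"])
    show "AE \<omega> in \<Omega>. (\<lambda>m. indicator (big_step (1 / 2 ^ m) T \<eta>) \<omega> :: ennreal) \<longlonglongrightarrow> 0"
    proof (rule AE_I2)
      fix \<omega> assume \<omega>: "\<omega> \<in> space \<Omega>"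
      have "uniformly_continuous_on {0..T+1} (\<lambda>s. 0 + B s \<omega>)"
        by (intro compact_uniformly_continuous path_cont \<omega>) auto
      then obtain d where d: "d > 0" "\<And>s s'. s \<in> {0..T+1} \<Longrightarrow> s' \<in> {0..T+1} \<Longrightarrow> dist s' s < d \<Longrightarrow> dist (B s' \<omega>) (B s \<omega>) < \<eta>"
        unfolding uniformly_continuous_on_def using \<eta> by force
      obtain m0 where m0: "(1/2) ^ m0 < d" using real_arch_pow_inv[OF d(1), of "1/2"] by auto
      have "\<omega> \<notin> big_step (1 / 2 ^ m) T \<eta>" if m: "m \<ge> m0" for m
      proof
        assume "\<omega> \<in> big_step (1 / 2 ^ m) T \<eta>"
        then obtain k where k: "real k * (1 / 2 ^ m) \<le> T" "norm (incr (1 / 2 ^ m) k \<omega>) \<ge> \<eta>" by (auto simp: big_step_def)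
        have h: "(1::real) / 2 ^ m \<le> (1/2) ^ m0" using power_decreasing[OF m, of "1/2 :: real"] by (simp add: power_one_over)
        have h1: "(1::real) / 2 ^ m \<le> 1" by simp
        have e: "real (Suc k) * (1 / 2 ^ m) = real k * (1 / 2 ^ m) + 1 / 2 ^ m" by (simp add: field_simps)
        have "dist (B (real (Suc k) * (1 / 2 ^ m)) \<omega>) (B (real k * (1 / 2 ^ m)) \<omega>) < \<eta>"
        proof (rule d(2))
          show "real k * (1 / 2 ^ m) \<in> {0..T+1}" using k by auto
          show "real (Suc k) * (1 / 2 ^ m) \<in> {0..T+1}" unfolding e using k(1) h1 by (auto intro: add_nonneg_nonneg add_mono)
          show "dist (real (Suc k) * (1 / 2 ^ m)) (real k * (1 / 2 ^ m)) < d" unfolding e using h m0 by (simp add: dist_real_def)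
        qed
        then show False using k(2) by (simp add: incr_def dist_norm)
      qed
      then have "eventually (\<lambda>m. indicator (big_step (1 / 2 ^ m) T \<eta>) \<omega> = (0 :: ennreal)) sequentially"
        by (intro eventually_sequentiallyI[of m0]) simp
      then show "(\<lambda>m. indicator (big_step (1 / 2 ^ m) T \<eta>) \<omega> :: ennreal) \<longlonglongrightarrow> 0" by (rule tendsto_eventually)
    qed
  qed (auto simp: emeasure_space_1 indicator_def)
  then show ?thesis using s by simp
qed

text \<open>The three limits are taken in order: the mesh tends to \<open>0\<close>, which removes big steps; then \<open>T\<close> tends to
  infinity; finally the cutoff \<open>e\<close> tends to \<open>0\<close>.\<close>

lemma hit_laplace_lower:
  fixes z :: "real ^ 'd"
  assumes l: "l > 0" and r: "0 \<le> \<rho>'" "\<rho>' < \<rho>" "\<rho> < norm x" and z: "norm z = \<rho>'"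
  shows "resolvent l 0 x \<le> resolvent l 0 z * hit_laplace l \<rho> x"
proof -
  obtain C where C: "C \<ge> 0" "\<And>t y. 0 < t \<Longrightarrow> t \<le> 1 \<Longrightarrow> \<rho> \<le> norm (y :: real ^ 'd) \<Longrightarrow> heat_kernel t y \<le> C * t"
    using heat_kernel_small_time[of \<rho>] r by (metis order.strict_trans1)
  have step: "resolvent l e x \<le> resolvent l 0 z * hit_laplace l \<rho> x + ennreal (C * e * (1 / l))" if e: "0 < e" "e < 1/2" for e
  proof -
    let ?U = "resolvent l e (0 :: real ^ 'd)" let ?A = "resolvent l 0 z * hit_laplace l \<rho> x"
    obtain u where u: "?U = ennreal u" "u \<ge> 0" using resolvent_finite[OF l e(1), of "0 :: real ^ 'd"] by (cases ?U) auto
    have 1: "resolvent l e x \<le> ?A + ?U * (0 + ennreal (exp (- l * T))) + ennreal (C * e * (1 / l))" if T: "T \<ge> 0" for T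
    proof (rule LIMSEQ_le_const)
      let ?h = "\<lambda>m::nat. 1 / 2 ^ m :: real"
      have hl: "?h \<longlonglongrightarrow> 0" using LIMSEQ_inverse_realpow_zero[of 2] by (simp add: inverse_eq_divide)
      have "(\<lambda>m. C * (e + ?h m) * (1 / l + ?h m)) \<longlonglongrightarrow> C * (e + 0) * (1 / l + 0)" by (intro tendsto_intros hl)
      then have t3: "(\<lambda>m. ennreal (C * (e + ?h m) * (1 / l + ?h m))) \<longlonglongrightarrow> ennreal (C * e * (1 / l))" by (intro tendsto_ennrealI) simp
      have t2: "(\<lambda>m. ?U * (emeasure \<Omega> (big_step (?h m) T (\<rho> - \<rho>')) + ennreal (exp (- l * T)))) \<longlonglongrightarrow> ?U * (0 + ennreal (exp (- l * T)))"
      proof (rule ennreal_tendsto_cmult)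
        show "?U < \<top>" unfolding u by simp
        show "(\<lambda>m. emeasure \<Omega> (big_step (?h m) T (\<rho> - \<rho>')) + ennreal (exp (- l * T))) \<longlonglongrightarrow> 0 + ennreal (exp (- l * T))"
          by (intro tendsto_add tendsto_const big_step_tendsto_0 T) (use r in simp)
      qed
      show "(\<lambda>m. ?A + ?U * (emeasure \<Omega> (big_step (?h m) T (\<rho> - \<rho>')) + ennreal (exp (- l * T))) + ennreal (C * (e + ?h m) * (1 / l + ?h m)))
        \<longlonglongrightarrow> ?A + ?U * (0 + ennreal (exp (- l * T))) + ennreal (C * e * (1 / l))"
        by (intro tendsto_add tendsto_const t2 t3)
      show "\<exists>N. \<forall>m\<ge>N. resolvent l e x \<le> ?A + ?U * (emeasure \<Omega> (big_step (?h m) T (\<rho> - \<rho>')) + ennreal (exp (- l * T))) + ennreal (C * (e + ?h m) * (1 / l + ?h m))"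
      proof (intro exI[of _ 1] allI impI)
        fix m :: nat assume m: "1 \<le> m"
        have h2: "?h m \<le> 1/2" using power_decreasing[OF m, of "1/2::real"] by (simp add: power_one_over)
        have "resolvent l e x \<le> resolvent l e z * walk_hit_laplace l (?h m) \<rho> x + ?U * (emeasure \<Omega> (big_step (?h m) T (\<rho> - \<rho>')) + ennreal (exp (- l * T))) + ennreal (C * (e + ?h m) * (1 / l + ?h m))"
        proof (rule walk_hit_laplace_lower[OF _ e(1) l _ r(3) _ z r(1,2)])
          show "0 \<le> C * (e + ?h m)" using C e by (intro mult_nonneg_nonneg add_nonneg_nonneg) auto
          show "heat_kernel t y \<le> C * (e + ?h m)" if "e < t" "t \<le> e + ?h m" "\<rho> \<le> norm y" for t and y :: "real ^ 'd"
          proof -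
            have "0 < t" "t \<le> 1" using that e h2 by linarith+
            then have "heat_kernel t y \<le> C * t" using that by (intro C(2)) auto
            also have "\<dots> \<le> C * (e + ?h m)" using that C by (intro mult_left_mono) auto
            finally show ?thesis .
          qed
        qed simp
        also have "\<dots> \<le> ?A + ?U * (emeasure \<Omega> (big_step (?h m) T (\<rho> - \<rho>')) + ennreal (exp (- l * T))) + ennreal (C * (e + ?h m) * (1 / l + ?h m))"
          by (intro add_right_mono mult_mono resolvent_antimono walk_hit_laplace_le l) (use e in auto)
        finally show "resolvent l e x \<le> ?A + ?U * (emeasure \<Omega> (big_step (?h m) T (\<rho> - \<rho>')) + ennreal (exp (- l * T))) + ennreal (C * (e + ?h m) * (1 / l + ?h m))" .
      qed
    qed
    have "(\<lambda>k. ?A + ?U * (0 + ennreal (exp (- l * real k))) + ennreal (C * e * (1 / l))) \<longlonglongrightarrow> ?A + ?U * (0 + ennreal 0) + ennreal (C * e * (1 / l))"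
    proof (intro tendsto_add tendsto_const ennreal_tendsto_cmult)
      show "?U < \<top>" unfolding u by simp
      have "((\<lambda>x. exp (- l * x)) \<longlongrightarrow> 0) at_top" using l by real_asymp
      then show "(\<lambda>k. ennreal (exp (- l * real k))) \<longlonglongrightarrow> ennreal 0"
        by (intro tendsto_ennrealI filterlim_compose[OF _ filterlim_real_sequentially])
    qed
    then have "resolvent l e x \<le> ?A + ?U * (0 + ennreal 0) + ennreal (C * e * (1 / l))"
      by (rule LIMSEQ_le_const) (use 1 in auto)
    then show ?thesis by simp
  qed
  let ?e = "\<lambda>k. 1 / (real k + 3)"
  have ek: "0 < ?e k" "?e k < 1/2" for k by (auto simp: field_simps)
  have el: "?e \<longlonglongrightarrow> 0" by real_asymp
  have "(\<lambda>k. resolvent l (?e k) x) \<longlonglongrightarrow> resolvent l 0 x"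
    unfolding resolvent_def
  proof (rule nn_integral_LIMSEQ)
    show "incseq (\<lambda>k t. ennreal (exp (- l * t) * heat_kernel t x) * indicator {?e k<..} t)"
    proof (intro incseq_SucI le_funI mult_left_mono)
      fix k and t :: real
      have "?e (Suc k) \<le> ?e k" by (simp add: field_simps)
      then show "indicator {?e k<..} t \<le> (indicator {?e (Suc k)<..} t :: ennreal)" by (auto simp: indicator_def)
    qed simp
    show "(\<lambda>k. ennreal (exp (- l * t) * heat_kernel t x) * indicator {?e k<..} t) \<longlonglongrightarrow> ennreal (exp (- l * t) * heat_kernel t x) * indicator {0<..} t" for t :: real
    proof (cases "t > 0")
      case True
      then have "eventually (\<lambda>k. ?e k < t) sequentially" using order_tendstoD(2)[OF el] by blast
      then show ?thesis using True by (intro tendsto_eventually) (auto elim!: eventually_mono)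
    next
      case False
      then have "t \<notin> {?e k<..}" for k using ek(1)[of k] by (auto simp: not_less intro: order_trans[of t 0] less_imp_le)
      then show ?thesis using False by simp
    qed
  qed measurable
  moreover have "(\<lambda>k. resolvent l 0 z * hit_laplace l \<rho> x + ennreal (C * ?e k * (1 / l))) \<longlonglongrightarrow> resolvent l 0 z * hit_laplace l \<rho> x + ennreal (C * 0 * (1 / l))"
    by (intro tendsto_add tendsto_const tendsto_ennrealI tendsto_mult el)
  ultimately have "resolvent l 0 x \<le> resolvent l 0 z * hit_laplace l \<rho> x + ennreal (C * 0 * (1 / l))"
    by (rule LIMSEQ_le) (use step[OF ek] in auto)
  then show ?thesis by simp
qed

end

section \<open>The resolvent as a radial Bessel function\<close>

text \<open>The substitution \<open>t = (c / s) exp (- v)\<close> with \<open>s\<^sup>2 = c l\<close> makes both terms of the exponent equal in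
  size and produces \<open>- 2 s cosh v\<close>.\<close>

lemma laplace_inverse_power_kernel:
  assumes c: "c > 0" and l: "l > 0"
  shows "(\<integral>\<^sup>+t. ennreal ((1 / t) ^ Suc m * exp (- c / t - l * t)) * indicator {0<..} t \<partial>lborel)
    = ennreal (bphi_real m (c * l) / c ^ m)"
proof -
  define s where "s = sqrt (c * l)"
  have s: "s > 0" using c l by (simp add: s_def)
  have ss: "c * l = s * s" using c l by (simp add: s_def)
  define g where "g v = c / s * exp (- v)" for v
  define f where "f t = (1 / t) ^ Suc m * exp (- c / t - l * t)" for t
  have g0: "g v > 0" for v using c s by (simp add: g_def)
  have rg: "range g = {0<..}"
  proof (intro set_eqI iffI)
    fix t :: real assume "t \<in> {0<..}"
    then have "g (- ln (s * t / c)) = t" using c s by (simp add: g_def)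
    then show "t \<in> range g" by (metis rangeI)
  qed (use g0 in auto)
  have fg: "\<bar>- g v\<bar> * f (g v) = (s / c) ^ m * exp (m * v - 2 * s * cosh v)" for v :: real
  proof -
    have "1 / g v = s / c * exp v" using c s by (simp add: g_def exp_minus field_simps)
    then have p: "(1 / g v) ^ Suc m = (1 / g v) * ((s / c) ^ m * exp (m * v))" by (simp add: power_mult_distrib exp_of_nat_mult power_divide)
    have "- c / g v = - (s * exp v)" using c s by (simp add: g_def exp_minus field_simps)
    moreover have "c * l / s = s" using s ss by simp
    then have "l * g v = s * exp (- v)" by (simp add: g_def) (metis mult.assoc mult.commute times_divide_eq_left)
    ultimately have "- c / g v - l * g v = - 2 * s * cosh v" by (simp add: cosh_field_def algebra_simps)
    then have "f (g v) = (1 / g v) * ((s / c) ^ m * exp (m * v)) * exp (- 2 * s * cosh v)" unfolding f_def p by simp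
    then have "\<bar>- g v\<bar> * f (g v) = (s / c) ^ m * (exp (m * v) * exp (- 2 * s * cosh v))" using g0[of v] by simp
    then show ?thesis by (simp add: exp_add[symmetric])
  qed
  let ?h = "\<lambda>v::real. (s / c) ^ m * exp (m * v - 2 * s * cosh v)"
  have hi: "integrable lborel ?h" using integrable_besselint_real[OF s] by simp
  have hI: "integral\<^sup>L lborel ?h = bphi_real m (c * l) / c ^ m"
    unfolding bphi_real_def besselint_real_def s_def[symmetric] by (simp add: power_divide)
  have habs: "?h absolutely_integrable_on UNIV" using hi by (simp add: set_integrable_def integrable_completion)
  have hint: "integral UNIV ?h = bphi_real m (c * l) / c ^ m"
    by (rule trans[OF integral_lborel[OF hi] hI])
  have "(\<lambda>v. \<bar>- g v\<bar> * f (g v)) absolutely_integrable_on UNIV \<and> integral UNIV (\<lambda>v. \<bar>- g v\<bar> * f (g v)) = bphi_real m (c * l) / c ^ m"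
  proof -
    have "(\<lambda>v. \<bar>- g v\<bar> * f (g v)) = ?h" by (rule ext) (rule fg)
    then show ?thesis using habs hint by simp
  qed
  then have "f absolutely_integrable_on (g ` UNIV) \<and> integral (g ` UNIV) f = bphi_real m (c * l) / c ^ m"
  proof (subst (asm) has_absolute_integral_change_of_variables_1'[where g = g])
    show "(g has_field_derivative - g x) (at x within UNIV)" for x unfolding g_def using s by (auto intro!: derivative_eq_intros)
    show "inj g"
    proof (rule injI)
      fix x y assume "g x = g y"
      then have e: "c / s * exp (- x) = c / s * exp (- y)" unfolding g_def .
      have "c / s \<noteq> 0" using c s by simp
      with e have "exp (- x) = exp (- y)" by (simp only: mult_cancel_left simp_thms)
      then show "x = y" by simp
    qed
  qed auto
  then have fi: "f absolutely_integrable_on {0<..}" and fI: "integral {0<..} f = bphi_real m (c * l) / c ^ m" unfolding rg by auto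
  have fm: "(\<lambda>t. indicator {0<..} t *\<^sub>R f t) \<in> borel_measurable lborel" unfolding f_def by measurable
  have "integrable lborel (\<lambda>t. indicator {0<..} t *\<^sub>R f t)"
    using fi fm unfolding set_integrable_def by (simp add: integrable_completion)
  then have "(\<integral>\<^sup>+t. ennreal (indicator {0<..} t *\<^sub>R f t) \<partial>lborel) = ennreal (\<integral>t. indicator {0<..} t *\<^sub>R f t \<partial>lborel)"
    by (rule nn_integral_eq_integral) (auto simp: f_def indicator_def)
  also have "(\<integral>t. indicator {0<..} t *\<^sub>R f t \<partial>lborel) = (LINT t:{0<..}|lebesgue. f t)"
    unfolding set_lebesgue_integral_def using fm by (rule integral_completion[symmetric])
  also have "\<dots> = integral {0<..} f" by (rule set_lebesgue_integral_eq_integral(2)[OF fi])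
  finally have "(\<integral>\<^sup>+t. ennreal (indicator {0<..} t *\<^sub>R f t) \<partial>lborel) = ennreal (bphi_real m (c * l) / c ^ m)" unfolding fI .
  moreover have "ennreal (indicator {0<..} t *\<^sub>R f t) = ennreal ((1 / t) ^ Suc m * exp (- c / t - l * t)) * indicator {0<..} t" for t
    by (cases "t > 0") (simp_all add: f_def)
  ultimately show ?thesis by simp
qed

text \<open>The resolvent in dimension \<open>2 N + 2\<close> as a function of half the squared radius.\<close>

definition resolvent_radial :: "nat \<Rightarrow> real \<Rightarrow> real \<Rightarrow> real" where
  "resolvent_radial N l y = bphi_real N (l * y) / ((2 * pi) ^ Suc N * y ^ N)"

lemma resolvent_eq_radial:
  fixes x :: "real ^ 'd"
  assumes d: "CARD('d) = 2 * N + 2" and l: "l > 0" and x: "x \<noteq> 0"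
  shows "resolvent l 0 x = ennreal (resolvent_radial N l ((norm x)\<^sup>2 / 2))"
proof -
  let ?c = "(norm x)\<^sup>2 / 2"
  have c: "?c > 0" using x by simp
  have "resolvent l 0 x = (\<integral>\<^sup>+t. ennreal (1 / (2 * pi) ^ Suc N) * (ennreal ((1 / t) ^ Suc N * exp (- ?c / t - l * t)) * indicator {0<..} t) \<partial>lborel)"
    unfolding resolvent_def
  proof (intro nn_integral_cong)
    fix t :: real
    have "exp (- l * t) * heat_kernel t x = 1 / (2 * pi) ^ Suc N * ((1 / t) ^ Suc N * exp (- ?c / t - l * t))" if t: "t > 0"
    proof -
      have "(1 / sqrt (2 * pi * t)) ^ CARD('d) = ((1 / sqrt (2 * pi * t))\<^sup>2) ^ Suc N"
        unfolding d power_mult[symmetric] by simp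
      also have "\<dots> = (1 / (2 * pi * t)) ^ Suc N" using t by (simp add: power_divide)
      also have "\<dots> = 1 / (2 * pi) ^ Suc N * (1 / t) ^ Suc N" by (simp add: power_divide power_mult_distrib)
      finally have "exp (- l * t) * heat_kernel t x = 1 / (2 * pi) ^ Suc N * (1 / t) ^ Suc N * (exp (- (norm x)\<^sup>2 / (2 * t)) * exp (- l * t))"
        by (simp only: heat_kernel_eq[OF t] mult_ac)
      also have "exp (- (norm x)\<^sup>2 / (2 * t)) * exp (- l * t) = exp (- ?c / t - l * t)" by (simp add: exp_add[symmetric])
      finally show ?thesis by (simp only: mult_ac)
    qed
    then show "ennreal (exp (- l * t) * heat_kernel t x) * indicator {0<..} t = ennreal (1 / (2 * pi) ^ Suc N) * (ennreal ((1 / t) ^ Suc N * exp (- ?c / t - l * t)) * indicator {0<..} t)"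
      by (auto simp: indicator_def ennreal_mult'[symmetric])
  qed
  also have "\<dots> = ennreal (1 / (2 * pi) ^ Suc N) * ennreal (bphi_real N (?c * l) / ?c ^ N)"
    by (subst nn_integral_cmult, measurable) (simp only: laplace_inverse_power_kernel[OF c l])
  also have "\<dots> = ennreal (resolvent_radial N l ?c)"
    unfolding resolvent_radial_def by (subst ennreal_mult'[symmetric]) (simp, simp add: mult.commute)
  finally show ?thesis .
qed

lemma bphi_real_deriv:
  assumes x: "x > 0"
  shows "(bphi_real (Suc n) has_real_derivative - bphi_real n x) (at x)"
proof -
  have z: "of_real x \<notin> \<real>\<^sub>\<le>\<^sub>0" using x by (simp add: complex_nonpos_Reals_iff)
  have "((\<lambda>x. bphi (Suc n) (of_real x)) has_vector_derivative - bphi n (of_real x)) (at x within UNIV)"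
    by (rule has_vector_derivative_real_field[OF bphi_Suc_deriv[OF z]])
  then have "((\<lambda>x. Re (bphi (Suc n) (of_real x))) has_vector_derivative Re (- bphi n (of_real x))) (at x)"
    by (rule bounded_linear.has_vector_derivative[OF bounded_linear_Re])
  then have "((\<lambda>x. Re (bphi (Suc n) (of_real x))) has_real_derivative - bphi_real n x) (at x)"
    using x by (simp add: has_real_derivative_iff_has_vector_derivative bphi_of_real)
  moreover have "eventually (\<lambda>w. Re (bphi (Suc n) (of_real w)) = bphi_real (Suc n) w) (nhds x)"
    by (rule eventually_mono[OF order_tendstoD(1)[OF filterlim_ident x]]) (simp add: bphi_of_real)
  ultimately show ?thesis by (subst DERIV_cong_ev[OF refl _ refl, of _ "\<lambda>x. Re (bphi (Suc n) (of_real x))"]) (auto elim: eventually_mono)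
qed

lemma bphi_real_recurrence:
  assumes x: "x > 0"
  shows "bphi_real (Suc (Suc n)) x = real (Suc n) * bphi_real (Suc n) x + x * bphi_real n x"
proof -
  have "of_real x \<notin> \<real>\<^sub>\<le>\<^sub>0" using x by (simp add: complex_nonpos_Reals_iff)
  from bphi_recurrence[OF this, of n] have "complex_of_real (bphi_real (Suc (Suc n)) x) = of_real (real (Suc n) * bphi_real (Suc n) x + x * bphi_real n x)"
    using x by (simp add: bphi_of_real)
  then show ?thesis by (simp only: of_real_eq_iff)
qed

lemma bphi_real_measurable [measurable]: "bphi_real n \<in> borel_measurable borel"
  unfolding bphi_real_def[abs_def] besselint_real_def by measurable

lemma bphi_real_tendsto_0: "(bphi_real n \<longlongrightarrow> 0) at_top"
proof (rule Lim_null_comparison)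
  let ?C = "besselint_real (real n) 1"
  show "eventually (\<lambda>x. norm (bphi_real n x) \<le> exp 2 * ?C * (sqrt x ^ n / exp (sqrt x))) at_top"
    using eventually_ge_at_top[of 1]
  proof eventually_elim
    case (elim x)
    then have s: "sqrt x \<ge> 1" by simp
    have "besselint_real (real n) (sqrt x) \<le> exp (- 2 * (sqrt x - 1)) * ?C" by (rule besselint_real_le[OF s])
    also have "\<dots> \<le> exp (2 - sqrt x) * ?C"
      using s besselint_real_pos[of 1 "real n"] by (intro mult_right_mono) auto
    finally have b: "besselint_real (real n) (sqrt x) \<le> exp (2 - sqrt x) * ?C" .
    have "norm (bphi_real n x) = sqrt x ^ n * besselint_real (real n) (sqrt x)"
      using bphi_real_pos[of x n] elim by (simp add: bphi_real_def)
    also have "\<dots> \<le> sqrt x ^ n * (exp (2 - sqrt x) * ?C)" using b elim by (intro mult_left_mono) auto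
    also have "\<dots> = exp 2 * ?C * (sqrt x ^ n / exp (sqrt x))" by (simp add: exp_diff)
    finally show ?case .
  qed
  have "((\<lambda>x::real. sqrt x ^ n / exp (sqrt x)) \<longlongrightarrow> 0) at_top"
    by (rule filterlim_compose[OF tendsto_power_div_exp_0 sqrt_at_top])
  from tendsto_mult_right_zero[OF this] show "((\<lambda>x. exp 2 * ?C * (sqrt x ^ n / exp (sqrt x))) \<longlongrightarrow> 0) at_top" .
qed

lemma bphi_real_scaled_tendsto_0: "l > 0 \<Longrightarrow> ((\<lambda>y. bphi_real n (l * y)) \<longlongrightarrow> 0) at_top"
  by (rule filterlim_compose[OF bphi_real_tendsto_0])
     (rule filterlim_tendsto_pos_mult_at_top[OF tendsto_const _ filterlim_ident])

lemma bphi_real_quotient_deriv: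
  assumes y: "y > 0" and l: "l > 0"
  shows "((\<lambda>y. - (bphi_real (Suc n) (l * y) / y ^ Suc n)) has_real_derivative bphi_real (Suc (Suc n)) (l * y) / y ^ Suc (Suc n)) (at y)"
proof -
  have "((\<lambda>y. bphi_real (Suc n) (l * y)) has_real_derivative - bphi_real n (l * y) * l) (at y)"
    using bphi_real_deriv[of "l * y" n] y l by (intro DERIV_chain2) (auto intro!: derivative_eq_intros)
  then have "((\<lambda>y. - (bphi_real (Suc n) (l * y) / y ^ Suc n)) has_real_derivative
      - ((- bphi_real n (l * y) * l * y ^ Suc n - bphi_real (Suc n) (l * y) * (real (Suc n) * y ^ n)) / (y ^ Suc n * y ^ Suc n))) (at y)"
    using y DERIV_pow[of "Suc n" y] by (intro DERIV_minus DERIV_divide) (simp_all del: of_nat_Suc power_Suc)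
  moreover have "- ((- bphi_real n (l * y) * l * y ^ Suc n - bphi_real (Suc n) (l * y) * (real (Suc n) * y ^ n)) / (y ^ Suc n * y ^ Suc n))
     = bphi_real (Suc (Suc n)) (l * y) / y ^ Suc (Suc n)"
    using y l by (simp add: bphi_real_recurrence field_simps)
  ultimately show ?thesis by simp
qed

text \<open>The integrand is minus the derivative of the resolvent, by the recurrence of \<open>\<phi>\<close> again a Bessel
  function, of order one higher.\<close>

lemma resolvent_radial_layer_cake:
  assumes N: "N = Suc n" and l: "l > 0" and a: "a > 0"
  shows "(\<integral>\<^sup>+y. ennreal (bphi_real (Suc N) (l * y) / ((2 * pi) ^ Suc N * y ^ Suc N)) * indicator {a..} y \<partial>lborel) = ennreal (resolvent_radial N l a)"
proof -
  let ?k = "1 / (2 * pi) ^ Suc N"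
  have "(\<integral>\<^sup>+y. ennreal (?k * (bphi_real (Suc N) (l * y) / y ^ Suc N)) * indicator {a..} y \<partial>lborel)
    = 0 - ?k * - (bphi_real N (l * a) / a ^ N)"
  proof (rule nn_integral_FTC_atLeast)
    fix y assume "a \<le> y"
    then have y: "y > 0" using a by simp
    show "((\<lambda>y. ?k * - (bphi_real N (l * y) / y ^ N)) has_real_derivative ?k * (bphi_real (Suc N) (l * y) / y ^ Suc N)) (at y)"
      unfolding N by (intro DERIV_cmult bphi_real_quotient_deriv y l)
    show "0 \<le> ?k * (bphi_real (Suc N) (l * y) / y ^ Suc N)" using bphi_real_pos[of "l * y" "Suc N"] y l by simp
  next
    have "((\<lambda>y. bphi_real N (l * y) / y ^ N) \<longlongrightarrow> 0) at_top"
    proof (rule real_tendsto_divide_at_top[OF bphi_real_scaled_tendsto_0[OF l]])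
      show "filterlim (\<lambda>y::real. y ^ N) at_top at_top" unfolding N by (intro filterlim_pow_at_top filterlim_ident) simp
    qed
    from tendsto_mult_right_zero[OF tendsto_minus[OF this, simplified minus_zero], of ?k]
    show "((\<lambda>y. ?k * - (bphi_real N (l * y) / y ^ N)) \<longlongrightarrow> 0) at_top" .
  qed measurable
  then show ?thesis by (simp add: resolvent_radial_def mult.commute)
qed

lemma emeasure_shell:
  assumes d: "CARD('d) = 2 * N + 2" and c: "c > 0"
  shows "emeasure lborel {x :: real ^ 'd. c < (norm x)\<^sup>2 / 2 \<and> (norm x)\<^sup>2 / 2 \<le> y}
    = ennreal ((2 * pi) ^ Suc N * (y ^ Suc N - c ^ Suc N) / fact (Suc N)) * indicator {c..} y"
proof (cases "y \<ge> c")
  case False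
  then have "{x :: real ^ 'd. c < (norm x)\<^sup>2 / 2 \<and> (norm x)\<^sup>2 / 2 \<le> y} = {}" by auto
  then show ?thesis using False by (simp only: emeasure_empty) simp
next
  case True
  have *: "(norm x)\<^sup>2 / 2 \<le> a \<longleftrightarrow> norm x \<le> sqrt (2 * a)" if "a > 0" for a and x :: "real ^ 'd"
    using that real_sqrt_le_iff[of "(norm x)\<^sup>2" "2 * a"] by (simp add: field_simps)
  have V: "unit_ball_vol (real CARD('d)) = pi ^ Suc N / fact (Suc N)"
  proof -
    have "real CARD('d) = real (2 * Suc N)" unfolding d by simp
    then show ?thesis by (simp only: unit_ball_vol_even)
  qed
  have cb: "emeasure lborel (cball (0 :: real ^ 'd) (sqrt (2 * a))) = ennreal ((2 * pi) ^ Suc N * a ^ Suc N / fact (Suc N))" if a: "a > 0" for a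
  proof -
    have "sqrt (2 * a) ^ CARD('d) = ((sqrt (2 * a))\<^sup>2) ^ Suc N" unfolding d power_mult[symmetric] by simp
    also have "\<dots> = 2 ^ Suc N * a ^ Suc N" using a by (simp add: power_mult_distrib)
    finally show ?thesis using a emeasure_cball[of "sqrt (2 * a)" "0 :: real ^ 'd"] by (simp add: V power_mult_distrib mult_ac)
  qed
  have y: "y > 0" using c True by simp
  have "{x :: real ^ 'd. c < (norm x)\<^sup>2 / 2 \<and> (norm x)\<^sup>2 / 2 \<le> y} = cball 0 (sqrt (2 * y)) - cball 0 (sqrt (2 * c))"
    by (intro set_eqI) (simp only: *[OF y] *[OF c] mem_Collect_eq Diff_iff mem_cball_0 not_le[symmetric] conj_commute)
  also have "emeasure lborel \<dots> = emeasure lborel (cball (0 :: real ^ 'd) (sqrt (2 * y))) - emeasure lborel (cball (0 :: real ^ 'd) (sqrt (2 * c)))"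
  proof (intro emeasure_Diff)
    show "cball 0 (sqrt (2 * c)) \<subseteq> cball (0 :: real ^ 'd) (sqrt (2 * y))" using True by (intro subset_cball) simp
  qed (auto simp: cb[OF c])
  also have "\<dots> = ennreal ((2 * pi) ^ Suc N * y ^ Suc N / fact (Suc N) - (2 * pi) ^ Suc N * c ^ Suc N / fact (Suc N))"
    unfolding cb[OF y] cb[OF c] by (rule ennreal_minus[symmetric, THEN sym]) (use c in simp)
  finally show ?thesis using True by (simp add: diff_divide_distrib right_diff_distrib del: fact_Suc power_Suc)
qed

text \<open>Inserting the layer-cake formula and exchanging the integrals leaves the volume of a spherical
  shell, a difference of two powers of \<open>y\<close>; both resulting integrands have explicit antiderivatives
  by the derivative formulas for \<open>\<phi>\<close>.\<close>

lemma resolvent_radial_outside_integral: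
  assumes d: "CARD('d) = 2 * N + 2" and N: "N = Suc n" and l: "l > 0" and c: "c > 0"
  shows "(\<integral>\<^sup>+x. ennreal (resolvent_radial N l ((norm x)\<^sup>2 / 2)) * indicator {x. (norm x)\<^sup>2 / 2 > c} x \<partial>(lborel :: (real ^ 'd) measure))
    = ennreal (bphi_real (Suc N) (l * c) / (l * fact N))"
proof -
  let ?p = "\<lambda>y. bphi_real (Suc N) (l * y) / ((2 * pi) ^ Suc N * y ^ Suc N)"
  let ?Q = "\<lambda>(x :: real ^ 'd) y. ennreal (?p y) * indicator {z. c < (norm (fst z))\<^sup>2 / 2 \<and> (norm (fst z))\<^sup>2 / 2 \<le> snd z} (x, y)"
  have meas: "(\<lambda>(x :: real ^ 'd, y). ?Q x y) \<in> borel_measurable (lborel \<Otimes>\<^sub>M lborel)" by measurable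
  have "(\<integral>\<^sup>+x. ennreal (resolvent_radial N l ((norm x)\<^sup>2 / 2)) * indicator {x. (norm x)\<^sup>2 / 2 > c} x \<partial>(lborel :: (real ^ 'd) measure))
    = (\<integral>\<^sup>+x. (\<integral>\<^sup>+y. ?Q x y \<partial>lborel) \<partial>lborel)"
  proof (intro nn_integral_cong)
    fix x :: "real ^ 'd"
    show "ennreal (resolvent_radial N l ((norm x)\<^sup>2 / 2)) * indicator {x. (norm x)\<^sup>2 / 2 > c} x = (\<integral>\<^sup>+y. ?Q x y \<partial>lborel)"
    proof (cases "c < (norm x)\<^sup>2 / 2")
      case True
      then have "(norm x)\<^sup>2 / 2 > 0" using c by (rule order.strict_trans[rotated])
      from resolvent_radial_layer_cake[OF N l this] True show ?thesis by (simp add: indicator_def del: power_Suc)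
    qed simp
  qed
  also have "\<dots> = (\<integral>\<^sup>+y. (\<integral>\<^sup>+x. ?Q x y \<partial>lborel) \<partial>lborel)"
    by (rule lborel_pair.Fubini'[OF meas, symmetric])
  also have "\<dots> = (\<integral>\<^sup>+y. ennreal (1 / fact (Suc N) * (bphi_real (Suc N) (l * y) - c ^ Suc N * (bphi_real (Suc N) (l * y) / y ^ Suc N))) * indicator {c..} y \<partial>lborel)"
  proof (intro nn_integral_cong)
    fix y :: real
    have "(\<integral>\<^sup>+x. ?Q x y \<partial>lborel) = (\<integral>\<^sup>+x. ennreal (?p y) * indicator {x :: real ^ 'd. c < (norm x)\<^sup>2 / 2 \<and> (norm x)\<^sup>2 / 2 \<le> y} x \<partial>lborel)"
      by (intro nn_integral_cong) (simp add: indicator_def)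
    also have "\<dots> = ennreal (?p y) * emeasure lborel {x :: real ^ 'd. c < (norm x)\<^sup>2 / 2 \<and> (norm x)\<^sup>2 / 2 \<le> y}"
      by (rule nn_integral_cmult_indicator) measurable
    also have "\<dots> = ennreal (1 / fact (Suc N) * (bphi_real (Suc N) (l * y) - c ^ Suc N * (bphi_real (Suc N) (l * y) / y ^ Suc N))) * indicator {c..} y"
    proof (cases "y \<ge> c")
      case True
      then have y: "y > 0" using c by simp
      have "?p y \<ge> 0" using bphi_real_pos[of "l * y" "Suc N"] y l by simp
      moreover have "?p y * ((2 * pi) ^ Suc N * (y ^ Suc N - c ^ Suc N) / fact (Suc N)) = 1 / fact (Suc N) * (bphi_real (Suc N) (l * y) - c ^ Suc N * (bphi_real (Suc N) (l * y) / y ^ Suc N))"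
        using y by (simp add: field_simps del: fact_Suc power_Suc)
      ultimately show ?thesis unfolding emeasure_shell[OF d c] using True by (simp add: ennreal_mult'[symmetric] del: fact_Suc power_Suc)
    next
      case False
      then show ?thesis unfolding emeasure_shell[OF d c] by simp
    qed
    finally show "(\<integral>\<^sup>+x. ?Q x y \<partial>lborel) = ennreal (1 / fact (Suc N) * (bphi_real (Suc N) (l * y) - c ^ Suc N * (bphi_real (Suc N) (l * y) / y ^ Suc N))) * indicator {c..} y" .
  qed
  also have "\<dots> = ennreal (0 - 1 / fact (Suc N) * (- (bphi_real (Suc (Suc N)) (l * c) / l) - c ^ Suc N * - (bphi_real N (l * c) / c ^ N)))"
  proof (rule nn_integral_FTC_atLeast[where F = "\<lambda>y. 1 / fact (Suc N) * (- (bphi_real (Suc (Suc N)) (l * y) / l) - c ^ Suc N * - (bphi_real N (l * y) / y ^ N))"])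
    fix y assume yc: "c \<le> y"
    then have y: "y > 0" using c by simp
    have "((\<lambda>y. bphi_real (Suc (Suc N)) (l * y)) has_real_derivative - bphi_real (Suc N) (l * y) * l) (at y)"
      using bphi_real_deriv[of "l * y" "Suc N"] y l by (intro DERIV_chain2) (auto intro!: derivative_eq_intros)
    from DERIV_minus[OF DERIV_cdivide[OF this, of l]]
    have d1: "((\<lambda>y. - (bphi_real (Suc (Suc N)) (l * y) / l)) has_real_derivative bphi_real (Suc N) (l * y)) (at y)" using l by simp
    show "((\<lambda>y. 1 / fact (Suc N) * (- (bphi_real (Suc (Suc N)) (l * y) / l) - c ^ Suc N * - (bphi_real N (l * y) / y ^ N)))
      has_real_derivative 1 / fact (Suc N) * (bphi_real (Suc N) (l * y) - c ^ Suc N * (bphi_real (Suc N) (l * y) / y ^ Suc N))) (at y)"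
      by (intro DERIV_cmult DERIV_diff d1) (unfold N, rule bphi_real_quotient_deriv[OF y l])
    have "c ^ Suc N / y ^ Suc N \<le> 1" using yc c y by (simp add: power_mono del: power_Suc)
    then have "c ^ Suc N / y ^ Suc N * bphi_real (Suc N) (l * y) \<le> 1 * bphi_real (Suc N) (l * y)"
      using bphi_real_pos[of "l * y" "Suc N"] y l by (intro mult_right_mono) auto
    then show "0 \<le> 1 / fact (Suc N) * (bphi_real (Suc N) (l * y) - c ^ Suc N * (bphi_real (Suc N) (l * y) / y ^ Suc N))"
      by (simp del: fact_Suc power_Suc)
  next
    have 1: "((\<lambda>y. - (bphi_real (Suc (Suc N)) (l * y) / l)) \<longlongrightarrow> 0) at_top"
      using tendsto_minus[OF tendsto_divide[OF bphi_real_scaled_tendsto_0[OF l] tendsto_const[of l]]] l by simp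
    have "((\<lambda>y. bphi_real N (l * y) / y ^ N) \<longlongrightarrow> 0) at_top"
    proof (rule real_tendsto_divide_at_top[OF bphi_real_scaled_tendsto_0[OF l]])
      show "filterlim (\<lambda>y::real. y ^ N) at_top at_top" unfolding N by (intro filterlim_pow_at_top filterlim_ident) simp
    qed
    from tendsto_mult_right_zero[OF tendsto_minus[OF this, simplified minus_zero], of "c ^ Suc N"]
    have 2: "((\<lambda>y. c ^ Suc N * - (bphi_real N (l * y) / y ^ N)) \<longlongrightarrow> 0) at_top" .
    from tendsto_mult_right_zero[OF tendsto_diff[OF 1 2, simplified diff_zero], of "1 / fact (Suc N)"]
    show "((\<lambda>y. 1 / fact (Suc N) * (- (bphi_real (Suc (Suc N)) (l * y) / l) - c ^ Suc N * - (bphi_real N (l * y) / y ^ N))) \<longlongrightarrow> 0) at_top" .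
  qed measurable
  also have "0 - 1 / fact (Suc N) * (- (bphi_real (Suc (Suc N)) (l * c) / l) - c ^ Suc N * - (bphi_real N (l * c) / c ^ N)) = bphi_real (Suc N) (l * c) / (l * fact N)"
  proof -
    have "l * c > 0" using c l by simp
    moreover have "0 - 1 / (k * F) * (- ((k * p + l * c * q) / l) - c ^ Suc N * - (q / c ^ N)) = p / (l * F)"
      if "k > 0" "F > 0" for k F p q :: real
      using c l that by (simp add: field_simps)
    ultimately show ?thesis unfolding bphi_real_recurrence[OF \<open>l * c > 0\<close>] fact_Suc by simp
  qed
  finally show ?thesis .
qed

section \<open>The Laplace transform of L\<close>

lemma resolvent_radial_pos: "l > 0 \<Longrightarrow> y > 0 \<Longrightarrow> resolvent_radial N l y > 0"
  unfolding resolvent_radial_def using bphi_real_pos[of "l * y" N] by simp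

lemma isCont_resolvent_radial:
  assumes N: "N = Suc n" and l: "l > 0" and \<rho>: "\<rho> > 0"
  shows "isCont (\<lambda>\<rho>. resolvent_radial N l (\<rho>\<^sup>2 / 2)) \<rho>"
proof -
  have y: "\<rho>\<^sup>2 / 2 > 0" using \<rho> by simp
  have "isCont (\<lambda>y. - (bphi_real N (l * y) / y ^ N)) (\<rho>\<^sup>2 / 2)"
    unfolding N by (rule DERIV_isCont[OF bphi_real_quotient_deriv[OF y l]])
  from continuous_mult_right[OF this, of "- 1 / (2 * pi) ^ Suc N"]
  have "isCont (resolvent_radial N l) (\<rho>\<^sup>2 / 2)" by (simp add: resolvent_radial_def[abs_def] mult.commute)
  moreover have "isCont (\<lambda>\<rho>::real. \<rho>\<^sup>2 / 2) \<rho>" by (intro continuous_intros) simp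
  ultimately show ?thesis using isCont_o2 by blast
qed

lemma eventually_at_left_real: "(a::real) < b \<Longrightarrow> eventually (\<lambda>x. x \<in> {a<..<b}) (at_left b)"
  by (auto simp: eventually_at_left_field intro: exI[of _ a])

context standard_brownian_motion
begin

text \<open>The upper bound holds for spheres slightly larger than the ball and the lower bound for slightly
  smaller ones; the resolvent is continuous in the radius.\<close>

lemma hit_laplace_eq:
  fixes x :: "real ^ 'd"
  assumes d: "CARD('d) = 2 * N + 2" and N: "N = Suc n" and l: "l > 0" and r: "r > 0" and x: "norm x > r"
  shows "hit_laplace l r x = ennreal (resolvent_radial N l ((norm x)\<^sup>2 / 2) / resolvent_radial N l (r\<^sup>2 / 2))"
proof -
  let ?G = "\<lambda>\<rho>. resolvent_radial N l (\<rho>\<^sup>2 / 2)"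
  have G0: "?G \<rho> > 0" if "\<rho> > 0" for \<rho> using that l by (intro resolvent_radial_pos) auto
  have resolvent: "resolvent l 0 z = ennreal (?G (norm z))" if "norm z > 0" for z :: "real ^ 'd"
    using that by (intro resolvent_eq_radial d l) auto
  have x0: "norm x > 0" using x r by linarith
  have up: "ennreal (?G \<rho>) * hit_laplace l r x \<le> ennreal (?G (norm x))" if \<rho>: "r < \<rho>" "\<rho> < norm x" for \<rho>
  proof -
    obtain z :: "real ^ 'd" where z: "norm z = \<rho>" using vector_choose_size[of \<rho>] r \<rho> by auto
    show ?thesis using hit_laplace_upper[OF l \<rho> z] resolvent[of z] resolvent[OF x0] z r \<rho> by simp
  qed
  have low: "ennreal (?G (norm x)) \<le> ennreal (?G \<rho>) * hit_laplace l r x" if \<rho>: "0 < \<rho>" "\<rho> < r" for \<rho>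
  proof -
    obtain z :: "real ^ 'd" where z: "norm z = \<rho>" using vector_choose_size[of \<rho>] \<rho> by auto
    show ?thesis using hit_laplace_lower[OF l less_imp_le[OF \<rho>(1)] \<rho>(2) x z] resolvent[of z] resolvent[OF x0] z \<rho> by simp
  qed
  obtain \<rho>0 where \<rho>0: "r < \<rho>0" "\<rho>0 < norm x" using dense[OF x] by auto
  have "hit_laplace l r x \<noteq> \<top>"
  proof
    assume "hit_laplace l r x = \<top>"
    with up[OF \<rho>0] G0[of \<rho>0] \<rho>0 r show False by (simp add: ennreal_mult_top top_unique)
  qed
  then obtain p where p: "hit_laplace l r x = ennreal p" "p \<ge> 0" by (cases "hit_laplace l r x") auto
  have up': "?G \<rho> * p \<le> ?G (norm x)" if "r < \<rho>" "\<rho> < norm x" for \<rho>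
  proof -
    have "ennreal (?G \<rho> * p) \<le> ennreal (?G (norm x))"
      using up[OF that] G0[of \<rho>] that r p by (simp add: ennreal_mult)
    then show ?thesis using G0[OF x0] by (simp add: ennreal_le_iff)
  qed
  have low': "?G (norm x) \<le> ?G \<rho> * p" if "0 < \<rho>" "\<rho> < r" for \<rho>
  proof -
    have "ennreal (?G (norm x)) \<le> ennreal (?G \<rho> * p)"
      using low[OF that] G0[of \<rho>] that p by (simp add: ennreal_mult)
    then show ?thesis using G0[of \<rho>] that p by (simp add: ennreal_le_iff)
  qed
  have lim: "((\<lambda>\<rho>. ?G \<rho> * p) \<longlongrightarrow> ?G r * p) (at r within A)" for A
  proof (rule tendsto_mult_right)
    show "(?G \<longlongrightarrow> ?G r) (at r within A)"
      using continuous_at_imp_continuous_at_within[OF isCont_resolvent_radial[OF N l r]] by (simp add: continuous_within)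
  qed
  have "?G r * p \<le> ?G (norm x)"
  proof (rule tendsto_upperbound[OF lim[of "{r<..}"]])
    show "eventually (\<lambda>\<rho>. ?G \<rho> * p \<le> ?G (norm x)) (at_right r)"
      using eventually_at_right_real[OF x] by eventually_elim (auto intro: up')
  qed simp
  moreover have "?G (norm x) \<le> ?G r * p"
  proof (rule tendsto_lowerbound[OF lim[of "{..<r}"]])
    show "eventually (\<lambda>\<rho>. ?G (norm x) \<le> ?G \<rho> * p) (at_left r)"
      using eventually_at_left_real[OF r] by eventually_elim (auto intro: low')
  qed simp
  ultimately have "p = ?G (norm x) / ?G r" using G0[OF r] by (simp add: field_simps)
  then show ?thesis using p by simp
qed

text \<open>The function \<open>L\<close> as an extended real: the expected volume of the Wiener sausage outside the ball.\<close>

definition sausage_excess :: "real \<Rightarrow> real \<Rightarrow> ennreal" where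
  "sausage_excess r t = (\<integral>\<^sup>+x. hit_prob r t x * indicator {x. norm x > r} x \<partial>lborel)"

lemma sausage_excess_measurable [measurable]: "sausage_excess r \<in> borel_measurable borel"
proof -
  have "(\<lambda>t. \<integral>\<^sup>+x. hit_prob r t x * indicator {x. norm x > r} x \<partial>lborel) \<in> borel_measurable borel"
    by measurable
  then show ?thesis unfolding sausage_excess_def[abs_def] .
qed

lemma laplace_sausage_excess:
  assumes d: "CARD('d) = 2 * N + 2" and N: "N = Suc n" and l: "l > 0" and r: "r > 0"
    and c: "c = r\<^sup>2 / 2" and k: "\<kappa> = (2 * pi) ^ Suc N * c ^ N / fact N"
  shows "(\<integral>\<^sup>+t. ennreal (l * exp (- l * t)) * sausage_excess r t * indicator {0<..} t \<partial>lborel)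
    = ennreal (\<kappa> * (real N / l + c * bratio_real n (c * l)))"
proof -
  have c0: "c > 0" unfolding c using r by simp
  have cond: "norm x > r \<longleftrightarrow> (norm x)\<^sup>2 / 2 > c" for x :: "real ^ 'd"
    unfolding c using r abs_le_square_iff[of "norm x" r] by (simp add: not_le[symmetric])
  let ?Q = "\<lambda>t (x :: real ^ 'd). ennreal (l * exp (- l * t)) * hit_prob r t x * indicator {0<..} t * indicator {x. norm x > r} x"
  have "(\<integral>\<^sup>+t. ennreal (l * exp (- l * t)) * sausage_excess r t * indicator {0<..} t \<partial>lborel)
    = (\<integral>\<^sup>+t. (\<integral>\<^sup>+x. ?Q t x \<partial>lborel) \<partial>lborel)"
  proof (intro nn_integral_cong)
    fix t :: real
    have "(\<integral>\<^sup>+x. ?Q t x \<partial>lborel) = (\<integral>\<^sup>+x. (ennreal (l * exp (- l * t)) * indicator {0<..} t) * (hit_prob r t x * indicator {x. norm x > r} x) \<partial>lborel)"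
      by (intro nn_integral_cong) (simp only: mult_ac)
    also have "\<dots> = (ennreal (l * exp (- l * t)) * indicator {0<..} t) * sausage_excess r t"
      unfolding sausage_excess_def by (rule nn_integral_cmult) measurable
    finally show "ennreal (l * exp (- l * t)) * sausage_excess r t * indicator {0<..} t = (\<integral>\<^sup>+x. ?Q t x \<partial>lborel)"
      by (simp only: mult_ac)
  qed
  also have "\<dots> = (\<integral>\<^sup>+x. (\<integral>\<^sup>+t. ?Q t x \<partial>lborel) \<partial>lborel)"
    by (rule lborel_pair.Fubini') measurable
  also have "\<dots> = (\<integral>\<^sup>+x. hit_laplace l r x * indicator {x. norm x > r} x \<partial>lborel)"
    unfolding hit_laplace_def by (intro nn_integral_cong nn_integral_multc) measurable
  also have "\<dots> = (\<integral>\<^sup>+x. ennreal (1 / resolvent_radial N l c) * (ennreal (resolvent_radial N l ((norm x)\<^sup>2 / 2)) * indicator {x. (norm x)\<^sup>2 / 2 > c} x) \<partial>(lborel :: (real ^ 'd) measure))"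
  proof (intro nn_integral_cong)
    fix x :: "real ^ 'd"
    show "hit_laplace l r x * indicator {x. norm x > r} x = ennreal (1 / resolvent_radial N l c) * (ennreal (resolvent_radial N l ((norm x)\<^sup>2 / 2)) * indicator {x. (norm x)\<^sup>2 / 2 > c} x)"
    proof (cases "norm x > r")
      case True
      then show ?thesis unfolding hit_laplace_eq[OF d N l r True] c[symmetric] using cond[of x] resolvent_radial_pos[OF l c0, of N] by (simp add: ennreal_mult'[symmetric])
    next
      case False
      then show ?thesis using cond[of x] by simp
    qed
  qed
  also have "\<dots> = ennreal (1 / resolvent_radial N l c) * ennreal (bphi_real (Suc N) (l * c) / (l * fact N))"
    unfolding resolvent_radial_outside_integral[OF d N l c0, symmetric]
    by (rule nn_integral_cmult) (unfold resolvent_radial_def, measurable)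
  also have "\<dots> = ennreal (1 / resolvent_radial N l c * (bphi_real (Suc N) (l * c) / (l * fact N)))"
    using resolvent_radial_pos[OF l c0, of N] by (intro ennreal_mult'[symmetric]) simp
  also have "1 / resolvent_radial N l c * (bphi_real (Suc N) (l * c) / (l * fact N)) = \<kappa> * (real N / l + c * bratio_real n (c * l))"
  proof -
    have lc: "c * l > 0" using c0 l by simp
    have p: "bphi_real N (c * l) > 0" by (rule bphi_real_pos[OF lc])
    have rec: "bphi_real (Suc N) (c * l) = real N * bphi_real N (c * l) + c * l * bphi_real n (c * l)"
      unfolding N by (rule bphi_real_recurrence[OF lc])
    have H: "bratio_real n (c * l) = bphi_real n (c * l) / bphi_real N (c * l)" by (simp add: bratio_real_def N)
    show ?thesis unfolding resolvent_radial_def k H mult.commute[of l c] rec using c0 l p by (simp add: field_simps)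
  qed
  finally show ?thesis .
qed

lemma hit_prob_mono: "0 \<le> s \<Longrightarrow> s \<le> t \<Longrightarrow> hit_prob r s x \<le> hit_prob r t x"
  using hits_sets[of t] by (auto simp: hit_prob_eq hits_def intro!: emeasure_mono intro: order_trans)

lemma sausage_excess_mono: "0 \<le> s \<Longrightarrow> s \<le> t \<Longrightarrow> sausage_excess r s \<le> sausage_excess r t"
  unfolding sausage_excess_def by (intro nn_integral_mono mult_right_mono hit_prob_mono) auto

text \<open>A monotone function whose Laplace transform is finite at one point is finite.\<close>

lemma sausage_excess_finite:
  assumes d: "CARD('d) = 2 * N + 2" and N: "N = Suc n" and r: "r > 0" and t: "t \<ge> 0"
  shows "sausage_excess r t < \<top>"
proof -
  define s where "s = t + 1"
  have s: "s > 0" "t \<le> s" using t by (auto simp: s_def)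
  have "sausage_excess r s * ennreal (exp (- s)) = (\<integral>\<^sup>+u. ennreal (1 * exp (- 1 * u)) * sausage_excess r s * indicator {s..} u \<partial>lborel)"
  proof -
    have "(\<integral>\<^sup>+u. sausage_excess r s * (ennreal (1 * exp (- 1 * u)) * indicator {s..} u) \<partial>lborel) = sausage_excess r s * ennreal (exp (- 1 * s))"
      unfolding exp_tail[OF zero_less_one, symmetric] by (rule nn_integral_cmult) measurable
    then show ?thesis by (simp add: mult_ac)
  qed
  also have "\<dots> \<le> (\<integral>\<^sup>+u. ennreal (1 * exp (- 1 * u)) * sausage_excess r u * indicator {0<..} u \<partial>lborel)"
  proof (intro nn_integral_mono)
    fix u :: real
    show "ennreal (1 * exp (- 1 * u)) * sausage_excess r s * indicator {s..} u \<le> ennreal (1 * exp (- 1 * u)) * sausage_excess r u * indicator {0<..} u"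
    proof (cases "u \<ge> s")
      case True
      then show ?thesis using s by (auto intro!: mult_left_mono sausage_excess_mono)
    qed simp
  qed
  also have "\<dots> < \<top>" using laplace_sausage_excess[OF d N zero_less_one r refl refl] by simp
  finally have "sausage_excess r s * ennreal (exp (- s)) < \<top>" .
  then have "sausage_excess r s < \<top>" by (auto simp: ennreal_mult_less_top)
  then show ?thesis using sausage_excess_mono[OF t s(2)] by (rule order.strict_trans1[rotated])
qed

lemma L_eq_sausage_excess:
  assumes t: "t \<ge> 0"
  shows "L \<Omega> B r t = enn2real (sausage_excess r t)"
proof -
  have hp: "hitting_prob \<Omega> B (cball 0 r) x t = enn2real (hit_prob r t x)" for x
    using hitting_prob_eq[OF t, of r x, symmetric] by (simp add: hitting_prob_def)
  have "L \<Omega> B r t = (\<integral>x. indicator (UNIV - cball 0 r) x *\<^sub>R enn2real (hit_prob r t x) \<partial>lborel)"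
    unfolding L_def set_lebesgue_integral_def hp ..
  also have "\<dots> = enn2real (\<integral>\<^sup>+x. ennreal (indicator (UNIV - cball 0 r) x *\<^sub>R enn2real (hit_prob r t x)) \<partial>lborel)"
    by (rule integral_eq_nn_integral) (measurable, auto)
  also have "(\<integral>\<^sup>+x. ennreal (indicator (UNIV - cball 0 r) x *\<^sub>R enn2real (hit_prob r t x)) \<partial>lborel) = sausage_excess r t"
    unfolding sausage_excess_def
  proof (intro nn_integral_cong)
    fix x
    have "ennreal (enn2real (hit_prob r t x)) = hit_prob r t x"
      using hitting_prob_eq[OF t, of r x, symmetric] by simp
    then show "ennreal (indicator (UNIV - cball 0 r) x *\<^sub>R enn2real (hit_prob r t x)) = hit_prob r t x * indicator {x. norm x > r} x"
      by (auto simp: indicator_def)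
  qed
  finally show ?thesis .
qed

lemma laplace_L:
  assumes d: "CARD('d) = 2 * N + 2" and N: "N = Suc n" and l: "l > 0" and r: "r > 0"
    and c: "c = r\<^sup>2 / 2" and k: "\<kappa> = (2 * pi) ^ Suc N * c ^ N / fact N"
  shows "has_bochner_integral lborel (\<lambda>t. indicator {0..} t *\<^sub>R (exp (- l * t) * L \<Omega> B r t)) (\<kappa> * (real N / l\<^sup>2 + c * bratio_real n (c * l) / l))"
proof (rule has_bochner_integral_nn_integral)
  have eq: "indicator {0..} t *\<^sub>R (exp (- l * t) * L \<Omega> B r t) = indicator {0..} t *\<^sub>R (exp (- l * t) * enn2real (sausage_excess r t))" for t
    by (cases "t \<ge> 0") (auto simp: L_eq_sausage_excess)
  show "(\<lambda>t. indicator {0..} t *\<^sub>R (exp (- l * t) * L \<Omega> B r t)) \<in> borel_measurable lborel"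
    unfolding eq by measurable
  show "AE t in lborel. 0 \<le> indicator {0..} t *\<^sub>R (exp (- l * t) * L \<Omega> B r t)" unfolding eq by simp
  have "c * l > 0" unfolding c using l r by simp
  then have H: "bratio_real n (c * l) > 0" unfolding bratio_real_def using bphi_real_pos[of "c * l"] by simp
  show "0 \<le> \<kappa> * (real N / l\<^sup>2 + c * bratio_real n (c * l) / l)" using H l r unfolding k c by simp
  have "(\<integral>\<^sup>+t. ennreal (indicator {0..} t *\<^sub>R (exp (- l * t) * L \<Omega> B r t)) \<partial>lborel)
    = (\<integral>\<^sup>+t. ennreal (1 / l) * (ennreal (l * exp (- l * t)) * sausage_excess r t * indicator {0<..} t) \<partial>lborel)"
  proof (rule nn_integral_cong_AE, rule AE_mp[OF AE_lborel_singleton[of 0]], rule AE_I2, rule impI)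
    fix t :: real assume t0: "t \<noteq> 0"
    show "ennreal (indicator {0..} t *\<^sub>R (exp (- l * t) * L \<Omega> B r t)) = ennreal (1 / l) * (ennreal (l * exp (- l * t)) * sausage_excess r t * indicator {0<..} t)"
    proof (cases "t > 0")
      case True
      then have e: "ennreal (enn2real (sausage_excess r t)) = sausage_excess r t"
        using sausage_excess_finite[OF d N r, of t] by simp
      have "ennreal (1 / l) * ennreal (l * exp (- l * t)) = ennreal (exp (- l * t))"
        using l by (subst ennreal_mult'[symmetric]) simp_all
      then have "ennreal (1 / l) * (ennreal (l * exp (- l * t)) * sausage_excess r t) = ennreal (exp (- l * t)) * sausage_excess r t"
        by (simp only: mult.assoc[symmetric])
      then show ?thesis unfolding eq using True e by (simp add: ennreal_mult)
    next
      case False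
      then have "t \<notin> {0..}" using t0 by auto
      then show ?thesis using False by simp
    qed
  qed
  also have "\<dots> = ennreal (1 / l) * ennreal (\<kappa> * (real N / l + c * bratio_real n (c * l)))"
    unfolding laplace_sausage_excess[OF d N l r c k, symmetric] by (rule nn_integral_cmult) measurable
  also have "\<dots> = ennreal (\<kappa> * (real N / l\<^sup>2 + c * bratio_real n (c * l) / l))"
    using l by (subst ennreal_mult'[symmetric]) (auto simp: field_simps power2_eq_square)
  finally show "(\<integral>\<^sup>+t. ennreal (indicator {0..} t *\<^sub>R (exp (- l * t) * L \<Omega> B r t)) \<partial>lborel) = ennreal (\<kappa> * (real N / l\<^sup>2 + c * bratio_real n (c * l) / l))" .
qed

lemma L_mono:
  assumes d: "CARD('d) = 2 * N + 2" and N: "N = Suc n" and r: "r > 0"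
  shows "mono_on {0..} (L \<Omega> B r)"
proof (rule mono_onI)
  fix s t :: real assume "s \<in> {0..}" "t \<in> {0..}" "s \<le> t"
  then show "L \<Omega> B r s \<le> L \<Omega> B r t"
    using sausage_excess_finite[OF d N r, of t] by (auto simp: L_eq_sausage_excess intro!: enn2real_mono sausage_excess_mono)
qed

end

section \<open>Uniqueness of Laplace transforms\<close>

text \<open>In the variable \<open>u = exp (- t)\<close> the hypotheses say that \<open>h\<close> annihilates all polynomials, hence by
  Weierstrass all continuous functions on \<open>[0, 1]\<close>, in particular a bump supported in the image
  of \<open>[a, b]\<close>.\<close>

lemma laplace_moments_not_positive:
  assumes int: "\<And>k. integrable lborel (\<lambda>t. indicator {0..} t *\<^sub>R (exp (- real (Suc k) * t) * h t))"
    and zero: "\<And>k. (\<integral>t. indicator {0..} t *\<^sub>R (exp (- real (Suc k) * t) * h t) \<partial>lborel) = 0"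
    and ab: "0 \<le> a" "a < b" and pos: "\<And>t. a < t \<Longrightarrow> t < b \<Longrightarrow> h t > 0"
  shows False
proof -
  define w where "w t = indicator {0..} t *\<^sub>R (exp (- t) * h t)" for t
  have w: "integrable lborel w" using int[of 0] by (simp add: w_def[abs_def])
  have wk: "w t * exp (- t) ^ k = indicator {0..} t *\<^sub>R (exp (- real (Suc k) * t) * h t)" for t k
    by (simp add: w_def exp_of_nat_mult[symmetric] exp_add[symmetric] algebra_simps)
  define C where "C = (\<integral>t. \<bar>w t\<bar> \<partial>lborel)"
  define \<psi> where "\<psi> u = max 0 ((u - exp (- b)) * (exp (- a) - u))" for u :: real
  have \<psi>c: "continuous_on A \<psi>" for A unfolding \<psi>_def by (intro continuous_intros)
  have wp: "integrable lborel (\<lambda>t. w t * q (exp (- t))) \<and> (\<integral>t. w t * q (exp (- t)) \<partial>lborel) = 0" if q: "real_polynomial_function q" for q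
  proof -
    obtain a n where q: "q = (\<lambda>x. \<Sum>i\<le>n. a i * x ^ i)" using q unfolding real_polynomial_function_iff_sum by blast
    have e: "w t * q (exp (- t)) = (\<Sum>i\<le>n. a i * (indicator {0..} t *\<^sub>R (exp (- real (Suc i) * t) * h t)))" for t
      unfolding q wk[symmetric] sum_distrib_left by (intro sum.cong) simp_all
    show ?thesis unfolding e
      by (intro conjI Bochner_Integration.integrable_sum integrable_mult_right int, subst Bochner_Integration.integral_sum)
         (auto intro!: integrable_mult_right int simp only: integral_mult_right_zero zero, simp)
  qed
  have pq: "exp (- b) < exp (- a)" "exp (- a) \<le> 1" using ab by simp_all
  have outside: "(u - exp (- b)) * (exp (- a) - u) \<le> 0" if "u \<le> exp (- b) \<or> u \<ge> exp (- a)" for u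
    using that
  proof
    assume "u \<le> exp (- b)" then show ?thesis using pq by (intro mult_nonpos_nonneg) linarith+
  next
    assume "u \<ge> exp (- a)" then show ?thesis using pq by (intro mult_nonneg_nonpos) linarith+
  qed
  have \<psi>b: "\<bar>\<psi> u\<bar> \<le> 1" if "u \<in> {0..1}" for u
  proof -
    have "(u - exp (- b)) * (exp (- a) - u) \<le> 1 * 1" if "u \<ge> exp (- b)" "u \<le> exp (- a)"
    proof (rule mult_mono)
      have "u \<le> 1" "u \<ge> 0" using \<open>u \<in> {0..1}\<close> by auto
      then show "u - exp (- b) \<le> 1" "exp (- a) - u \<le> 1" using exp_gt_zero[of "- b"] pq by argo+
    qed (use that in auto)
    with outside[of u] have "(u - exp (- b)) * (exp (- a) - u) \<le> 1" by fastforce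
    then show ?thesis unfolding \<psi>_def by simp
  qed
  have wm: "w \<in> borel_measurable lborel" using w by simp
  have \<psi>m: "(\<lambda>t::real. \<psi> (exp (- t))) \<in> borel_measurable borel" unfolding \<psi>_def by measurable
  have w\<psi>: "integrable lborel (\<lambda>t. w t * \<psi> (exp (- t)))"
  proof (rule Bochner_Integration.integrable_bound[OF w])
    show "AE t in lborel. norm (w t * \<psi> (exp (- t))) \<le> norm (w t)"
    proof (rule AE_I2)
      fix t :: real
      show "norm (w t * \<psi> (exp (- t))) \<le> norm (w t)"
        using mult_left_mono[OF \<psi>b[of "exp (- t)"], of "\<bar>w t\<bar>"] by (cases "t \<ge> 0") (auto simp: abs_mult w_def)
    qed
  qed (use wm \<psi>m in measurable)
  have "\<bar>\<integral>t. w t * \<psi> (exp (- t)) \<partial>lborel\<bar> \<le> e * C" if e: "e > 0" for e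
  proof -
    obtain q where q: "real_polynomial_function q" "\<And>u. u \<in> {0..1} \<Longrightarrow> \<bar>\<psi> u - q u\<bar> < e"
      using Stone_Weierstrass_real_polynomial_function[OF compact_Icc \<psi>c e, of 0 1] by blast
    have "(\<integral>t. w t * \<psi> (exp (- t)) \<partial>lborel) = (\<integral>t. w t * \<psi> (exp (- t)) \<partial>lborel) - (\<integral>t. w t * q (exp (- t)) \<partial>lborel)"
      using wp[OF q(1)] by simp
    also have "\<dots> = (\<integral>t. w t * \<psi> (exp (- t)) - w t * q (exp (- t)) \<partial>lborel)"
      by (rule Bochner_Integration.integral_diff[symmetric, OF w\<psi>]) (use wp[OF q(1)] in blast)
    also have "norm \<dots> \<le> (\<integral>t. e * \<bar>w t\<bar> \<partial>lborel)"
    proof (rule Bochner_Integration.integral_norm_bound_integral)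
      show "integrable lborel (\<lambda>t. w t * \<psi> (exp (- t)) - w t * q (exp (- t)))"
        by (rule Bochner_Integration.integrable_diff[OF w\<psi>]) (use wp[OF q(1)] in blast)
      show "integrable lborel (\<lambda>t. e * \<bar>w t\<bar>)" using w by simp
      fix t :: real
      show "norm (w t * \<psi> (exp (- t)) - w t * q (exp (- t))) \<le> e * \<bar>w t\<bar>"
      proof (cases "t \<ge> 0")
        case True
        then have "\<bar>\<psi> (exp (- t)) - q (exp (- t))\<bar> \<le> e" using q(2)[of "exp (- t)"] by simp
        from mult_left_mono[OF this, of "\<bar>w t\<bar>"] show ?thesis
          by (simp add: right_diff_distrib[symmetric] abs_mult mult.commute)
      qed (simp add: w_def)
    qed
    finally show ?thesis by (simp add: C_def)
  qed
  then have "\<bar>\<integral>t. w t * \<psi> (exp (- t)) \<partial>lborel\<bar> \<le> 0 + e" if "e > 0" for e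
  proof -
    have C: "C \<ge> 0" by (simp add: C_def)
    have "e / (C + 1) * C \<le> e" using C that by (simp add: field_simps)
    moreover have "\<bar>\<integral>t. w t * \<psi> (exp (- t)) \<partial>lborel\<bar> \<le> e / (C + 1) * C"
      using C that by (intro \<open>\<And>e. e > 0 \<Longrightarrow> _ \<le> e * C\<close>) simp
    ultimately show ?thesis by simp
  qed
  then have "\<bar>\<integral>t. w t * \<psi> (exp (- t)) \<partial>lborel\<bar> \<le> 0" by (rule field_le_epsilon)
  then have I0: "(\<integral>t. w t * \<psi> (exp (- t)) \<partial>lborel) = 0" by simp
  have pos': "w t * \<psi> (exp (- t)) > 0" if "a < t" "t < b" for t
    using that ab pos[OF that] by (simp add: w_def \<psi>_def max_def not_le)
  have nn: "w t * \<psi> (exp (- t)) \<ge> 0" for t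
  proof (cases "a < t \<and> t < b")
    case False
    then have "(exp (- t) - exp (- b)) * (exp (- a) - exp (- t)) \<le> 0"
      by (intro outside) (auto simp: not_less)
    then show ?thesis by (simp add: \<psi>_def)
  qed (use pos' in \<open>auto intro: less_imp_le\<close>)
  have "AE t in lborel. w t * \<psi> (exp (- t)) = 0"
    using integral_nonneg_eq_0_iff_AE[OF w\<psi>] nn I0 by simp
  then have "AE t in lborel. t \<notin> {a<..<b}" by eventually_elim (use pos' in force)
  then have "emeasure lborel {a<..<b} = 0"
    by (subst (asm) AE_iff_measurable[where N = "{a<..<b}"]) auto
  then show False using ab by simp
qed

text \<open>If \<open>f\<close> and \<open>g\<close> differ at \<open>t\<close>, monotonicity of \<open>f\<close> and continuity of \<open>g\<close> give the difference a fixed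
  sign on an interval to the right or to the left of \<open>t\<close>.\<close>

lemma laplace_unique_mono_continuous:
  fixes f g :: "real \<Rightarrow> real"
  assumes f: "mono_on {0..} f" and g: "continuous_on {0..} g"
    and fi: "\<And>l. l > 0 \<Longrightarrow> has_bochner_integral lborel (\<lambda>t. indicator {0..} t *\<^sub>R (exp (- l * t) * f t)) (I l)"
    and gi: "\<And>l. l > 0 \<Longrightarrow> has_bochner_integral lborel (\<lambda>t. indicator {0..} t *\<^sub>R (exp (- l * t) * g t)) (I l)"
    and t: "t > 0"
  shows "f t = g t"
proof -
  have d: "has_bochner_integral lborel (\<lambda>t. indicator {0..} t *\<^sub>R (exp (- l * t) * (f t - g t))) 0" if "l > 0" for l
    using has_bochner_integral_diff[OF fi[OF that] gi[OF that]] by (simp add: algebra_simps)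
  have di: "integrable lborel (\<lambda>t. indicator {0..} t *\<^sub>R (exp (- real (Suc k) * t) * (f t - g t)))" "(\<integral>t. indicator {0..} t *\<^sub>R (exp (- real (Suc k) * t) * (f t - g t)) \<partial>lborel) = 0" for k
    by (rule integrable.intros[OF d] has_bochner_integral_integral_eq[OF d], simp)+
  have d': "has_bochner_integral lborel (\<lambda>t. indicator {0..} t *\<^sub>R (exp (- l * t) * (g t - f t))) 0" if "l > 0" for l
    using has_bochner_integral_diff[OF gi[OF that] fi[OF that]] by (simp add: algebra_simps)
  have di': "integrable lborel (\<lambda>t. indicator {0..} t *\<^sub>R (exp (- real (Suc k) * t) * (g t - f t)))" "(\<integral>t. indicator {0..} t *\<^sub>R (exp (- real (Suc k) * t) * (g t - f t)) \<partial>lborel) = 0" for k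
    by (rule integrable.intros[OF d'] has_bochner_integral_integral_eq[OF d'], simp)+
  have cont: "isCont g t" using g t by (intro continuous_on_interior[of "{0..}"]) auto
  have "\<not> f t > g t"
  proof
    assume lt: "f t > g t"
    have "eventually (\<lambda>s. g s < f t) (at_right t)"
      using order_tendstoD(2)[OF isContD[OF cont] lt] by (auto simp: eventually_at_split)
    then obtain b where b: "b > t" "\<And>s. t < s \<Longrightarrow> s < b \<Longrightarrow> g s < f t" unfolding eventually_at_right_field by auto
    show False
    proof (rule laplace_moments_not_positive[of "\<lambda>t. f t - g t" t b])
      fix s assume s: "t < s" "s < b"
      then have "f t \<le> f s" using f t by (auto simp: mono_on_def)
      then show "f s - g s > 0" using b(2)[OF s] by simp
    qed (rule di | use t b(1) in simp)+
  qed
  moreover have "\<not> f t < g t"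
  proof
    assume lt: "f t < g t"
    have "eventually (\<lambda>s. f t < g s) (at_left t)"
      using order_tendstoD(1)[OF isContD[OF cont] lt] by (auto simp: eventually_at_split)
    then obtain b where b: "b < t" "\<And>s. b < s \<Longrightarrow> s < t \<Longrightarrow> f t < g s" unfolding eventually_at_left_field by auto
    show False
    proof (rule laplace_moments_not_positive[of "\<lambda>t. g t - f t" "max 0 b" t])
      fix s assume s: "max 0 b < s" "s < t"
      then have "f s \<le> f t" using f t by (auto simp: mono_on_def)
      then show "g s - f s > 0" using b(2)[of s] s by simp
    qed (rule di' | use t b(1) in simp)+
  qed
  ultimately show ?thesis by simp
qed

section \<open>The expansion\<close>

lemma laplace_power:
  fixes l :: real
  assumes l: "l > 0"
  shows "has_bochner_integral lborel (\<lambda>t. indicator {0..} t *\<^sub>R (exp (- l * t) * t ^ k)) (fact k / l ^ Suc k)"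
proof -
  have "has_bochner_integral lborel (\<lambda>x::real. indicator {0..} x *\<^sub>R (x ^ k * exp (- x))) (fact k)"
  proof (rule has_bochner_integral_nn_integral)
    have "(\<integral>\<^sup>+x. ennreal (indicator {0..} x *\<^sub>R (x ^ k * exp (- x))) \<partial>lborel) = (\<integral>\<^sup>+x. ennreal (x ^ k * exp (- x)) * indicator {0..} x \<partial>lborel)"
      by (intro nn_integral_cong) (simp add: indicator_def)
    also have "\<dots> = ennreal (fact k)" using nn_intergal_power_times_exp_Ici[of k] by simp
    finally show "(\<integral>\<^sup>+x. ennreal (indicator {0..} x *\<^sub>R (x ^ k * exp (- x))) \<partial>lborel) = ennreal (fact k)" .
  qed (auto simp: indicator_def)
  then have "has_bochner_integral lborel (\<lambda>x::real. indicator {0..} (0 + l * x) *\<^sub>R ((0 + l * x) ^ k * exp (- (0 + l * x)))) (fact k /\<^sub>R \<bar>l\<bar>)"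
    using l by (subst (asm) lborel_has_bochner_integral_real_affine_iff[of l _ _ 0]) auto
  from has_bochner_integral_mult_right[OF this, of "1 / l ^ k"]
  have "has_bochner_integral lborel (\<lambda>x::real. 1 / l ^ k * (indicator {0..} (0 + l * x) *\<^sub>R ((0 + l * x) ^ k * exp (- (0 + l * x))))) (1 / l ^ k * (fact k /\<^sub>R \<bar>l\<bar>))" by simp
  moreover have "1 / l ^ k * (indicator {0..} (0 + l * x) *\<^sub>R ((0 + l * x) ^ k * exp (- (0 + l * x)))) = indicator {0..} x *\<^sub>R (exp (- l * x) * x ^ k)" for x
    using l by (auto simp: indicator_def power_mult_distrib zero_le_mult_iff)
  moreover have "1 / l ^ k * (fact k /\<^sub>R \<bar>l\<bar>) = fact k / l ^ Suc k" using l by (simp add: field_simps)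
  ultimately show ?thesis by simp
qed

lemma laplace_rescale:
  fixes c l I :: real
  assumes c: "c > 0" and K: "has_bochner_integral lborel (\<lambda>t. indicator {0..} t *\<^sub>R (exp (- (c * l) * t) * K t)) I"
  shows "has_bochner_integral lborel (\<lambda>t. indicator {0..} t *\<^sub>R (exp (- l * t) * K (t / c))) (c * I)"
proof -
  have "has_bochner_integral lborel (\<lambda>x. indicator {0..} (0 + 1 / c * x) *\<^sub>R (exp (- (c * l) * (0 + 1 / c * x)) * K (0 + 1 / c * x))) (I /\<^sub>R \<bar>1 / c\<bar>)"
    using c K by (subst (asm) lborel_has_bochner_integral_real_affine_iff[of "1 / c" _ _ 0]) auto
  moreover have "indicator {0..} (0 + 1 / c * x) *\<^sub>R (exp (- (c * l) * (0 + 1 / c * x)) * K (0 + 1 / c * x)) = indicator {0..} x *\<^sub>R (exp (- l * x) * K (x / c))" for x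
    using c by (auto simp: indicator_def zero_le_divide_iff)
  moreover have "I /\<^sub>R \<bar>1 / c\<bar> = c * I" using c by simp
  ultimately show ?thesis by (simp only:)
qed

text \<open>The right-hand side is continuous and has the Laplace transform of \<open>L\<close>: the constant \<open>1 / n\<close> in \<open>K\<close>'s
  transform cancels the one in the formula.\<close>

lemma (in standard_brownian_motion) L_closed_form:
  assumes d: "CARD('d) = 2 * N + 2" and N: "N = Suc n" and n: "n \<ge> 1" and r: "r > 0"
    and c: "c = r\<^sup>2 / 2" and k: "\<kappa> = (2 * pi) ^ Suc N * c ^ N / fact N"
    and K: "continuous_on {0..} K"
    and lap: "\<And>l. l > 0 \<Longrightarrow> has_bochner_integral lborel (\<lambda>t. indicator {0..} t *\<^sub>R (exp (- l * t) * K t)) ((1 / real n - bratio_real n l) / l)"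
    and t: "t > 0"
  shows "L \<Omega> B r t = \<kappa> * (real N * t + c * (1 / real n - K (t / c)))"
proof (rule laplace_unique_mono_continuous[OF L_mono[OF d N r] _ laplace_L[OF d N _ r c k] _ t])
  have c0: "c > 0" unfolding c using r by simp
  show "continuous_on {0..} (\<lambda>t. \<kappa> * (real N * t + c * (1 / real n - K (t / c))))"
    using c0 by (intro continuous_intros continuous_on_compose2[OF K]) auto
  fix l :: real assume l: "l > 0"
  have Kc: "has_bochner_integral lborel (\<lambda>t. indicator {0..} t *\<^sub>R (exp (- l * t) * K (t / c))) (c * ((1 / real n - bratio_real n (c * l)) / (c * l)))"
    by (rule laplace_rescale[OF c0 lap]) (use c0 l in simp)
  have "has_bochner_integral lborel
     (\<lambda>t. \<kappa> * (real N * (indicator {0..} t *\<^sub>R (exp (- l * t) * t ^ 1)) + c * (1 / real n * (indicator {0..} t *\<^sub>R (exp (- l * t) * t ^ 0)) - indicator {0..} t *\<^sub>R (exp (- l * t) * K (t / c)))))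
     (\<kappa> * (real N * (fact 1 / l ^ Suc 1) + c * (1 / real n * (fact 0 / l ^ Suc 0) - c * ((1 / real n - bratio_real n (c * l)) / (c * l)))))"
    by (intro has_bochner_integral_mult_right has_bochner_integral_add has_bochner_integral_diff laplace_power l Kc)
  moreover have "\<kappa> * (real N * (fact 1 / l ^ Suc 1) + c * (1 / real n * (fact 0 / l ^ Suc 0) - c * ((1 / real n - bratio_real n (c * l)) / (c * l)))) = \<kappa> * (real N / l\<^sup>2 + c * bratio_real n (c * l) / l)"
    using c0 l n by (simp add: field_simps power2_eq_square)
  moreover have "\<kappa> * (real N * (indicator {0..} t *\<^sub>R (exp (- l * t) * t ^ 1)) + c * (1 / real n * (indicator {0..} t *\<^sub>R (exp (- l * t) * t ^ 0)) - indicator {0..} t *\<^sub>R (exp (- l * t) * K (t / c))))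
     = indicator {0..} t *\<^sub>R (exp (- l * t) * (\<kappa> * (real N * t + c * (1 / real n - K (t / c)))))" for t
    by (simp add: algebra_simps)
  ultimately show "has_bochner_integral lborel (\<lambda>t. indicator {0..} t *\<^sub>R (exp (- l * t) * (\<kappa> * (real N * t + c * (1 / real n - K (t / c)))))) (\<kappa> * (real N / l\<^sup>2 + c * bratio_real n (c * l) / l))"
    by (simp only:)
qed

text \<open>Used to rewrite a polynomial in \<open>ln (t / c)\<close> as one in \<open>ln t\<close>.\<close>

lemma shifted_polynomial_coefficients:
  fixes a :: real
  shows "\<exists>e. \<forall>x. (\<Sum>k\<le>q. d k * (x + a) ^ k) = (\<Sum>k\<le>q. e k * x ^ k)"
proof (induction q)
  case 0 show ?case by (intro exI[of _ d]) simp
next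
  case (Suc q)
  then obtain e where e: "\<And>x. (\<Sum>k\<le>q. d k * (x + a) ^ k) = (\<Sum>k\<le>q. e k * x ^ k)" by blast
  let ?e = "\<lambda>k. (if k \<le> q then e k else 0) + d (Suc q) * (real (Suc q choose k) * a ^ (Suc q - k))"
  have step: "(\<Sum>k\<le>Suc q. d k * (x + a) ^ k) = (\<Sum>k\<le>Suc q. ?e k * x ^ k)" for x
  proof -
    have "(\<Sum>k\<le>Suc q. ?e k * x ^ k) = (\<Sum>k\<le>Suc q. (if k \<le> q then e k else 0) * x ^ k) + (\<Sum>k\<le>Suc q. d (Suc q) * (real (Suc q choose k) * x ^ k * a ^ (Suc q - k)))"
      unfolding sum.distrib[symmetric] by (intro sum.cong refl) (simp only: algebra_simps)
    also have "(\<Sum>k\<le>Suc q. (if k \<le> q then e k else 0) * x ^ k) = (\<Sum>k\<le>q. e k * x ^ k)" by simp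
    also have "(\<Sum>k\<le>Suc q. d (Suc q) * (real (Suc q choose k) * x ^ k * a ^ (Suc q - k))) = d (Suc q) * (x + a) ^ Suc q"
      unfolding binomial_ring[of x a "Suc q"] sum_distrib_left ..
    finally show ?thesis by (simp add: e)
  qed
  show ?case by (intro exI[of _ ?e] allI step)
qed

lemma sum_lessThan_blocks: "(\<Sum>p<N * M. f p) = (\<Sum>m = 0..<M. \<Sum>j = 0..<(N::nat). (f (N * m + j) :: real))"
proof (induction M)
  case (Suc M)
  have "(\<Sum>p<N * M + j. f p) = (\<Sum>p<N * M. f p) + (\<Sum>i = 0..<j. f (N * M + i))" for j
    by (induction j) auto
  from this[of N] show ?case using Suc by (simp add: add.commute)
qed simp

text \<open>The expansion of \<open>K\<close> is inserted into the closed form of \<open>L\<close>.  Grouping the exponents \<open>n + p\<close> by the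
  quotient and the remainder of \<open>p\<close> modulo \<open>N\<close> gives the double sum; the half-integral powers get
  the coefficient zero.\<close>

theorem theorem2p1:
  fixes \<Omega> :: "'w measure" and B :: "real \<Rightarrow> 'w \<Rightarrow> real ^ 'd"
    and d N M :: nat and r S :: real
  assumes bm: "standard_brownian_motion \<Omega> B"
    and d: "d = CARD('d)" "d \<ge> 6" "even d"
    and r: "r > 0"
    and N: "N = d div 2 - 1"
    and M: "M \<ge> 1"
    and S: "S = unit_sphere_area TYPE(real ^ 'd) * r ^ (d - 2)"
  shows "\<exists>(\<rho>1 :: nat \<Rightarrow> nat \<Rightarrow> nat \<Rightarrow> real) (\<rho>2 :: nat \<Rightarrow> nat \<Rightarrow> nat \<Rightarrow> real)
            (\<rho>3 :: nat \<Rightarrow> real) (\<rho>4 :: nat \<Rightarrow> real).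
    (\<lambda>t. L \<Omega> B r t - S *
      ((real d - 2) / 2 * t + r ^ 2 / (real d - 4)
       + (\<Sum>m = 0..<M. \<Sum>n = 0..<N.
            r ^ (2 * N * (m + 1) + 2 * n) / t powr (real (N * (m + 1) + n) - 1)
              * (\<Sum>k = 0..m. \<rho>1 m n k * ln t ^ k))
       + (\<Sum>m = 0..<M. \<Sum>n = 0..<N * (M - m).
            r ^ (2 * N * (m + 1) + 2 * n + 1) / t powr (real (N * (m + 1) + n) - 1 / 2)
              * (\<Sum>k = 0..m. \<rho>2 m n k * ln t ^ k))
       + r ^ (2 * N * (M + 1)) / t powr (real (N * (M + 1)) - 1)
           * (\<Sum>k = 0..M. \<rho>3 k * ln t ^ k)
       + r ^ (2 * N * (M + 1) + 1) / t powr (real (N * (M + 1)) - 1 / 2)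
           * (\<Sum>k = 0..M. \<rho>4 k * ln t ^ k)))
    \<in> O[at_top](\<lambda>t. 1 / t powr (real (N * (M + 1)) - 1 / 2))"
proof -
  interpret standard_brownian_motion \<Omega> B by (rule bm)
  define n where "n = N - 1"
  define c where "c = r\<^sup>2 / 2"
  \<comment> \<open>the last term kept, \<open>p = N M\<close>, is the one with coefficients \<open>\<rho>3\<close>, and the remainder exponent \<open>n + P - 1/2\<close> is \<open>N (M + 1) - 1/2\<close>\<close>
  define P where "P = N * M + 1"
  have dN: "d = 2 * N + 2" using N d(2,3) by auto
  have cd: "CARD('d) = 2 * N + 2" using dN d(1) by simp
  have n: "N = Suc n" "n \<ge> 1" using dN d(2) unfolding n_def by linarith+
  have c0: "c > 0" unfolding c_def using r by simp
  have S_eq: "S = (2 * pi) ^ Suc N * c ^ N / fact N"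
  proof -
    have e: "real DIM(real ^ 'd) / 2 = real N + 1" by (simp add: cd)
    have "unit_sphere_area TYPE(real ^ 'd) = 2 * pi ^ Suc N / fact N"
      unfolding unit_sphere_area_eq e
      using Gamma_fact[of N, where 'a = real] powr_realpow[of pi "Suc N"] by (simp add: add.commute)
    moreover have "r ^ (d - 2) = (r\<^sup>2) ^ N" unfolding dN by (simp add: power_mult)
    moreover have "c ^ N = (r\<^sup>2) ^ N / 2 ^ N" unfolding c_def by (rule power_divide)
    ultimately show ?thesis unfolding S by (simp add: power_mult_distrib)
  qed
  have P1: "P \<ge> 1" by (simp add: P_def)
  obtain K dd where K: "continuous_on {0..} K"
    and lap: "\<forall>l>0. set_integrable lborel {0..} (\<lambda>t. exp (- l * t) * K t) \<and> (LINT t:{0..}|lborel. exp (- l * t) * K t) = (1 / real n - bratio_real n l) / l"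
    and tail: "(\<lambda>t. K t - (\<Sum>p<P. 1 / t ^ (n + p) * (\<Sum>k\<le>p div Suc n. dd p k * ln t ^ k))) \<in> O[at_top](\<lambda>t. 1 / t powr (real (n + P) - 1 / 2))"
    using bessel_ratio_tail[OF n(2) P1] by blast
  have lap': "has_bochner_integral lborel (\<lambda>t. indicator {0..} t *\<^sub>R (exp (- l * t) * K t)) ((1 / real n - bratio_real n l) / l)" if "l > 0" for l
    using lap that unfolding set_integrable_def set_lebesgue_integral_def by (simp add: has_bochner_integral_iff)
  have L_eq: "L \<Omega> B r t = S * (real N * t + c * (1 / real n - K (t / c)))" if "t > 0" for t
    by (rule L_closed_form[OF cd n r c_def S_eq K lap' that])
  have "\<forall>p. \<exists>e. \<forall>x. (\<Sum>k\<le>p div N. dd p k * (x + - ln c) ^ k) = (\<Sum>k\<le>p div N. e k * x ^ k)"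
    by (intro allI shifted_polynomial_coefficients)
  then obtain e where e: "\<And>p x. (\<Sum>k\<le>p div N. dd p k * (x + - ln c) ^ k) = (\<Sum>k\<le>p div N. e p k * x ^ k)"
    by metis
  \<comment> \<open>with \<open>p = N m + j\<close>, \<open>j < N\<close>, the exponent \<open>n + p\<close> is \<open>N (m + 1) + j - 1\<close> and the degree in the logarithm is \<open>p div N = m\<close>\<close>
  define T where "T p t = c * (1 / (t / c) ^ (n + p) * (\<Sum>k\<le>p div Suc n. dd p k * ln (t / c) ^ k))" for p t
  \<comment> \<open>the powers of \<open>r\<close> prescribed in the theorem are divided out again\<close>
  define \<rho>1 where "\<rho>1 m j k = - (c ^ Suc (n + (N * m + j)) * e (N * m + j) k / r ^ (2 * N * (m + 1) + 2 * j))" for m j k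
  have T_eq: "- T (N * m + j) t = r ^ (2 * N * (m + 1) + 2 * j) / t powr (real (N * (m + 1) + j) - 1) * (\<Sum>k = 0..m. \<rho>1 m j k * ln t ^ k)"
    if t: "t > 0" and j: "j < N" for m j t
  proof -
    have q: "(N * m + j) div N = m" using j by simp
    have "real (N * (m + 1) + j) - 1 = real (n + (N * m + j))" by (simp add: n(1))
    then have pw: "t powr (real (N * (m + 1) + j) - 1) = t ^ (n + (N * m + j))" using t by (simp add: powr_realpow del: of_nat_add)
    have "(\<Sum>k\<le>(N * m + j) div Suc n. dd (N * m + j) k * ln (t / c) ^ k) = (\<Sum>k\<le>m. e (N * m + j) k * ln t ^ k)"
      using e[of "N * m + j" "ln t"] q t c0 by (simp add: ln_div n(1)[symmetric])
    then have T': "T (N * m + j) t = c ^ Suc (n + (N * m + j)) / t ^ (n + (N * m + j)) * (\<Sum>k\<le>m. e (N * m + j) k * ln t ^ k)"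
      unfolding T_def by (simp add: power_divide)
    have "(\<Sum>k = 0..m. \<rho>1 m j k * ln t ^ k) = - (c ^ Suc (n + (N * m + j)) / r ^ (2 * N * (m + 1) + 2 * j)) * (\<Sum>k\<le>m. e (N * m + j) k * ln t ^ k)"
      unfolding \<rho>1_def sum_distrib_left atMost_atLeast0 by (intro sum.cong) auto
    then show ?thesis unfolding T' pw using r by simp
  qed
  have T_sum: "- (\<Sum>p<P. T p t) = (\<Sum>m = 0..<M. \<Sum>j = 0..<N. r ^ (2 * N * (m + 1) + 2 * j) / t powr (real (N * (m + 1) + j) - 1) * (\<Sum>k = 0..m. \<rho>1 m j k * ln t ^ k))
      + r ^ (2 * N * (M + 1)) / t powr (real (N * (M + 1)) - 1) * (\<Sum>k = 0..M. \<rho>1 M 0 k * ln t ^ k)" if t: "t > 0" for t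
  proof -
    have "- (\<Sum>p<P. T p t) = (\<Sum>m = 0..<M. \<Sum>j = 0..<N. - T (N * m + j) t) + - T (N * M + 0) t"
      unfolding P_def by (simp add: sum_lessThan_blocks sum_negf)
    also have "(\<Sum>m = 0..<M. \<Sum>j = 0..<N. - T (N * m + j) t) = (\<Sum>m = 0..<M. \<Sum>j = 0..<N. r ^ (2 * N * (m + 1) + 2 * j) / t powr (real (N * (m + 1) + j) - 1) * (\<Sum>k = 0..m. \<rho>1 m j k * ln t ^ k))"
      by (intro sum.cong refl T_eq[OF t]) simp
    also have "- T (N * M + 0) t = r ^ (2 * N * (M + 1)) / t powr (real (N * (M + 1)) - 1) * (\<Sum>k = 0..M. \<rho>1 M 0 k * ln t ^ k)"
      using T_eq[OF t, of 0 M] n(1) by simp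
    finally show ?thesis .
  qed
  let ?R = "\<lambda>t. K t - (\<Sum>p<P. 1 / t ^ (n + p) * (\<Sum>k\<le>p div Suc n. dd p k * ln t ^ k))"
  let ?x = "real (N * (M + 1)) - 1 / 2"
  have x: "real (n + P) - 1 / 2 = ?x" by (simp add: P_def n(1))
  have "filterlim (\<lambda>t. t / c) at_top at_top" using c0 by real_asymp
  from landau_o.big.compose[OF tail this]
  have "(\<lambda>t. ?R (t / c)) \<in> O[at_top](\<lambda>t. 1 / (t / c) powr ?x)" unfolding x .
  also have "(\<lambda>t. 1 / (t / c) powr ?x) \<in> O[at_top](\<lambda>t. 1 / t powr ?x)"
  proof (rule landau_o.bigI[of "c powr ?x"])
    show "c powr ?x > 0" using c0 by simp
    show "eventually (\<lambda>t. norm (1 / (t / c) powr ?x) \<le> c powr ?x * norm (1 / t powr ?x)) at_top"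
      using eventually_gt_at_top[of 0] by eventually_elim (use c0 in \<open>simp add: powr_divide\<close>)
  qed
  finally have "(\<lambda>t. ?R (t / c)) \<in> O[at_top](\<lambda>t. 1 / t powr ?x)" .
  moreover have "- (S * c) \<noteq> 0" unfolding S_eq using c0 by simp
  ultimately have "(\<lambda>t. - (S * c) * ?R (t / c)) \<in> O[at_top](\<lambda>t. 1 / t powr ?x)"
    by (subst landau_o.big.cmult_in_iff)
  moreover have "eventually (\<lambda>t. - (S * c) * ?R (t / c) = L \<Omega> B r t - S *
      ((real d - 2) / 2 * t + r ^ 2 / (real d - 4)
       + (\<Sum>m = 0..<M. \<Sum>n = 0..<N. r ^ (2 * N * (m + 1) + 2 * n) / t powr (real (N * (m + 1) + n) - 1) * (\<Sum>k = 0..m. \<rho>1 m n k * ln t ^ k))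
       + (\<Sum>m = 0..<M. \<Sum>n = 0..<N * (M - m). r ^ (2 * N * (m + 1) + 2 * n + 1) / t powr (real (N * (m + 1) + n) - 1 / 2) * (\<Sum>k = 0..m. 0 * ln t ^ k))
       + r ^ (2 * N * (M + 1)) / t powr (real (N * (M + 1)) - 1) * (\<Sum>k = 0..M. \<rho>1 M 0 k * ln t ^ k)
       + r ^ (2 * N * (M + 1) + 1) / t powr (real (N * (M + 1)) - 1 / 2) * (\<Sum>k = 0..M. 0 * ln t ^ k))) at_top"
    using eventually_gt_at_top[of 0]
  proof eventually_elim
    case (elim t)
    have lead: "(real d - 2) / 2 * t = real N * t" "r ^ 2 / (real d - 4) = c * (1 / real n)"
      using n by (auto simp: dN c_def field_simps)
    have cR: "c * ?R (t / c) = c * K (t / c) - (\<Sum>p<P. T p t)" unfolding T_def right_diff_distrib sum_distrib_left ..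
    have combine: "- (S * c) * R = S * (u + c * (v - k)) - S * (u + c * v + X + 0 + Y + 0)"
      if "X + Y = - Z" "c * R = c * k - Z" for X Y Z R k u v :: real
    proof -
      have "Z = - (X + Y)" using that(1) by simp
      then have "c * R = c * k + X + Y" using that(2) by simp
      then have "- (S * c) * R = - S * (c * k + X + Y)" by simp
      then show ?thesis by (simp add: algebra_simps)
    qed
    show ?case unfolding L_eq[OF elim] lead mult_zero_left sum.neutral_const mult_zero_right
      by (rule combine[OF T_sum[OF elim, symmetric] cR])
  qed
  ultimately show ?thesis
    by (intro exI[of _ \<rho>1] exI[of _ "\<lambda>_ _ _. 0"] exI[of _ "\<rho>1 M 0"] exI[of _ "\<lambda>_. 0"]) (subst (asm) landau_o.big.in_cong)
qed

end
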